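(* Let $\hbar\in\mathbb{C}$ with $\sinh\hbar\ne0$, and let $\widetilde U(\mathfrak{af}_1)_\hbar$ be the universal HFG algebra generated by $X$ and $Y$ subject to the relation $$[X,Y]=\frac{\sinh\hbar Y}{\sinh\hbar}.$$ Then $\widetilde U(\mathfrak{af}_1)_\hbar$ is an infinite-dimensional HFG Hopf algebra with respect to the comultiplication $\Delta$, counit $\varepsilon$ and antipode $S$ determined by $$\Delta\colon X\mapsto X\otimes e^{-\hbar Y}+e^{\hbar Y}\otimes X,\quad Y\mapsto1\otimes Y+Y\otimes1;$$ $$S\colon X\mapsto-X-\frac{\hbar}{\sinh\hbar}\sinh\hbar Y,\quad Y\mapsto-Y;\qquad\varepsilon\colon X,Y\mapsto0.$$ Moreover, $S$ is invertible.
   Context: The algebra $\mathscr{F}_n$ of free entire functions in generators $\zeta_1,\ldots,\zeta_n$ consists of all series $a=\sum_{\alpha\in W_n}c_\alpha\zeta_\alpha$ with $\|a\|_\rho:=\sum_\alpha|c_\alpha|\rho^{|\alpha|}<\infty$ for all $\rho>0$, where $W_n$ is the set of words in $1,\ldots,n$ and $\zeta_\alpha$ is the corresponding product of generators. A Fr\'echet Arens--Michael algebra (Fr\'echet algebra whose topology is given by submultiplicative seminorms) is HFG (holomorphically finitely generated) if it is topologically isomorphic to $\mathscr{F}_n/I$ for some $n$ and closed two-sided ideal $I$. The universal HFG algebra generated by given generators subject to given relations (possibly involving entire functions of the generators) is the quotient of the algebra of free entire functions in these generators by the closed two-sided ideal generated by the relations. $\mathbin{\widehat{\otimes}}$ is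 the complete projective tensor product. A Hopf $\mathbin{\widehat{\otimes}}$-algebra is a Hopf algebra in the monoidal category of complete locally convex spaces with product $\mathbin{\widehat{\otimes}}$ (all structure maps continuous). An HFG Hopf algebra is a Hopf $\mathbin{\widehat{\otimes}}$-algebra that is an HFG algebra. "Determined by" means that $\Delta$ and $\varepsilon$ are the continuous unital homomorphisms (with $\Delta$ taking values in $\widetilde U(\mathfrak{af}_1)_\hbar\mathbin{\widehat{\otimes}}\widetilde U(\mathfrak{af}_1)_\hbar$), and $S$ the continuous antihomomorphism, with the given values on generators. *)

theory Defs
  imports "HOL-Analysis.Analysis" "HOL-Algebra.QuotRing" "HOL-Algebra.Module" "HOL-Library.Poly_Mapping"
begin

section \<open>Locally convex spaces and algebras over the complex numbers\<close>

text \<open>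
  Spaces and algebras are explicit structures: a \<^typ>\<open>('r, 'a) module\<close> record of HOL-Algebra together
  with a topology on its carrier. For a mere locally convex space the fields \<open>mult\<close> and \<open>one\<close>, which
  that record always has, are irrelevant.
\<close>

record 'a lc_struct = "(complex, 'a) module" +
  topol :: "'a topology"

definition complex_alg :: "complex lc_struct" where
  "complex_alg = \<lparr>carrier = UNIV, mult = (*), one = 1, zero = 0, add = (+), smult = (*),
     topol = euclidean\<rparr>"

abbreviation complex_space :: "(complex, 'a, 'm) module_scheme \<Rightarrow> bool" where
  "complex_space V \<equiv> Module.module complex_alg V"

text \<open>The locale \<^locale>\<open>algebra\<close> of HOL-Algebra only covers commutative algebras.\<close>

definition complex_algebra :: "(complex, 'a, 'm) module_scheme \<Rightarrow> bool" where
  "complex_algebra A \<longleftrightarrow> complex_space A \<and> ring A \<and>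
     (\<forall>c. \<forall>x\<in>carrier A. \<forall>y\<in>carrier A.
        (c \<odot>\<^bsub>A\<^esub> x) \<otimes>\<^bsub>A\<^esub> y = c \<odot>\<^bsub>A\<^esub> (x \<otimes>\<^bsub>A\<^esub> y) \<and>
        x \<otimes>\<^bsub>A\<^esub> (c \<odot>\<^bsub>A\<^esub> y) = c \<odot>\<^bsub>A\<^esub> (x \<otimes>\<^bsub>A\<^esub> y))"

definition finite_dimensional :: "(complex, 'a, 'm) module_scheme \<Rightarrow> bool" where
  "finite_dimensional V \<longleftrightarrow> (\<exists>B. finite B \<and> B \<subseteq> carrier V \<and>
     (\<forall>x\<in>carrier V. \<exists>c. x = finsum V (\<lambda>b. c b \<odot>\<^bsub>V\<^esub> b) B))"

definition seminorm :: "(complex, 'a, 'm) module_scheme \<Rightarrow> ('a \<Rightarrow> real) \<Rightarrow> bool" where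
  "seminorm V p \<longleftrightarrow>
     (\<forall>x\<in>carrier V. 0 \<le> p x) \<and>
     (\<forall>x\<in>carrier V. \<forall>y\<in>carrier V. p (x \<oplus>\<^bsub>V\<^esub> y) \<le> p x + p y) \<and>
     (\<forall>c. \<forall>x\<in>carrier V. p (c \<odot>\<^bsub>V\<^esub> x) = cmod c * p x)"

definition submultiplicative :: "(complex, 'a, 'm) module_scheme \<Rightarrow> ('a \<Rightarrow> real) \<Rightarrow> bool" where
  "submultiplicative A p \<longleftrightarrow> (\<forall>x\<in>carrier A. \<forall>y\<in>carrier A. p (x \<otimes>\<^bsub>A\<^esub> y) \<le> p x * p y)"

definition seminorm_topology ::
    "(complex, 'a, 'm) module_scheme \<Rightarrow> ('a \<Rightarrow> real) set \<Rightarrow> 'a topology" where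
  "seminorm_topology V P = topology (\<lambda>W. W \<subseteq> carrier V \<and>
     (\<forall>x\<in>W. \<exists>Q e. finite Q \<and> Q \<subseteq> P \<and> e > 0 \<and>
        {y \<in> carrier V. \<forall>p\<in>Q. p (y \<ominus>\<^bsub>V\<^esub> x) < e} \<subseteq> W))"

lemma istopology_seminorm:
  "istopology (\<lambda>W. W \<subseteq> carrier V \<and>
     (\<forall>x\<in>W. \<exists>Q e. finite Q \<and> Q \<subseteq> P \<and> e > 0 \<and>
        {y \<in> carrier V. \<forall>p\<in>Q. p (y \<ominus>\<^bsub>V\<^esub> x) < (e::real)} \<subseteq> W))"
proof -
  define N where "N x Q e = {y \<in> carrier V. \<forall>p\<in>Q. p (y \<ominus>\<^bsub>V\<^esub> x) < (e::real)}" for x Q e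
  define op where "op W \<longleftrightarrow> W \<subseteq> carrier V \<and>
     (\<forall>x\<in>W. \<exists>Q e. finite Q \<and> Q \<subseteq> P \<and> e > 0 \<and> N x Q e \<subseteq> W)" for W
  have op1: "W \<subseteq> carrier V" if "op W" for W
    using that by (simp add: op_def)
  have op2: "\<exists>Q e. finite Q \<and> Q \<subseteq> P \<and> e > 0 \<and> N x Q e \<subseteq> W" if "op W" "x \<in> W" for W x
    using that by (simp add: op_def)
  have N_mono: "N x (Q \<union> Q') (min e e') \<subseteq> N x Q e \<inter> N x Q' e'" for x Q Q' e e'
    unfolding N_def by (intro subsetI) simp
  have int: "op (S \<inter> T)" if ST: "op S" "op T" for S T
    unfolding op_def
  proof (intro conjI ballI)
    show "S \<inter> T \<subseteq> carrier V" using op1[OF ST(1)] by (rule le_infI1)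
    fix x assume x: "x \<in> S \<inter> T"
    obtain Q e where Q: "finite Q" "Q \<subseteq> P" "e > 0" "N x Q e \<subseteq> S"
      using op2[OF ST(1), of x] x by auto
    obtain Q' e' where Q': "finite Q'" "Q' \<subseteq> P" "e' > 0" "N x Q' e' \<subseteq> T"
      using op2[OF ST(2), of x] x by auto
    have "N x (Q \<union> Q') (min e e') \<subseteq> S \<inter> T"
      by (rule order_trans[OF N_mono Int_mono[OF Q(4) Q'(4)]])
    moreover have "finite (Q \<union> Q')" "Q \<union> Q' \<subseteq> P" "min e e' > 0" using Q Q' by simp_all
    ultimately show "\<exists>Q e. finite Q \<and> Q \<subseteq> P \<and> e > 0 \<and> N x Q e \<subseteq> S \<inter> T"
      by (intro exI conjI)
  qed
  have un: "op (\<Union>K)" if K: "\<forall>S\<in>K. op S" for K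
    unfolding op_def
  proof (intro conjI ballI)
    show "\<Union>K \<subseteq> carrier V" by (rule Union_least) (use K op1 in simp)
    fix x assume "x \<in> \<Union>K"
    then obtain S where S: "S \<in> K" "x \<in> S" by blast
    obtain Q e where "finite Q" "Q \<subseteq> P" "e > 0" "N x Q e \<subseteq> S"
      using op2[of S x] K S by auto
    moreover have "S \<subseteq> \<Union>K" using S by blast
    ultimately show "\<exists>Q e. finite Q \<and> Q \<subseteq> P \<and> e > 0 \<and> N x Q e \<subseteq> \<Union>K"
      by (meson order_trans)
  qed
  have "istopology op" unfolding istopology_def using int un by simp
  then show ?thesis unfolding op_def N_def .
qed

definition lc_space ::
    "(complex, 'a) module \<Rightarrow> ('a \<Rightarrow> real) set \<Rightarrow> 'a lc_struct" where
  "lc_space V P = module.extend V (lc_struct.fields (seminorm_topology V P))"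

definition cont_seminorms :: "'a lc_struct \<Rightarrow> ('a \<Rightarrow> real) set" where
  "cont_seminorms V = {p. seminorm V p \<and> continuous_map (topol V) euclideanreal p}"

definition frechet_space :: "'a lc_struct \<Rightarrow> bool" where
  "frechet_space V \<longleftrightarrow> complex_space V \<and>
     (\<exists>p :: nat \<Rightarrow> 'a \<Rightarrow> real.
        (\<forall>k. seminorm V (p k)) \<and>
        topol V = seminorm_topology V (range p) \<and>
        (\<forall>x\<in>carrier V. (\<forall>k. p k x = 0) \<longrightarrow> x = \<zero>\<^bsub>V\<^esub>) \<and>
        (\<forall>s :: nat \<Rightarrow> 'a. (\<forall>i. s i \<in> carrier V) \<and>
             (\<forall>k. \<forall>e>0. \<exists>N. \<forall>i\<ge>N. \<forall>j\<ge>N. p k (s i \<ominus>\<^bsub>V\<^esub> s j) < e) \<longrightarrow>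
           (\<exists>x\<in>carrier V. \<forall>k. (\<lambda>i. p k (s i \<ominus>\<^bsub>V\<^esub> x)) \<longlonglongrightarrow> 0)))"

definition frechet_arens_michael :: "'a lc_struct \<Rightarrow> bool" where
  "frechet_arens_michael A \<longleftrightarrow> complex_algebra A \<and> frechet_space A \<and>
     (\<exists>P. (\<forall>p\<in>P. seminorm A p \<and> submultiplicative A p) \<and> topol A = seminorm_topology A P)"

text \<open>All maps between structures are normalised to be \<^const>\<open>undefined\<close> off the carrier, so that
  equality of maps is equality on the carrier.\<close>

definition cont_linear :: "'a lc_struct \<Rightarrow> 'b lc_struct \<Rightarrow> ('a \<Rightarrow> 'b) set" where
  "cont_linear V W = {f \<in> carrier V \<rightarrow>\<^sub>E carrier W.
     (\<forall>x\<in>carrier V. \<forall>y\<in>carrier V. f (x \<oplus>\<^bsub>V\<^esub> y) = f x \<oplus>\<^bsub>W\<^esub> f y) \<and>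
     (\<forall>c. \<forall>x\<in>carrier V. f (c \<odot>\<^bsub>V\<^esub> x) = c \<odot>\<^bsub>W\<^esub> f x) \<and>
     continuous_map (topol V) (topol W) f}"

definition cont_alg_hom :: "'a lc_struct \<Rightarrow> 'b lc_struct \<Rightarrow> ('a \<Rightarrow> 'b) set" where
  "cont_alg_hom A B = cont_linear A B \<inter> ring_hom A B"

definition cont_alg_antihom :: "'a lc_struct \<Rightarrow> 'b lc_struct \<Rightarrow> ('a \<Rightarrow> 'b) set" where
  "cont_alg_antihom A B = {f \<in> cont_linear A B.
     (\<forall>x\<in>carrier A. \<forall>y\<in>carrier A. f (x \<otimes>\<^bsub>A\<^esub> y) = f y \<otimes>\<^bsub>B\<^esub> f x) \<and> f \<one>\<^bsub>A\<^esub> = \<one>\<^bsub>B\<^esub>}"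

definition top_alg_isomorphic :: "'a lc_struct \<Rightarrow> 'b lc_struct \<Rightarrow> bool" where
  "top_alg_isomorphic A B \<longleftrightarrow> (\<exists>f\<in>cont_alg_hom A B. \<exists>g\<in>cont_alg_hom B A.
     (\<forall>x\<in>carrier A. g (f x) = x) \<and> (\<forall>y\<in>carrier B. f (g y) = y))"

definition top_lin_invertible :: "'a lc_struct \<Rightarrow> ('a \<Rightarrow> 'a) \<Rightarrow> bool" where
  "top_lin_invertible V f \<longleftrightarrow> f \<in> cont_linear V V \<and> (\<exists>g\<in>cont_linear V V.
     (\<forall>x\<in>carrier V. g (f x) = x) \<and> (\<forall>x\<in>carrier V. f (g x) = x))"

section \<open>Quotients by closed ideals\<close>

definition quot_alg :: "'a lc_struct \<Rightarrow> 'a set \<Rightarrow> 'a set lc_struct" where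
  "quot_alg A I =
     \<lparr>carrier = carrier (A Quot I), mult = mult (A Quot I), one = one (A Quot I),
      zero = zero (A Quot I), add = add (A Quot I),
      smult = (\<lambda>c C. \<Union>x\<in>C. I +>\<^bsub>A\<^esub> (c \<odot>\<^bsub>A\<^esub> x)),
      topol = topology (\<lambda>W. W \<subseteq> carrier (A Quot I) \<and>
                 openin (topol A) {x \<in> carrier A. I +>\<^bsub>A\<^esub> x \<in> W})\<rparr>"

definition closed_ideal_gen :: "'a lc_struct \<Rightarrow> 'a set \<Rightarrow> 'a set" where
  "closed_ideal_gen A S = \<Inter>{I. ideal I A \<and> closedin (topol A) I \<and> S \<subseteq> I}"

section \<open>Free entire functions and HFG algebras\<close>

text \<open>The series \<open>\<Sum> c\<^sub>\<alpha> \<zeta>\<^sub>\<alpha>\<close> is represented by its coefficient function \<open>c\<close> on words.\<close>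

abbreviation words :: "nat \<Rightarrow> nat list set" where
  "words n \<equiv> lists {1..n}"

definition fe_norm :: "nat \<Rightarrow> real \<Rightarrow> (nat list \<Rightarrow> complex) \<Rightarrow> real" where
  "fe_norm n r a = (\<Sum>\<^sub>\<infinity>w\<in>words n. cmod (a w) * r ^ length w)"

definition free_entire :: "nat \<Rightarrow> (nat list \<Rightarrow> complex) lc_struct" where
  "free_entire n = lc_space
     \<lparr>carrier = {a. (\<forall>w. w \<notin> words n \<longrightarrow> a w = 0) \<and>
                    (\<forall>r>0. (\<lambda>w. cmod (a w) * r ^ length w) summable_on words n)},
      mult = (\<lambda>a b w. \<Sum>k\<le>length w. a (take k w) * b (drop k w)),
      one = (\<lambda>w. if w = [] then 1 else 0),
      zero = (\<lambda>w. 0),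
      add = (\<lambda>a b w. a w + b w),
      smult = (\<lambda>c a w. c * a w)\<rparr>
     {fe_norm n r | r. r > 0}"

definition fe_gen :: "nat \<Rightarrow> nat list \<Rightarrow> complex" where
  "fe_gen i = (\<lambda>w. if w = [i] then 1 else 0)"

text \<open>For an entire function \<open>f\<close>, this is \<open>f(\<zeta>\<^sub>i) = \<Sum>\<^sub>k (f\<^bsup>(k)\<^esup>(0) / k!) \<zeta>\<^sub>i\<^bsup>k\<^esup>\<close>.\<close>

definition fe_fun :: "(complex \<Rightarrow> complex) \<Rightarrow> nat \<Rightarrow> nat list \<Rightarrow> complex" where
  "fe_fun f i = (\<lambda>w. if w = replicate (length w) i
                     then (deriv ^^ length w) f 0 / fact (length w) else 0)"

definition HFG_algebra :: "'a lc_struct \<Rightarrow> bool" where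
  "HFG_algebra A \<longleftrightarrow> frechet_arens_michael A \<and>
     (\<exists>n I. ideal I (free_entire n) \<and> closedin (topol (free_entire n)) I \<and>
        top_alg_isomorphic A (quot_alg (free_entire n) I))"

text \<open>A relation \<open>a = b\<close> is given as the pair \<open>(a, b)\<close>.\<close>

definition relation_ideal ::
    "nat \<Rightarrow> ((nat list \<Rightarrow> complex) \<times> (nat list \<Rightarrow> complex)) set \<Rightarrow> (nat list \<Rightarrow> complex) set" where
  "relation_ideal n R =
     closed_ideal_gen (free_entire n) {a \<ominus>\<^bsub>free_entire n\<^esub> b | a b. (a, b) \<in> R}"

definition universal_HFG ::
    "nat \<Rightarrow> ((nat list \<Rightarrow> complex) \<times> (nat list \<Rightarrow> complex)) set \<Rightarrow>
     (nat list \<Rightarrow> complex) set lc_struct" where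
  "universal_HFG n R = quot_alg (free_entire n) (relation_ideal n R)"

section \<open>The complete projective tensor product of Frechet spaces\<close>

text \<open>
  \<open>V \<otimes> W\<close> is the quotient of the free vector space on \<open>V \<times> W\<close> by the bilinearity relations. Its
  projective topology is given by the seminorms
  \<open>u \<mapsto> inf {\<Sum> \<bar>c\<^sub>i\<bar> p(x\<^sub>i) q(y\<^sub>i) | u = \<Sum> c\<^sub>i x\<^sub>i \<otimes> y\<^sub>i}\<close> for continuous seminorms \<open>p\<close>, \<open>q\<close>. The Hausdorff
  completion is formed by Cauchy sequences modulo null sequences. This is the full completion because
  the topology of \<open>V \<otimes> W\<close> is given by countably many seminorms when \<open>V\<close> and \<open>W\<close> are Frechet spaces,
  the only case in which the construction is used. Frechet spaces are closed under this tensor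
  product, so they form a full monoidal subcategory of the complete locally convex spaces.

  Sequences are taken directly in the free vector space; elements that are equal in \<open>V \<otimes> W\<close> have
  seminorm distance 0 and are therefore identified.
\<close>

definition fv_scale :: "complex \<Rightarrow> ('k \<Rightarrow>\<^sub>0 complex) \<Rightarrow> ('k \<Rightarrow>\<^sub>0 complex)" where
  "fv_scale c u = Poly_Mapping.map ((*) c) u"

abbreviation fv_pair :: "'a \<Rightarrow> 'b \<Rightarrow> ('a \<times> 'b \<Rightarrow>\<^sub>0 complex)" where
  "fv_pair x y \<equiv> Poly_Mapping.single (x, y) 1"

definition fv_carrier :: "'a lc_struct \<Rightarrow> 'b lc_struct \<Rightarrow> ('a \<times> 'b \<Rightarrow>\<^sub>0 complex) set" where
  "fv_carrier V W = {u. Poly_Mapping.keys u \<subseteq> carrier V \<times> carrier W}"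

definition bilinear_relations ::
    "'a lc_struct \<Rightarrow> 'b lc_struct \<Rightarrow> ('a \<times> 'b \<Rightarrow>\<^sub>0 complex) set" where
  "bilinear_relations V W = Modules.module.span fv_scale
     ({fv_pair (x \<oplus>\<^bsub>V\<^esub> x') y - fv_pair x y - fv_pair x' y | x x' y.
         x \<in> carrier V \<and> x' \<in> carrier V \<and> y \<in> carrier W} \<union>
      {fv_pair x (y \<oplus>\<^bsub>W\<^esub> y') - fv_pair x y - fv_pair x y' | x y y'.
         x \<in> carrier V \<and> y \<in> carrier W \<and> y' \<in> carrier W} \<union>
      {fv_pair (c \<odot>\<^bsub>V\<^esub> x) y - fv_scale c (fv_pair x y) | c x y.
         x \<in> carrier V \<and> y \<in> carrier W} \<union>
      {fv_pair x (c \<odot>\<^bsub>W\<^esub> y) - fv_scale c (fv_pair x y) | c x y.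
         x \<in> carrier V \<and> y \<in> carrier W})"

definition proj_seminorm ::
    "'a lc_struct \<Rightarrow> 'b lc_struct \<Rightarrow> ('a \<Rightarrow> real) \<Rightarrow> ('b \<Rightarrow> real) \<Rightarrow>
     ('a \<times> 'b \<Rightarrow>\<^sub>0 complex) \<Rightarrow> real" where
  "proj_seminorm V W p q u =
     Inf {\<Sum>(x, y)\<in>Poly_Mapping.keys v. cmod (Poly_Mapping.lookup v (x, y)) * p x * q y | v.
            v \<in> fv_carrier V W \<and> v - u \<in> bilinear_relations V W}"

type_synonym ('a, 'b) ctensor = "(nat \<Rightarrow> ('a \<times> 'b \<Rightarrow>\<^sub>0 complex)) set"

definition tensor_Cauchy ::
    "'a lc_struct \<Rightarrow> 'b lc_struct \<Rightarrow> (nat \<Rightarrow> ('a \<times> 'b \<Rightarrow>\<^sub>0 complex)) set" where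
  "tensor_Cauchy V W = {s. (\<forall>i. s i \<in> fv_carrier V W) \<and>
     (\<forall>p\<in>cont_seminorms V. \<forall>q\<in>cont_seminorms W. \<forall>e>0. \<exists>N. \<forall>i\<ge>N. \<forall>j\<ge>N.
        proj_seminorm V W p q (s i - s j) < e)}"

definition tensor_null_rel ::
    "'a lc_struct \<Rightarrow> 'b lc_struct \<Rightarrow>
     ((nat \<Rightarrow> ('a \<times> 'b \<Rightarrow>\<^sub>0 complex)) \<times> (nat \<Rightarrow> ('a \<times> 'b \<Rightarrow>\<^sub>0 complex))) set" where
  "tensor_null_rel V W = {(s, t). s \<in> tensor_Cauchy V W \<and> t \<in> tensor_Cauchy V W \<and>
     (\<forall>p\<in>cont_seminorms V. \<forall>q\<in>cont_seminorms W.
        (\<lambda>i. proj_seminorm V W p q (s i - t i)) \<longlonglongrightarrow> 0)}"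

definition tensor_class ::
    "'a lc_struct \<Rightarrow> 'b lc_struct \<Rightarrow> (nat \<Rightarrow> ('a \<times> 'b \<Rightarrow>\<^sub>0 complex)) \<Rightarrow> ('a, 'b) ctensor" where
  "tensor_class V W s = tensor_null_rel V W `` {s}"

definition tensor_seminorm ::
    "'a lc_struct \<Rightarrow> 'b lc_struct \<Rightarrow> ('a \<Rightarrow> real) \<Rightarrow> ('b \<Rightarrow> real) \<Rightarrow> ('a, 'b) ctensor \<Rightarrow> real" where
  "tensor_seminorm V W p q C =
     (THE r. \<forall>s\<in>C. (\<lambda>i. proj_seminorm V W p q (s i)) \<longlonglongrightarrow> r)"

definition tensor_space :: "'a lc_struct \<Rightarrow> 'b lc_struct \<Rightarrow> ('a, 'b) ctensor lc_struct" where
  "tensor_space V W = lc_space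
     \<lparr>carrier = tensor_Cauchy V W // tensor_null_rel V W,
      mult = undefined, one = undefined,
      zero = tensor_class V W (\<lambda>i. 0),
      add = (\<lambda>C D. \<Union>s\<in>C. \<Union>t\<in>D. tensor_class V W (\<lambda>i. s i + t i)),
      smult = (\<lambda>c C. \<Union>s\<in>C. tensor_class V W (\<lambda>i. fv_scale c (s i)))\<rparr>
     {tensor_seminorm V W p q | p q. p \<in> cont_seminorms V \<and> q \<in> cont_seminorms W}"

definition elem_tensor :: "'a lc_struct \<Rightarrow> 'b lc_struct \<Rightarrow> 'a \<Rightarrow> 'b \<Rightarrow> ('a, 'b) ctensor" where
  "elem_tensor V W x y = tensor_class V W (\<lambda>i. fv_pair x y)"

text \<open>The continuous linear map on the tensor product induced by a continuous bilinear map \<open>\<beta>\<close>.\<close>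

definition tensor_lift ::
    "'a lc_struct \<Rightarrow> 'b lc_struct \<Rightarrow> 'c lc_struct \<Rightarrow> ('a \<Rightarrow> 'b \<Rightarrow> 'c) \<Rightarrow> ('a, 'b) ctensor \<Rightarrow> 'c" where
  "tensor_lift V W Z \<beta> = (THE f. f \<in> cont_linear (tensor_space V W) Z \<and>
     (\<forall>x\<in>carrier V. \<forall>y\<in>carrier W. f (elem_tensor V W x y) = \<beta> x y))"

definition tensor_map ::
    "'a lc_struct \<Rightarrow> 'b lc_struct \<Rightarrow> 'c lc_struct \<Rightarrow> 'd lc_struct \<Rightarrow>
     ('a \<Rightarrow> 'c) \<Rightarrow> ('b \<Rightarrow> 'd) \<Rightarrow> ('a, 'b) ctensor \<Rightarrow> ('c, 'd) ctensor" where
  "tensor_map V W V' W' f g =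
     tensor_lift V W (tensor_space V' W') (\<lambda>x y. elem_tensor V' W' (f x) (g y))"

definition tensor_assoc ::
    "'a lc_struct \<Rightarrow> 'b lc_struct \<Rightarrow> 'c lc_struct \<Rightarrow>
     (('a, 'b) ctensor, 'c) ctensor \<Rightarrow> ('a, ('b, 'c) ctensor) ctensor" where
  "tensor_assoc U V W =
     tensor_lift (tensor_space U V) W (tensor_space U (tensor_space V W))
       (\<lambda>t z. tensor_lift U V (tensor_space U (tensor_space V W))
                (\<lambda>x y. elem_tensor U (tensor_space V W) x (elem_tensor V W y z)) t)"

text \<open>The multiplication extends \<open>(a \<otimes> b) (c \<otimes> d) = a c \<otimes> b d\<close>.\<close>

definition tensor_alg :: "'a lc_struct \<Rightarrow> 'b lc_struct \<Rightarrow> ('a, 'b) ctensor lc_struct" where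
  "tensor_alg A B = (tensor_space A B)
     \<lparr>mult := (\<lambda>u v. tensor_lift A B (tensor_space A B)
                 (\<lambda>a b. tensor_lift A B (tensor_space A B)
                    (\<lambda>c d. elem_tensor A B (a \<otimes>\<^bsub>A\<^esub> c) (b \<otimes>\<^bsub>B\<^esub> d)) v) u),
      one := elem_tensor A B \<one>\<^bsub>A\<^esub> \<one>\<^bsub>B\<^esub>\<rparr>"

section \<open>Hopf algebras with respect to the complete projective tensor product\<close>

text \<open>
  The underlying space is required to be Frechet (see the remark on the tensor product above), which
  every HFG algebra is. Joint continuity of the multiplication says that it induces a continuous
  linear map on the completed tensor square.
\<close>

definition ctensor_algebra :: "'a lc_struct \<Rightarrow> bool" where
  "ctensor_algebra A \<longleftrightarrow> complex_algebra A \<and> frechet_space A \<and>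
     continuous_map (prod_topology (topol A) (topol A)) (topol A) (\<lambda>(x, y). x \<otimes>\<^bsub>A\<^esub> y)"

definition ctensor_bialgebra ::
    "'a lc_struct \<Rightarrow> ('a \<Rightarrow> ('a, 'a) ctensor) \<Rightarrow> ('a \<Rightarrow> complex) \<Rightarrow> bool" where
  "ctensor_bialgebra A \<Delta> \<epsilon> \<longleftrightarrow>
     ctensor_algebra A \<and>
     \<Delta> \<in> cont_alg_hom A (tensor_alg A A) \<and>
     \<epsilon> \<in> cont_alg_hom A complex_alg \<and>
     (\<forall>x\<in>carrier A.
        tensor_assoc A A A (tensor_map A A (tensor_space A A) A \<Delta> id (\<Delta> x)) =
        tensor_map A A A (tensor_space A A) id \<Delta> (\<Delta> x)) \<and>
     (\<forall>x\<in>carrier A. tensor_lift A A A (\<lambda>a b. \<epsilon> a \<odot>\<^bsub>A\<^esub> b) (\<Delta> x) = x) \<and>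
     (\<forall>x\<in>carrier A. tensor_lift A A A (\<lambda>a b. \<epsilon> b \<odot>\<^bsub>A\<^esub> a) (\<Delta> x) = x)"

definition ctensor_Hopf_algebra ::
    "'a lc_struct \<Rightarrow> ('a \<Rightarrow> ('a, 'a) ctensor) \<Rightarrow> ('a \<Rightarrow> complex) \<Rightarrow> ('a \<Rightarrow> 'a) \<Rightarrow> bool" where
  "ctensor_Hopf_algebra A \<Delta> \<epsilon> S \<longleftrightarrow>
     ctensor_bialgebra A \<Delta> \<epsilon> \<and>
     S \<in> cont_linear A A \<and>
     (\<forall>x\<in>carrier A. tensor_lift A A A (\<lambda>a b. S a \<otimes>\<^bsub>A\<^esub> b) (\<Delta> x) = \<epsilon> x \<odot>\<^bsub>A\<^esub> \<one>\<^bsub>A\<^esub>) \<and>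
     (\<forall>x\<in>carrier A. tensor_lift A A A (\<lambda>a b. a \<otimes>\<^bsub>A\<^esub> S b) (\<Delta> x) = \<epsilon> x \<odot>\<^bsub>A\<^esub> \<one>\<^bsub>A\<^esub>)"

definition HFG_Hopf_algebra ::
    "'a lc_struct \<Rightarrow> ('a \<Rightarrow> ('a, 'a) ctensor) \<Rightarrow> ('a \<Rightarrow> complex) \<Rightarrow> ('a \<Rightarrow> 'a) \<Rightarrow> bool" where
  "HFG_Hopf_algebra A \<Delta> \<epsilon> S \<longleftrightarrow> HFG_algebra A \<and> ctensor_Hopf_algebra A \<Delta> \<epsilon> S"

section \<open>The algebra \<open>U(af\<^sub>1)\<^sub>h\<close>\<close>

text \<open>The generators are \<open>X = \<zeta>\<^sub>1\<close> and \<open>Y = \<zeta>\<^sub>2\<close>.\<close>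

definition af_relations :: "complex \<Rightarrow> ((nat list \<Rightarrow> complex) \<times> (nat list \<Rightarrow> complex)) set" where
  "af_relations h = (let F = free_entire 2; X = fe_gen 1; Y = fe_gen 2 in
     {(X \<otimes>\<^bsub>F\<^esub> Y \<ominus>\<^bsub>F\<^esub> Y \<otimes>\<^bsub>F\<^esub> X, (1 / sinh h) \<odot>\<^bsub>F\<^esub> fe_fun (\<lambda>z. sinh (h * z)) 2)})"

definition U_af :: "complex \<Rightarrow> (nat list \<Rightarrow> complex) set lc_struct" where
  "U_af h = universal_HFG 2 (af_relations h)"

definition af_class :: "complex \<Rightarrow> (nat list \<Rightarrow> complex) \<Rightarrow> (nat list \<Rightarrow> complex) set" where
  "af_class h a = relation_ideal 2 (af_relations h) +>\<^bsub>free_entire 2\<^esub> a"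

definition X_af :: "complex \<Rightarrow> (nat list \<Rightarrow> complex) set" where
  "X_af h = af_class h (fe_gen 1)"

definition Y_af :: "complex \<Rightarrow> (nat list \<Rightarrow> complex) set" where
  "Y_af h = af_class h (fe_gen 2)"

text \<open>\<open>f(Y)\<close> for an entire function \<open>f\<close>.\<close>

definition fun_Y_af :: "complex \<Rightarrow> (complex \<Rightarrow> complex) \<Rightarrow> (nat list \<Rightarrow> complex) set" where
  "fun_Y_af h f = af_class h (fe_fun f 2)"

definition is_af_comultiplication ::
    "complex \<Rightarrow> ((nat list \<Rightarrow> complex) set \<Rightarrow>
       ((nat list \<Rightarrow> complex) set, (nat list \<Rightarrow> complex) set) ctensor) \<Rightarrow> bool" where
  "is_af_comultiplication h \<Delta> \<longleftrightarrow>
     (let U = U_af h; T = tensor_alg U U; X = X_af h; Y = Y_af h in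
       \<Delta> \<in> cont_alg_hom U T \<and>
       \<Delta> X = elem_tensor U U X (fun_Y_af h (\<lambda>z. exp (- h * z))) \<oplus>\<^bsub>T\<^esub>
             elem_tensor U U (fun_Y_af h (\<lambda>z. exp (h * z))) X \<and>
       \<Delta> Y = elem_tensor U U \<one>\<^bsub>U\<^esub> Y \<oplus>\<^bsub>T\<^esub> elem_tensor U U Y \<one>\<^bsub>U\<^esub>)"

definition is_af_counit :: "complex \<Rightarrow> ((nat list \<Rightarrow> complex) set \<Rightarrow> complex) \<Rightarrow> bool" where
  "is_af_counit h \<epsilon> \<longleftrightarrow> \<epsilon> \<in> cont_alg_hom (U_af h) complex_alg \<and> \<epsilon> (X_af h) = 0 \<and> \<epsilon> (Y_af h) = 0"

definition is_af_antipode ::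
    "complex \<Rightarrow> ((nat list \<Rightarrow> complex) set \<Rightarrow> (nat list \<Rightarrow> complex) set) \<Rightarrow> bool" where
  "is_af_antipode h S \<longleftrightarrow>
     (let U = U_af h; X = X_af h; Y = Y_af h in
       S \<in> cont_alg_antihom U U \<and>
       S X = (\<ominus>\<^bsub>U\<^esub> X) \<ominus>\<^bsub>U\<^esub> (h / sinh h) \<odot>\<^bsub>U\<^esub> fun_Y_af h (\<lambda>z. sinh (h * z)) \<and>
       S Y = \<ominus>\<^bsub>U\<^esub> Y)"

end

theory Submission
  imports Defs
begin

text \<open>
  Write \<open>F\<close> for the algebra of free entire functions in \<open>\<zeta>_1, \<zeta>_2\<close> and \<open>U\<close> for its quotient by the
  closed ideal of the relation \<open>[X, Y] = sinh(hY) / sinh h\<close>. The whole proof rests on the universal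
  property of \<open>U\<close>. Every Frechet Arens--Michael algebra \<open>B\<close> that occurs comes with an increasing
  sequence of submultiplicative seminorms defining its topology. A choice of two elements of \<open>B\<close>
  extends to a continuous homomorphism \<open>F \<rightarrow> B\<close>, because a product of values along a word \<open>w\<close> grows at
  most like \<open>\<rho>^|w|\<close> and the norms of \<open>F\<close> are weighted \<open>l^1\<close> norms (\<open>FE_hom_exists\<close>); the homomorphism is
  unique because polynomials are dense (\<open>FE_hom_eq\<close>). Continuous homomorphisms vanish on the relation
  ideal as soon as they respect the relation, so homomorphisms \<open>U \<rightarrow> B\<close> are the same as pairs \<open>x\<close>, \<open>y\<close> in
  \<open>B\<close> with \<open>x y - y x = (e - e') / (2 sinh h)\<close>, where \<open>e\<close> and \<open>e'\<close> are the exponentials of \<open>h y\<close> and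
  \<open>-h y\<close> (\<open>U_hom_exists\<close>, \<open>U_hom_eq\<close>). Homomorphisms preserve exponentials, being continuous, which is
  why \<open>sinh(hY)\<close> is handled through exponentials throughout.

  The counit comes from the pair \<open>0, 0\<close> in \<open>\<complex>\<close>, and the antipode from a pair in the opposite algebra.
  For the comultiplication one needs that the completed projective tensor product \<open>U \<otimes> U\<close> is again
  such an algebra (\<open>graded_algebra_TA\<close>) and that the exponential of \<open>c (1 \<otimes> Y + Y \<otimes> 1)\<close> is
  \<open>E(c) \<otimes> E(c)\<close> with \<open>E(c) = exp(cY)\<close>; the latter is the addition theorem for exponentials of commuting
  elements (\<open>is_exp_add\<close>). The relation is then a telescoping sum:
  \<open>[\<Delta>X, \<Delta>Y] = [X, Y] \<otimes> E(-h) + E(h) \<otimes> [X, Y]\<close> is \<open>1 / (2 sinh h)\<close> times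
  \<open>(E(h) - E(-h)) \<otimes> E(-h) + E(h) \<otimes> (E(h) - E(-h)) = E(h) \<otimes> E(h) - E(-h) \<otimes> E(-h)\<close>.

  Coassociativity and the counit axioms are equalities of continuous homomorphisms, hence need checking
  on \<open>X\<close> and \<open>Y\<close> only. The maps in the antipode axiom are not multiplicative, but
  \<open>S(a c) b d = S(c) (S(a) b) d\<close> shows that \<open>\<mu> (S \<otimes> 1)\<close>, with \<open>\<mu>\<close> for the multiplication, sends
  \<open>u v\<close> to \<open>r\<close> times the image of \<open>v\<close> whenever it sends \<open>u\<close> to the scalar \<open>r\<close> (\<open>mu_S_left\<close>). By induction on words it is enough to consider the
  generators, where the axiom amounts to the commutation rule
  \<open>X E(c) = E(c) X + (c / sinh h) E(c) sinh(hY)\<close> (\<open>XE_rel\<close>). The inverse of \<open>S\<close> is the antihomomorphism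
  with \<open>X \<mapsto> -X + (h / sinh h) sinh(hY)\<close> and \<open>Y \<mapsto> -Y\<close>. Finally \<open>X \<mapsto> z\<close>, \<open>Y \<mapsto> 0\<close> defines a homomorphism to
  the entire functions in one variable (\<open>evaluation_exists\<close>), whose image contains all powers of \<open>z\<close>, so
  that \<open>U\<close> has infinite dimension.

  Continuous linear maps out of \<open>F\<close> and out of tensor products are constructed by extending
  a map from a family with dense span (\<open>generates_extend\<close>), and equalities are proved by comparing
  values on such a family (\<open>generates_eq\<close>).
\<close>

section \<open>Graded Frechet spaces\<close>

lemma complex_alg_simps [simp]:
  "carrier complex_alg = UNIV" "mult complex_alg = (*)" "one complex_alg = 1"
  "zero complex_alg = 0" "add complex_alg = (+)" "smult complex_alg = (*)"
  by (simp_all add: complex_alg_def)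

lemma cring_complex_alg: "cring complex_alg"
proof (intro cringI abelian_groupI comm_monoidI)
  fix x :: complex
  show "\<exists>y\<in>carrier complex_alg. y \<oplus>\<^bsub>complex_alg\<^esub> x = \<zero>\<^bsub>complex_alg\<^esub>"
    by (intro bexI[of _ "- x"]) auto
qed (auto simp: algebra_simps)

lemma complex_spaceI:
  assumes "abelian_group V"
    and "\<And>c x. x \<in> carrier V \<Longrightarrow> c \<odot>\<^bsub>V\<^esub> x \<in> carrier V"
    and "\<And>a b x. x \<in> carrier V \<Longrightarrow> (a + b) \<odot>\<^bsub>V\<^esub> x = a \<odot>\<^bsub>V\<^esub> x \<oplus>\<^bsub>V\<^esub> b \<odot>\<^bsub>V\<^esub> x"
    and "\<And>a x y. x \<in> carrier V \<Longrightarrow> y \<in> carrier V \<Longrightarrow>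
           a \<odot>\<^bsub>V\<^esub> (x \<oplus>\<^bsub>V\<^esub> y) = a \<odot>\<^bsub>V\<^esub> x \<oplus>\<^bsub>V\<^esub> a \<odot>\<^bsub>V\<^esub> y"
    and "\<And>a b x. x \<in> carrier V \<Longrightarrow> (a * b) \<odot>\<^bsub>V\<^esub> x = a \<odot>\<^bsub>V\<^esub> (b \<odot>\<^bsub>V\<^esub> x)"
    and "\<And>x. x \<in> carrier V \<Longrightarrow> 1 \<odot>\<^bsub>V\<^esub> x = x"
  shows "complex_space V"
  by (rule moduleI) (use assms cring_complex_alg in auto)

locale cvs = Module.module complex_alg V for V :: "'a lc_struct" (structure)
begin

lemma sm_closed [simp, intro]: "x \<in> carrier V \<Longrightarrow> c \<odot> x \<in> carrier V"
  using smult_closed[of c x] by simp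

lemma sm_ladd: "x \<in> carrier V \<Longrightarrow> (a + b) \<odot> x = a \<odot> x \<oplus> b \<odot> x"
  using smult_l_distr[of a b x] by simp

lemma sm_radd: "x \<in> carrier V \<Longrightarrow> y \<in> carrier V \<Longrightarrow> a \<odot> (x \<oplus> y) = a \<odot> x \<oplus> a \<odot> y"
  using smult_r_distr[of a x y] by simp

lemma sm_sm [simp]: "x \<in> carrier V \<Longrightarrow> a \<odot> (b \<odot> x) = (a * b) \<odot> x"
  using smult_assoc1[of a b x] by simp

lemma sm_1 [simp]: "x \<in> carrier V \<Longrightarrow> 1 \<odot> x = x"
  using smult_one[of x] by simp

lemma sm_0 [simp]: "x \<in> carrier V \<Longrightarrow> 0 \<odot> x = \<zero>"
  using smult_l_null[of x] by simp

lemma sm_zero [simp]: "c \<odot> \<zero> = \<zero>"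
  using smult_r_null[of c] by simp

lemma neg_eq_sm: "x \<in> carrier V \<Longrightarrow> \<ominus> x = (-1) \<odot> x"
proof -
  assume x: "x \<in> carrier V"
  have "(-1) \<odot> x \<oplus> x = (-1 + 1) \<odot> x"
    using x by (subst sm_ladd) auto
  then show ?thesis using x by (simp add: minus_equality)
qed

lemma sm_neg: "x \<in> carrier V \<Longrightarrow> c \<odot> (\<ominus> x) = \<ominus> (c \<odot> x)"
  by (simp add: neg_eq_sm)

lemma sm_minus: "x \<in> carrier V \<Longrightarrow> y \<in> carrier V \<Longrightarrow> c \<odot> (x \<ominus> y) = c \<odot> x \<ominus> c \<odot> y"
  by (simp add: minus_eq sm_radd sm_neg)

lemma minus_split:
  "x \<in> carrier V \<Longrightarrow> y \<in> carrier V \<Longrightarrow> z \<in> carrier V \<Longrightarrow> x \<ominus> z = (x \<ominus> y) \<oplus> (y \<ominus> z)"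
  by (simp add: minus_eq a_ac r_neg1 r_neg2)

lemma minus_plus_cancel: "x \<in> carrier V \<Longrightarrow> y \<in> carrier V \<Longrightarrow> (x \<ominus> y) \<oplus> y = x"
  by (simp add: minus_eq a_assoc l_neg)

lemma plus_minus_cancel: "x \<in> carrier V \<Longrightarrow> y \<in> carrier V \<Longrightarrow> (x \<oplus> y) \<ominus> x = y"
  by (simp add: minus_eq a_comm[of x y] a_assoc r_neg)

lemma minus_self: "x \<in> carrier V \<Longrightarrow> x \<ominus> x = \<zero>"
  by (simp add: minus_eq r_neg)

lemma minus_zero_right: "x \<in> carrier V \<Longrightarrow> x \<ominus> \<zero> = x"
  by (simp add: minus_eq)

lemma neg_minus: "x \<in> carrier V \<Longrightarrow> y \<in> carrier V \<Longrightarrow> \<ominus> (x \<ominus> y) = y \<ominus> x"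
  by (simp add: minus_eq minus_add a_ac)

lemma minus_eq_zero: "x \<in> carrier V \<Longrightarrow> y \<in> carrier V \<Longrightarrow> x \<ominus> y = \<zero> \<Longrightarrow> x = y"
  using minus_plus_cancel[of x y] by simp

lemma plus_minus_plus:
  "x \<in> carrier V \<Longrightarrow> y \<in> carrier V \<Longrightarrow> x' \<in> carrier V \<Longrightarrow> y' \<in> carrier V \<Longrightarrow>
    (x \<oplus> y) \<ominus> (x' \<oplus> y') = (x \<ominus> x') \<oplus> (y \<ominus> y')"
  by (simp add: minus_eq minus_add a_ac)

context
  fixes q assumes q: "seminorm V q"
begin

lemma snorm_nonneg: "x \<in> carrier V \<Longrightarrow> 0 \<le> q x"
  using q by (simp add: seminorm_def)

lemma snorm_add: "x \<in> carrier V \<Longrightarrow> y \<in> carrier V \<Longrightarrow> q (x \<oplus> y) \<le> q x + q y"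
  using q by (simp add: seminorm_def)

lemma snorm_sm: "x \<in> carrier V \<Longrightarrow> q (c \<odot> x) = cmod c * q x"
  using q by (simp add: seminorm_def)

lemma snorm_zero: "q \<zero> = 0"
  using snorm_sm[of \<zero> 0] by simp

lemma snorm_neg: "x \<in> carrier V \<Longrightarrow> q (\<ominus> x) = q x"
  using snorm_sm[of x "-1"] by (simp add: neg_eq_sm)

lemma snorm_minus_commute: "x \<in> carrier V \<Longrightarrow> y \<in> carrier V \<Longrightarrow> q (x \<ominus> y) = q (y \<ominus> x)"
  using snorm_neg[of "x \<ominus> y"] by (simp add: neg_minus)

lemma snorm_triangle:
  "x \<in> carrier V \<Longrightarrow> y \<in> carrier V \<Longrightarrow> z \<in> carrier V \<Longrightarrow> q (x \<ominus> z) \<le> q (x \<ominus> y) + q (y \<ominus> z)"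
  using snorm_add[of "x \<ominus> y" "y \<ominus> z"] by (simp add: minus_split[of x y z])

lemma snorm_diff: "x \<in> carrier V \<Longrightarrow> y \<in> carrier V \<Longrightarrow> \<bar>q x - q y\<bar> \<le> q (x \<ominus> y)"
  using snorm_add[of "x \<ominus> y" y] snorm_add[of "y \<ominus> x" x] snorm_minus_commute[of x y]
  by (simp add: minus_plus_cancel)

end

end

definition graded_open :: "'a lc_struct \<Rightarrow> (nat \<Rightarrow> 'a \<Rightarrow> real) \<Rightarrow> 'a set \<Rightarrow> bool" where
  "graded_open V p W \<longleftrightarrow> W \<subseteq> carrier V \<and>
     (\<forall>x\<in>W. \<exists>k e. e > 0 \<and> {y \<in> carrier V. p k (y \<ominus>\<^bsub>V\<^esub> x) < e} \<subseteq> W)"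

lemma openin_seminorm_topology:
  "openin (seminorm_topology V P) W \<longleftrightarrow> W \<subseteq> carrier V \<and>
     (\<forall>x\<in>W. \<exists>Q e. finite Q \<and> Q \<subseteq> P \<and> e > 0 \<and>
        {y \<in> carrier V. \<forall>p\<in>Q. p (y \<ominus>\<^bsub>V\<^esub> x) < e} \<subseteq> W)"
  unfolding seminorm_topology_def
  by (subst topology_inverse'[OF istopology_seminorm]) (rule refl)

text \<open>Taking the maximum of the indices and of the constants, by induction on the family: this is what
  makes it possible to work with one seminorm at a time when the sequence is increasing.\<close>

lemma (in cvs) finite_dominated:
  assumes p: "\<And>k. seminorm V (p k)" and incr: "\<And>k x. x \<in> carrier V \<Longrightarrow> p k x \<le> p (Suc k) x"
    and "finite Q" "\<And>q. q \<in> Q \<Longrightarrow> \<exists>k C. \<forall>x\<in>carrier V. q x \<le> C * p k x"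
  shows "\<exists>k::nat. \<exists>C>0. \<forall>q\<in>Q. \<forall>x\<in>carrier V. q x \<le> C * p k x"
  using assms(3,4)
proof (induction Q)
  case empty
  show ?case by (intro exI[of _ 0] exI[of _ 1]) auto
next
  case (insert q Q)
  have mono: "p j x \<le> p k x" if "j \<le> k" "x \<in> carrier V" for j k x
    using lift_Suc_mono_le[of "\<lambda>k. p k x" j k] incr that by simp
  obtain k C where k: "C > 0" "\<And>q x. q \<in> Q \<Longrightarrow> x \<in> carrier V \<Longrightarrow> q x \<le> C * p k x"
    using insert.IH[OF insert.prems[OF insertI2]] by blast
  obtain k' C' where k': "\<And>x. x \<in> carrier V \<Longrightarrow> q x \<le> C' * p k' x"
    using insert.prems[of q] by auto
  let ?K = "max k k'" and ?D = "max C \<bar>C'\<bar>"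
  have a: "C * p k x \<le> ?D * p ?K x" "C' * p k' x \<le> ?D * p ?K x" if x: "x \<in> carrier V" for x
  proof -
    have 0: "0 \<le> p k x" "0 \<le> p k' x" using snorm_nonneg[OF p x] by auto
    show "C * p k x \<le> ?D * p ?K x"
      by (intro mult_mono mono[OF _ x]) (use 0 k(1) in auto)
    have "C' * p k' x \<le> \<bar>C'\<bar> * p k' x" using 0 by (intro mult_right_mono) auto
    also have "\<dots> \<le> ?D * p ?K x"
      by (intro mult_mono mono[OF _ x]) (use 0 k(1) in auto)
    finally show "C' * p k' x \<le> ?D * p ?K x" .
  qed
  have "\<forall>r\<in>insert q Q. \<forall>x\<in>carrier V. r x \<le> ?D * p ?K x"
  proof (intro ballI)
    fix r x assume "r \<in> insert q Q" and x: "x \<in> carrier V"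
    then show "r x \<le> ?D * p ?K x"
      using order_trans[OF k(2)[of r x] a(1)] order_trans[OF k'[of x] a(2)] by auto
  qed
  then show ?case using k(1) by (intro exI[of _ ?K] exI[of _ ?D]) auto
qed

lemma dominated_range:
  fixes p :: "nat \<Rightarrow> 'a \<Rightarrow> real"
  assumes "q \<in> range p"
  shows "\<exists>k C. \<forall>x\<in>A. q x \<le> C * p k x"
proof -
  obtain k where "q = p k" using assms by blast
  then show ?thesis by (intro exI[of _ k] exI[of _ 1]) simp
qed

text \<open>A finite intersection of seminorm balls contains a ball of one \<open>p k\<close> by
  \<open>finite_dominated\<close>, so an enlargement of the sequence \<open>p\<close> by dominated seminorms does not change the topology.\<close>

lemma (in cvs) openin_graded:
  assumes p: "\<And>k. seminorm V (p k)" and incr: "\<And>k x. x \<in> carrier V \<Longrightarrow> p k x \<le> p (Suc k) x"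
    and P: "\<And>q. q \<in> P \<Longrightarrow> \<exists>k C. \<forall>x\<in>carrier V. q x \<le> C * p k x" and "range p \<subseteq> P"
  shows "openin (seminorm_topology V P) W \<longleftrightarrow> graded_open V p W"
proof -
  have "(\<exists>Q e. finite Q \<and> Q \<subseteq> P \<and> e > 0 \<and> {y \<in> carrier V. \<forall>p\<in>Q. p (y \<ominus> x) < e} \<subseteq> W) \<longleftrightarrow>
        (\<exists>k e. e > 0 \<and> {y \<in> carrier V. p k (y \<ominus> x) < e} \<subseteq> W)"
    (is "?L x \<longleftrightarrow> ?R x") if x: "x \<in> carrier V" for x
  proof
    assume "?R x"
    then obtain k e where "e > 0" "{y \<in> carrier V. p k (y \<ominus> x) < e} \<subseteq> W" by blast
    then show "?L x" using assms(4)
      by (intro exI[of _ "{p k}"] exI[of _ e]) auto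
  next
    assume "?L x"
    then obtain Q e where Q: "finite Q" "Q \<subseteq> P" "e > 0" "{y \<in> carrier V. \<forall>p\<in>Q. p (y \<ominus> x) < e} \<subseteq> W"
      by blast
    have "\<exists>k. \<exists>C>0. \<forall>q\<in>Q. \<forall>x\<in>carrier V. q x \<le> C * p k x"
      by (rule finite_dominated) (use p incr Q P in auto)
    then obtain k C where C: "C > 0" "\<And>q x. q \<in> Q \<Longrightarrow> x \<in> carrier V \<Longrightarrow> q x \<le> C * p k x"
      by blast
    have "{y \<in> carrier V. p k (y \<ominus> x) < e / C} \<subseteq> W"
    proof
      fix y assume "y \<in> {y \<in> carrier V. p k (y \<ominus> x) < e / C}"
      then have y: "y \<in> carrier V" "C * p k (y \<ominus> x) < e"
        using C(1) by (auto simp: field_simps)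
      have "q (y \<ominus> x) < e" if "q \<in> Q" for q
        using C(2)[OF that, of "y \<ominus> x"] x y by auto
      then show "y \<in> W" using Q(4) y by blast
    qed
    then show "?R x" using Q(3) C(1) by (intro exI[of _ k] exI[of _ "e / C"]) auto
  qed
  note eq = this
  show ?thesis
    unfolding openin_seminorm_topology graded_open_def
  proof (rule conj_cong[OF refl], rule ball_cong[OF refl])
    fix x assume "W \<subseteq> carrier V" "x \<in> W"
    then show "?L x \<longleftrightarrow> ?R x" by (intro eq) auto
  qed
qed

lemma (in cvs) seminorm_topology_graded:
  assumes "\<And>k. seminorm V (p k)" "\<And>k x. x \<in> carrier V \<Longrightarrow> p k x \<le> p (Suc k) x"
    and "\<And>q. q \<in> P \<Longrightarrow> \<exists>k C. \<forall>x\<in>carrier V. q x \<le> C * p k x" "range p \<subseteq> P"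
  shows "seminorm_topology V P = seminorm_topology V (range p)"
proof -
  have 1: "\<exists>k C. \<forall>x\<in>carrier V. q x \<le> C * p k x" if "q \<in> range p" for q
    by (rule dominated_range[OF that])
  have "openin (seminorm_topology V P) W = graded_open V p W" for W
    by (rule openin_graded) (use assms in auto)
  moreover have "openin (seminorm_topology V (range p)) W = graded_open V p W" for W
    by (rule openin_graded) (use assms 1 in auto)
  ultimately show ?thesis by (simp add: topology_eq)
qed

definition converges :: "'a lc_struct \<Rightarrow> (nat \<Rightarrow> 'a \<Rightarrow> real) \<Rightarrow> (nat \<Rightarrow> 'a) \<Rightarrow> 'a \<Rightarrow> bool" where
  "converges V p s x \<longleftrightarrow> (\<forall>i. s i \<in> carrier V) \<and> x \<in> carrier V \<and>
     (\<forall>k. (\<lambda>i. p k (s i \<ominus>\<^bsub>V\<^esub> x)) \<longlonglongrightarrow> 0)"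

definition Cauchy_in :: "'a lc_struct \<Rightarrow> (nat \<Rightarrow> 'a \<Rightarrow> real) \<Rightarrow> (nat \<Rightarrow> 'a) \<Rightarrow> bool" where
  "Cauchy_in V p s \<longleftrightarrow> (\<forall>i. s i \<in> carrier V) \<and>
     (\<forall>k. \<forall>e>0. \<exists>N. \<forall>i\<ge>N. \<forall>j\<ge>N. p k (s i \<ominus>\<^bsub>V\<^esub> s j) < e)"

text \<open>In a Frechet space the defining seminorms can be chosen to form an increasing sequence. Fixing such
  a sequence as part of the data turns topological statements into inequalities between seminorms.\<close>

locale graded_frechet = cvs V for V :: "'a lc_struct" (structure) +
  fixes p :: "nat \<Rightarrow> 'a \<Rightarrow> real"
  assumes snorm: "seminorm V (p k)"
    and incr: "x \<in> carrier V \<Longrightarrow> p k x \<le> p (Suc k) x"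
    and topol_eq: "topol V = seminorm_topology V (range p)"
    and separated: "x \<in> carrier V \<Longrightarrow> (\<And>k. p k x = 0) \<Longrightarrow> x = \<zero>"
    and complete: "Cauchy_in V p s \<Longrightarrow> \<exists>x. converges V p s x"
begin

lemmas nonneg [simp] = snorm_nonneg[OF snorm]
lemmas p_add = snorm_add[OF snorm]
lemmas p_sm = snorm_sm[OF snorm]
lemmas p_zero [simp] = snorm_zero[OF snorm]
lemmas p_triangle = snorm_triangle[OF snorm]
lemmas p_commute = snorm_minus_commute[OF snorm]
lemmas p_diff = snorm_diff[OF snorm]

lemma p_mono: "j \<le> k \<Longrightarrow> x \<in> carrier V \<Longrightarrow> p j x \<le> p k x"
  using lift_Suc_mono_le[of "\<lambda>k. p k x" j k] incr by simp

lemma space: "complex_space V"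
  by (rule cvs_axioms[unfolded cvs_def])

lemma frechet_space: "frechet_space V"
proof -
  have "\<exists>x\<in>carrier V. \<forall>k. (\<lambda>i. p k (s i \<ominus> x)) \<longlonglongrightarrow> 0"
    if "\<forall>i. s i \<in> carrier V" "\<forall>k. \<forall>e>0. \<exists>N. \<forall>i\<ge>N. \<forall>j\<ge>N. p k (s i \<ominus> s j) < e" for s
    using complete[of s] that by (auto simp: Cauchy_in_def converges_def)
  then show ?thesis
    unfolding frechet_space_def using space snorm topol_eq separated
    by (intro conjI exI[of _ p] allI ballI impI) blast+
qed

lemma openin_iff: "openin (topol V) W \<longleftrightarrow> graded_open V p W"
  unfolding topol_eq
proof (rule openin_graded)
  show "\<exists>k C. \<forall>x\<in>carrier V. q x \<le> C * p k x" if "q \<in> range p" for q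
    by (rule dominated_range[OF that])
qed (auto intro: snorm incr)

lemma topspace_eq [simp]: "topspace (topol V) = carrier V"
proof -
  have "openin (topol V) (carrier V)"
    unfolding openin_iff graded_open_def by (intro conjI ballI exI[of _ 0] exI[of _ 1]) auto
  then show ?thesis
    by (meson graded_open_def openin_iff openin_subset openin_topspace subset_antisym)
qed

text \<open>Rescaling \<open>x\<close> into the ball \<open>p k < e\<close>; the summand \<open>d\<close> in the scaling factor keeps it finite when
  \<open>p k x = 0\<close>.\<close>

lemma ball_bound:
  assumes q: "seminorm V q" and e: "e > 0" "\<And>x. x \<in> carrier V \<Longrightarrow> p k x < e \<Longrightarrow> q x < 1"
    and x: "x \<in> carrier V"
  shows "q x \<le> (2 / e) * p k x"
proof (rule field_le_epsilon)
  fix d :: real assume d: "d > 0"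
  define t where "t = e / (2 * (p k x + d * e / 2))"
  have pos: "p k x + d * e / 2 > 0" using nonneg[OF x, of k] d e(1) by (intro add_nonneg_pos) auto
  have t: "t > 0" using pos e(1) by (simp add: t_def)
  have "p k (complex_of_real t \<odot> x) = t * p k x" using t x by (simp add: p_sm)
  also have "\<dots> \<le> t * (p k x + d * e / 2)" using t d e(1) by (intro mult_left_mono) auto
  also have "\<dots> = e / 2" using pos by (simp add: t_def field_simps)
  also have "\<dots> < e" using e(1) by simp
  finally have "q (complex_of_real t \<odot> x) < 1" using e(2) x by auto
  then have "t * q x < 1" using snorm_sm[OF q x, of "complex_of_real t"] t by simp
  then have "q x < 1 / t" using t by (simp add: field_simps)
  also have "1 / t = 2 / e * p k x + d" using e(1) by (simp add: t_def field_simps)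
  finally show "q x \<le> 2 / e * p k x + d" by simp
qed

text \<open>The neighbourhood \<open>q < 1\<close> of the origin contains a ball of some \<open>p k\<close>, and homogeneity
  (\<open>ball_bound\<close>) turns this into a global estimate.\<close>

lemma cont_seminorms_iff:
  "q \<in> cont_seminorms V \<longleftrightarrow> seminorm V q \<and> (\<exists>k C. \<forall>x\<in>carrier V. q x \<le> C * p k x)"
proof (cases "seminorm V q")
  case q: True
  have "\<exists>k C. \<forall>x\<in>carrier V. q x \<le> C * p k x" if "continuous_map (topol V) euclideanreal q"
  proof -
    have "openin (topol V) {x \<in> topspace (topol V). q x \<in> {..<1}}"
      by (rule openin_continuous_map_preimage[OF that]) auto
    then have "graded_open V p {x \<in> carrier V. q x < 1}" by (simp add: openin_iff)
    moreover have "\<zero> \<in> {x \<in> carrier V. q x < 1}" by (simp add: snorm_zero[OF q])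
    ultimately obtain k e where e: "e > 0" "{y \<in> carrier V. p k (y \<ominus> \<zero>) < e} \<subseteq> {x \<in> carrier V. q x < 1}"
      unfolding graded_open_def by blast
    have "q x < 1" if "x \<in> carrier V" "p k x < e" for x
      using e(2) that by (auto simp: minus_zero_right subset_iff)
    from ball_bound[OF q e(1) this] show ?thesis by blast
  qed
  moreover have "continuous_map (topol V) euclideanreal q" if "\<forall>x\<in>carrier V. q x \<le> C * p k x" for k C
    unfolding continuous_map_def
  proof (intro conjI allI impI)
    fix U :: "real set" assume U: "openin euclideanreal U"
    have "\<exists>k e. e > 0 \<and> {y \<in> carrier V. p k (y \<ominus> x) < e} \<subseteq> {x \<in> carrier V. q x \<in> U}"
      if x: "x \<in> carrier V" "q x \<in> U" for x
    proof -
      obtain d where d: "d > 0" "\<And>r. \<bar>r - q x\<bar> < d \<Longrightarrow> r \<in> U"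
        using U x(2) by (auto simp: open_dist dist_real_def)
      have C: "\<bar>C\<bar> + 1 > 0" by simp
      have "q y \<in> U" if y: "y \<in> carrier V" "p k (y \<ominus> x) < d / (\<bar>C\<bar> + 1)" for y
      proof (rule d(2))
        have "\<bar>q y - q x\<bar> \<le> q (y \<ominus> x)" using snorm_diff[OF q] x y by simp
        also have "\<dots> \<le> C * p k (y \<ominus> x)"
          using \<open>\<forall>x\<in>carrier V. q x \<le> C * p k x\<close> x y by auto
        also have "\<dots> \<le> (\<bar>C\<bar> + 1) * p k (y \<ominus> x)"
          using x y by (intro mult_right_mono) auto
        also have "\<dots> < d" using y(2) C by (simp add: field_simps)
        finally show "\<bar>q y - q x\<bar> < d" .
      qed
      then show ?thesis using d(1) C by (intro exI[of _ k] exI[of _ "d / (\<bar>C\<bar> + 1)"]) auto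
    qed
    then show "openin (topol V) {x \<in> topspace (topol V). q x \<in> U}"
      by (auto simp: openin_iff graded_open_def)
  qed auto
  ultimately show ?thesis using q by (auto simp: cont_seminorms_def)
qed (simp add: cont_seminorms_def)

lemma p_cont [simp]: "p k \<in> cont_seminorms V"
  using dominated_range[of "p k" p "carrier V"] by (simp add: cont_seminorms_iff snorm)

lemma convergesD: "converges V p s x \<Longrightarrow> s i \<in> carrier V" "converges V p s x \<Longrightarrow> x \<in> carrier V"
  by (auto simp: converges_def)

lemma converges_bound:
  assumes "\<And>i. s i \<in> carrier V" "x \<in> carrier V"
    and "\<And>k i. p k (s i \<ominus> x) \<le> b k i" "\<And>k. b k \<longlonglongrightarrow> 0"
  shows "converges V p s x"
  unfolding converges_def
proof (intro conjI allI)
  fix k show "(\<lambda>i. p k (s i \<ominus> x)) \<longlonglongrightarrow> 0"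
    by (rule tendsto_sandwich[of "\<lambda>_. 0" _ _ "b k"]) (use assms in auto)
qed (use assms in auto)

lemma converges_const: "x \<in> carrier V \<Longrightarrow> converges V p (\<lambda>_. x) x"
  by (simp add: converges_def minus_self)

lemma converges_unique:
  assumes "converges V p s x" "converges V p s y"
  shows "x = y"
proof (rule minus_eq_zero)
  show xy: "x \<in> carrier V" "y \<in> carrier V" using assms by (auto simp: converges_def)
  show "x \<ominus> y = \<zero>"
  proof (rule separated)
    fix k
    have "p k (x \<ominus> y) \<le> p k (s i \<ominus> x) + p k (s i \<ominus> y)" for i
      using p_triangle[of x "s i" y k] p_commute[of x "s i" k] convergesD[OF assms(1)] xy by simp
    moreover have "(\<lambda>i. p k (s i \<ominus> x) + p k (s i \<ominus> y)) \<longlonglongrightarrow> 0 + 0"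
      using assms by (intro tendsto_add) (auto simp: converges_def)
    ultimately have "p k (x \<ominus> y) \<le> 0 + 0" by (intro LIMSEQ_le_const) auto
    then show "p k (x \<ominus> y) = 0" using xy by (intro antisym) auto
  qed (use xy in auto)
qed

lemma converges_add:
  assumes "converges V p s x" "converges V p t y"
  shows "converges V p (\<lambda>i. s i \<oplus> t i) (x \<oplus> y)"
proof (rule converges_bound)
  fix k i
  show "p k (s i \<oplus> t i \<ominus> (x \<oplus> y)) \<le> p k (s i \<ominus> x) + p k (t i \<ominus> y)"
    using p_add[of "s i \<ominus> x" "t i \<ominus> y" k] assms by (simp add: plus_minus_plus converges_def)
  show "(\<lambda>i. p k (s i \<ominus> x) + p k (t i \<ominus> y)) \<longlonglongrightarrow> 0"
    using tendsto_add[of "\<lambda>i. p k (s i \<ominus> x)" 0 _ "\<lambda>i. p k (t i \<ominus> y)" 0] assms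
    by (simp add: converges_def)
qed (use assms in \<open>auto simp: converges_def\<close>)

lemma converges_sm:
  assumes "converges V p s x"
  shows "converges V p (\<lambda>i. c \<odot> s i) (c \<odot> x)"
proof (rule converges_bound)
  fix k i
  show "p k (c \<odot> s i \<ominus> c \<odot> x) \<le> cmod c * p k (s i \<ominus> x)"
    using assms by (simp add: converges_def p_sm flip: sm_minus)
  show "(\<lambda>i. cmod c * p k (s i \<ominus> x)) \<longlonglongrightarrow> 0"
    using assms by (intro tendsto_mult_right_zero) (simp add: converges_def)
qed (use assms in \<open>auto simp: converges_def\<close>)

lemma converges_minus:
  assumes "converges V p s x" "converges V p t y"
  shows "converges V p (\<lambda>i. s i \<ominus> t i) (x \<ominus> y)"
  using converges_add[OF assms(1) converges_sm[OF assms(2), of "-1"]]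
    convergesD[OF assms(1)] convergesD[OF assms(2)]
  by (simp add: minus_eq neg_eq_sm)

lemma converges_seminorm:
  assumes "converges V p s x"
  shows "(\<lambda>i. p k (s i)) \<longlonglongrightarrow> p k x"
proof (rule Lim_transform[OF tendsto_const])
  show "(\<lambda>i. p k (s i) - p k x) \<longlonglongrightarrow> 0"
    by (rule Lim_null_comparison[of _ "\<lambda>i. p k (s i \<ominus> x)"])
      (use assms p_diff in \<open>auto simp: converges_def\<close>)
qed

lemma converges_bound_limit:
  assumes "converges V p s x" "\<And>i. p k (s i) \<le> b i" "b \<longlonglongrightarrow> c"
  shows "p k x \<le> c"
  using converges_seminorm[OF assms(1), of k] assms(3) assms(2) by (intro LIMSEQ_le) auto

lemma converges_subseq:
  "converges V p s x \<Longrightarrow> strict_mono f \<Longrightarrow> converges V p (\<lambda>i. s (f i)) x"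
  unfolding converges_def using LIMSEQ_subseq_LIMSEQ[of "\<lambda>i. p _ (s i \<ominus> x)" 0 f]
  by (auto simp: o_def)

lemma converges_null_diff:
  assumes "converges V p s x" "\<And>i. t i \<in> carrier V" "\<And>k. (\<lambda>i. p k (t i \<ominus> s i)) \<longlonglongrightarrow> 0"
  shows "converges V p t x"
proof (rule converges_bound)
  note s = convergesD[OF assms(1)]
  fix k i
  show "p k (t i \<ominus> x) \<le> p k (t i \<ominus> s i) + p k (s i \<ominus> x)"
    using p_triangle[of "t i" "s i" x k] assms(2) s by simp
  show "(\<lambda>i. p k (t i \<ominus> s i) + p k (s i \<ominus> x)) \<longlonglongrightarrow> 0"
    using tendsto_add[OF assms(3)[of k], of "\<lambda>i. p k (s i \<ominus> x)" 0] assms(1) by (simp add: converges_def)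
qed (use assms convergesD[OF assms(1)] in auto)

end

lemma cvs_of_complex_space: "complex_space V \<Longrightarrow> cvs V"
  by (simp add: cvs_def)

lemma graded_frechet_complex: "graded_frechet complex_alg (\<lambda>k. cmod)"
proof -
  have sp: "complex_space complex_alg"
    by (rule complex_spaceI) (use cring.axioms(1)[OF cring_complex_alg] in \<open>auto simp: algebra_simps ring_def\<close>)
  interpret cvs complex_alg using sp by (simp add: cvs_def)
  have neg: "\<ominus>\<^bsub>complex_alg\<^esub> x = - x" for x by (rule minus_equality) auto
  then have min: "x \<ominus>\<^bsub>complex_alg\<^esub> y = x - y" for x y by (simp add: minus_eq)
  have sn: "seminorm complex_alg cmod" by (auto simp: seminorm_def norm_mult norm_triangle_ineq)
  show ?thesis
  proof
    show "topol complex_alg = seminorm_topology complex_alg (range (\<lambda>k::nat. cmod))"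
      unfolding topology_eq
    proof
      fix W
      have "openin (topol complex_alg) W \<longleftrightarrow> graded_open complex_alg (\<lambda>k. cmod) W"
        by (auto simp: complex_alg_def[THEN arg_cong[of _ _ topol]] graded_open_def min[unfolded complex_alg_def] 
             open_contains_ball ball_def dist_norm min norm_minus_commute)
      also have "\<dots> \<longleftrightarrow> openin (seminorm_topology complex_alg (range (\<lambda>k::nat. cmod))) W"
        by (rule openin_graded[symmetric]) (auto simp: sn intro: exI[of _ 1])
      finally show "openin (topol complex_alg) W = openin (seminorm_topology complex_alg (range (\<lambda>k::nat. cmod))) W" .
    qed
    fix s assume "Cauchy_in complex_alg (\<lambda>k. cmod) s"
    then have "Cauchy s" by (auto simp: Cauchy_in_def min dist_norm Cauchy_def)
    then obtain x where "s \<longlonglongrightarrow> x" using Cauchy_convergent_iff convergentD by blast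
    then show "\<exists>x. converges complex_alg (\<lambda>k. cmod) s x"
      by (intro exI[of _ x]) (auto simp: converges_def min LIM_zero_iff tendsto_norm_zero_iff)
  qed (auto simp: sn)
qed

section \<open>Bounded linear maps\<close>

text \<open>Continuous linear maps in terms of seminorm estimates. Unlike \<open>cont_linear\<close> this does not fix the
  values outside of the carrier, so that these maps can be composed as plain functions.\<close>

definition blin ::
    "'a lc_struct \<Rightarrow> (nat \<Rightarrow> 'a \<Rightarrow> real) \<Rightarrow> 'b lc_struct \<Rightarrow> (nat \<Rightarrow> 'b \<Rightarrow> real) \<Rightarrow> ('a \<Rightarrow> 'b) set" where
  "blin V p W q = {f \<in> carrier V \<rightarrow> carrier W.
     (\<forall>x\<in>carrier V. \<forall>y\<in>carrier V. f (x \<oplus>\<^bsub>V\<^esub> y) = f x \<oplus>\<^bsub>W\<^esub> f y) \<and>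
     (\<forall>c. \<forall>x\<in>carrier V. f (c \<odot>\<^bsub>V\<^esub> x) = c \<odot>\<^bsub>W\<^esub> f x) \<and>
     (\<forall>j. \<exists>k C. \<forall>x\<in>carrier V. q j (f x) \<le> C * p k x)}"

lemma blinI:
  assumes "\<And>x. x \<in> carrier V \<Longrightarrow> f x \<in> carrier W"
    and "\<And>x y. x \<in> carrier V \<Longrightarrow> y \<in> carrier V \<Longrightarrow> f (x \<oplus>\<^bsub>V\<^esub> y) = f x \<oplus>\<^bsub>W\<^esub> f y"
    and "\<And>c x. x \<in> carrier V \<Longrightarrow> f (c \<odot>\<^bsub>V\<^esub> x) = c \<odot>\<^bsub>W\<^esub> f x"
    and "\<And>j. \<exists>k C. \<forall>x\<in>carrier V. q j (f x) \<le> C * p k x"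
  shows "f \<in> blin V p W q"
  using assms by (auto simp: blin_def)

lemma blinD:
  assumes "f \<in> blin V p W q"
  shows "x \<in> carrier V \<Longrightarrow> f x \<in> carrier W"
    and "x \<in> carrier V \<Longrightarrow> y \<in> carrier V \<Longrightarrow> f (x \<oplus>\<^bsub>V\<^esub> y) = f x \<oplus>\<^bsub>W\<^esub> f y"
    and "x \<in> carrier V \<Longrightarrow> f (c \<odot>\<^bsub>V\<^esub> x) = c \<odot>\<^bsub>W\<^esub> f x"
    and "\<exists>k C. \<forall>x\<in>carrier V. q j (f x) \<le> C * p k x"
  using assms by (auto simp: blin_def)

lemma blin_cong:
  assumes "f \<in> blin V p W q" "\<And>x. x \<in> carrier V \<Longrightarrow> f x = g x" "graded_frechet V p"
  shows "g \<in> blin V p W q"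
proof -
  interpret V: graded_frechet V p by fact
  show ?thesis using assms(1,2) unfolding blin_def by (auto simp: Pi_iff)
qed

lemma blin_bound:
  assumes "f \<in> blin V p W q" "graded_frechet V p"
  shows "\<exists>k C. C > 0 \<and> (\<forall>x\<in>carrier V. q j (f x) \<le> C * p k x)"
proof -
  interpret V: graded_frechet V p by fact
  obtain k C where *: "\<And>x. x \<in> carrier V \<Longrightarrow> q j (f x) \<le> C * p k x"
    using blinD(4)[OF assms(1)] by meson
  have "q j (f x) \<le> (\<bar>C\<bar> + 1) * p k x" if "x \<in> carrier V" for x
    by (rule order_trans[OF *[OF that]], intro mult_right_mono) (use that in auto)
  then show ?thesis by (intro exI[of _ k] exI[of _ "\<bar>C\<bar> + 1"]) auto
qed

lemma blin_zero:
  assumes "f \<in> blin V p W q" "graded_frechet V p" "graded_frechet W q"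
  shows "f \<zero>\<^bsub>V\<^esub> = \<zero>\<^bsub>W\<^esub>"
proof -
  interpret V: graded_frechet V p by fact
  interpret W: graded_frechet W q by fact
  show ?thesis using blinD(3)[OF assms(1), of "\<zero>\<^bsub>V\<^esub>" 0] blinD(1)[OF assms(1), of "\<zero>\<^bsub>V\<^esub>"] by simp
qed

lemma blin_neg:
  assumes "f \<in> blin V p W q" "graded_frechet V p" "graded_frechet W q" "x \<in> carrier V"
  shows "f (\<ominus>\<^bsub>V\<^esub> x) = \<ominus>\<^bsub>W\<^esub> (f x)"
proof -
  interpret V: graded_frechet V p by fact
  interpret W: graded_frechet W q by fact
  show ?thesis using assms by (simp add: V.neg_eq_sm W.neg_eq_sm blinD[OF assms(1)])
qed

lemma blin_minus:
  assumes "f \<in> blin V p W q" "graded_frechet V p" "graded_frechet W q" "x \<in> carrier V" "y \<in> carrier V"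
  shows "f (x \<ominus>\<^bsub>V\<^esub> y) = f x \<ominus>\<^bsub>W\<^esub> f y"
proof -
  interpret V: graded_frechet V p by fact
  interpret W: graded_frechet W q by fact
  show ?thesis using assms by (simp add: V.minus_eq W.minus_eq blin_neg blinD[OF assms(1)])
qed

lemma blin_converges:
  assumes "f \<in> blin V p W q" "graded_frechet V p" "graded_frechet W q" "converges V p s x"
  shows "converges W q (\<lambda>i. f (s i)) (f x)"
proof -
  interpret V: graded_frechet V p by fact
  interpret W: graded_frechet W q by fact
  note s = V.convergesD[OF assms(4)]
  have "\<forall>j. \<exists>k C. \<forall>x\<in>carrier V. q j (f x) \<le> C * p k x" using assms(1) by (simp add: blin_def)
  then obtain k C where *: "\<And>j x. x \<in> carrier V \<Longrightarrow> q j (f x) \<le> C j * p (k j) x" by metis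
  show ?thesis
  proof (rule W.converges_bound)
    fix j i
    show "q j (f (s i) \<ominus>\<^bsub>W\<^esub> f x) \<le> C j * p (k j) (s i \<ominus>\<^bsub>V\<^esub> x)"
      using *[of "s i \<ominus>\<^bsub>V\<^esub> x" j] s by (simp add: blin_minus[OF assms(1-3)])
    show "(\<lambda>i. C j * p (k j) (s i \<ominus>\<^bsub>V\<^esub> x)) \<longlonglongrightarrow> 0"
      using assms(4) by (intro tendsto_mult_right_zero) (simp add: converges_def)
  qed (use s blinD(1)[OF assms(1)] in auto)
qed

lemma blin_comp:
  assumes f: "f \<in> blin V p W q" and g: "g \<in> blin W q Z r" and "graded_frechet W q"
  shows "(\<lambda>x. g (f x)) \<in> blin V p Z r"
proof (rule blinI)
  fix j
  obtain k C where C: "C > 0" "\<And>y. y \<in> carrier W \<Longrightarrow> r j (g y) \<le> C * q k y"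
    using blin_bound[OF g assms(3), where j = j] by blast
  obtain l D where D: "\<And>x. x \<in> carrier V \<Longrightarrow> q k (f x) \<le> D * p l x"
    using blinD(4)[OF f] by meson
  have "r j (g (f x)) \<le> (C * D) * p l x" if "x \<in> carrier V" for x
    using order_trans[OF C(2)[OF blinD(1)[OF f that]] mult_left_mono[OF D[OF that], of C]] C(1)
    by (simp add: mult.assoc)
  then show "\<exists>k C. \<forall>x\<in>carrier V. r j (g (f x)) \<le> C * p k x" by blast
qed (use blinD[OF f] blinD[OF g] in auto)

lemma blin_id: "graded_frechet V p \<Longrightarrow> (\<lambda>x. x) \<in> blin V p V p"
proof (rule blinI)
  show "\<exists>k C. \<forall>x\<in>carrier V. p j x \<le> C * p k x" for j
    by (intro exI[of _ j] exI[of _ 1]) simp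
qed auto

lemma blin_sm:
  assumes f: "f \<in> blin V p W q" and "graded_frechet W q"
  shows "(\<lambda>x. c \<odot>\<^bsub>W\<^esub> f x) \<in> blin V p W q"
proof (rule blinI)
  interpret W: graded_frechet W q by fact
  fix j
  obtain l D where D: "\<And>x. x \<in> carrier V \<Longrightarrow> q j (f x) \<le> D * p l x"
    using blinD(4)[OF f] by meson
  have "q j (c \<odot>\<^bsub>W\<^esub> f x) \<le> (cmod c * D) * p l x" if "x \<in> carrier V" for x
    using mult_left_mono[OF D[OF that], of "cmod c"] blinD(1)[OF f that] by (simp add: W.p_sm)
  then show "\<exists>k C. \<forall>x\<in>carrier V. q j (c \<odot>\<^bsub>W\<^esub> f x) \<le> C * p k x" by blast
next
  interpret W: graded_frechet W q by fact
  show "c \<odot>\<^bsub>W\<^esub> f (d \<odot>\<^bsub>V\<^esub> x) = d \<odot>\<^bsub>W\<^esub> (c \<odot>\<^bsub>W\<^esub> f x)" if "x \<in> carrier V" for d x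
    using that by (simp add: blinD[OF f] mult.commute)
qed (use blinD[OF f] assms(2) in \<open>auto simp: graded_frechet_def cvs.sm_radd cvs.sm_closed\<close>)

lemma blin_add:
  assumes f: "f \<in> blin V p W q" and g: "g \<in> blin V p W q"
    and "graded_frechet V p" "graded_frechet W q"
  shows "(\<lambda>x. f x \<oplus>\<^bsub>W\<^esub> g x) \<in> blin V p W q"
proof (rule blinI)
  interpret V: graded_frechet V p by fact
  interpret W: graded_frechet W q by fact
  fix j
  obtain k C where C: "C > 0" "\<And>y. y \<in> carrier V \<Longrightarrow> q j (f y) \<le> C * p k y"
    using blin_bound[OF f assms(3), where j = j] by blast
  obtain l D where D: "D > 0" "\<And>x. x \<in> carrier V \<Longrightarrow> q j (g x) \<le> D * p l x"
    using blin_bound[OF g assms(3), where j = j] by blast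
  have "q j (f x \<oplus>\<^bsub>W\<^esub> g x) \<le> (C + D) * p (max k l) x" if x: "x \<in> carrier V" for x
  proof -
    have "q j (f x \<oplus>\<^bsub>W\<^esub> g x) \<le> C * p k x + D * p l x"
      using W.p_add[of "f x" "g x" j] C(2)[OF x] D(2)[OF x] blinD(1)[OF f x] blinD(1)[OF g x] by simp
    also have "\<dots> \<le> C * p (max k l) x + D * p (max k l) x"
      using C D x by (intro add_mono mult_left_mono V.p_mono) auto
    finally show ?thesis by (simp add: algebra_simps)
  qed
  then show "\<exists>k C. \<forall>x\<in>carrier V. q j (f x \<oplus>\<^bsub>W\<^esub> g x) \<le> C * p k x" by blast
next
  interpret W: graded_frechet W q by fact
  show "x \<in> carrier V \<Longrightarrow> f x \<oplus>\<^bsub>W\<^esub> g x \<in> carrier W" for x using blinD(1)[OF f] blinD(1)[OF g] by simp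
  show "f (x \<oplus>\<^bsub>V\<^esub> y) \<oplus>\<^bsub>W\<^esub> g (x \<oplus>\<^bsub>V\<^esub> y) = f x \<oplus>\<^bsub>W\<^esub> g x \<oplus>\<^bsub>W\<^esub> (f y \<oplus>\<^bsub>W\<^esub> g y)"
    if "x \<in> carrier V" "y \<in> carrier V" for x y
    using that by (simp add: blinD[OF f] blinD[OF g] W.a_ac)
  show "f (c \<odot>\<^bsub>V\<^esub> x) \<oplus>\<^bsub>W\<^esub> g (c \<odot>\<^bsub>V\<^esub> x) = c \<odot>\<^bsub>W\<^esub> (f x \<oplus>\<^bsub>W\<^esub> g x)" if "x \<in> carrier V" for c x
    using that by (simp add: blinD[OF f] blinD[OF g] W.sm_radd)
qed

text \<open>For continuous \<open>f\<close> the seminorm \<open>q j \<circ> f\<close> is continuous, hence dominated by some \<open>p k\<close>.\<close>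

lemma cont_linear_blin:
  assumes f: "f \<in> cont_linear V W" and "graded_frechet V p" "graded_frechet W q"
  shows "f \<in> blin V p W q"
proof (rule blinI)
  interpret V: graded_frechet V p by fact
  interpret W: graded_frechet W q by fact
  note f' = f[unfolded cont_linear_def]
  show 1: "x \<in> carrier V \<Longrightarrow> f x \<in> carrier W" for x using f' by auto
  show 2: "x \<in> carrier V \<Longrightarrow> y \<in> carrier V \<Longrightarrow> f (x \<oplus>\<^bsub>V\<^esub> y) = f x \<oplus>\<^bsub>W\<^esub> f y" for x y using f' by auto
  show 3: "x \<in> carrier V \<Longrightarrow> f (c \<odot>\<^bsub>V\<^esub> x) = c \<odot>\<^bsub>W\<^esub> f x" for c x using f' by auto
  fix j
  have "(\<lambda>x. q j (f x)) \<in> cont_seminorms V"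
  proof -
    have "seminorm V (\<lambda>x. q j (f x))"
      using W.p_add W.p_sm 1 2 3 by (auto simp: seminorm_def)
    moreover have "continuous_map (topol V) euclideanreal (q j \<circ> f)"
      by (rule continuous_map_compose[of _ "topol W"])
        (use f' W.p_cont[of j] in \<open>auto simp: cont_seminorms_def\<close>)
    ultimately show ?thesis by (simp add: cont_seminorms_def o_def)
  qed
  then show "\<exists>k C. \<forall>x\<in>carrier V. q j (f x) \<le> C * p k x" by (simp add: V.cont_seminorms_iff)
qed

lemma blin_cont_linear:
  assumes f: "f \<in> blin V p W q" and "graded_frechet V p" "graded_frechet W q"
  shows "restrict f (carrier V) \<in> cont_linear V W"
proof -
  interpret V: graded_frechet V p by fact
  interpret W: graded_frechet W q by fact
  have "continuous_map (topol V) (topol W) (restrict f (carrier V))"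
    unfolding continuous_map_def
  proof (intro conjI allI impI)
    fix U assume "openin (topol W) U"
    then have U: "graded_open W q U" by (simp add: W.openin_iff)
    have "\<exists>k e. e > 0 \<and> {y \<in> carrier V. p k (y \<ominus>\<^bsub>V\<^esub> x) < e} \<subseteq> {x \<in> carrier V. f x \<in> U}"
      if x: "x \<in> carrier V" "f x \<in> U" for x
    proof -
      obtain j e where e: "e > 0" "{y \<in> carrier W. q j (y \<ominus>\<^bsub>W\<^esub> f x) < e} \<subseteq> U"
        using U x(2) unfolding graded_open_def by blast
      obtain k C where C: "C > 0" "\<And>y. y \<in> carrier V \<Longrightarrow> q j (f y) \<le> C * p k y"
        using blin_bound[OF f assms(2), where j = j] by blast
      have "f y \<in> U" if y: "y \<in> carrier V" "p k (y \<ominus>\<^bsub>V\<^esub> x) < e / C" for y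
      proof -
        have "q j (f y \<ominus>\<^bsub>W\<^esub> f x) \<le> C * p k (y \<ominus>\<^bsub>V\<^esub> x)"
          using C(2)[of "y \<ominus>\<^bsub>V\<^esub> x"] x y by (simp add: blin_minus[OF assms])
        also have "\<dots> < e" using y(2) C(1) by (simp add: field_simps)
        finally show ?thesis using e(2) blinD(1)[OF f y(1)] by blast
      qed
      then show ?thesis using e(1) C(1) by (intro exI[of _ k] exI[of _ "e / C"]) auto
    qed
    then have "graded_open V p {x \<in> carrier V. f x \<in> U}" by (auto simp: graded_open_def)
    moreover have "{x \<in> topspace (topol V). restrict f (carrier V) x \<in> U} = {x \<in> carrier V. f x \<in> U}"
      by auto
    ultimately show "openin (topol V) {x \<in> topspace (topol V). restrict f (carrier V) x \<in> U}"
      by (simp add: V.openin_iff)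
  qed (use blinD[OF f] in auto)
  then show ?thesis using blinD[OF f] by (auto simp: cont_linear_def)
qed

lemma cont_linearI:
  assumes "f \<in> blin V p W q" "f \<in> extensional (carrier V)" "graded_frechet V p" "graded_frechet W q"
  shows "f \<in> cont_linear V W"
  using blin_cont_linear[OF assms(1,3,4)] assms(2) by (simp add: extensional_restrict)

lemma cont_linear_eqI:
  assumes "f \<in> cont_linear V W" "g \<in> cont_linear V W" "\<And>x. x \<in> carrier V \<Longrightarrow> f x = g x"
  shows "f = g"
  by (rule PiE_ext[of f "carrier V" "\<lambda>_. carrier W"]) (use assms in \<open>auto simp: cont_linear_def\<close>)

section \<open>Free vector spaces and extension by continuity\<close>

lemma lookup_fv_scale [simp]: "Poly_Mapping.lookup (fv_scale c u) k = c * Poly_Mapping.lookup u k"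
  unfolding fv_scale_def by (simp add: Poly_Mapping.map.rep_eq when_def)

lemma keys_fv_scale: "Poly_Mapping.keys (fv_scale c u) \<subseteq> Poly_Mapping.keys u"
  by (auto simp: in_keys_iff)

lemma fv_scale_single [simp]: "fv_scale c (Poly_Mapping.single k d) = Poly_Mapping.single k (c * d)"
  by (rule poly_mapping_eqI) (simp add: lookup_single when_def)

lemma module_fv_scale: "Modules.module fv_scale"
  by unfold_locales (rule poly_mapping_eqI, simp add: lookup_add algebra_simps)+

lemma keys_add_subset:
  "Poly_Mapping.keys u \<subseteq> K \<Longrightarrow> Poly_Mapping.keys v \<subseteq> K \<Longrightarrow> Poly_Mapping.keys (u + v) \<subseteq> K"
  using keys_add[of u v] by auto

lemma keys_diff_subset:
  fixes u v :: "'k \<Rightarrow>\<^sub>0 complex"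
  shows "Poly_Mapping.keys u \<subseteq> K \<Longrightarrow> Poly_Mapping.keys v \<subseteq> K \<Longrightarrow> Poly_Mapping.keys (u - v) \<subseteq> K"
  using keys_diff[of u v] by auto

lemma keys_scale_subset: "Poly_Mapping.keys u \<subseteq> K \<Longrightarrow> Poly_Mapping.keys (fv_scale c u) \<subseteq> K"
  using keys_fv_scale[of c u] by auto

lemma fv_induct [consumes 1, case_names zero single add]:
  fixes u :: "'k \<Rightarrow>\<^sub>0 complex"
  assumes "Poly_Mapping.keys u \<subseteq> K"
    and "P 0" "\<And>k c. k \<in> K \<Longrightarrow> P (Poly_Mapping.single k c)"
    and "\<And>u v. Poly_Mapping.keys u \<subseteq> K \<Longrightarrow> Poly_Mapping.keys v \<subseteq> K \<Longrightarrow> P u \<Longrightarrow> P v \<Longrightarrow> P (u + v)"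
  shows "P u"
proof -
  have "P u" if "finite A" "A \<subseteq> K" "Poly_Mapping.keys u \<subseteq> A" for A u
    using that
  proof (induction A arbitrary: u)
    case empty
    then show ?case using assms(2) by simp
  next
    case (insert k A)
    let ?s = "Poly_Mapping.single k (Poly_Mapping.lookup u k)"
    have keys: "Poly_Mapping.keys (u - ?s) \<subseteq> A"
    proof
      fix x assume "x \<in> Poly_Mapping.keys (u - ?s)"
      then have "Poly_Mapping.lookup u x \<noteq> 0" "x \<noteq> k"
        by (auto simp: in_keys_iff lookup_minus lookup_single when_def split: if_splits)
      then show "x \<in> A" using insert.prems(2) by (auto simp: in_keys_iff)
    qed
    have "P (?s + (u - ?s))"
    proof (rule assms(4))
      show "P ?s" using assms(3) insert.prems(1) by simp
      show "P (u - ?s)" using insert.IH[OF _ keys] insert.prems(1) by simp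
    qed (use keys insert.prems in auto)
    then show ?case by simp
  qed
  from this[OF _ assms(1) subset_refl] show ?thesis by simp
qed

text \<open>The weighted \<open>l^1\<close> norm, with weights \<open>w\<close>, of a formal linear combination.\<close>

definition wsum :: "('k \<Rightarrow> real) \<Rightarrow> ('k \<Rightarrow>\<^sub>0 complex) \<Rightarrow> real" where
  "wsum w u = (\<Sum>k\<in>Poly_Mapping.keys u. cmod (Poly_Mapping.lookup u k) * w k)"

lemma wsum_superset:
  "finite A \<Longrightarrow> Poly_Mapping.keys u \<subseteq> A \<Longrightarrow> wsum w u = (\<Sum>k\<in>A. cmod (Poly_Mapping.lookup u k) * w k)"
  unfolding wsum_def by (rule sum.mono_neutral_left) (auto simp: in_keys_iff)

lemma wsum_add:
  assumes "\<And>k. k \<in> K \<Longrightarrow> 0 \<le> w k" "Poly_Mapping.keys u \<subseteq> K" "Poly_Mapping.keys v \<subseteq> K"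
  shows "wsum w (u + v) \<le> wsum w u + wsum w v"
proof -
  let ?A = "Poly_Mapping.keys u \<union> Poly_Mapping.keys v"
  have "wsum w (u + v) = (\<Sum>k\<in>?A. cmod (Poly_Mapping.lookup (u + v) k) * w k)"
    by (rule wsum_superset) (use keys_add[of u v] in auto)
  also have "\<dots> \<le> (\<Sum>k\<in>?A. cmod (Poly_Mapping.lookup u k) * w k + cmod (Poly_Mapping.lookup v k) * w k)"
  proof (rule sum_mono)
    fix k assume "k \<in> ?A"
    then have "0 \<le> w k" using assms by auto
    then show "cmod (Poly_Mapping.lookup (u + v) k) * w k
        \<le> cmod (Poly_Mapping.lookup u k) * w k + cmod (Poly_Mapping.lookup v k) * w k"
      unfolding lookup_add distrib_right[symmetric] by (intro mult_right_mono norm_triangle_ineq)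
  qed
  also have "\<dots> = wsum w u + wsum w v"
    by (simp add: sum.distrib wsum_superset[of ?A])
  finally show ?thesis .
qed

lemma wsum_scale: "wsum w (fv_scale c u) = cmod c * wsum w u"
  by (subst (1 2) wsum_superset[of "Poly_Mapping.keys u"])
    (use keys_fv_scale[of c u] in \<open>auto simp: norm_mult sum_distrib_left mult.assoc\<close>)

lemma wsum_single [simp]: "wsum w (Poly_Mapping.single k c) = cmod c * w k"
  by (subst wsum_superset[of "{k}"]) auto

lemma wsum_nonneg:
  "(\<And>k. k \<in> K \<Longrightarrow> 0 \<le> w k) \<Longrightarrow> Poly_Mapping.keys u \<subseteq> K \<Longrightarrow> 0 \<le> wsum w u"
  unfolding wsum_def by (intro sum_nonneg mult_nonneg_nonneg) auto

lemma wsum_mono: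
  assumes "\<And>k. k \<in> K \<Longrightarrow> w k \<le> C * w' k" "Poly_Mapping.keys u \<subseteq> K"
  shows "wsum w u \<le> C * wsum w' u"
proof -
  have "wsum w u \<le> (\<Sum>k\<in>Poly_Mapping.keys u. C * (cmod (Poly_Mapping.lookup u k) * w' k))"
    unfolding wsum_def
  proof (rule sum_mono)
    fix k assume "k \<in> Poly_Mapping.keys u"
    then have "w k \<le> C * w' k" using assms by auto
    then show "cmod (Poly_Mapping.lookup u k) * w k \<le> C * (cmod (Poly_Mapping.lookup u k) * w' k)"
      using mult_left_mono[of "w k" "C * w' k" "cmod (Poly_Mapping.lookup u k)"]
      by (simp add: mult.left_commute)
  qed
  then show ?thesis by (simp add: wsum_def sum_distrib_left)
qed

text \<open>The linear extension of \<open>b\<close> to formal linear combinations.\<close>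

definition fv_ext :: "'a lc_struct \<Rightarrow> ('k \<Rightarrow> 'a) \<Rightarrow> ('k \<Rightarrow>\<^sub>0 complex) \<Rightarrow> 'a" where
  "fv_ext Z b u = finsum Z (\<lambda>k. Poly_Mapping.lookup u k \<odot>\<^bsub>Z\<^esub> b k) (Poly_Mapping.keys u)"

context cvs
begin

context
  fixes b :: "'k \<Rightarrow> 'a" and K
  assumes b: "\<And>k. k \<in> K \<Longrightarrow> b k \<in> carrier V"
begin

lemma fv_ext_closed: "Poly_Mapping.keys u \<subseteq> K \<Longrightarrow> fv_ext V b u \<in> carrier V"
  unfolding fv_ext_def using b by (intro finsum_closed) auto

lemma fv_ext_superset:
  "finite A \<Longrightarrow> A \<subseteq> K \<Longrightarrow> Poly_Mapping.keys u \<subseteq> A \<Longrightarrow>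
    fv_ext V b u = finsum V (\<lambda>k. Poly_Mapping.lookup u k \<odot> b k) A"
  unfolding fv_ext_def using b
  by (intro add.finprod_mono_neutral_cong_left) (auto simp: in_keys_iff subset_iff)

lemma fv_ext_single: "k \<in> K \<Longrightarrow> fv_ext V b (Poly_Mapping.single k c) = c \<odot> b k"
  using b by (subst fv_ext_superset[of "{k}"]) auto

lemma fv_ext_add:
  assumes "Poly_Mapping.keys u \<subseteq> K" "Poly_Mapping.keys v \<subseteq> K"
  shows "fv_ext V b (u + v) = fv_ext V b u \<oplus> fv_ext V b v"
proof -
  let ?A = "Poly_Mapping.keys u \<union> Poly_Mapping.keys v"
  have A: "finite ?A" "?A \<subseteq> K" "Poly_Mapping.keys u \<subseteq> ?A" "Poly_Mapping.keys v \<subseteq> ?A"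
    "Poly_Mapping.keys (u + v) \<subseteq> ?A"
    using assms keys_add[of u v] by auto
  have bA: "k \<in> ?A \<Longrightarrow> b k \<in> carrier V" for k using A(2) b by auto
  have "fv_ext V b (u + v) =
      finsum V (\<lambda>k. Poly_Mapping.lookup u k \<odot> b k \<oplus> Poly_Mapping.lookup v k \<odot> b k) ?A"
    unfolding fv_ext_superset[OF A(1,2,5)]
    by (rule finsum_cong') (use bA in \<open>auto simp: lookup_add sm_ladd\<close>)
  also have "\<dots> = finsum V (\<lambda>k. Poly_Mapping.lookup u k \<odot> b k) ?A \<oplus>
      finsum V (\<lambda>k. Poly_Mapping.lookup v k \<odot> b k) ?A"
    by (rule finsum_addf) (use bA in auto)
  finally show ?thesis
    by (simp only: fv_ext_superset[OF A(1,2,3)] fv_ext_superset[OF A(1,2,4)])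
qed

lemma fv_ext_scale:
  assumes "Poly_Mapping.keys u \<subseteq> K"
  shows "fv_ext V b (fv_scale c u) = c \<odot> fv_ext V b u"
proof -
  have bA: "k \<in> Poly_Mapping.keys u \<Longrightarrow> b k \<in> carrier V" for k using assms b by auto
  have "fv_ext V b (fv_scale c u) =
      finsum V (\<lambda>k. c \<odot> (Poly_Mapping.lookup u k \<odot> b k)) (Poly_Mapping.keys u)"
    unfolding fv_ext_superset[OF finite_keys assms keys_fv_scale]
    by (rule finsum_cong') (use bA in auto)
  also have "\<dots> = c \<odot> fv_ext V b u"
    unfolding fv_ext_def using finsum_smult_ldistr[of "Poly_Mapping.keys u" c] bA
    by (subst finsum_smult_ldistr) auto
  finally show ?thesis .
qed

lemma fv_ext_minus:
  assumes "Poly_Mapping.keys u \<subseteq> K" "Poly_Mapping.keys v \<subseteq> K"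
  shows "fv_ext V b (u - v) = fv_ext V b u \<ominus> fv_ext V b v"
proof -
  have eq: "u - v = u + fv_scale (-1) v" by (rule poly_mapping_eqI) (simp add: lookup_minus lookup_add)
  show ?thesis
    using assms fv_ext_closed[OF assms(2)]
    by (simp add: eq fv_ext_add fv_ext_scale keys_scale_subset minus_eq neg_eq_sm)
qed

lemma fv_ext_seminorm:
  assumes "seminorm V q" "Poly_Mapping.keys u \<subseteq> K"
  shows "q (fv_ext V b u) \<le> wsum (\<lambda>k. q (b k)) u"
proof -
  have "q (finsum V (\<lambda>k. Poly_Mapping.lookup u k \<odot> b k) A) \<le>
      (\<Sum>k\<in>A. cmod (Poly_Mapping.lookup u k) * q (b k))" if "finite A" "A \<subseteq> K" for A
    using that
  proof (induction A)
    case empty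
    show ?case by (simp add: snorm_zero[OF assms(1)])
  next
    case (insert k A)
    have bA: "k' \<in> insert k A \<Longrightarrow> b k' \<in> carrier V" for k' using insert.prems b by auto
    have "finsum V (\<lambda>k. Poly_Mapping.lookup u k \<odot> b k) (insert k A) =
        Poly_Mapping.lookup u k \<odot> b k \<oplus> finsum V (\<lambda>k. Poly_Mapping.lookup u k \<odot> b k) A"
      using bA insert.hyps by (intro finsum_insert) auto
    moreover have "finsum V (\<lambda>k. Poly_Mapping.lookup u k \<odot> b k) A \<in> carrier V"
      using bA by (intro finsum_closed) auto
    ultimately show ?case
      using insert bA[of k] snorm_add[OF assms(1), of "Poly_Mapping.lookup u k \<odot> b k"
          "finsum V (\<lambda>k. Poly_Mapping.lookup u k \<odot> b k) A"]
      by (simp add: snorm_sm[OF assms(1)])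
  qed
  then show ?thesis using assms(2) by (simp add: fv_ext_def wsum_def)
qed

end

end

lemma blin_fv_ext:
  assumes "f \<in> blin V p W q" "graded_frechet V p" "graded_frechet W q"
    and "\<And>k. k \<in> K \<Longrightarrow> b k \<in> carrier V" "Poly_Mapping.keys u \<subseteq> K"
  shows "f (fv_ext V b u) = fv_ext W (\<lambda>k. f (b k)) u"
proof -
  interpret V: graded_frechet V p by fact
  interpret W: graded_frechet W q by fact
  note f = blinD[OF assms(1)]
  have fb: "\<And>k. k \<in> K \<Longrightarrow> f (b k) \<in> carrier W" using assms(4) f(1) by auto
  show ?thesis using assms(5)
  proof (induction rule: fv_induct)
    case zero
    show ?case
      using blin_zero[OF assms(1-3)] by (simp add: fv_ext_def)
  next
    case (single k c)
    then show ?case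
      using assms(4) fb by (simp add: V.fv_ext_single[OF assms(4)] W.fv_ext_single[OF fb] f(3))
  next
    case (add u v)
    then show ?case
      by (simp add: V.fv_ext_add[OF assms(4)] W.fv_ext_add[OF fb] V.fv_ext_closed[OF assms(4)] f(2))
  qed
qed

text \<open>The family \<open>\<iota>\<close> spans a dense subspace. As the topology is given by countably many seminorms, density
  can be stated with sequences; formal linear combinations name the elements of the span.\<close>

definition generates ::
    "'a lc_struct \<Rightarrow> (nat \<Rightarrow> 'a \<Rightarrow> real) \<Rightarrow> 'k set \<Rightarrow> ('k \<Rightarrow> 'a) \<Rightarrow> bool" where
  "generates V p K \<iota> \<longleftrightarrow> (\<forall>k\<in>K. \<iota> k \<in> carrier V) \<and>
     (\<forall>x\<in>carrier V. \<exists>s. (\<forall>i. Poly_Mapping.keys (s i) \<subseteq> K) \<and>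
        converges V p (\<lambda>i. fv_ext V \<iota> (s i)) x)"

lemma generates_eq:
  assumes "generates V p K \<iota>" "graded_frechet V p" "graded_frechet W q"
    and "f \<in> blin V p W q" "g \<in> blin V p W q"
    and eq: "\<And>k. k \<in> K \<Longrightarrow> f (\<iota> k) = g (\<iota> k)" and x: "x \<in> carrier V"
  shows "f x = g x"
proof -
  interpret V: graded_frechet V p by fact
  interpret W: graded_frechet W q by fact
  have \<iota>: "\<And>k. k \<in> K \<Longrightarrow> \<iota> k \<in> carrier V" using assms(1) by (simp add: generates_def)
  obtain s where s: "\<And>i. Poly_Mapping.keys (s i) \<subseteq> K" "converges V p (\<lambda>i. fv_ext V \<iota> (s i)) x"
    using assms(1) x unfolding generates_def by blast
  have "f (fv_ext V \<iota> (s i)) = g (fv_ext V \<iota> (s i))" for i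
  proof -
    have "f (fv_ext V \<iota> (s i)) = fv_ext W (\<lambda>k. f (\<iota> k)) (s i)"
      by (rule blin_fv_ext[OF assms(4,2,3) \<iota> s(1)])
    also have "\<dots> = fv_ext W (\<lambda>k. g (\<iota> k)) (s i)"
      unfolding fv_ext_def
      by (rule W.finsum_cong') (use s(1)[of i] eq \<iota> blinD(1)[OF assms(5)] in auto)
    also have "\<dots> = g (fv_ext V \<iota> (s i))"
      by (rule blin_fv_ext[OF assms(5,2,3) \<iota> s(1), symmetric])
    finally show ?thesis .
  qed
  then show ?thesis
    using blin_converges[OF assms(4,2,3) s(2)] blin_converges[OF assms(5,2,3) s(2)] W.converges_unique
    by simp
qed

lemma generates_bound:
  assumes "generates V p K \<iota>" "graded_frechet V p" "graded_frechet W q" "f \<in> blin V p W q"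
    and le: "\<And>u. Poly_Mapping.keys u \<subseteq> K \<Longrightarrow>
      q j (fv_ext W (\<lambda>k. f (\<iota> k)) u) \<le> C * p k (fv_ext V \<iota> u)"
    and x: "x \<in> carrier V"
  shows "q j (f x) \<le> C * p k x"
proof -
  interpret V: graded_frechet V p by fact
  interpret W: graded_frechet W q by fact
  have \<iota>: "\<And>k. k \<in> K \<Longrightarrow> \<iota> k \<in> carrier V" using assms(1) by (simp add: generates_def)
  obtain s where s: "\<And>i. Poly_Mapping.keys (s i) \<subseteq> K" "converges V p (\<lambda>i. fv_ext V \<iota> (s i)) x"
    using assms(1) x unfolding generates_def by blast
  show ?thesis
  proof (rule W.converges_bound_limit[OF blin_converges[OF assms(4,2,3) s(2)]])
    show "q j (f (fv_ext V \<iota> (s i))) \<le> C * p k (fv_ext V \<iota> (s i))" for i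
      using le[OF s(1)[of i]] by (simp add: blin_fv_ext[OF assms(4,2,3) \<iota> s(1)])
    show "(\<lambda>i. C * p k (fv_ext V \<iota> (s i))) \<longlonglongrightarrow> C * p k x"
      by (intro tendsto_mult_left V.converges_seminorm s(2))
  qed
qed

lemma (in graded_frechet) converges_Cauchy:
  assumes "converges V p s x"
  shows "Cauchy_in V p s"
  unfolding Cauchy_in_def
proof (intro conjI allI impI)
  fix k and e :: real assume "e > 0"
  note s = convergesD[OF assms]
  have "(\<lambda>i. p k (s i \<ominus> x)) \<longlonglongrightarrow> 0" using assms by (simp add: converges_def)
  then obtain N where N: "\<And>i. i \<ge> N \<Longrightarrow> \<bar>p k (s i \<ominus> x)\<bar> < e / 2"
    using LIMSEQ_D[of _ 0 "e / 2"] \<open>e > 0\<close> by (metis diff_zero half_gt_zero real_norm_def)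
  have "p k (s i \<ominus> s j) < e" if "i \<ge> N" "j \<ge> N" for i j
    using p_triangle[of "s i" x "s j" k] p_commute[of x "s j" k] N[OF that(1)] N[OF that(2)] s by simp
  then show "\<exists>N. \<forall>i\<ge>N. \<forall>j\<ge>N. p k (s i \<ominus> s j) < e" by blast
qed (use convergesD[OF assms] in auto)

text \<open>The estimate makes the linear extension of \<open>b\<close> a well-defined uniformly continuous map on the span
  of \<open>\<iota>\<close>, although \<open>\<iota>\<close> may be linearly dependent: combinations with the same value are at distance 0
  in every seminorm. It therefore extends to the closure of the span, by completeness of \<open>W\<close>.\<close>

theorem generates_extend:
  assumes gen: "generates V p K \<iota>" and VV: "graded_frechet V p" and WW: "graded_frechet W q"
    and b: "\<And>k. k \<in> K \<Longrightarrow> b k \<in> carrier W"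
    and le: "\<And>j. \<exists>k C. \<forall>u. Poly_Mapping.keys u \<subseteq> K \<longrightarrow>
      q j (fv_ext W b u) \<le> C * p k (fv_ext V \<iota> u)"
  shows "\<exists>f\<in>cont_linear V W. \<forall>k\<in>K. f (\<iota> k) = b k"
proof -
  interpret V: graded_frechet V p by fact
  interpret W: graded_frechet W q by fact
  let ?I = "fv_ext V \<iota>" and ?B = "fv_ext W b"
  have \<iota>: "\<And>k. k \<in> K \<Longrightarrow> \<iota> k \<in> carrier V" using gen by (simp add: generates_def)
  obtain \<kappa> C where le': "\<And>j u. Poly_Mapping.keys u \<subseteq> K \<Longrightarrow> q j (?B u) \<le> C j * p (\<kappa> j) (?I u)"
    using le by metis
  have diff: "q j (?B u \<ominus>\<^bsub>W\<^esub> ?B v) \<le> C j * p (\<kappa> j) (?I u \<ominus>\<^bsub>V\<^esub> ?I v)"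
    if "Poly_Mapping.keys u \<subseteq> K" "Poly_Mapping.keys v \<subseteq> K" for j u v
    using le'[OF keys_diff_subset[OF that], of j] that
    by (simp add: W.fv_ext_minus[OF b] V.fv_ext_minus[OF \<iota>])
  \<comment> \<open>the sequences of combinations whose values tend to \<open>x\<close>; the value of \<open>f\<close> at \<open>x\<close> must be the limit along any of them\<close>
  define approx where "approx s x \<longleftrightarrow> (\<forall>i. Poly_Mapping.keys (s i) \<subseteq> K) \<and> converges V p (\<lambda>i. ?I (s i)) x"
    for s x
  have ex: "\<exists>y. converges W q (\<lambda>i. ?B (s i)) y" if s: "approx s x" for s x
  proof (rule W.complete, unfold Cauchy_in_def, intro conjI allI impI)
    show "?B (s i) \<in> carrier W" for i by (rule W.fv_ext_closed[OF b]) (use s in \<open>auto simp: approx_def\<close>)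
    fix j and e :: real assume e: "e > 0"
    have "Cauchy_in V p (\<lambda>i. ?I (s i))" using V.converges_Cauchy s by (auto simp: approx_def)
    then obtain N where N: "\<And>i i'. i \<ge> N \<Longrightarrow> i' \<ge> N \<Longrightarrow>
        p (\<kappa> j) (?I (s i) \<ominus>\<^bsub>V\<^esub> ?I (s i')) < e / (\<bar>C j\<bar> + 1)"
      using e unfolding Cauchy_in_def
      by (metis abs_ge_zero add_nonneg_pos divide_pos_pos less_numeral_extra(1))
    have "q j (?B (s i) \<ominus>\<^bsub>W\<^esub> ?B (s i')) < e" if "i \<ge> N" "i' \<ge> N" for i i'
    proof -
      have c: "?I (s i) \<ominus>\<^bsub>V\<^esub> ?I (s i') \<in> carrier V"
        by (intro V.minus_closed V.fv_ext_closed[OF \<iota>]) (use s in \<open>auto simp: approx_def\<close>)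
      have "q j (?B (s i) \<ominus>\<^bsub>W\<^esub> ?B (s i')) \<le> C j * p (\<kappa> j) (?I (s i) \<ominus>\<^bsub>V\<^esub> ?I (s i'))"
        using diff s by (auto simp: approx_def)
      also have "\<dots> \<le> (\<bar>C j\<bar> + 1) * p (\<kappa> j) (?I (s i) \<ominus>\<^bsub>V\<^esub> ?I (s i'))"
        using c by (intro mult_right_mono) auto
      also have "\<dots> < e" using N[OF that] by (simp add: field_simps)
      finally show ?thesis .
    qed
    then show "\<exists>N. \<forall>i\<ge>N. \<forall>i'\<ge>N. q j (?B (s i) \<ominus>\<^bsub>W\<^esub> ?B (s i')) < e" by blast
  qed
  have indep: "converges W q (\<lambda>i. ?B (t i)) y" if "approx s x" "approx t x" "converges W q (\<lambda>i. ?B (s i)) y"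
    for s t x y
  proof (rule W.converges_null_diff[OF that(3)])
    show "?B (t i) \<in> carrier W" for i by (rule W.fv_ext_closed[OF b]) (use that in \<open>auto simp: approx_def\<close>)
    fix j
    have "converges V p (\<lambda>i. ?I (t i) \<ominus>\<^bsub>V\<^esub> ?I (s i)) (x \<ominus>\<^bsub>V\<^esub> x)"
      using that by (intro V.converges_minus) (auto simp: approx_def)
    moreover have "x \<in> carrier V" using that V.convergesD by (auto simp: approx_def)
    ultimately have "(\<lambda>i. p (\<kappa> j) (?I (t i) \<ominus>\<^bsub>V\<^esub> ?I (s i))) \<longlonglongrightarrow> 0"
      using V.converges_seminorm[of _ _ "\<kappa> j"] by (fastforce simp: V.minus_self)
    then have "(\<lambda>i. C j * p (\<kappa> j) (?I (t i) \<ominus>\<^bsub>V\<^esub> ?I (s i))) \<longlonglongrightarrow> 0"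
      by (rule tendsto_mult_right_zero)
    then show "(\<lambda>i. q j (?B (t i) \<ominus>\<^bsub>W\<^esub> ?B (s i))) \<longlonglongrightarrow> 0"
    proof (rule tendsto_sandwich[OF _ _ tendsto_const, rotated 2])
      show "\<forall>\<^sub>F i in sequentially. 0 \<le> q j (?B (t i) \<ominus>\<^bsub>W\<^esub> ?B (s i))"
        by (intro always_eventually allI W.nonneg W.minus_closed W.fv_ext_closed[OF b])
          (use that in \<open>auto simp: approx_def\<close>)
      show "\<forall>\<^sub>F i in sequentially. q j (?B (t i) \<ominus>\<^bsub>W\<^esub> ?B (s i)) \<le> C j * p (\<kappa> j) (?I (t i) \<ominus>\<^bsub>V\<^esub> ?I (s i))"
        using diff that by (intro always_eventually) (auto simp: approx_def)
    qed
  qed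
  define f where "f x = (SOME y. \<forall>s. approx s x \<longrightarrow> converges W q (\<lambda>i. ?B (s i)) y)" for x
  have f: "converges W q (\<lambda>i. ?B (s i)) (f x)" if "approx s x" for s x
  proof -
    have "\<exists>y. \<forall>s. approx s x \<longrightarrow> converges W q (\<lambda>i. ?B (s i)) y"
      using ex[OF that] indep[OF that] by blast
    from someI_ex[OF this] that show ?thesis unfolding f_def by blast
  qed
  have approx: "\<exists>s. approx s x" if "x \<in> carrier V" for x
    using gen that by (auto simp: generates_def approx_def)
  have "f \<in> blin V p W q"
  proof (rule blinI)
    fix x y c assume x: "x \<in> carrier V"
    obtain s where s: "approx s x" using approx[OF x] by blast
    show "f x \<in> carrier W" using W.convergesD(2)[OF f[OF s]] .
    have "approx (\<lambda>i. fv_scale c (s i)) (c \<odot>\<^bsub>V\<^esub> x)"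
      using s V.converges_sm by (auto simp: approx_def V.fv_ext_scale[OF \<iota>] intro!: keys_scale_subset)
    from f[OF this] have "converges W q (\<lambda>i. c \<odot>\<^bsub>W\<^esub> ?B (s i)) (f (c \<odot>\<^bsub>V\<^esub> x))"
      using s by (simp add: W.fv_ext_scale[OF b] approx_def)
    then show "f (c \<odot>\<^bsub>V\<^esub> x) = c \<odot>\<^bsub>W\<^esub> f x"
      using W.converges_unique W.converges_sm[OF f[OF s]] by blast
    assume "y \<in> carrier V"
    then obtain t where t: "approx t y" using approx by blast
    have "approx (\<lambda>i. s i + t i) (x \<oplus>\<^bsub>V\<^esub> y)"
      using s t V.converges_add by (auto simp: approx_def V.fv_ext_add[OF \<iota>] dest!: keys_add[THEN subsetD])
    from f[OF this] have "converges W q (\<lambda>i. ?B (s i) \<oplus>\<^bsub>W\<^esub> ?B (t i)) (f (x \<oplus>\<^bsub>V\<^esub> y))"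
      using s t by (simp add: W.fv_ext_add[OF b] approx_def)
    then show "f (x \<oplus>\<^bsub>V\<^esub> y) = f x \<oplus>\<^bsub>W\<^esub> f y"
      using W.converges_unique W.converges_add[OF f[OF s] f[OF t]] by blast
  next
    fix j
    have "q j (f x) \<le> C j * p (\<kappa> j) x" if x: "x \<in> carrier V" for x
    proof -
      obtain s where s: "approx s x" using approx[OF x] by blast
      show ?thesis
      proof (rule W.converges_bound_limit[OF f[OF s]])
        show "q j (?B (s i)) \<le> C j * p (\<kappa> j) (?I (s i))" for i
          using le' s by (auto simp: approx_def)
        show "(\<lambda>i. C j * p (\<kappa> j) (?I (s i))) \<longlonglongrightarrow> C j * p (\<kappa> j) x"
          using s by (intro tendsto_mult_left V.converges_seminorm) (auto simp: approx_def)
      qed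
    qed
    then show "\<exists>k C. \<forall>x\<in>carrier V. q j (f x) \<le> C * p k x" by blast
  qed
  moreover have "f (\<iota> k) = b k" if k: "k \<in> K" for k
  proof -
    have "approx (\<lambda>_. Poly_Mapping.single k 1) (\<iota> k)"
      using k \<iota> by (auto simp: approx_def V.fv_ext_single[OF \<iota>] intro!: V.converges_const)
    from f[OF this] have "converges W q (\<lambda>_. b k) (f (\<iota> k))"
      using k b by (simp add: W.fv_ext_single[OF b])
    then show ?thesis using W.converges_unique W.converges_const[OF b[OF k]] by blast
  qed
  ultimately show ?thesis
    using blin_cont_linear[OF _ VV WW] \<iota> by (intro bexI[of _ "restrict f (carrier V)"]) auto
qed

section \<open>The complete projective tensor product\<close>

lemma lc_space_simps [simp]:
  "carrier (lc_space V P) = carrier V" "add (lc_space V P) = add V" "zero (lc_space V P) = zero V"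
  "smult (lc_space V P) = smult V" "mult (lc_space V P) = mult V" "one (lc_space V P) = one V"
  by (simp_all add: lc_space_def module.defs lc_struct.defs)

lemma a_inv_lc_space [simp]: "a_inv (lc_space V P) = a_inv V"
  by (simp add: fun_eq_iff a_inv_def m_inv_def)

lemma a_minus_lc_space [simp]: "a_minus (lc_space V P) = a_minus V"
  by (simp add: fun_eq_iff a_minus_def)

lemma topol_lc_space: "topol (lc_space V P) = seminorm_topology (lc_space V P) P"
proof -
  have "topol (lc_space V P) = seminorm_topology V P"
    by (simp add: lc_space_def module.defs lc_struct.defs)
  then show ?thesis by (simp add: seminorm_topology_def)
qed

locale tensor_pair = V: graded_frechet V p + W: graded_frechet W q
  for V :: "'a lc_struct" and p and W :: "'b lc_struct" and q
begin

abbreviation "FV \<equiv> fv_carrier V W"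
abbreviation "BR \<equiv> bilinear_relations V W"
abbreviation "K \<equiv> carrier V \<times> carrier W"

lemma FV_iff: "u \<in> FV \<longleftrightarrow> Poly_Mapping.keys u \<subseteq> K"
  by (simp add: fv_carrier_def)

lemma FV_closed [simp, intro]:
  "0 \<in> FV" "u \<in> FV \<Longrightarrow> v \<in> FV \<Longrightarrow> u + v \<in> FV" "u \<in> FV \<Longrightarrow> v \<in> FV \<Longrightarrow> u - v \<in> FV"
  "u \<in> FV \<Longrightarrow> - u \<in> FV" "u \<in> FV \<Longrightarrow> fv_scale c u \<in> FV"
  "x \<in> carrier V \<Longrightarrow> y \<in> carrier W \<Longrightarrow> Poly_Mapping.single (x, y) c \<in> FV"
  by (auto simp: FV_iff keys_add_subset keys_diff_subset keys_scale_subset)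

lemma fv_subspace: "module.subspace fv_scale FV"
  unfolding module.subspace_def[OF module_fv_scale] by auto

lemma BR_subset: "BR \<subseteq> FV"
  unfolding bilinear_relations_def
  by (rule module.span_minimal[OF module_fv_scale _ fv_subspace]) auto

lemma BR_closed:
  "0 \<in> BR" "u \<in> BR \<Longrightarrow> v \<in> BR \<Longrightarrow> u + v \<in> BR" "u \<in> BR \<Longrightarrow> v \<in> BR \<Longrightarrow> u - v \<in> BR"
  "u \<in> BR \<Longrightarrow> - u \<in> BR" "u \<in> BR \<Longrightarrow> fv_scale c u \<in> BR"
  unfolding bilinear_relations_def
  by (rule module.span_zero[OF module_fv_scale] module.span_add[OF module_fv_scale]
      module.span_diff[OF module_fv_scale] module.span_neg[OF module_fv_scale]
      module.span_scale[OF module_fv_scale]; assumption)+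

lemma BR_gen:
  "x \<in> carrier V \<Longrightarrow> x' \<in> carrier V \<Longrightarrow> y \<in> carrier W \<Longrightarrow>
    fv_pair (x \<oplus>\<^bsub>V\<^esub> x') y - fv_pair x y - fv_pair x' y \<in> BR"
  "x \<in> carrier V \<Longrightarrow> y \<in> carrier W \<Longrightarrow> y' \<in> carrier W \<Longrightarrow>
    fv_pair x (y \<oplus>\<^bsub>W\<^esub> y') - fv_pair x y - fv_pair x y' \<in> BR"
  "x \<in> carrier V \<Longrightarrow> y \<in> carrier W \<Longrightarrow> fv_pair (c \<odot>\<^bsub>V\<^esub> x) y - fv_scale c (fv_pair x y) \<in> BR"
  "x \<in> carrier V \<Longrightarrow> y \<in> carrier W \<Longrightarrow> fv_pair x (c \<odot>\<^bsub>W\<^esub> y) - fv_scale c (fv_pair x y) \<in> BR"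
  unfolding bilinear_relations_def by (rule module.span_base[OF module_fv_scale]; blast)+

subsection \<open>Projective seminorms\<close>

abbreviation wt :: "('a \<Rightarrow> real) \<Rightarrow> ('b \<Rightarrow> real) \<Rightarrow> 'a \<times> 'b \<Rightarrow> real" where
  "wt a b \<equiv> \<lambda>k. a (fst k) * b (snd k)"

abbreviation "\<pi> \<equiv> proj_seminorm V W"

lemma proj_seminorm_eq: "\<pi> a b u = Inf (wsum (wt a b) ` {v \<in> FV. v - u \<in> BR})"
  unfolding proj_seminorm_def wsum_def
  by (rule arg_cong[of _ _ Inf]) (auto simp: image_def case_prod_unfold mult.assoc)

context
  fixes a b assumes a: "seminorm V a" and b: "seminorm W b"
begin

lemma wt_nonneg: "k \<in> K \<Longrightarrow> 0 \<le> wt a b k"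
  using V.snorm_nonneg[OF a] W.snorm_nonneg[OF b] by auto

lemma wsum_wt_nonneg: "v \<in> FV \<Longrightarrow> 0 \<le> wsum (wt a b) v"
  by (rule wsum_nonneg[of K]) (auto simp: FV_iff intro: wt_nonneg)

lemma proj_le: "v \<in> FV \<Longrightarrow> v - u \<in> BR \<Longrightarrow> \<pi> a b u \<le> wsum (wt a b) v"
  unfolding proj_seminorm_eq by (rule cInf_lower) (auto intro!: bdd_belowI[of _ 0] wsum_wt_nonneg)

lemma proj_greatest:
  "u \<in> FV \<Longrightarrow> (\<And>v. v \<in> FV \<Longrightarrow> v - u \<in> BR \<Longrightarrow> c \<le> wsum (wt a b) v) \<Longrightarrow> c \<le> \<pi> a b u"
  unfolding proj_seminorm_eq by (rule cInf_greatest) (use BR_closed(1) in auto)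

text \<open>The infimum need not be attained; all further estimates work with almost optimal representatives.\<close>

lemma proj_approx:
  assumes "u \<in> FV" "e > 0"
  obtains v where "v \<in> FV" "v - u \<in> BR" "wsum (wt a b) v < \<pi> a b u + e"
proof (rule ccontr)
  assume "\<not> thesis"
  then have "\<pi> a b u + e \<le> \<pi> a b u" using that by (intro proj_greatest[OF assms(1)]) force
  then show False using assms(2) by simp
qed

lemma proj_nonneg: "u \<in> FV \<Longrightarrow> 0 \<le> \<pi> a b u"
  by (rule proj_greatest) (auto intro: wsum_wt_nonneg)

lemma proj_le_self: "u \<in> FV \<Longrightarrow> \<pi> a b u \<le> wsum (wt a b) u"
  by (rule proj_le) (auto intro: BR_closed)

lemma proj_add: "u \<in> FV \<Longrightarrow> v \<in> FV \<Longrightarrow> \<pi> a b (u + v) \<le> \<pi> a b u + \<pi> a b v"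
proof (rule field_le_epsilon)
  fix e :: real assume uv: "u \<in> FV" "v \<in> FV" and "e > 0"
  then have e: "e / 2 > 0" by simp
  obtain u' where u': "u' \<in> FV" "u' - u \<in> BR" "wsum (wt a b) u' < \<pi> a b u + e / 2"
    by (rule proj_approx[OF uv(1) e])
  obtain v' where v': "v' \<in> FV" "v' - v \<in> BR" "wsum (wt a b) v' < \<pi> a b v + e / 2"
    by (rule proj_approx[OF uv(2) e])
  have "u' + v' - (u + v) \<in> BR" using BR_closed(2)[OF u'(2) v'(2)] by (simp add: algebra_simps)
  then have "\<pi> a b (u + v) \<le> wsum (wt a b) (u' + v')" using u' v' by (intro proj_le) auto
  also have "\<dots> \<le> wsum (wt a b) u' + wsum (wt a b) v'"
    by (rule wsum_add[of K]) (use wt_nonneg u' v' in \<open>auto simp: FV_iff\<close>)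
  finally show "\<pi> a b (u + v) \<le> \<pi> a b u + \<pi> a b v + e" using u'(3) v'(3) by simp
qed

lemma proj_scale_le: "u \<in> FV \<Longrightarrow> \<pi> a b (fv_scale c u) \<le> cmod c * \<pi> a b u"
proof (rule field_le_epsilon)
  fix e :: real assume u: "u \<in> FV" and "e > 0"
  then have e: "e / (cmod c + 1) > 0" by (simp add: add_nonneg_pos)
  obtain v where v: "v \<in> FV" "v - u \<in> BR" "wsum (wt a b) v < \<pi> a b u + e / (cmod c + 1)"
    by (rule proj_approx[OF u e])
  have "fv_scale c v - fv_scale c u = fv_scale c (v - u)"
    by (rule poly_mapping_eqI) (simp add: lookup_minus algebra_simps)
  then have "\<pi> a b (fv_scale c u) \<le> wsum (wt a b) (fv_scale c v)"
    using v BR_closed(5)[OF v(2)] by (intro proj_le) auto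
  also have "\<dots> = cmod c * wsum (wt a b) v" by (rule wsum_scale)
  also have "\<dots> \<le> cmod c * (\<pi> a b u + e / (cmod c + 1))" using v by (intro mult_left_mono) auto
  also have "\<dots> \<le> cmod c * \<pi> a b u + e"
  proof -
    have "cmod c / (cmod c + 1) \<le> 1" by (simp add: divide_simps add_nonneg_pos)
    then have "cmod c * (e / (cmod c + 1)) \<le> e"
      using mult_left_mono[of "cmod c / (cmod c + 1)" 1 e] \<open>e > 0\<close> by (simp add: mult.commute)
    then show ?thesis by (simp add: distrib_left)
  qed
  finally show "\<pi> a b (fv_scale c u) \<le> cmod c * \<pi> a b u + e" .
qed

lemma proj_scale: assumes "u \<in> FV" shows "\<pi> a b (fv_scale c u) = cmod c * \<pi> a b u"
proof (cases "c = 0")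
  case True
  then show ?thesis using proj_scale_le[OF assms, of 0] proj_nonneg[of "fv_scale 0 u"] assms by simp
next
  case False
  have "fv_scale (1 / c) (fv_scale c u) = u"
    by (rule poly_mapping_eqI) (use False in simp)
  then have "\<pi> a b u \<le> cmod (1 / c) * \<pi> a b (fv_scale c u)"
    using proj_scale_le[of "fv_scale c u" "1 / c"] assms by simp
  then have "cmod c * \<pi> a b u \<le> \<pi> a b (fv_scale c u)"
    using False by (simp add: norm_divide field_simps)
  then show ?thesis using proj_scale_le[OF assms, of c] by simp
qed

lemma proj_zero: "\<pi> a b 0 = 0"
  using proj_le_self[of 0] proj_nonneg[of 0] by (simp add: wsum_def)

lemma proj_BR: "u \<in> BR \<Longrightarrow> \<pi> a b u = 0"
  using proj_le[of 0 u] proj_nonneg[of u] BR_closed(4) BR_subset by (auto simp: wsum_def)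

lemma proj_neg: "u \<in> FV \<Longrightarrow> \<pi> a b (- u) = \<pi> a b u"
proof -
  have "fv_scale (-1) u = - u" by (rule poly_mapping_eqI) simp
  then show "u \<in> FV \<Longrightarrow> ?thesis" using proj_scale[of u "-1"] by simp
qed

lemma proj_minus_commute: "u \<in> FV \<Longrightarrow> v \<in> FV \<Longrightarrow> \<pi> a b (u - v) = \<pi> a b (v - u)"
  using proj_neg[of "u - v"] by simp

lemma proj_triangle:
  "u \<in> FV \<Longrightarrow> v \<in> FV \<Longrightarrow> w \<in> FV \<Longrightarrow> \<pi> a b (u - w) \<le> \<pi> a b (u - v) + \<pi> a b (v - w)"
  using proj_add[of "u - v" "v - w"] by simp

lemma proj_diff: "u \<in> FV \<Longrightarrow> v \<in> FV \<Longrightarrow> \<bar>\<pi> a b u - \<pi> a b v\<bar> \<le> \<pi> a b (u - v)"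
  using proj_add[of "u - v" v] proj_add[of "v - u" u] proj_minus_commute[of u v] by simp

lemma proj_pair: "x \<in> carrier V \<Longrightarrow> y \<in> carrier W \<Longrightarrow> \<pi> a b (fv_pair x y) \<le> a x * b y"
  using proj_le_self[of "fv_pair x y"] by simp

end

text \<open>Domination of the factors passes to the projective seminorm, because it holds for each representative.
  Hence the diagonal family \<open>\<pi> (p k) (q k)\<close> suffices to describe the projective topology.\<close>

lemma proj_dominated:
  assumes "seminorm V a" "seminorm W b" "seminorm V a'" "seminorm W b'"
    and "C \<ge> 0" "\<And>x. x \<in> carrier V \<Longrightarrow> a x \<le> C * a' x"
    and "D \<ge> 0" "\<And>x. x \<in> carrier W \<Longrightarrow> b x \<le> D * b' x" and u: "u \<in> FV"
  shows "\<pi> a b u \<le> (C * D) * \<pi> a' b' u"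
proof (rule field_le_epsilon)
  fix e :: real assume e: "e > 0"
  have CD: "C * D \<ge> 0" using assms by simp
  then have "e / (C * D + 1) > 0" using e by (simp add: add_nonneg_pos)
  then obtain v where v: "v \<in> FV" "v - u \<in> BR" "wsum (wt a' b') v < \<pi> a' b' u + e / (C * D + 1)"
    by (rule proj_approx[OF assms(3,4) u])
  have "\<pi> a b u \<le> wsum (wt a b) v" by (rule proj_le[OF assms(1,2) v(1,2)])
  also have "\<dots> \<le> (C * D) * wsum (wt a' b') v"
  proof (rule wsum_mono[of K])
    fix k assume "k \<in> K"
    then have "a (fst k) * b (snd k) \<le> (C * a' (fst k)) * (D * b' (snd k))"
      using assms V.snorm_nonneg[OF assms(1)] V.snorm_nonneg[OF assms(3)] W.snorm_nonneg[OF assms(2)]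
      by (intro mult_mono) auto
    then show "wt a b k \<le> C * D * wt a' b' k" by (simp add: mult_ac)
  qed (use v in \<open>auto simp: FV_iff\<close>)
  also have "\<dots> \<le> (C * D) * (\<pi> a' b' u + e / (C * D + 1))" using v CD by (intro mult_left_mono) auto
  also have "\<dots> \<le> (C * D) * \<pi> a' b' u + e"
  proof -
    have "C * D / (C * D + 1) \<le> 1" using CD by (simp add: divide_simps add_nonneg_pos)
    then have "(C * D) * (e / (C * D + 1)) \<le> e"
      using mult_left_mono[of "C * D / (C * D + 1)" 1 e] e by (simp add: mult.commute)
    then show ?thesis by (simp add: distrib_left)
  qed
  finally show "\<pi> a b u \<le> C * D * \<pi> a' b' u + e" .
qed

abbreviation "pj k \<equiv> \<pi> (p k) (q k)"

lemma pj_mono: "j \<le> k \<Longrightarrow> u \<in> FV \<Longrightarrow> pj j u \<le> pj k u"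
  using proj_dominated[of "p j" "q j" "p k" "q k" 1 1 u] V.snorm W.snorm V.p_mono W.p_mono by simp

lemma cont_dominated:
  assumes "a \<in> cont_seminorms V" "b \<in> cont_seminorms W"
  shows "\<exists>k C. C > 0 \<and> (\<forall>u\<in>FV. \<pi> a b u \<le> C * pj k u)"
proof -
  obtain k C where k: "seminorm V a" "\<And>x. x \<in> carrier V \<Longrightarrow> a x \<le> C * p k x"
    using assms(1) by (auto simp: V.cont_seminorms_iff)
  obtain l D where l: "seminorm W b" "\<And>x. x \<in> carrier W \<Longrightarrow> b x \<le> D * q l x"
    using assms(2) by (auto simp: W.cont_seminorms_iff)
  let ?m = "max k l" and ?C = "\<bar>C\<bar> + 1" and ?D = "\<bar>D\<bar> + 1"
  have "a x \<le> ?C * p ?m x" if x: "x \<in> carrier V" for x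
    by (rule order_trans[OF k(2)[OF x]], intro mult_mono V.p_mono) (use x in auto)
  moreover have "b x \<le> ?D * q ?m x" if x: "x \<in> carrier W" for x
    by (rule order_trans[OF l(2)[OF x]], intro mult_mono W.p_mono) (use x in auto)
  ultimately have "\<pi> a b u \<le> (?C * ?D) * pj ?m u" if "u \<in> FV" for u
    using that k(1) l(1) V.snorm W.snorm by (intro proj_dominated) auto
  moreover have "?C * ?D > 0" by (simp add: add_nonneg_pos)
  ultimately show ?thesis by blast
qed

subsection \<open>The completion\<close>

text \<open>By \<open>cont_dominated\<close> it is enough to consider the diagonal seminorms.\<close>

lemma tensor_Cauchy_iff:
  "s \<in> tensor_Cauchy V W \<longleftrightarrow> (\<forall>i. s i \<in> FV) \<and>
     (\<forall>k. \<forall>e>0. \<exists>N. \<forall>i\<ge>N. \<forall>j\<ge>N. pj k (s i - s j) < e)"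
proof (intro iffI conjI ballI allI impI)
  assume s: "(\<forall>i. s i \<in> FV) \<and> (\<forall>k. \<forall>e>0. \<exists>N. \<forall>i\<ge>N. \<forall>j\<ge>N. pj k (s i - s j) < e)"
  have "\<exists>N. \<forall>i\<ge>N. \<forall>j\<ge>N. \<pi> a b (s i - s j) < e"
    if ab: "a \<in> cont_seminorms V" "b \<in> cont_seminorms W" and e: "e > 0" for a b e
  proof -
    obtain k C where C: "C > 0" "\<And>u. u \<in> FV \<Longrightarrow> \<pi> a b u \<le> C * pj k u"
      using cont_dominated[OF ab] by blast
    have "e / C > 0" using e C by simp
    then obtain N where N: "\<And>i j. i \<ge> N \<Longrightarrow> j \<ge> N \<Longrightarrow> pj k (s i - s j) < e / C" using s by meson
    have "\<pi> a b (s i - s j) < e" if "i \<ge> N" "j \<ge> N" for i j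
    proof -
      have "C * pj k (s i - s j) < e" using N[OF that] C(1) by (simp add: field_simps)
      moreover have "\<pi> a b (s i - s j) \<le> C * pj k (s i - s j)" using s by (intro C(2)) auto
      ultimately show ?thesis by simp
    qed
    then show ?thesis by blast
  qed
  then show "s \<in> tensor_Cauchy V W" using s by (simp add: tensor_Cauchy_def)
qed (auto simp: tensor_Cauchy_def)

lemma tensor_null_iff:
  "(s, t) \<in> tensor_null_rel V W \<longleftrightarrow> s \<in> tensor_Cauchy V W \<and> t \<in> tensor_Cauchy V W \<and>
     (\<forall>k. (\<lambda>i. pj k (s i - t i)) \<longlonglongrightarrow> 0)"
proof (intro iffI)
  assume s: "s \<in> tensor_Cauchy V W \<and> t \<in> tensor_Cauchy V W \<and> (\<forall>k. (\<lambda>i. pj k (s i - t i)) \<longlonglongrightarrow> 0)"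
  then have FV: "s i \<in> FV" "t i \<in> FV" for i by (auto simp: tensor_Cauchy_iff)
  have "(\<lambda>i. \<pi> a b (s i - t i)) \<longlonglongrightarrow> 0"
    if ab: "a \<in> cont_seminorms V" "b \<in> cont_seminorms W" for a b
  proof -
    obtain k C where C: "C > 0" "\<And>u. u \<in> FV \<Longrightarrow> \<pi> a b u \<le> C * pj k u"
      using cont_dominated[OF ab] by blast
    have lim: "(\<lambda>i. C * pj k (s i - t i)) \<longlonglongrightarrow> 0" using s by (intro tendsto_mult_right_zero) auto
    show ?thesis
      by (rule tendsto_sandwich[OF _ _ tendsto_const lim])
        (use C(2) FV proj_nonneg ab in \<open>auto simp: cont_seminorms_def intro!: always_eventually\<close>)
  qed
  then show "(s, t) \<in> tensor_null_rel V W" using s by (simp add: tensor_null_rel_def)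
qed (auto simp: tensor_null_rel_def)

lemma Cauchy_FV: "s \<in> tensor_Cauchy V W \<Longrightarrow> s i \<in> FV"
  by (simp add: tensor_Cauchy_iff)

lemma tensor_Cauchy_const: "u \<in> FV \<Longrightarrow> (\<lambda>i. u) \<in> tensor_Cauchy V W"
  by (simp add: tensor_Cauchy_iff proj_zero V.snorm W.snorm)

lemma tensor_Cauchy_add:
  assumes "s \<in> tensor_Cauchy V W" "t \<in> tensor_Cauchy V W"
  shows "(\<lambda>i. s i + t i) \<in> tensor_Cauchy V W"
  unfolding tensor_Cauchy_iff
proof (intro conjI allI impI)
  fix k and e :: real assume "e > 0"
  then have e: "e / 2 > 0" by simp
  obtain N M where N: "\<forall>i\<ge>N. \<forall>j\<ge>N. pj k (s i - s j) < e / 2" and M: "\<forall>i\<ge>M. \<forall>j\<ge>M. pj k (t i - t j) < e / 2"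
    using assms e unfolding tensor_Cauchy_iff by meson
  have "pj k (s i + t i - (s j + t j)) < e" if "i \<ge> max N M" "j \<ge> max N M" for i j
  proof -
    have eq: "s i + t i - (s j + t j) = (s i - s j) + (t i - t j)" by simp
    have "pj k (s i + t i - (s j + t j)) \<le> pj k (s i - s j) + pj k (t i - t j)"
      unfolding eq using assms by (intro proj_add V.snorm W.snorm) (auto simp: Cauchy_FV)
    moreover have "pj k (s i - s j) < e / 2" "pj k (t i - t j) < e / 2" using N M that by auto
    ultimately show ?thesis by linarith
  qed
  then show "\<exists>N. \<forall>i\<ge>N. \<forall>j\<ge>N. pj k (s i + t i - (s j + t j)) < e" by blast
qed (use assms in \<open>auto simp: Cauchy_FV\<close>)

lemma scale_diff: "fv_scale c u - fv_scale c v = fv_scale c (u - v)"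
  by (rule poly_mapping_eqI) (simp add: lookup_minus algebra_simps)

lemma tensor_Cauchy_scale:
  assumes "s \<in> tensor_Cauchy V W"
  shows "(\<lambda>i. fv_scale c (s i)) \<in> tensor_Cauchy V W"
  unfolding tensor_Cauchy_iff
proof (intro conjI allI impI)
  fix k and e :: real assume "e > 0"
  then have e: "e / (cmod c + 1) > 0" by (simp add: add_nonneg_pos)
  obtain N where N: "\<forall>i\<ge>N. \<forall>j\<ge>N. pj k (s i - s j) < e / (cmod c + 1)"
    using assms e unfolding tensor_Cauchy_iff by meson
  have "pj k (fv_scale c (s i) - fv_scale c (s j)) < e" if "i \<ge> N" "j \<ge> N" for i j
  proof -
    have FV: "s i - s j \<in> FV" using assms by (auto simp: Cauchy_FV)
    have "pj k (fv_scale c (s i) - fv_scale c (s j)) = cmod c * pj k (s i - s j)"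
      unfolding scale_diff using FV by (intro proj_scale V.snorm W.snorm)
    also have "\<dots> \<le> (cmod c + 1) * pj k (s i - s j)"
      by (intro mult_right_mono proj_nonneg V.snorm W.snorm FV) auto
    also have "\<dots> < e"
    proof -
      have "cmod c + 1 > 0" by (simp add: add_nonneg_pos)
      moreover have "pj k (s i - s j) < e / (cmod c + 1)" using N that by blast
      ultimately show ?thesis by (simp only: pos_less_divide_eq mult.commute)
    qed
    finally show ?thesis .
  qed
  then show "\<exists>N. \<forall>i\<ge>N. \<forall>j\<ge>N. pj k (fv_scale c (s i) - fv_scale c (s j)) < e" by blast
qed (use assms in \<open>auto simp: Cauchy_FV\<close>)

abbreviation "cls \<equiv> tensor_class V W"
abbreviation "TC \<equiv> tensor_Cauchy V W"
abbreviation "T \<equiv> tensor_space V W"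

lemma equiv_null: "equiv TC (tensor_null_rel V W)"
proof (rule equivI)
  show "tensor_null_rel V W \<subseteq> TC \<times> TC" by (auto simp: tensor_null_rel_def)
  show "refl_on TC (tensor_null_rel V W)"
    by (auto simp: refl_on_def tensor_null_iff proj_zero V.snorm W.snorm)
  show "sym (tensor_null_rel V W)"
  proof (rule symI)
    fix s t assume "(s, t) \<in> tensor_null_rel V W"
    then show "(t, s) \<in> tensor_null_rel V W"
      using proj_minus_commute[OF V.snorm W.snorm Cauchy_FV Cauchy_FV, of s t]
      by (simp add: tensor_null_iff)
  qed
  show "trans (tensor_null_rel V W)"
  proof (rule transI)
    fix s t u assume st: "(s, t) \<in> tensor_null_rel V W" "(t, u) \<in> tensor_null_rel V W"
    then have FV: "s i \<in> FV" "t i \<in> FV" "u i \<in> FV" for i by (auto simp: tensor_null_iff Cauchy_FV)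
    have "(\<lambda>i. pj k (s i - u i)) \<longlonglongrightarrow> 0" for k
    proof (rule tendsto_sandwich[OF _ _ tendsto_const])
      show "(\<lambda>i. pj k (s i - t i) + pj k (t i - u i)) \<longlonglongrightarrow> 0"
        using st tendsto_add[of "\<lambda>i. pj k (s i - t i)" 0 _ "\<lambda>i. pj k (t i - u i)" 0]
        by (simp add: tensor_null_iff)
    qed (auto intro!: always_eventually proj_nonneg proj_triangle V.snorm W.snorm FV)
    then show "(s, u) \<in> tensor_null_rel V W" using st by (simp add: tensor_null_iff)
  qed
qed

lemma cls_eq_iff: "s \<in> TC \<Longrightarrow> t \<in> TC \<Longrightarrow> cls s = cls t \<longleftrightarrow> (\<forall>k. (\<lambda>i. pj k (s i - t i)) \<longlonglongrightarrow> 0)"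
  unfolding tensor_class_def by (subst eq_equiv_class_iff[OF equiv_null]) (auto simp: tensor_null_iff)

lemma mem_cls: "t \<in> cls s \<longleftrightarrow> s \<in> TC \<and> t \<in> TC \<and> cls t = cls s"
proof -
  have "t \<in> cls s \<longleftrightarrow> (s, t) \<in> tensor_null_rel V W" by (simp add: tensor_class_def)
  also have "\<dots> \<longleftrightarrow> s \<in> TC \<and> t \<in> TC \<and> cls s = cls t"
    using cls_eq_iff[of s t] by (auto simp: tensor_null_iff)
  finally show ?thesis by auto
qed

lemma carrier_T: "carrier T = cls ` TC"
  by (auto simp: tensor_space_def quotient_def tensor_class_def)

lemma zero_T: "\<zero>\<^bsub>T\<^esub> = cls (\<lambda>i. 0)"
  by (simp add: tensor_space_def)

lemma add_T:
  assumes "s \<in> TC" "t \<in> TC"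
  shows "cls s \<oplus>\<^bsub>T\<^esub> cls t = cls (\<lambda>i. s i + t i)"
proof -
  have "cls (\<lambda>i. s' i + t' i) = cls (\<lambda>i. s i + t i)" if "s' \<in> cls s" "t' \<in> cls t" for s' t'
  proof -
    have st': "s' \<in> TC" "t' \<in> TC" "cls s' = cls s" "cls t' = cls t" using that by (auto simp: mem_cls)
    have lim: "(\<lambda>i. pj k (s' i - s i)) \<longlonglongrightarrow> 0" "(\<lambda>i. pj k (t' i - t i)) \<longlonglongrightarrow> 0" for k
      using cls_eq_iff st' assms by auto
    have "(\<lambda>i. pj k (s' i + t' i - (s i + t i))) \<longlonglongrightarrow> 0" for k
    proof (rule tendsto_sandwich[OF _ _ tendsto_const])
      show "(\<lambda>i. pj k (s' i - s i) + pj k (t' i - t i)) \<longlonglongrightarrow> 0"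
        using tendsto_add[OF lim] by simp
      have "pj k (s' i + t' i - (s i + t i)) \<le> pj k (s' i - s i) + pj k (t' i - t i)" for i
        using proj_add[OF V.snorm W.snorm, of "s' i - s i" "t' i - t i" k k] st' assms
        by (simp add: Cauchy_FV algebra_simps)
      then show "\<forall>\<^sub>F i in sequentially. pj k (s' i + t' i - (s i + t i)) \<le> pj k (s' i - s i) + pj k (t' i - t i)"
        by (intro always_eventually) auto
      show "\<forall>\<^sub>F i in sequentially. 0 \<le> pj k (s' i + t' i - (s i + t i))"
        using st' assms by (intro always_eventually allI proj_nonneg V.snorm W.snorm) (auto simp: Cauchy_FV)
    qed
    then show ?thesis using st' assms by (subst cls_eq_iff) (auto intro: tensor_Cauchy_add)
  qed
  moreover have "s \<in> cls s" "t \<in> cls t" using assms by (auto simp: mem_cls)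
  ultimately have "(\<Union>s'\<in>cls s. \<Union>t'\<in>cls t. cls (\<lambda>i. s' i + t' i)) = cls (\<lambda>i. s i + t i)" by blast
  then show ?thesis by (simp add: tensor_space_def)
qed

lemma smult_T:
  assumes "s \<in> TC"
  shows "c \<odot>\<^bsub>T\<^esub> cls s = cls (\<lambda>i. fv_scale c (s i))"
proof -
  have "cls (\<lambda>i. fv_scale c (s' i)) = cls (\<lambda>i. fv_scale c (s i))" if "s' \<in> cls s" for s'
  proof -
    have st': "s' \<in> TC" "cls s' = cls s" using that by (auto simp: mem_cls)
    have lim: "(\<lambda>i. pj k (s' i - s i)) \<longlonglongrightarrow> 0" for k using cls_eq_iff st' assms by auto
    have "pj k (fv_scale c (s' i) - fv_scale c (s i)) = cmod c * pj k (s' i - s i)" for k i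
      unfolding scale_diff using st' assms by (intro proj_scale V.snorm W.snorm) (auto simp: Cauchy_FV)
    then have "(\<lambda>i. pj k (fv_scale c (s' i) - fv_scale c (s i))) \<longlonglongrightarrow> 0" for k
      using tendsto_mult_right_zero[OF lim] by simp
    then show ?thesis using st' assms by (subst cls_eq_iff) (auto intro: tensor_Cauchy_scale)
  qed
  moreover have "s \<in> cls s" using assms by (auto simp: mem_cls)
  ultimately have "(\<Union>s'\<in>cls s. cls (\<lambda>i. fv_scale c (s' i))) = cls (\<lambda>i. fv_scale c (s i))" by blast
  then show ?thesis by (simp add: tensor_space_def)
qed

lemma TC_zero: "(\<lambda>i. 0) \<in> TC" by (rule tensor_Cauchy_const) simp

lemma complex_space_T: "complex_space T"
proof (rule complex_spaceI)
  show "abelian_group T"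
  proof (rule abelian_groupI)
    fix x y z assume "x \<in> carrier T" "y \<in> carrier T" "z \<in> carrier T"
    then obtain s t u where "x = cls s" "s \<in> TC" "y = cls t" "t \<in> TC" "z = cls u" "u \<in> TC"
      by (auto simp: carrier_T)
    then show "x \<oplus>\<^bsub>T\<^esub> y \<oplus>\<^bsub>T\<^esub> z = x \<oplus>\<^bsub>T\<^esub> (y \<oplus>\<^bsub>T\<^esub> z)"
      by (simp add: add_T tensor_Cauchy_add add.assoc)
  next
    fix x y assume "x \<in> carrier T" "y \<in> carrier T"
    then obtain s t where st: "x = cls s" "s \<in> TC" "y = cls t" "t \<in> TC" by (auto simp: carrier_T)
    then show "x \<oplus>\<^bsub>T\<^esub> y = y \<oplus>\<^bsub>T\<^esub> x" by (simp add: add_T add.commute)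
    show "x \<oplus>\<^bsub>T\<^esub> y \<in> carrier T" using st by (auto simp: add_T carrier_T intro: tensor_Cauchy_add)
    show "\<zero>\<^bsub>T\<^esub> \<oplus>\<^bsub>T\<^esub> x = x" using st by (simp add: zero_T add_T TC_zero)
    have "fv_scale (-1) (s i) + s i = 0" for i by (rule poly_mapping_eqI) (simp add: lookup_add)
    then show "\<exists>y\<in>carrier T. y \<oplus>\<^bsub>T\<^esub> x = \<zero>\<^bsub>T\<^esub>"
      using st by (intro bexI[of _ "cls (\<lambda>i. fv_scale (-1) (s i))"])
        (auto simp: zero_T add_T carrier_T tensor_Cauchy_scale)
  next
    show "\<zero>\<^bsub>T\<^esub> \<in> carrier T" by (auto simp: zero_T carrier_T TC_zero)
  qed
next
  fix c d x y assume "x \<in> carrier T" "y \<in> carrier T"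
  then obtain s t where st: "x = cls s" "s \<in> TC" "y = cls t" "t \<in> TC" by (auto simp: carrier_T)
  have "fv_scale c (s i + t i) = fv_scale c (s i) + fv_scale c (t i)" for i
    by (rule poly_mapping_eqI) (simp add: lookup_add algebra_simps)
  then show "c \<odot>\<^bsub>T\<^esub> (x \<oplus>\<^bsub>T\<^esub> y) = c \<odot>\<^bsub>T\<^esub> x \<oplus>\<^bsub>T\<^esub> c \<odot>\<^bsub>T\<^esub> y"
    using st by (simp add: add_T smult_T tensor_Cauchy_add tensor_Cauchy_scale)
next
  fix c d x assume "x \<in> carrier T"
  then obtain s where st: "x = cls s" "s \<in> TC" by (auto simp: carrier_T)
  show "c \<odot>\<^bsub>T\<^esub> x \<in> carrier T" using st by (auto simp: smult_T carrier_T intro: tensor_Cauchy_scale)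
  have "fv_scale (c + d) (s i) = fv_scale c (s i) + fv_scale d (s i)"
    "fv_scale (c * d) (s i) = fv_scale c (fv_scale d (s i))" "fv_scale 1 (s i) = s i" for i
    by (rule poly_mapping_eqI, simp add: lookup_add algebra_simps)+
  then show "(c + d) \<odot>\<^bsub>T\<^esub> x = c \<odot>\<^bsub>T\<^esub> x \<oplus>\<^bsub>T\<^esub> d \<odot>\<^bsub>T\<^esub> x" "(c * d) \<odot>\<^bsub>T\<^esub> x = c \<odot>\<^bsub>T\<^esub> (d \<odot>\<^bsub>T\<^esub> x)" "1 \<odot>\<^bsub>T\<^esub> x = x"
    using st by (simp_all add: add_T smult_T tensor_Cauchy_scale)
qed

sublocale T: cvs T
  by (rule cvs_of_complex_space[OF complex_space_T])

lemma minus_T: "s \<in> TC \<Longrightarrow> t \<in> TC \<Longrightarrow> cls s \<ominus>\<^bsub>T\<^esub> cls t = cls (\<lambda>i. s i - t i)"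
proof -
  assume st: "s \<in> TC" "t \<in> TC"
  then have c: "cls t \<in> carrier T" by (simp add: carrier_T)
  have eq: "s i + fv_scale (-1) (t i) = s i - t i" for i
    by (rule poly_mapping_eqI) (simp add: lookup_add lookup_minus)
  have "cls s \<ominus>\<^bsub>T\<^esub> cls t = cls s \<oplus>\<^bsub>T\<^esub> (-1) \<odot>\<^bsub>T\<^esub> cls t"
    by (simp add: T.minus_eq T.neg_eq_sm[OF c])
  also have "\<dots> = cls (\<lambda>i. s i + fv_scale (-1) (t i))"
    using st by (simp only: smult_T add_T tensor_Cauchy_scale)
  finally show ?thesis by (simp only: eq)
qed

lemma TC_minus: "s \<in> TC \<Longrightarrow> t \<in> TC \<Longrightarrow> (\<lambda>i. s i - t i) \<in> TC"
proof -
  assume st: "s \<in> TC" "t \<in> TC"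
  have "s i + fv_scale (-1) (t i) = s i - t i" for i
    by (rule poly_mapping_eqI) (simp add: lookup_add lookup_minus)
  then show ?thesis using tensor_Cauchy_add[OF st(1) tensor_Cauchy_scale[OF st(2), of "-1"]] by simp
qed

text \<open>The seminorm of an equivalence class of Cauchy sequences is a limit that does not depend on the
  representative, so that the definite description defining it is justified.\<close>

lemma tensor_seminorm_lim:
  assumes ab: "a \<in> cont_seminorms V" "b \<in> cont_seminorms W" and s: "s \<in> TC"
  shows "(\<lambda>i. \<pi> a b (s i)) \<longlonglongrightarrow> tensor_seminorm V W a b (cls s)"
proof -
  have sn: "seminorm V a" "seminorm W b" using ab by (auto simp: cont_seminorms_def)
  have "Cauchy (\<lambda>i. \<pi> a b (s i))"
  proof (rule CauchyI)
    fix e :: real assume "e > 0"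
    then obtain N where N: "\<forall>i\<ge>N. \<forall>j\<ge>N. \<pi> a b (s i - s j) < e"
      using s ab unfolding tensor_Cauchy_def by blast
    have "norm (\<pi> a b (s i) - \<pi> a b (s j)) < e" if "i \<ge> N" "j \<ge> N" for i j
    proof -
      have "norm (\<pi> a b (s i) - \<pi> a b (s j)) \<le> \<pi> a b (s i - s j)"
        using proj_diff[OF sn Cauchy_FV[OF s] Cauchy_FV[OF s]] by simp
      also have "\<dots> < e" using N that by simp
      finally show ?thesis .
    qed
    then show "\<exists>M. \<forall>m\<ge>M. \<forall>n\<ge>M. norm (\<pi> a b (s m) - \<pi> a b (s n)) < e" by blast
  qed
  then obtain r where r: "(\<lambda>i. \<pi> a b (s i)) \<longlonglongrightarrow> r"
    using Cauchy_convergent_iff convergentD by blast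
  have all: "(\<lambda>i. \<pi> a b (t i)) \<longlonglongrightarrow> r" if t: "t \<in> cls s" for t
  proof -
    have t': "t \<in> TC" "(t, s) \<in> tensor_null_rel V W"
      using t s cls_eq_iff[of t s] by (auto simp: mem_cls tensor_null_iff)
    have "(\<lambda>i. \<pi> a b (t i - s i)) \<longlonglongrightarrow> 0" using t'(2) ab by (auto simp: tensor_null_rel_def)
    then have "(\<lambda>i. \<pi> a b (t i) - \<pi> a b (s i)) \<longlonglongrightarrow> 0"
      by (rule Lim_null_comparison[rotated])
        (use proj_diff[OF sn Cauchy_FV[OF t'(1)] Cauchy_FV[OF s]] in auto)
    from tendsto_add[OF this r] show ?thesis by simp
  qed
  have "tensor_seminorm V W a b (cls s) = r"
    unfolding tensor_seminorm_def
  proof (rule the_equality)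
    show "\<forall>s\<in>cls s. (\<lambda>i. \<pi> a b (s i)) \<longlonglongrightarrow> r" using all by blast
    fix r' assume "\<forall>s\<in>cls s. (\<lambda>i. \<pi> a b (s i)) \<longlonglongrightarrow> r'"
    moreover have "s \<in> cls s" using s by (simp add: mem_cls)
    ultimately show "r' = r" using r LIMSEQ_unique by blast
  qed
  with r show ?thesis by simp
qed

abbreviation "P k \<equiv> tensor_seminorm V W (p k) (q k)"

lemma tensor_seminorm_seminorm:
  assumes ab: "a \<in> cont_seminorms V" "b \<in> cont_seminorms W"
  shows "seminorm T (tensor_seminorm V W a b)"
proof -
  have sn: "seminorm V a" "seminorm W b" using ab by (auto simp: cont_seminorms_def)
  note lim = tensor_seminorm_lim[OF ab]
  show ?thesis
    unfolding seminorm_def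
  proof (intro conjI ballI allI)
    fix x c assume "x \<in> carrier T"
    then obtain s where s: "x = cls s" "s \<in> TC" by (auto simp: carrier_T)
    show "0 \<le> tensor_seminorm V W a b x" unfolding s(1)
      by (rule LIMSEQ_le_const[OF lim[OF s(2)]]) (use proj_nonneg[OF sn Cauchy_FV[OF s(2)]] in auto)
    have "(\<lambda>i. \<pi> a b (fv_scale c (s i))) \<longlonglongrightarrow> cmod c * tensor_seminorm V W a b x"
      using tendsto_mult_left[OF lim[OF s(2)], of "cmod c"] by (simp add: s proj_scale[OF sn Cauchy_FV])
    then show "tensor_seminorm V W a b (c \<odot>\<^bsub>T\<^esub> x) = cmod c * tensor_seminorm V W a b x"
      using lim[OF tensor_Cauchy_scale[OF s(2), of c]] s LIMSEQ_unique by (auto simp: smult_T)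
    fix y assume "y \<in> carrier T"
    then obtain t where t: "y = cls t" "t \<in> TC" by (auto simp: carrier_T)
    show "tensor_seminorm V W a b (x \<oplus>\<^bsub>T\<^esub> y) \<le> tensor_seminorm V W a b x + tensor_seminorm V W a b y"
      unfolding s(1) t(1) add_T[OF s(2) t(2)]
      by (rule LIMSEQ_le[OF lim[OF tensor_Cauchy_add[OF s(2) t(2)]] tendsto_add[OF lim[OF s(2)] lim[OF t(2)]]])
        (use proj_add[OF sn Cauchy_FV[OF s(2)] Cauchy_FV[OF t(2)]] in auto)
  qed
qed

lemma P_lim: "s \<in> TC \<Longrightarrow> (\<lambda>i. pj k (s i)) \<longlonglongrightarrow> P k (cls s)"
  by (rule tensor_seminorm_lim) auto

lemma P_const: "u \<in> FV \<Longrightarrow> P k (cls (\<lambda>i. u)) = pj k u"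
  by (rule LIMSEQ_unique[OF P_lim[OF tensor_Cauchy_const] tendsto_const])

lemma converges_const_cls:
  assumes s: "s \<in> TC"
  shows "converges T P (\<lambda>i. cls (\<lambda>_. s i)) (cls s)"
  unfolding converges_def
proof (intro conjI allI)
  show "cls (\<lambda>_. s i) \<in> carrier T" for i
    using tensor_Cauchy_const[OF Cauchy_FV[OF s]] by (auto simp: carrier_T)
  show "cls s \<in> carrier T" using s by (auto simp: carrier_T)
  fix k
  have c: "(\<lambda>_. s i) \<in> TC" for i by (rule tensor_Cauchy_const[OF Cauchy_FV[OF s]])
  show "(\<lambda>i. P k (cls (\<lambda>_. s i) \<ominus>\<^bsub>T\<^esub> cls s)) \<longlonglongrightarrow> 0"
  proof (rule LIMSEQ_I)
    fix e :: real assume e: "e > 0"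
    then have "e / 2 > 0" by simp
    then obtain N where N: "\<forall>i\<ge>N. \<forall>j\<ge>N. pj k (s i - s j) < e / 2" using s unfolding tensor_Cauchy_iff by meson
    have "norm (P k (cls (\<lambda>_. s i) \<ominus>\<^bsub>T\<^esub> cls s) - 0) < e" if i: "i \<ge> N" for i
    proof -
      have m: "(\<lambda>j. s i - s j) \<in> TC" by (rule TC_minus[OF c s])
      have "0 \<le> P k (cls (\<lambda>j. s i - s j))"
        using T.snorm_nonneg[OF tensor_seminorm_seminorm] m by (auto simp: carrier_T)
      moreover have "P k (cls (\<lambda>j. s i - s j)) \<le> e / 2"
        by (rule LIMSEQ_le_const2[OF P_lim[OF m]]) (use N i less_imp_le in blast)
      ultimately show ?thesis using e by (simp add: minus_T[OF c s])
    qed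
    then show "\<exists>N. \<forall>i\<ge>N. norm (P k (cls (\<lambda>_. s i) \<ominus>\<^bsub>T\<^esub> cls s) - 0) < e" by blast
  qed
qed

text \<open>The completion by Cauchy sequences is complete by the usual diagonal argument, where the \<open>i\<close>-th member
  of a Cauchy sequence of classes is approximated with respect to the \<open>i\<close>-th seminorm.\<close>

theorem graded_frechet_T: "graded_frechet T P"
proof
  show sn: "seminorm T (P k)" for k by (rule tensor_seminorm_seminorm) auto
  show incr: "P k x \<le> P (Suc k) x" if x: "x \<in> carrier T" for k x
  proof -
    obtain s where s: "x = cls s" "s \<in> TC" using x unfolding carrier_T by blast
    show ?thesis unfolding s(1)
      by (rule LIMSEQ_le[OF P_lim[OF s(2)] P_lim[OF s(2)]]) (use pj_mono[OF _ Cauchy_FV[OF s(2)]] in auto)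
  qed
  show "topol T = seminorm_topology T (range P)"
  proof -
    have "topol T = seminorm_topology T
        {tensor_seminorm V W a b | a b. a \<in> cont_seminorms V \<and> b \<in> cont_seminorms W}"
      unfolding tensor_space_def by (rule topol_lc_space)
    also have "\<dots> = seminorm_topology T (range P)"
    proof (rule T.seminorm_topology_graded)
      fix r assume "r \<in> {tensor_seminorm V W a b | a b. a \<in> cont_seminorms V \<and> b \<in> cont_seminorms W}"
      then obtain a b where r: "r = tensor_seminorm V W a b" and ab: "a \<in> cont_seminorms V" "b \<in> cont_seminorms W"
        by blast
      obtain k C where C: "C > 0" "\<And>u. u \<in> FV \<Longrightarrow> \<pi> a b u \<le> C * pj k u"
        using cont_dominated[OF ab] by blast
      have "r x \<le> C * P k x" if x: "x \<in> carrier T" for x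
      proof -
        obtain s where s: "x = cls s" "s \<in> TC" using x unfolding carrier_T by blast
        show ?thesis unfolding s(1) r
          by (rule LIMSEQ_le[OF tensor_seminorm_lim[OF ab s(2)] tendsto_mult_left[OF P_lim[OF s(2)]]])
            (use C(2) Cauchy_FV[OF s(2)] in auto)
      qed
      then show "\<exists>k C. \<forall>x\<in>carrier T. r x \<le> C * P k x" by blast
    qed (use sn incr in \<open>auto intro!: V.p_cont W.p_cont\<close>)
    finally show ?thesis .
  qed
  show "x = \<zero>\<^bsub>T\<^esub>" if x: "x \<in> carrier T" "\<And>k. P k x = 0" for x
  proof -
    obtain s where s: "x = cls s" "s \<in> TC" using x(1) unfolding carrier_T by blast
    have "(\<lambda>i. pj k (s i - 0)) \<longlonglongrightarrow> 0" for k using P_lim[OF s(2), of k] x(2)[of k] s by simp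
    then show ?thesis using s TC_zero by (simp add: zero_T cls_eq_iff)
  qed
  show "\<exists>x. converges T P S x" if "Cauchy_in T P S" for S
  proof -
    have S: "S i \<in> carrier T" for i using that by (simp add: Cauchy_in_def)
    \<comment> \<open>approximate the \<open>i\<close>-th term up to \<open>1 / (i + 1)\<close> in the \<open>i\<close>-th seminorm\<close>
    have "\<exists>u\<in>FV. P i (S i \<ominus>\<^bsub>T\<^esub> cls (\<lambda>_. u)) < 1 / real (Suc i)" for i
    proof -
      obtain s where s: "S i = cls s" "s \<in> TC" using S[of i] by (auto simp: carrier_T)
      have "(\<lambda>j. P i (cls (\<lambda>_. s j) \<ominus>\<^bsub>T\<^esub> cls s)) \<longlonglongrightarrow> 0"
        using converges_const_cls[OF s(2)] by (simp add: converges_def)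
      then have "\<forall>\<^sub>F j in sequentially. P i (cls (\<lambda>_. s j) \<ominus>\<^bsub>T\<^esub> cls s) < 1 / real (Suc i)"
        by (rule order_tendstoD) simp
      then obtain j where "P i (cls (\<lambda>_. s j) \<ominus>\<^bsub>T\<^esub> cls s) < 1 / real (Suc i)"
        by (auto simp: eventually_sequentially)
      moreover have "cls (\<lambda>_. s j) \<in> carrier T"
        using tensor_Cauchy_const[OF Cauchy_FV[OF s(2)]] by (auto simp: carrier_T)
      ultimately have "P i (S i \<ominus>\<^bsub>T\<^esub> cls (\<lambda>_. s j)) < 1 / real (Suc i)"
        using T.snorm_minus_commute[OF sn S[of i]] s by simp
      then show ?thesis using Cauchy_FV[OF s(2)] by blast
    qed
    then obtain u where u: "\<And>i. u i \<in> FV" "\<And>i. P i (S i \<ominus>\<^bsub>T\<^esub> cls (\<lambda>_. u i)) < 1 / real (Suc i)"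
      by metis
    have cu: "cls (\<lambda>_. u i) \<in> carrier T" for i using tensor_Cauchy_const[OF u(1)] by (auto simp: carrier_T)
    have Pmono: "P j x \<le> P k x" if "j \<le> k" "x \<in> carrier T" for j k x
      using lift_Suc_mono_le[of "\<lambda>k. P k x" j k] incr that by simp
    have dist: "P k (S i \<ominus>\<^bsub>T\<^esub> cls (\<lambda>_. u i)) < 1 / real (Suc i)" if "k \<le> i" for k i
      using Pmono[OF that, of "S i \<ominus>\<^bsub>T\<^esub> cls (\<lambda>_. u i)"] u(2)[of i] S cu by simp
    have uTC: "u \<in> TC"
      unfolding tensor_Cauchy_iff
    proof (intro conjI allI impI)
      fix k and e :: real assume e: "e > 0"
      then have e3: "e / 3 > 0" by simp
      obtain N where N: "\<forall>i\<ge>N. \<forall>j\<ge>N. P k (S i \<ominus>\<^bsub>T\<^esub> S j) < e / 3" using \<open>Cauchy_in T P S\<close> e3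
        unfolding Cauchy_in_def by meson
      obtain M where M: "1 / real (Suc M) < e / 3" using e3 nat_approx_posE by blast
      have small: "1 / real (Suc i) < e / 3" if "i \<ge> M" for i
        using M that by (meson frac_le le_less_trans less_eq_real_def of_nat_0_less_iff of_nat_mono
            Suc_le_mono zero_less_Suc zero_le_one)
      have "pj k (u i - u j) < e" if "i \<ge> max k (max N M)" "j \<ge> max k (max N M)" for i j
      proof -
        have "pj k (u i - u j) = P k (cls (\<lambda>_. u i) \<ominus>\<^bsub>T\<^esub> cls (\<lambda>_. u j))"
          using u(1) by (simp add: minus_T tensor_Cauchy_const P_const)
        also have "\<dots> \<le> P k (cls (\<lambda>_. u i) \<ominus>\<^bsub>T\<^esub> S i) + P k (S i \<ominus>\<^bsub>T\<^esub> cls (\<lambda>_. u j))"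
          by (rule T.snorm_triangle[OF sn cu S cu])
        also have "P k (S i \<ominus>\<^bsub>T\<^esub> cls (\<lambda>_. u j)) \<le> P k (S i \<ominus>\<^bsub>T\<^esub> S j) + P k (S j \<ominus>\<^bsub>T\<^esub> cls (\<lambda>_. u j))"
          by (rule T.snorm_triangle[OF sn S S cu])
        also have "P k (cls (\<lambda>_. u i) \<ominus>\<^bsub>T\<^esub> S i) = P k (S i \<ominus>\<^bsub>T\<^esub> cls (\<lambda>_. u i))"
          by (rule T.snorm_minus_commute[OF sn cu S])
        finally show ?thesis
          using dist[of k i] dist[of k j] small[of i] small[of j] N that by fastforce
      qed
      then show "\<exists>N. \<forall>i\<ge>N. \<forall>j\<ge>N. pj k (u i - u j) < e" by blast
    qed (rule u(1))
    have "converges T P S (cls u)"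
      unfolding converges_def
    proof (intro conjI allI)
      fix k
      have "(\<lambda>i. P k (S i \<ominus>\<^bsub>T\<^esub> cls (\<lambda>_. u i))) \<longlonglongrightarrow> 0"
      proof (rule tendsto_sandwich[OF _ _ tendsto_const])
        show "(\<lambda>i. 1 / real (Suc i)) \<longlonglongrightarrow> 0" using LIMSEQ_inverse_real_of_nat by (simp add: inverse_eq_divide)
        show "\<forall>\<^sub>F i in sequentially. P k (S i \<ominus>\<^bsub>T\<^esub> cls (\<lambda>_. u i)) \<le> 1 / real (Suc i)"
          using dist less_imp_le unfolding eventually_sequentially by blast
        show "\<forall>\<^sub>F i in sequentially. 0 \<le> P k (S i \<ominus>\<^bsub>T\<^esub> cls (\<lambda>_. u i))"
          using T.snorm_nonneg[OF sn] S cu by (intro always_eventually) auto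
      qed
      moreover have "(\<lambda>i. P k (cls (\<lambda>_. u i) \<ominus>\<^bsub>T\<^esub> cls u)) \<longlonglongrightarrow> 0"
        using converges_const_cls[OF uTC] by (simp add: converges_def)
      ultimately have lim: "(\<lambda>i. P k (S i \<ominus>\<^bsub>T\<^esub> cls (\<lambda>_. u i)) + P k (cls (\<lambda>_. u i) \<ominus>\<^bsub>T\<^esub> cls u)) \<longlonglongrightarrow> 0"
        using tendsto_add by fastforce
      have clsu: "cls u \<in> carrier T" using uTC by (auto simp: carrier_T)
      show "(\<lambda>i. P k (S i \<ominus>\<^bsub>T\<^esub> cls u)) \<longlonglongrightarrow> 0"
        by (rule tendsto_sandwich[OF _ _ tendsto_const lim])
          (use T.snorm_nonneg[OF sn] T.snorm_triangle[OF sn S cu clsu] S clsu in \<open>auto intro!: always_eventually\<close>)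
    qed (use S uTC in \<open>auto simp: carrier_T\<close>)
    then show ?thesis by blast
  qed
qed

sublocale T: graded_frechet T P
  by (rule graded_frechet_T)

subsection \<open>Elementary tensors and the universal property\<close>

abbreviation elem :: "'a \<Rightarrow> 'b \<Rightarrow> ('a, 'b) ctensor" where "elem \<equiv> elem_tensor V W"

lemma cls_const_eq: "u \<in> FV \<Longrightarrow> v \<in> FV \<Longrightarrow> u - v \<in> BR \<Longrightarrow> cls (\<lambda>_. u) = cls (\<lambda>_. v)"
  by (subst cls_eq_iff) (auto simp: tensor_Cauchy_const proj_BR V.snorm W.snorm)

lemma elem_closed [simp, intro]: "x \<in> carrier V \<Longrightarrow> y \<in> carrier W \<Longrightarrow> elem x y \<in> carrier T"
  by (auto simp: elem_tensor_def carrier_T intro!: imageI tensor_Cauchy_const)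

lemma elem_add_left:
  "x \<in> carrier V \<Longrightarrow> x' \<in> carrier V \<Longrightarrow> y \<in> carrier W \<Longrightarrow> elem (x \<oplus>\<^bsub>V\<^esub> x') y = elem x y \<oplus>\<^bsub>T\<^esub> elem x' y"
  using BR_gen(1)[of x x' y] unfolding elem_tensor_def
  by (simp add: add_T tensor_Cauchy_const, intro cls_const_eq) (auto simp: diff_diff_eq)

lemma elem_add_right:
  "x \<in> carrier V \<Longrightarrow> y \<in> carrier W \<Longrightarrow> y' \<in> carrier W \<Longrightarrow> elem x (y \<oplus>\<^bsub>W\<^esub> y') = elem x y \<oplus>\<^bsub>T\<^esub> elem x y'"
  using BR_gen(2)[of x y y'] unfolding elem_tensor_def
  by (simp add: add_T tensor_Cauchy_const, intro cls_const_eq) (auto simp: diff_diff_eq)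

lemma elem_scale_left:
  "x \<in> carrier V \<Longrightarrow> y \<in> carrier W \<Longrightarrow> elem (c \<odot>\<^bsub>V\<^esub> x) y = c \<odot>\<^bsub>T\<^esub> elem x y"
  using BR_gen(3)[of x y c] unfolding elem_tensor_def
  by (simp add: smult_T tensor_Cauchy_const, intro cls_const_eq) (auto simp: diff_diff_eq)

lemma elem_scale_right:
  "x \<in> carrier V \<Longrightarrow> y \<in> carrier W \<Longrightarrow> elem x (c \<odot>\<^bsub>W\<^esub> y) = c \<odot>\<^bsub>T\<^esub> elem x y"
  using BR_gen(4)[of x y c] unfolding elem_tensor_def
  by (simp add: smult_T tensor_Cauchy_const, intro cls_const_eq) (auto simp: diff_diff_eq)

lemma P_elem: "x \<in> carrier V \<Longrightarrow> y \<in> carrier W \<Longrightarrow> P k (elem x y) \<le> p k x * q k y"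
  using proj_pair[OF V.snorm W.snorm] by (auto simp: elem_tensor_def P_const)

abbreviation "\<iota> \<equiv> \<lambda>k. elem (fst k) (snd k)"

lemma fv_ext_elem: "Poly_Mapping.keys u \<subseteq> K \<Longrightarrow> fv_ext T \<iota> u = cls (\<lambda>_. u)"
proof (induction rule: fv_induct)
  case zero
  show ?case by (simp add: fv_ext_def zero_T)
next
  case (single k c)
  then obtain x y where k: "k = (x, y)" "x \<in> carrier V" "y \<in> carrier W" by auto
  have "fv_ext T \<iota> (Poly_Mapping.single k c) = c \<odot>\<^bsub>T\<^esub> \<iota> k"
    by (rule T.fv_ext_single[of K]) (use single in auto)
  then show ?case
    using k by (simp add: elem_tensor_def smult_T tensor_Cauchy_const)
next
  case (add u v)
  have "fv_ext T \<iota> (u + v) = fv_ext T \<iota> u \<oplus>\<^bsub>T\<^esub> fv_ext T \<iota> v"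
    by (rule T.fv_ext_add[of K]) (use add in auto)
  also have "\<dots> = cls (\<lambda>_. u + v)"
    using add by (simp add: add_T tensor_Cauchy_const FV_iff)
  finally show ?case .
qed

lemma generates_T: "generates T P K \<iota>"
  unfolding generates_def
proof (intro conjI ballI)
  fix x assume "x \<in> carrier T"
  then obtain s where s: "x = cls s" "s \<in> TC" by (auto simp: carrier_T)
  then have keys: "Poly_Mapping.keys (s i) \<subseteq> K" for i using Cauchy_FV[OF s(2)] by (simp add: FV_iff)
  show "\<exists>s. (\<forall>i. Poly_Mapping.keys (s i) \<subseteq> K) \<and> converges T P (\<lambda>i. fv_ext T \<iota> (s i)) x"
    using converges_const_cls[OF s(2)] keys s(1) by (intro exI[of _ s]) (simp add: fv_ext_elem)
qed auto

text \<open>Elementary tensors span a dense subspace.\<close>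

lemma tensor_eq:
  assumes "graded_frechet Z r" "f \<in> blin T P Z r" "g \<in> blin T P Z r"
    and "\<And>x y. x \<in> carrier V \<Longrightarrow> y \<in> carrier W \<Longrightarrow> f (elem x y) = g (elem x y)" "t \<in> carrier T"
  shows "f t = g t"
  by (rule generates_eq[OF generates_T graded_frechet_T assms(1-3) _ assms(5)]) (use assms(4) in auto)

end

text \<open>Jointly continuous bilinear maps. As the seminorms increase, one index \<open>k\<close> can control both arguments.\<close>

definition bbil where
  "bbil V p W q Z r \<beta> \<longleftrightarrow>
     (\<forall>x\<in>carrier V. \<forall>y\<in>carrier W. \<beta> x y \<in> carrier Z) \<and>
     (\<forall>x\<in>carrier V. \<forall>x'\<in>carrier V. \<forall>y\<in>carrier W. \<beta> (x \<oplus>\<^bsub>V\<^esub> x') y = \<beta> x y \<oplus>\<^bsub>Z\<^esub> \<beta> x' y) \<and>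
     (\<forall>x\<in>carrier V. \<forall>y\<in>carrier W. \<forall>y'\<in>carrier W. \<beta> x (y \<oplus>\<^bsub>W\<^esub> y') = \<beta> x y \<oplus>\<^bsub>Z\<^esub> \<beta> x y') \<and>
     (\<forall>c. \<forall>x\<in>carrier V. \<forall>y\<in>carrier W. \<beta> (c \<odot>\<^bsub>V\<^esub> x) y = c \<odot>\<^bsub>Z\<^esub> \<beta> x y) \<and>
     (\<forall>c. \<forall>x\<in>carrier V. \<forall>y\<in>carrier W. \<beta> x (c \<odot>\<^bsub>W\<^esub> y) = c \<odot>\<^bsub>Z\<^esub> \<beta> x y) \<and>
     (\<forall>j::nat. \<exists>k::nat. \<exists>C. \<forall>x\<in>carrier V. \<forall>y\<in>carrier W. (r j (\<beta> x y) :: real) \<le> C * (p k x * q k y))"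

context tensor_pair
begin

context
  fixes Z :: "'c lc_struct" and r \<beta>
  assumes Z: "graded_frechet Z r" and \<beta>: "bbil V p W q Z r \<beta>"
begin

interpretation Z: graded_frechet Z r by (rule Z)

lemma bilD:
  "x \<in> carrier V \<Longrightarrow> y \<in> carrier W \<Longrightarrow> \<beta> x y \<in> carrier Z"
  "x \<in> carrier V \<Longrightarrow> x' \<in> carrier V \<Longrightarrow> y \<in> carrier W \<Longrightarrow> \<beta> (x \<oplus>\<^bsub>V\<^esub> x') y = \<beta> x y \<oplus>\<^bsub>Z\<^esub> \<beta> x' y"
  "x \<in> carrier V \<Longrightarrow> y \<in> carrier W \<Longrightarrow> y' \<in> carrier W \<Longrightarrow> \<beta> x (y \<oplus>\<^bsub>W\<^esub> y') = \<beta> x y \<oplus>\<^bsub>Z\<^esub> \<beta> x y'"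
  "x \<in> carrier V \<Longrightarrow> y \<in> carrier W \<Longrightarrow> \<beta> (c \<odot>\<^bsub>V\<^esub> x) y = c \<odot>\<^bsub>Z\<^esub> \<beta> x y"
  "x \<in> carrier V \<Longrightarrow> y \<in> carrier W \<Longrightarrow> \<beta> x (c \<odot>\<^bsub>W\<^esub> y) = c \<odot>\<^bsub>Z\<^esub> \<beta> x y"
  using \<beta> by (auto simp: bbil_def)

abbreviation (input) "bb \<equiv> \<lambda>k. \<beta> (fst k) (snd k)"

lemma bb_closed: "k \<in> K \<Longrightarrow> bb k \<in> carrier Z"
  using bilD(1) by auto

lemma fvZ:
  "u \<in> FV \<Longrightarrow> v \<in> FV \<Longrightarrow> fv_ext Z bb (u + v) = fv_ext Z bb u \<oplus>\<^bsub>Z\<^esub> fv_ext Z bb v"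
  "u \<in> FV \<Longrightarrow> v \<in> FV \<Longrightarrow> fv_ext Z bb (u - v) = fv_ext Z bb u \<ominus>\<^bsub>Z\<^esub> fv_ext Z bb v"
  "u \<in> FV \<Longrightarrow> fv_ext Z bb (fv_scale c u) = c \<odot>\<^bsub>Z\<^esub> fv_ext Z bb u"
  "x \<in> carrier V \<Longrightarrow> y \<in> carrier W \<Longrightarrow> fv_ext Z bb (Poly_Mapping.single (x, y) c) = c \<odot>\<^bsub>Z\<^esub> \<beta> x y"
  "u \<in> FV \<Longrightarrow> fv_ext Z bb u \<in> carrier Z"
  using bb_closed Z.fv_ext_add[of K bb u v] Z.fv_ext_minus[of K bb u v] Z.fv_ext_scale[of K bb u c]
    Z.fv_ext_single[of K bb "(x, y)" c] Z.fv_ext_closed[of K bb u]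
  by (simp_all add: FV_iff)

text \<open>The kernel of the linear extension of \<open>\<beta>\<close> is a subspace containing the generators of the bilinearity
  relations.\<close>

lemma fv_ext_BR:
  assumes "u \<in> BR"
  shows "fv_ext Z bb u = \<zero>\<^bsub>Z\<^esub>"
proof -
  let ?N = "{u \<in> FV. fv_ext Z bb u = \<zero>\<^bsub>Z\<^esub>}"
  have sub: "module.subspace fv_scale ?N"
    unfolding module.subspace_def[OF module_fv_scale]
    by (auto simp: fvZ fv_ext_def[of _ _ 0])
  have canc: "a \<oplus>\<^bsub>Z\<^esub> b \<ominus>\<^bsub>Z\<^esub> a \<ominus>\<^bsub>Z\<^esub> b = \<zero>\<^bsub>Z\<^esub>" if "a \<in> carrier Z" "b \<in> carrier Z" for a b
    using that by (simp add: Z.plus_minus_cancel Z.minus_self)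
  have "BR \<subseteq> ?N"
    unfolding bilinear_relations_def
  proof (rule module.span_minimal[OF module_fv_scale _ sub], intro Un_least subsetI)
    fix u assume "u \<in> {fv_pair (x \<oplus>\<^bsub>V\<^esub> x') y - fv_pair x y - fv_pair x' y | x x' y.
         x \<in> carrier V \<and> x' \<in> carrier V \<and> y \<in> carrier W}"
    then show "u \<in> ?N" by (auto simp: fvZ bilD canc)
  next
    fix u assume "u \<in> {fv_pair x (y \<oplus>\<^bsub>W\<^esub> y') - fv_pair x y - fv_pair x y' | x y y'.
         x \<in> carrier V \<and> y \<in> carrier W \<and> y' \<in> carrier W}"
    then show "u \<in> ?N" by (auto simp: fvZ bilD canc)
  next
    fix u assume "u \<in> {fv_pair (c \<odot>\<^bsub>V\<^esub> x) y - fv_scale c (fv_pair x y) | c x y.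
         x \<in> carrier V \<and> y \<in> carrier W}"
    then show "u \<in> ?N" by (auto simp: fvZ bilD Z.minus_self)
  next
    fix u assume "u \<in> {fv_pair x (c \<odot>\<^bsub>W\<^esub> y) - fv_scale c (fv_pair x y) | c x y.
         x \<in> carrier V \<and> y \<in> carrier W}"
    then show "u \<in> ?N" by (auto simp: fvZ bilD Z.minus_self)
  qed
  then show ?thesis using assms by auto
qed

text \<open>The estimate holds for every representative of \<open>u\<close> modulo the relations, by the triangle inequality,
  and so for the infimum. This is where the projective seminorms are needed.\<close>

lemma fv_ext_proj_bound:
  assumes le: "\<And>x y. x \<in> carrier V \<Longrightarrow> y \<in> carrier W \<Longrightarrow> r j (\<beta> x y) \<le> C * (p k x * q k y)"
    and C: "C \<ge> 0" and u: "u \<in> FV"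
  shows "r j (fv_ext Z bb u) \<le> C * pj k u"
proof -
  have *: "r j (fv_ext Z bb u) \<le> C * wsum (wt (p k) (q k)) v" if v: "v \<in> FV" "v - u \<in> BR" for v
  proof -
    have "fv_ext Z bb v \<ominus>\<^bsub>Z\<^esub> fv_ext Z bb u = \<zero>\<^bsub>Z\<^esub>"
      using fv_ext_BR[OF v(2)] v(1) u by (simp add: fvZ)
    then have "fv_ext Z bb u = fv_ext Z bb v"
      using Z.minus_eq_zero[of "fv_ext Z bb v" "fv_ext Z bb u"] v(1) u by (simp add: fvZ)
    also have "r j (fv_ext Z bb v) \<le> wsum (\<lambda>k. r j (bb k)) v"
      by (rule Z.fv_ext_seminorm[of K]) (use v(1) bb_closed Z.snorm in \<open>auto simp: FV_iff\<close>)
    also have "\<dots> \<le> C * wsum (wt (p k) (q k)) v"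
      by (rule wsum_mono[of K]) (use le v(1) in \<open>auto simp: FV_iff\<close>)
    finally show ?thesis .
  qed
  show ?thesis
  proof (cases "C = 0")
    case True
    then show ?thesis using *[OF u] BR_closed(1) by simp
  next
    case False
    then have "r j (fv_ext Z bb u) / C \<le> pj k u"
      using * C by (intro proj_greatest[OF V.snorm W.snorm u]) (simp add: field_simps)
    then show ?thesis using False C by (simp add: field_simps)
  qed
qed

lemma tensor_lift_exists: "\<exists>f\<in>cont_linear T Z. \<forall>x\<in>carrier V. \<forall>y\<in>carrier W. f (elem x y) = \<beta> x y"
proof -
  have "\<exists>f\<in>cont_linear T Z. \<forall>k\<in>K. f (\<iota> k) = bb k"
  proof (rule generates_extend[OF generates_T graded_frechet_T Z bb_closed])
    fix j
    obtain k C where le: "\<And>x y. x \<in> carrier V \<Longrightarrow> y \<in> carrier W \<Longrightarrow> r j (\<beta> x y) \<le> C * (p k x * q k y)"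
      using \<beta> unfolding bbil_def by meson
    have "r j (fv_ext Z bb u) \<le> \<bar>C\<bar> * P k (fv_ext T \<iota> u)" if u: "Poly_Mapping.keys u \<subseteq> K" for u
    proof -
      have "r j (\<beta> x y) \<le> \<bar>C\<bar> * (p k x * q k y)" if "x \<in> carrier V" "y \<in> carrier W" for x y
        by (rule order_trans[OF le[OF that]], rule mult_right_mono) (use that in auto)
      from fv_ext_proj_bound[OF this _ u[folded FV_iff]] show ?thesis
        using u by (simp add: fv_ext_elem P_const FV_iff)
    qed
    then show "\<exists>k C. \<forall>u. Poly_Mapping.keys u \<subseteq> K \<longrightarrow> r j (fv_ext Z bb u) \<le> C * P k (fv_ext T \<iota> u)"
      by blast
  qed auto
  then show ?thesis by fastforce
qed

lemma tensor_lift_ex1: "\<exists>!f. f \<in> cont_linear T Z \<and> (\<forall>x\<in>carrier V. \<forall>y\<in>carrier W. f (elem x y) = \<beta> x y)"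
proof (rule ex_ex1I)
  show "\<exists>f. f \<in> cont_linear T Z \<and> (\<forall>x\<in>carrier V. \<forall>y\<in>carrier W. f (elem x y) = \<beta> x y)"
    using tensor_lift_exists by blast
  fix f g assume f: "f \<in> cont_linear T Z \<and> (\<forall>x\<in>carrier V. \<forall>y\<in>carrier W. f (elem x y) = \<beta> x y)"
    and g: "g \<in> cont_linear T Z \<and> (\<forall>x\<in>carrier V. \<forall>y\<in>carrier W. g (elem x y) = \<beta> x y)"
  have "f t = g t" if "t \<in> carrier T" for t
    by (rule tensor_eq[OF Z _ _ _ that])
      (use f g cont_linear_blin[OF _ graded_frechet_T Z] in auto)
  then show "f = g" using f g by (intro cont_linear_eqI[of f T Z g]) auto
qed

lemma tensor_lift_cont: "tensor_lift V W Z \<beta> \<in> cont_linear T Z"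
  and tensor_lift_elem:
    "x \<in> carrier V \<Longrightarrow> y \<in> carrier W \<Longrightarrow> tensor_lift V W Z \<beta> (elem x y) = \<beta> x y"
  using theI'[OF tensor_lift_ex1] by (auto simp: tensor_lift_def)

lemma tensor_lift_blin: "tensor_lift V W Z \<beta> \<in> blin T P Z r"
  by (rule cont_linear_blin[OF tensor_lift_cont graded_frechet_T Z])

lemma tensor_lift_bound:
  assumes le: "\<And>x y. x \<in> carrier V \<Longrightarrow> y \<in> carrier W \<Longrightarrow> r j (\<beta> x y) \<le> C * (p k x * q k y)"
    and C: "C \<ge> 0" and t: "t \<in> carrier T"
  shows "r j (tensor_lift V W Z \<beta> t) \<le> C * P k t"
proof (rule generates_bound[OF generates_T graded_frechet_T Z tensor_lift_blin _ t])
  fix u :: "('a \<times> 'b) \<Rightarrow>\<^sub>0 complex" assume u: "Poly_Mapping.keys u \<subseteq> K"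
  have "fv_ext Z (\<lambda>k. tensor_lift V W Z \<beta> (\<iota> k)) u = fv_ext Z bb u"
    unfolding fv_ext_def
    by (rule Z.finsum_cong') (use u tensor_lift_elem bilD(1) in \<open>auto simp: subset_iff\<close>)
  then show "r j (fv_ext Z (\<lambda>k. tensor_lift V W Z \<beta> (\<iota> k)) u) \<le> C * P k (fv_ext T \<iota> u)"
    using fv_ext_proj_bound[OF le C u[folded FV_iff]] u by (simp add: fv_ext_elem P_const FV_iff)
qed

end

end

section \<open>Graded Arens--Michael algebras\<close>

text \<open>The seminorm of the unit is not normalized: it may vanish in a quotient and exceed 1 elsewhere.
  Powers are therefore bounded by \<open>p k 1 * p k x ^ n\<close>.\<close>

locale graded_algebra = graded_frechet A p + ring A for A :: "'a lc_struct" (structure) and p +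
  assumes sm_mult_left: "x \<in> carrier A \<Longrightarrow> y \<in> carrier A \<Longrightarrow> (c \<odot> x) \<otimes> y = c \<odot> (x \<otimes> y)"
    and sm_mult_right: "x \<in> carrier A \<Longrightarrow> y \<in> carrier A \<Longrightarrow> x \<otimes> (c \<odot> y) = c \<odot> (x \<otimes> y)"
    and submult: "x \<in> carrier A \<Longrightarrow> y \<in> carrier A \<Longrightarrow> p k (x \<otimes> y) \<le> p k x * p k y"
begin

lemma frechet: "graded_frechet A p" ..

lemma ring: "ring A" ..

lemma mul_closed [simp, intro]: "x \<in> carrier A \<Longrightarrow> y \<in> carrier A \<Longrightarrow> x \<otimes> y \<in> carrier A"
  by (rule monoid.m_closed[OF ring.is_monoid[OF ring]])

lemma mul_assoc:
  "x \<in> carrier A \<Longrightarrow> y \<in> carrier A \<Longrightarrow> z \<in> carrier A \<Longrightarrow> (x \<otimes> y) \<otimes> z = x \<otimes> (y \<otimes> z)"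
  by (rule monoid.m_assoc[OF ring.is_monoid[OF ring]])

lemma unit_closed [simp, intro]: "\<one> \<in> carrier A"
  by (rule monoid.one_closed[OF ring.is_monoid[OF ring]])

lemma mul_unit [simp]: "x \<in> carrier A \<Longrightarrow> \<one> \<otimes> x = x" "x \<in> carrier A \<Longrightarrow> x \<otimes> \<one> = x"
  by (rule monoid.l_one[OF ring.is_monoid[OF ring]] monoid.r_one[OF ring.is_monoid[OF ring]]; assumption)+

lemma mul_distr:
  "x \<in> carrier A \<Longrightarrow> y \<in> carrier A \<Longrightarrow> z \<in> carrier A \<Longrightarrow> (x \<oplus> y) \<otimes> z = x \<otimes> z \<oplus> y \<otimes> z"
  "x \<in> carrier A \<Longrightarrow> y \<in> carrier A \<Longrightarrow> z \<in> carrier A \<Longrightarrow> z \<otimes> (x \<oplus> y) = z \<otimes> x \<oplus> z \<otimes> y"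
  by (rule ring.ring_simprules(13,23)[OF ring]; assumption)+

lemma complex_algebra: "complex_algebra A"
  using space ring sm_mult_left sm_mult_right by (simp add: complex_algebra_def)

lemma frechet_arens_michael: "frechet_arens_michael A"
  unfolding frechet_arens_michael_def
  using complex_algebra frechet_space snorm submult topol_eq
  by (intro conjI exI[of _ "range p"]) (auto simp: submultiplicative_def)

lemma mult_blin_left: "a \<in> carrier A \<Longrightarrow> (\<lambda>x. a \<otimes> x) \<in> blin A p A p"
proof (rule blinI)
  assume a: "a \<in> carrier A"
  show "\<exists>k C. \<forall>x\<in>carrier A. p j (a \<otimes> x) \<le> C * p k x" for j
    using submult[OF a, of _ j] by (intro exI[of _ j] exI[of _ "p j a"]) auto
qed (auto simp: mul_distr sm_mult_right)

lemma mult_blin_right: "a \<in> carrier A \<Longrightarrow> (\<lambda>x. x \<otimes> a) \<in> blin A p A p"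
proof (rule blinI)
  assume a: "a \<in> carrier A"
  show "\<exists>k C. \<forall>x\<in>carrier A. p j (x \<otimes> a) \<le> C * p k x" for j
    using submult[OF _ a, of _ j] by (intro exI[of _ j] exI[of _ "p j a"]) (auto simp: mult.commute)
qed (auto simp: mul_distr sm_mult_left)

lemma mul_minus_minus:
  assumes "x \<in> carrier A" "y \<in> carrier A" "x' \<in> carrier A" "y' \<in> carrier A"
  shows "x' \<otimes> y' \<ominus> x \<otimes> y = (x' \<ominus> x) \<otimes> (y' \<ominus> y) \<oplus> (x' \<ominus> x) \<otimes> y \<oplus> x \<otimes> (y' \<ominus> y)"
proof -
  have "x' \<otimes> y' = ((x' \<ominus> x) \<oplus> x) \<otimes> ((y' \<ominus> y) \<oplus> y)" using assms by (simp add: minus_plus_cancel)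
  also have "\<dots> = x \<otimes> y \<oplus> ((x' \<ominus> x) \<otimes> (y' \<ominus> y) \<oplus> (x' \<ominus> x) \<otimes> y \<oplus> x \<otimes> (y' \<ominus> y))"
    using assms by (simp add: mul_distr M.a_ac)
  finally show ?thesis using assms by (simp add: plus_minus_cancel)
qed

lemma p_mul_minus:
  assumes "x \<in> carrier A" "y \<in> carrier A" "x' \<in> carrier A" "y' \<in> carrier A"
  shows "p k (x' \<otimes> y' \<ominus> x \<otimes> y) \<le>
    p k (x' \<ominus> x) * p k (y' \<ominus> y) + p k (x' \<ominus> x) * p k y + p k x * p k (y' \<ominus> y)"
  unfolding mul_minus_minus[OF assms]
  using assms by (intro order_trans[OF p_add] add_mono submult) auto

lemma converges_mult:
  assumes "converges A p s x" "converges A p t y"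
  shows "converges A p (\<lambda>i. s i \<otimes> t i) (x \<otimes> y)"
proof (rule converges_bound)
  note c = convergesD[OF assms(1)] convergesD[OF assms(2)]
  fix k i
  show "p k (s i \<otimes> t i \<ominus> x \<otimes> y) \<le>
    p k (s i \<ominus> x) * p k (t i \<ominus> y) + p k (s i \<ominus> x) * p k y + p k x * p k (t i \<ominus> y)"
    by (rule p_mul_minus) (use c in auto)
  have "(\<lambda>i. p k (s i \<ominus> x)) \<longlonglongrightarrow> 0" "(\<lambda>i. p k (t i \<ominus> y)) \<longlonglongrightarrow> 0" using assms by (auto simp: converges_def)
  then have "(\<lambda>i. p k (s i \<ominus> x) * p k (t i \<ominus> y) + p k (s i \<ominus> x) * p k y + p k x * p k (t i \<ominus> y))
    \<longlonglongrightarrow> 0 * 0 + 0 * p k y + p k x * 0"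
    by (intro tendsto_intros)
  then show "(\<lambda>i. p k (s i \<ominus> x) * p k (t i \<ominus> y) + p k (s i \<ominus> x) * p k y + p k x * p k (t i \<ominus> y)) \<longlonglongrightarrow> 0"
    by simp
qed (use convergesD[OF assms(1)] convergesD[OF assms(2)] in auto)

text \<open>Joint continuity at \<open>(x, y)\<close> from
  \<open>x' y' - x y = (x' - x) (y' - y) + (x' - x) y + x (y' - y)\<close>.\<close>

lemma ctensor_algebra: "ctensor_algebra A"
proof -
  have "continuous_map (prod_topology (topol A) (topol A)) (topol A) (\<lambda>(x, y). x \<otimes> y)"
    unfolding continuous_map_def
  proof (intro conjI allI impI)
    fix U assume "openin (topol A) U"
    then have U: "graded_open A p U" by (simp add: openin_iff)
    let ?N = "\<lambda>k e x. {y \<in> carrier A. p k (y \<ominus> x) < e}"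
    have openN: "openin (topol A) (?N k e x)" if x: "x \<in> carrier A" for k e x
      unfolding openin_iff graded_open_def
    proof (intro conjI ballI)
      fix y assume y: "y \<in> ?N k e x"
      have "p k (z \<ominus> x) < e" if "z \<in> carrier A" "p k (z \<ominus> y) < e - p k (y \<ominus> x)" for z
        using p_triangle[of z y x k] that x y by auto
      then show "\<exists>k' e'. e' > 0 \<and> ?N k' e' y \<subseteq> ?N k e x"
        using y by (intro exI[of _ k] exI[of _ "e - p k (y \<ominus> x)"]) auto
    qed auto
    show "openin (prod_topology (topol A) (topol A))
        {z \<in> topspace (prod_topology (topol A) (topol A)). (case z of (x, y) \<Rightarrow> x \<otimes> y) \<in> U}"
      unfolding openin_prod_topology_alt
    proof (intro allI impI)
      fix x y assume "(x, y) \<in> {z \<in> topspace (prod_topology (topol A) (topol A)). (case z of (x, y) \<Rightarrow> x \<otimes> y) \<in> U}"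
      then have xy: "x \<in> carrier A" "y \<in> carrier A" "x \<otimes> y \<in> U" by auto
      then obtain k e where e: "e > 0" "?N k e (x \<otimes> y) \<subseteq> U" using U unfolding graded_open_def by blast
      define M where "M = 1 + p k x + p k y"
      have M: "M > 0" "M \<ge> 1" using nonneg[OF xy(1), of k] nonneg[OF xy(2), of k] unfolding M_def by linarith+
      define d where "d = min 1 (e / (2 * M))"
      have d: "d > 0" "d \<le> 1" "d * (2 * M) \<le> e"
        using M e by (auto simp: d_def min_def field_simps)
      have "x' \<otimes> y' \<in> U" if x': "x' \<in> ?N k d x" and y': "y' \<in> ?N k d y" for x' y'
      proof -
        have c: "x' \<in> carrier A" "y' \<in> carrier A" "p k (x' \<ominus> x) < d" "p k (y' \<ominus> y) < d" using x' y' by auto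
        have "p k (x' \<otimes> y' \<ominus> x \<otimes> y) \<le>
            p k (x' \<ominus> x) * p k (y' \<ominus> y) + p k (x' \<ominus> x) * p k y + p k x * p k (y' \<ominus> y)"
          by (rule p_mul_minus) (use xy c in auto)
        also have "\<dots> \<le> d * 1 + d * p k y + p k x * d"
          using c d xy by (intro add_mono mult_mono) auto
        also have "\<dots> = d * M" by (simp add: M_def algebra_simps)
        also have "\<dots> < d * (2 * M)" using d M by simp
        also have "\<dots> \<le> e" by (rule d(3))
        finally show ?thesis using e(2) c by blast
      qed
      then show "\<exists>S R. openin (topol A) S \<and> openin (topol A) R \<and> x \<in> S \<and> y \<in> R \<and>
          S \<times> R \<subseteq> {z \<in> topspace (prod_topology (topol A) (topol A)). (case z of (x, y) \<Rightarrow> x \<otimes> y) \<in> U}"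
        using openN[OF xy(1), of k d] openN[OF xy(2), of k d] xy d(1)
        by (intro exI[of _ "?N k d x"] exI[of _ "?N k d y"]) (auto simp: minus_self)
    qed
  qed auto
  then show ?thesis using complex_algebra frechet_space by (simp add: ctensor_algebra_def)
qed

end

lemma graded_algebra_complex: "graded_algebra complex_alg (\<lambda>k. cmod)"
  unfolding graded_algebra_def graded_algebra_axioms_def
  using graded_frechet_complex cring.axioms(1)[OF cring_complex_alg] by (auto simp: norm_mult)

text \<open>The structure of a locally convex space does not depend on the multiplication and the unit in the
  record. The following rules make it possible to treat a tensor product of algebras and the opposite
  algebra as the underlying spaces.\<close>

lemma update_mult_simps [simp]:
  fixes V :: "'a lc_struct" and W :: "'b lc_struct"
  shows "a_inv (V\<lparr>mult := m, one := e\<rparr>) = a_inv V"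
    and "a_minus (V\<lparr>mult := m, one := e\<rparr>) = a_minus V"
    and "seminorm (V\<lparr>mult := m, one := e\<rparr>) = seminorm V"
    and "converges (V\<lparr>mult := m, one := e\<rparr>) = converges V"
    and "Cauchy_in (V\<lparr>mult := m, one := e\<rparr>) = Cauchy_in V"
    and "cont_linear (V\<lparr>mult := m, one := e\<rparr>) W = cont_linear V W"
    and "cont_linear W (V\<lparr>mult := m, one := e\<rparr>) = cont_linear W V"
    and "blin (V\<lparr>mult := m, one := e\<rparr>) = blin V"
    and "blin W p (V\<lparr>mult := m, one := e\<rparr>) = blin W p V"
    and "seminorm_topology (V\<lparr>mult := m, one := e\<rparr>) = seminorm_topology V"
    and "topol (V\<lparr>mult := m, one := e\<rparr>) = topol V"
    and "cont_seminorms (V\<lparr>mult := m, one := e\<rparr>) = cont_seminorms V"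
    and "fv_carrier (V\<lparr>mult := m, one := e\<rparr>) W = fv_carrier V W"
    and "fv_carrier W (V\<lparr>mult := m, one := e\<rparr>) = fv_carrier W V"
    and "bilinear_relations (V\<lparr>mult := m, one := e\<rparr>) W = bilinear_relations V W"
    and "bilinear_relations W (V\<lparr>mult := m, one := e\<rparr>) = bilinear_relations W V"
  by (simp_all add: fun_eq_iff a_inv_def m_inv_def a_minus_def seminorm_def converges_def Cauchy_in_def
      cont_linear_def blin_def seminorm_topology_def cont_seminorms_def fv_carrier_def bilinear_relations_def)

lemma update_mult_simps_tensor [simp]:
  fixes V :: "'a lc_struct" and W :: "'b lc_struct"
  shows "proj_seminorm (V\<lparr>mult := m, one := e\<rparr>) W = proj_seminorm V W"
    and "proj_seminorm W (V\<lparr>mult := m, one := e\<rparr>) = proj_seminorm W V"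
    and "tensor_Cauchy (V\<lparr>mult := m, one := e\<rparr>) W = tensor_Cauchy V W"
    and "tensor_Cauchy W (V\<lparr>mult := m, one := e\<rparr>) = tensor_Cauchy W V"
    and "tensor_null_rel (V\<lparr>mult := m, one := e\<rparr>) W = tensor_null_rel V W"
    and "tensor_null_rel W (V\<lparr>mult := m, one := e\<rparr>) = tensor_null_rel W V"
    and "tensor_class (V\<lparr>mult := m, one := e\<rparr>) W = tensor_class V W"
    and "tensor_class W (V\<lparr>mult := m, one := e\<rparr>) = tensor_class W V"
    and "tensor_seminorm (V\<lparr>mult := m, one := e\<rparr>) W = tensor_seminorm V W"
    and "tensor_seminorm W (V\<lparr>mult := m, one := e\<rparr>) = tensor_seminorm W V"
    and "tensor_space (V\<lparr>mult := m, one := e\<rparr>) W = tensor_space V W"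
    and "tensor_space W (V\<lparr>mult := m, one := e\<rparr>) = tensor_space W V"
    and "elem_tensor (V\<lparr>mult := m, one := e\<rparr>) W = elem_tensor V W"
    and "elem_tensor W (V\<lparr>mult := m, one := e\<rparr>) = elem_tensor W V"
  by (simp_all add: fun_eq_iff proj_seminorm_def tensor_Cauchy_def tensor_null_rel_def tensor_class_def
      tensor_seminorm_def tensor_space_def elem_tensor_def)

lemma update_mult_simps_lift [simp]:
  fixes V :: "'a lc_struct" and W :: "'b lc_struct" and Z :: "'c lc_struct"
  shows "tensor_lift (V\<lparr>mult := m, one := e\<rparr>) W Z = tensor_lift V W Z"
    and "tensor_lift W (V\<lparr>mult := m, one := e\<rparr>) Z = tensor_lift W V Z"
    and "tensor_lift W Z (V\<lparr>mult := m, one := e\<rparr>) = tensor_lift W Z V"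
  by (simp_all add: fun_eq_iff tensor_lift_def)

lemma abelian_group_upd: "abelian_group V \<Longrightarrow> abelian_group (V\<lparr>mult := m, one := e\<rparr>)"
  by (simp add: abelian_group_def abelian_monoid_def abelian_group_axioms_def)

lemma graded_frechet_upd:
  fixes V :: "'a lc_struct"
  assumes "graded_frechet V p"
  shows "graded_frechet (V\<lparr>mult := m, one := e\<rparr>) p"
proof -
  interpret graded_frechet V p by fact
  have "complex_space (V\<lparr>mult := m, one := e\<rparr>)"
    by (rule complex_spaceI) (auto simp: sm_ladd sm_radd intro: abelian_group_upd[OF M.abelian_group_axioms])
  then show ?thesis
    unfolding graded_frechet_def cvs_def graded_frechet_axioms_def
    using snorm incr topol_eq separated complete by simp
qed

text \<open>Antihomomorphisms are homomorphisms into the opposite algebra, so that the universal property of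
  \<open>U\<close> also yields the antipode.\<close>

definition opposite :: "'a lc_struct \<Rightarrow> 'a lc_struct" where
  "opposite A = A\<lparr>mult := (\<lambda>x y. y \<otimes>\<^bsub>A\<^esub> x), one := \<one>\<^bsub>A\<^esub>\<rparr>"

lemma opposite_simps [simp]:
  "carrier (opposite A) = carrier A" "add (opposite A) = add A" "zero (opposite A) = zero A"
  "smult (opposite A) = smult A" "mult (opposite A) = (\<lambda>x y. y \<otimes>\<^bsub>A\<^esub> x)" "one (opposite A) = one A"
  "topol (opposite A) = topol A"
  by (simp_all add: opposite_def)

lemma opposite_simps2 [simp]:
  "a_minus (opposite A) = a_minus A" "converges (opposite A) = converges A"
  "cont_linear W (opposite A) = cont_linear W A"
  unfolding opposite_def by (simp_all only: update_mult_simps)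

lemma graded_algebra_opposite:
  assumes "graded_algebra A p"
  shows "graded_algebra (opposite A) p"
proof -
  interpret graded_algebra A p by fact
  interpret B: graded_frechet "opposite A" p
    unfolding opposite_def by (rule graded_frechet_upd[OF frechet])
  have "ring (opposite A)"
    by (rule ringI) (auto simp: mul_assoc mul_distr intro!: monoidI B.M.abelian_group_axioms)
  moreover have "p k (y \<otimes>\<^bsub>A\<^esub> x) \<le> p k x * p k y" if "x \<in> carrier A" "y \<in> carrier A" for k x y
    using submult[of y x k] that by (simp add: mult.commute)
  ultimately show ?thesis
    unfolding graded_algebra_def graded_algebra_axioms_def
    using sm_mult_left sm_mult_right B.graded_frechet_axioms by auto
qed

section \<open>Homomorphisms\<close>

definition alg_hom ::
    "'a lc_struct \<Rightarrow> (nat \<Rightarrow> 'a \<Rightarrow> real) \<Rightarrow> 'b lc_struct \<Rightarrow> (nat \<Rightarrow> 'b \<Rightarrow> real) \<Rightarrow> ('a \<Rightarrow> 'b) set" where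
  "alg_hom A p B q = {f \<in> blin A p B q.
     (\<forall>x\<in>carrier A. \<forall>y\<in>carrier A. f (x \<otimes>\<^bsub>A\<^esub> y) = f x \<otimes>\<^bsub>B\<^esub> f y) \<and> f \<one>\<^bsub>A\<^esub> = \<one>\<^bsub>B\<^esub>}"

lemma alg_homD:
  assumes "f \<in> alg_hom A p B q"
  shows "f \<in> blin A p B q" "x \<in> carrier A \<Longrightarrow> y \<in> carrier A \<Longrightarrow> f (x \<otimes>\<^bsub>A\<^esub> y) = f x \<otimes>\<^bsub>B\<^esub> f y"
    "f \<one>\<^bsub>A\<^esub> = \<one>\<^bsub>B\<^esub>" "x \<in> carrier A \<Longrightarrow> f x \<in> carrier B"
  using assms blinD(1) by (auto simp: alg_hom_def)

lemma cont_alg_hom_iff: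
  assumes "graded_frechet A p" "graded_frechet B q"
  shows "f \<in> cont_alg_hom A B \<longleftrightarrow> f \<in> alg_hom A p B q \<and> f \<in> extensional (carrier A)"
proof
  assume "f \<in> cont_alg_hom A B"
  then show "f \<in> alg_hom A p B q \<and> f \<in> extensional (carrier A)"
    using cont_linear_blin[OF _ assms]
    by (auto simp: cont_alg_hom_def alg_hom_def ring_hom_def cont_linear_def PiE_def)
next
  assume "f \<in> alg_hom A p B q \<and> f \<in> extensional (carrier A)"
  then show "f \<in> cont_alg_hom A B"
    using cont_linearI[OF _ _ assms] blinD[of f A p B q]
    by (auto simp: cont_alg_hom_def alg_hom_def ring_hom_def)
qed

lemma alg_hom_restrict:
  assumes "graded_algebra A p" "graded_algebra B q" "f \<in> alg_hom A p B q"
  shows "restrict f (carrier A) \<in> cont_alg_hom A B"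
proof -
  interpret A: graded_algebra A p by fact
  interpret B: graded_algebra B q by fact
  have "restrict f (carrier A) \<in> blin A p B q"
    by (rule blin_cong[OF alg_homD(1)[OF assms(3)] _ A.frechet]) auto
  then show ?thesis
    using assms(3) by (auto simp: cont_alg_hom_iff[OF A.frechet B.frechet] alg_hom_def)
qed

lemma cont_alg_antihom_iff:
  assumes "graded_algebra A p" "graded_algebra B q"
  shows "f \<in> cont_alg_antihom A B \<longleftrightarrow> f \<in> cont_alg_hom A (opposite B)"
  by (auto simp: cont_alg_antihom_def cont_alg_hom_def ring_hom_def cont_linear_def)

lemma alg_hom_comp:
  assumes "f \<in> alg_hom A p B q" "g \<in> alg_hom B q C r" "graded_frechet B q"
  shows "(\<lambda>x. g (f x)) \<in> alg_hom A p C r"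
  using assms blin_comp[OF alg_homD(1)[OF assms(1)] alg_homD(1)[OF assms(2)] assms(3)]
    alg_homD(4)[OF assms(1)]
  by (auto simp: alg_hom_def)

lemma alg_hom_id: "graded_frechet A p \<Longrightarrow> (\<lambda>x. x) \<in> alg_hom A p A p"
  by (simp add: alg_hom_def blin_id)

lemma bbil_elem_comp:
  assumes "graded_frechet V p" "graded_frechet W q" "graded_frechet V' p'" "graded_frechet W' q'"
    and f: "f \<in> blin V p V' p'" and g: "g \<in> blin W q W' q'"
  shows "bbil V p W q (tensor_space V' W') (\<lambda>k. tensor_seminorm V' W' (p' k) (q' k))
    (\<lambda>x y. elem_tensor V' W' (f x) (g y))"
proof -
  interpret V: graded_frechet V p by fact
  interpret W: graded_frechet W q by fact
  interpret T: tensor_pair V' p' W' q' using assms by (simp add: tensor_pair_def)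
  note f' = blinD[OF f] and g' = blinD[OF g]
  have "\<exists>k C. \<forall>x\<in>carrier V. \<forall>y\<in>carrier W. T.P j (T.elem (f x) (g y)) \<le> C * (p k x * q k y)" for j
  proof -
    obtain k C where C: "C > 0" "\<And>x. x \<in> carrier V \<Longrightarrow> p' j (f x) \<le> C * p k x"
      using blin_bound[OF f assms(1), of j] by blast
    obtain l D where D: "D > 0" "\<And>x. x \<in> carrier W \<Longrightarrow> q' j (g x) \<le> D * q l x"
      using blin_bound[OF g assms(2), of j] by blast
    let ?m = "max k l"
    have "T.P j (T.elem (f x) (g y)) \<le> (C * D) * (p ?m x * q ?m y)"
      if xy: "x \<in> carrier V" "y \<in> carrier W" for x y
    proof -
      have "T.P j (T.elem (f x) (g y)) \<le> p' j (f x) * q' j (g y)"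
        using xy f' g' by (intro T.P_elem) auto
      also have "\<dots> \<le> (C * p ?m x) * (D * q ?m y)"
      proof (rule mult_mono)
        show "p' j (f x) \<le> C * p ?m x"
          by (rule order_trans[OF C(2)[OF xy(1)]], rule mult_left_mono) (use C V.p_mono xy in auto)
        show "q' j (g y) \<le> D * q ?m y"
          by (rule order_trans[OF D(2)[OF xy(2)]], rule mult_left_mono) (use D W.p_mono xy in auto)
      qed (use C xy f' g' in auto)
      finally show ?thesis by (simp add: mult_ac)
    qed
    then show ?thesis by blast
  qed
  then show ?thesis
    unfolding bbil_def using f' g'
    by (auto simp: T.elem_add_left T.elem_add_right T.elem_scale_left T.elem_scale_right)
qed

section \<open>The tensor product of algebras\<close>

locale tensor_alg_pair = A: graded_algebra A p + B: graded_algebra B q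
  for A :: "'a lc_struct" and p and B :: "'b lc_struct" and q
begin

sublocale tensor_pair A p B q
  by (simp add: tensor_pair_def A.frechet B.frechet)

abbreviation "TA \<equiv> tensor_alg A B"

text \<open>Left multiplication by \<open>a \<otimes> b\<close>; the product of general tensors is obtained from it by extending
  linearly in \<open>a \<otimes> b\<close>.\<close>

definition "L a b = tensor_lift A B T (\<lambda>c d. elem (a \<otimes>\<^bsub>A\<^esub> c) (b \<otimes>\<^bsub>B\<^esub> d))"

lemma L_bbil:
  "a \<in> carrier A \<Longrightarrow> b \<in> carrier B \<Longrightarrow> bbil A p B q T P (\<lambda>c d. elem (a \<otimes>\<^bsub>A\<^esub> c) (b \<otimes>\<^bsub>B\<^esub> d))"
  by (rule bbil_elem_comp[OF A.frechet B.frechet A.frechet B.frechet A.mult_blin_left B.mult_blin_left])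

lemma L_blin: "a \<in> carrier A \<Longrightarrow> b \<in> carrier B \<Longrightarrow> L a b \<in> blin T P T P"
  unfolding L_def by (rule tensor_lift_blin[OF graded_frechet_T L_bbil])

lemma L_elem:
  "a \<in> carrier A \<Longrightarrow> b \<in> carrier B \<Longrightarrow> c \<in> carrier A \<Longrightarrow> d \<in> carrier B \<Longrightarrow>
    L a b (elem c d) = elem (a \<otimes>\<^bsub>A\<^esub> c) (b \<otimes>\<^bsub>B\<^esub> d)"
  unfolding L_def by (rule tensor_lift_elem[OF graded_frechet_T L_bbil])

lemma L_bound:
  assumes ab: "a \<in> carrier A" "b \<in> carrier B" and t: "t \<in> carrier T"
  shows "P k (L a b t) \<le> P k t * (p k a * q k b)"
proof -
  have "P k (L a b t) \<le> (p k a * q k b) * P k t"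
    unfolding L_def
  proof (rule tensor_lift_bound[OF graded_frechet_T L_bbil[OF ab] _ _ t])
    fix c d assume cd: "c \<in> carrier A" "d \<in> carrier B"
    have "P k (elem (a \<otimes>\<^bsub>A\<^esub> c) (b \<otimes>\<^bsub>B\<^esub> d)) \<le> p k (a \<otimes>\<^bsub>A\<^esub> c) * q k (b \<otimes>\<^bsub>B\<^esub> d)"
      using ab cd by (intro P_elem) auto
    also have "\<dots> \<le> (p k a * p k c) * (q k b * q k d)"
      using ab cd by (intro mult_mono A.submult B.submult) auto
    finally show "P k (elem (a \<otimes>\<^bsub>A\<^esub> c) (b \<otimes>\<^bsub>B\<^esub> d)) \<le> p k a * q k b * (p k c * q k d)"
      by (simp add: mult_ac)
  qed (use ab in auto)
  then show ?thesis by (simp add: mult.commute)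
qed

lemma L_bbil_factors:
  assumes t: "t \<in> carrier T"
  shows "bbil A p B q T P (\<lambda>a b. L a b t)"
proof -
  note eq = tensor_eq[OF graded_frechet_T _ _ _ t]
  note bl = L_blin blin_add[OF _ _ graded_frechet_T graded_frechet_T] blin_sm[OF _ graded_frechet_T]
  show ?thesis
    unfolding bbil_def
  proof (intro conjI allI ballI)
    fix a a' b assume *: "a \<in> carrier A" "a' \<in> carrier A" "b \<in> carrier B"
    show "L (a \<oplus>\<^bsub>A\<^esub> a') b t = L a b t \<oplus>\<^bsub>T\<^esub> L a' b t"
      by (rule eq) (use * in \<open>auto simp: L_elem A.mul_distr elem_add_left intro!: bl\<close>)
  next
    fix a b b' assume *: "a \<in> carrier A" "b \<in> carrier B" "b' \<in> carrier B"
    show "L a (b \<oplus>\<^bsub>B\<^esub> b') t = L a b t \<oplus>\<^bsub>T\<^esub> L a b' t"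
      by (rule eq) (use * in \<open>auto simp: L_elem B.mul_distr elem_add_right intro!: bl\<close>)
  next
    fix c a b assume *: "a \<in> carrier A" "b \<in> carrier B"
    show "L (c \<odot>\<^bsub>A\<^esub> a) b t = c \<odot>\<^bsub>T\<^esub> L a b t"
      by (rule eq) (use * in \<open>auto simp: L_elem A.sm_mult_left elem_scale_left intro!: bl\<close>)
    show "L a (c \<odot>\<^bsub>B\<^esub> b) t = c \<odot>\<^bsub>T\<^esub> L a b t"
      by (rule eq) (use * in \<open>auto simp: L_elem B.sm_mult_left elem_scale_right intro!: bl\<close>)
  next
    show "\<exists>k C. \<forall>a\<in>carrier A. \<forall>b\<in>carrier B. P j (L a b t) \<le> C * (p k a * q k b)" for j
      by (intro exI[of _ j] exI[of _ "P j t"] ballI L_bound t)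
  next
    fix a b assume "a \<in> carrier A" "b \<in> carrier B"
    then show "L a b t \<in> carrier T" using blinD(1)[OF L_blin t] by blast
  qed
qed

lemma TA_mult: "u \<otimes>\<^bsub>TA\<^esub> v = tensor_lift A B T (\<lambda>a b. L a b v) u"
  by (simp add: tensor_alg_def L_def)

lemma TA_simps [simp]:
  "carrier TA = carrier T" "add TA = add T" "zero TA = zero T" "smult TA = smult T"
  "one TA = elem \<one>\<^bsub>A\<^esub> \<one>\<^bsub>B\<^esub>" "blin TA = blin T" "cont_linear TA Z = cont_linear T Z"
  "tensor_space TA Y = tensor_space T Y" "tensor_space Y TA = tensor_space Y T"
  "elem_tensor TA Y = elem_tensor T Y" "elem_tensor Y TA = elem_tensor Y T"
  "tensor_seminorm TA Y = tensor_seminorm T Y" "tensor_seminorm Y TA = tensor_seminorm Y T"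
  "converges TA = converges T"
  by (simp_all add: tensor_alg_def)

lemma TA_simps2 [simp]:
  "blin Y r TA = blin Y r T" "cont_linear Y TA = cont_linear Y T" "a_minus TA = a_minus T"
  "tensor_lift TA X Z = tensor_lift T X Z" "tensor_lift X TA Z = tensor_lift X T Z"
  "tensor_lift X Z TA = tensor_lift X Z T"
  by (simp_all add: tensor_alg_def)

lemma TA_elem:
  "a \<in> carrier A \<Longrightarrow> b \<in> carrier B \<Longrightarrow> t \<in> carrier T \<Longrightarrow> elem a b \<otimes>\<^bsub>TA\<^esub> t = L a b t"
  unfolding TA_mult by (rule tensor_lift_elem[OF graded_frechet_T L_bbil_factors])

lemma TA_elem_elem:
  "a \<in> carrier A \<Longrightarrow> b \<in> carrier B \<Longrightarrow> c \<in> carrier A \<Longrightarrow> d \<in> carrier B \<Longrightarrow>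
    elem a b \<otimes>\<^bsub>TA\<^esub> elem c d = elem (a \<otimes>\<^bsub>A\<^esub> c) (b \<otimes>\<^bsub>B\<^esub> d)"
  by (simp add: TA_elem L_elem)

lemma TA_blin_right: "v \<in> carrier T \<Longrightarrow> (\<lambda>u. u \<otimes>\<^bsub>TA\<^esub> v) \<in> blin T P T P"
  unfolding TA_mult by (rule tensor_lift_blin[OF graded_frechet_T L_bbil_factors])

lemma TA_closed: "u \<in> carrier T \<Longrightarrow> v \<in> carrier T \<Longrightarrow> u \<otimes>\<^bsub>TA\<^esub> v \<in> carrier T"
  using blinD(1)[OF TA_blin_right] .

text \<open>Two applications of the estimate for lifted bilinear maps, with the constants \<open>p k a * q k b\<close> and
  \<open>P k v\<close>: the same index occurs on both sides, which keeps the tensor product Arens--Michael.\<close>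

lemma TA_submult: "u \<in> carrier T \<Longrightarrow> v \<in> carrier T \<Longrightarrow> P k (u \<otimes>\<^bsub>TA\<^esub> v) \<le> P k u * P k v"
  using tensor_lift_bound[OF graded_frechet_T L_bbil_factors, of v k "P k v" k u] L_bound
  unfolding TA_mult by (simp add: mult.commute)

lemma TA_blin_left: assumes u: "u \<in> carrier T" shows "(\<lambda>v. u \<otimes>\<^bsub>TA\<^esub> v) \<in> blin T P T P"
proof (rule blinI)
  note eq = tensor_eq[OF graded_frechet_T _ _ _ u]
  note bl = TA_blin_right blin_add[OF _ _ graded_frechet_T graded_frechet_T] blin_sm[OF _ graded_frechet_T]
  show "u \<otimes>\<^bsub>TA\<^esub> x \<in> carrier T" if "x \<in> carrier T" for x using TA_closed u that .
  show "u \<otimes>\<^bsub>TA\<^esub> (x \<oplus>\<^bsub>T\<^esub> y) = u \<otimes>\<^bsub>TA\<^esub> x \<oplus>\<^bsub>T\<^esub> u \<otimes>\<^bsub>TA\<^esub> y" if "x \<in> carrier T" "y \<in> carrier T" for x y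
    by (rule eq) (use that in \<open>auto simp: TA_elem blinD(2)[OF L_blin] intro!: bl\<close>)
  show "u \<otimes>\<^bsub>TA\<^esub> (c \<odot>\<^bsub>T\<^esub> x) = c \<odot>\<^bsub>T\<^esub> (u \<otimes>\<^bsub>TA\<^esub> x)" if "x \<in> carrier T" for c x
    by (rule eq) (use that in \<open>auto simp: TA_elem blinD(3)[OF L_blin] intro!: bl\<close>)
  show "\<exists>k C. \<forall>x\<in>carrier T. P j (u \<otimes>\<^bsub>TA\<^esub> x) \<le> C * P k x" for j
    by (intro exI[of _ j] exI[of _ "P j u"] ballI TA_submult u)
qed

text \<open>Both sides are continuous and linear in each of the three arguments, so that elementary tensors
  suffice.\<close>

lemma TA_assoc:
  assumes u: "u \<in> carrier T" and v: "v \<in> carrier T" and w: "w \<in> carrier T"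
  shows "(u \<otimes>\<^bsub>TA\<^esub> v) \<otimes>\<^bsub>TA\<^esub> w = u \<otimes>\<^bsub>TA\<^esub> (v \<otimes>\<^bsub>TA\<^esub> w)"
proof (rule tensor_eq[OF graded_frechet_T _ _ _ u])
  show "(\<lambda>u. (u \<otimes>\<^bsub>TA\<^esub> v) \<otimes>\<^bsub>TA\<^esub> w) \<in> blin T P T P"
    by (rule blin_comp[OF TA_blin_right[OF v] TA_blin_right[OF w] graded_frechet_T])
  show "(\<lambda>u. u \<otimes>\<^bsub>TA\<^esub> (v \<otimes>\<^bsub>TA\<^esub> w)) \<in> blin T P T P" by (rule TA_blin_right[OF TA_closed[OF v w]])
  fix a b assume ab: "a \<in> carrier A" "b \<in> carrier B"
  show "(elem a b \<otimes>\<^bsub>TA\<^esub> v) \<otimes>\<^bsub>TA\<^esub> w = elem a b \<otimes>\<^bsub>TA\<^esub> (v \<otimes>\<^bsub>TA\<^esub> w)"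
  proof (rule tensor_eq[OF graded_frechet_T _ _ _ v])
    show "(\<lambda>v. (elem a b \<otimes>\<^bsub>TA\<^esub> v) \<otimes>\<^bsub>TA\<^esub> w) \<in> blin T P T P"
      using ab by (intro blin_comp[OF TA_blin_left TA_blin_right[OF w] graded_frechet_T]) auto
    show "(\<lambda>v. elem a b \<otimes>\<^bsub>TA\<^esub> (v \<otimes>\<^bsub>TA\<^esub> w)) \<in> blin T P T P"
      using ab by (intro blin_comp[OF TA_blin_right[OF w] TA_blin_left graded_frechet_T]) auto
    fix c d assume cd: "c \<in> carrier A" "d \<in> carrier B"
    show "(elem a b \<otimes>\<^bsub>TA\<^esub> elem c d) \<otimes>\<^bsub>TA\<^esub> w = elem a b \<otimes>\<^bsub>TA\<^esub> (elem c d \<otimes>\<^bsub>TA\<^esub> w)"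
    proof (rule tensor_eq[OF graded_frechet_T _ _ _ w])
      show "(\<lambda>w. (elem a b \<otimes>\<^bsub>TA\<^esub> elem c d) \<otimes>\<^bsub>TA\<^esub> w) \<in> blin T P T P"
        using ab cd by (intro TA_blin_left TA_closed) auto
      show "(\<lambda>w. elem a b \<otimes>\<^bsub>TA\<^esub> (elem c d \<otimes>\<^bsub>TA\<^esub> w)) \<in> blin T P T P"
        using ab cd by (intro blin_comp[OF TA_blin_left TA_blin_left graded_frechet_T]) auto
      fix e f assume "e \<in> carrier A" "f \<in> carrier B"
      then show "(elem a b \<otimes>\<^bsub>TA\<^esub> elem c d) \<otimes>\<^bsub>TA\<^esub> elem e f = elem a b \<otimes>\<^bsub>TA\<^esub> (elem c d \<otimes>\<^bsub>TA\<^esub> elem e f)"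
        using ab cd by (simp add: TA_elem_elem A.mul_assoc B.mul_assoc)
    qed
  qed
qed

theorem graded_algebra_TA: "graded_algebra TA P"
proof -
  have one: "elem \<one>\<^bsub>A\<^esub> \<one>\<^bsub>B\<^esub> \<otimes>\<^bsub>TA\<^esub> u = u" "u \<otimes>\<^bsub>TA\<^esub> elem \<one>\<^bsub>A\<^esub> \<one>\<^bsub>B\<^esub> = u" if u: "u \<in> carrier T" for u
    by (rule tensor_eq[OF graded_frechet_T _ _ _ u];
        auto simp: TA_elem_elem intro!: TA_blin_left TA_blin_right blin_id graded_frechet_T)+
  have fr: "graded_frechet TA P"
    unfolding tensor_alg_def by (rule graded_frechet_upd[OF graded_frechet_T])
  then interpret TA: graded_frechet TA P .
  have "monoid TA"
    by (rule monoidI) (auto simp: TA_closed TA_assoc one)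
  then have "ring TA"
    using TA.M.abelian_group_axioms blinD(2)[OF TA_blin_left] blinD(2)[OF TA_blin_right]
    by (intro ringI) auto
  then show ?thesis
    unfolding graded_algebra_def graded_algebra_axioms_def
    using fr blinD(3)[OF TA_blin_left] blinD(3)[OF TA_blin_right] TA_submult by auto
qed

sublocale TA: graded_algebra TA P
  by (rule graded_algebra_TA)

text \<open>Both sides of the multiplicativity equation are continuous and linear in each argument.\<close>

lemma tensor_alg_hom:
  assumes Z: "graded_algebra Z r" and f: "f \<in> blin T P Z r"
    and mult: "\<And>a b c d. a \<in> carrier A \<Longrightarrow> b \<in> carrier B \<Longrightarrow> c \<in> carrier A \<Longrightarrow> d \<in> carrier B \<Longrightarrow>
      f (elem (a \<otimes>\<^bsub>A\<^esub> c) (b \<otimes>\<^bsub>B\<^esub> d)) = f (elem a b) \<otimes>\<^bsub>Z\<^esub> f (elem c d)"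
    and one: "f (elem \<one>\<^bsub>A\<^esub> \<one>\<^bsub>B\<^esub>) = \<one>\<^bsub>Z\<^esub>"
  shows "f \<in> alg_hom TA P Z r"
proof -
  interpret Z: graded_algebra Z r by fact
  have "f (u \<otimes>\<^bsub>TA\<^esub> v) = f u \<otimes>\<^bsub>Z\<^esub> f v" if u: "u \<in> carrier T" and v: "v \<in> carrier T" for u v
  proof (rule tensor_eq[OF Z.frechet _ _ _ u])
    show "(\<lambda>u. f (u \<otimes>\<^bsub>TA\<^esub> v)) \<in> blin T P Z r"
      by (rule blin_comp[OF TA_blin_right[OF v] f graded_frechet_T])
    show "(\<lambda>u. f u \<otimes>\<^bsub>Z\<^esub> f v) \<in> blin T P Z r"
      by (rule blin_comp[OF f Z.mult_blin_right[OF blinD(1)[OF f v]] Z.frechet])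
    fix a b assume ab: "a \<in> carrier A" "b \<in> carrier B"
    show "f (elem a b \<otimes>\<^bsub>TA\<^esub> v) = f (elem a b) \<otimes>\<^bsub>Z\<^esub> f v"
    proof (rule tensor_eq[OF Z.frechet _ _ _ v])
      show "(\<lambda>v. f (elem a b \<otimes>\<^bsub>TA\<^esub> v)) \<in> blin T P Z r"
        using ab by (intro blin_comp[OF TA_blin_left f graded_frechet_T]) auto
      show "(\<lambda>v. f (elem a b) \<otimes>\<^bsub>Z\<^esub> f v) \<in> blin T P Z r"
        using ab by (intro blin_comp[OF f Z.mult_blin_left[OF blinD(1)[OF f]] Z.frechet]) auto
    qed (use ab mult in \<open>simp add: TA_elem_elem\<close>)
  qed
  then show ?thesis using f one by (simp add: alg_hom_def)
qed

lemma embed_left: "(\<lambda>a. elem a \<one>\<^bsub>B\<^esub>) \<in> alg_hom A p TA P"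
proof -
  have "(\<lambda>a. elem a \<one>\<^bsub>B\<^esub>) \<in> blin A p T P"
  proof (rule blinI)
    fix j show "\<exists>k C. \<forall>x\<in>carrier A. P j (elem x \<one>\<^bsub>B\<^esub>) \<le> C * p k x"
      using P_elem[OF _ B.unit_closed, of _ j] by (intro exI[of _ j] exI[of _ "q j \<one>\<^bsub>B\<^esub>"]) (auto simp: mult.commute)
  qed (auto simp: elem_add_left elem_scale_left)
  then show ?thesis by (simp add: alg_hom_def TA_elem_elem)
qed

lemma embed_right: "(\<lambda>b. elem \<one>\<^bsub>A\<^esub> b) \<in> alg_hom B q TA P"
proof -
  have "(\<lambda>b. elem \<one>\<^bsub>A\<^esub> b) \<in> blin B q T P"
  proof (rule blinI)
    fix j show "\<exists>k C. \<forall>x\<in>carrier B. P j (elem \<one>\<^bsub>A\<^esub> x) \<le> C * q k x"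
      using P_elem[OF A.unit_closed, of _ j] by (intro exI[of _ j] exI[of _ "p j \<one>\<^bsub>A\<^esub>"]) auto
  qed (auto simp: elem_add_right elem_scale_right)
  then show ?thesis by (simp add: alg_hom_def TA_elem_elem)
qed

end

lemma tensor_map_elem:
  assumes "graded_frechet V p" "graded_frechet W q" "graded_frechet V' p'" "graded_frechet W' q'"
    and f: "f \<in> blin V p V' p'" and g: "g \<in> blin W q W' q'"
    and "x \<in> carrier V" "y \<in> carrier W"
  shows "tensor_map V W V' W' f g (elem_tensor V W x y) = elem_tensor V' W' (f x) (g y)"
proof -
  interpret T: tensor_pair V p W q using assms by (simp add: tensor_pair_def)
  interpret T': tensor_pair V' p' W' q' using assms by (simp add: tensor_pair_def)
  show ?thesis
    unfolding tensor_map_def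
    by (rule T.tensor_lift_elem[OF T'.graded_frechet_T bbil_elem_comp[OF assms(1-6)] assms(7,8)])
qed

lemma tensor_map_blin:
  assumes "graded_frechet V p" "graded_frechet W q" "graded_frechet V' p'" "graded_frechet W' q'"
    and f: "f \<in> blin V p V' p'" and g: "g \<in> blin W q W' q'"
  shows "tensor_map V W V' W' f g \<in> blin (tensor_space V W) (\<lambda>k. tensor_seminorm V W (p k) (q k))
    (tensor_space V' W') (\<lambda>k. tensor_seminorm V' W' (p' k) (q' k))"
proof -
  interpret T: tensor_pair V p W q using assms by (simp add: tensor_pair_def)
  interpret T': tensor_pair V' p' W' q' using assms by (simp add: tensor_pair_def)
  show ?thesis
    unfolding tensor_map_def
    by (rule T.tensor_lift_blin[OF T'.graded_frechet_T bbil_elem_comp[OF assms(1-6)]])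
qed

lemma tensor_map_hom:
  assumes A: "graded_algebra A p" and B: "graded_algebra B q"
    and C: "graded_algebra C r" and D: "graded_algebra D s"
    and f: "f \<in> alg_hom A p C r" and g: "g \<in> alg_hom B q D s"
  shows "tensor_map A B C D f g \<in> alg_hom (tensor_alg A B) (\<lambda>k. tensor_seminorm A B (p k) (q k))
    (tensor_alg C D) (\<lambda>k. tensor_seminorm C D (r k) (s k))"
proof -
  interpret AB: tensor_alg_pair A p B q using assms by (simp add: tensor_alg_pair_def)
  interpret CD: tensor_alg_pair C r D s using assms by (simp add: tensor_alg_pair_def)
  note fr = AB.A.frechet AB.B.frechet CD.A.frechet CD.B.frechet
  note f' = alg_homD[OF f] and g' = alg_homD[OF g]
  note el = tensor_map_elem[OF fr f'(1) g'(1)]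
  show ?thesis
  proof (rule AB.tensor_alg_hom[OF CD.graded_algebra_TA])
    show "tensor_map A B C D f g \<in> blin AB.T AB.P CD.TA CD.P"
      using tensor_map_blin[OF fr f'(1) g'(1)] by simp
  qed (auto simp: el f' g' CD.TA_elem_elem)
qed

section \<open>Associativity\<close>

locale tensor_triple = U: graded_algebra U p + V: graded_algebra V q + W: graded_algebra W r
  for U :: "'a lc_struct" and p and V :: "'b lc_struct" and q and W :: "'c lc_struct" and r
begin

sublocale UV: tensor_alg_pair U p V q by (simp add: tensor_alg_pair_def U.graded_algebra_axioms V.graded_algebra_axioms)
sublocale VW: tensor_alg_pair V q W r by (simp add: tensor_alg_pair_def V.graded_algebra_axioms W.graded_algebra_axioms)
sublocale UV_W: tensor_alg_pair UV.TA UV.P W r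
  by (simp add: tensor_alg_pair_def UV.graded_algebra_TA W.graded_algebra_axioms)
sublocale U_VW: tensor_alg_pair U p VW.TA VW.P
  by (simp add: tensor_alg_pair_def VW.graded_algebra_TA U.graded_algebra_axioms)

text \<open>For fixed \<open>z\<close> this is the map \<open>x \<otimes> y \<mapsto> x \<otimes> (y \<otimes> z)\<close>, which is the inner lift in the
  definition of the associator.\<close>

definition "G z = tensor_lift U V U_VW.T (\<lambda>x y. U_VW.elem x (VW.elem y z))"

lemma VW_elem_blin: "z \<in> carrier W \<Longrightarrow> (\<lambda>y. VW.elem y z) \<in> blin V q VW.T VW.P"
proof (rule blinI)
  assume z: "z \<in> carrier W"
  show "\<exists>k C. \<forall>x\<in>carrier V. VW.P j (VW.elem x z) \<le> C * q k x" for j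
    using VW.P_elem[OF _ z, of _ j] by (intro exI[of _ j] exI[of _ "r j z"]) (auto simp: mult.commute)
qed (auto simp: VW.elem_add_left VW.elem_scale_left)

lemma G_bbil: "z \<in> carrier W \<Longrightarrow> bbil U p V q U_VW.T U_VW.P (\<lambda>x y. U_VW.elem x (VW.elem y z))"
  using bbil_elem_comp[OF U.frechet V.frechet U.frechet VW.graded_frechet_T blin_id[OF U.frechet] VW_elem_blin]
  by simp

lemma G_blin: "z \<in> carrier W \<Longrightarrow> G z \<in> blin UV.T UV.P U_VW.T U_VW.P"
  unfolding G_def by (rule UV.tensor_lift_blin[OF U_VW.graded_frechet_T G_bbil])

lemma G_elem:
  "z \<in> carrier W \<Longrightarrow> x \<in> carrier U \<Longrightarrow> y \<in> carrier V \<Longrightarrow> G z (UV.elem x y) = U_VW.elem x (VW.elem y z)"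
  unfolding G_def by (rule UV.tensor_lift_elem[OF U_VW.graded_frechet_T G_bbil])

text \<open>The estimate is uniform in \<open>z\<close>, so the map is bilinear and bounded in both of \<open>t\<close> and \<open>z\<close>.\<close>

lemma G_bound:
  assumes z: "z \<in> carrier W" and t: "t \<in> carrier UV.T"
  shows "U_VW.P k (G z t) \<le> 1 * (UV.P k t * r k z)"
proof -
  have "U_VW.P k (G z t) \<le> r k z * UV.P k t"
    unfolding G_def
  proof (rule UV.tensor_lift_bound[OF U_VW.graded_frechet_T G_bbil[OF z] _ _ t])
    fix x y assume xy: "x \<in> carrier U" "y \<in> carrier V"
    have "U_VW.P k (U_VW.elem x (VW.elem y z)) \<le> p k x * VW.P k (VW.elem y z)"
      using xy z by (intro U_VW.P_elem) auto
    also have "\<dots> \<le> p k x * (q k y * r k z)" using xy z by (intro mult_left_mono VW.P_elem) auto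
    finally show "U_VW.P k (U_VW.elem x (VW.elem y z)) \<le> r k z * (p k x * q k y)" by (simp add: mult_ac)
  qed (use z in auto)
  then show ?thesis by (simp add: mult.commute)
qed

lemma assoc_bbil: "bbil UV.T UV.P W r U_VW.T U_VW.P (\<lambda>t z. G z t)"
  unfolding bbil_def
proof (intro conjI allI ballI)
  fix t z z' c assume t: "t \<in> carrier UV.T" and z: "z \<in> carrier W"
  note eq = UV.tensor_eq[OF U_VW.graded_frechet_T _ _ _ t]
  show "G z t \<in> carrier U_VW.T" using blinD(1)[OF G_blin[OF z] t] .
  show "G z (c \<odot>\<^bsub>UV.T\<^esub> t) = c \<odot>\<^bsub>U_VW.T\<^esub> G z t" using blinD(3)[OF G_blin[OF z] t] .
  show "G (c \<odot>\<^bsub>W\<^esub> z) t = c \<odot>\<^bsub>U_VW.T\<^esub> G z t"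
  proof (rule eq)
    show "G (c \<odot>\<^bsub>W\<^esub> z) \<in> blin UV.T UV.P U_VW.T U_VW.P" using z by (intro G_blin) auto
    show "(\<lambda>t. c \<odot>\<^bsub>U_VW.T\<^esub> G z t) \<in> blin UV.T UV.P U_VW.T U_VW.P"
      by (intro blin_sm G_blin z U_VW.graded_frechet_T)
  qed (use z in \<open>auto simp: G_elem VW.elem_scale_right U_VW.elem_scale_right[simplified]\<close>)
  show "G z (t \<oplus>\<^bsub>UV.T\<^esub> t') = G z t \<oplus>\<^bsub>U_VW.T\<^esub> G z t'" if "t' \<in> carrier UV.T" for t'
    using blinD(2)[OF G_blin[OF z] t that] .
  show "G (z \<oplus>\<^bsub>W\<^esub> z') t = G z t \<oplus>\<^bsub>U_VW.T\<^esub> G z' t" if "z' \<in> carrier W" for z'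
  proof (rule eq)
    show "G (z \<oplus>\<^bsub>W\<^esub> z') \<in> blin UV.T UV.P U_VW.T U_VW.P" using z that by (intro G_blin) auto
    show "(\<lambda>t. G z t \<oplus>\<^bsub>U_VW.T\<^esub> G z' t) \<in> blin UV.T UV.P U_VW.T U_VW.P"
      by (intro blin_add G_blin z that U_VW.graded_frechet_T UV.graded_frechet_T)
  qed (use z that in \<open>auto simp: G_elem VW.elem_add_right U_VW.elem_add_right[simplified]\<close>)
next
  show "\<exists>k C. \<forall>t\<in>carrier UV.T. \<forall>z\<in>carrier W. U_VW.P j (G z t) \<le> C * (UV.P k t * r k z)" for j
    by (intro exI[of _ j] exI[of _ 1] ballI G_bound)
qed

lemma assoc_eq: "tensor_assoc U V W = tensor_lift UV.T W U_VW.T (\<lambda>t z. G z t)"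
  by (simp add: tensor_assoc_def G_def)

lemma assoc_blin: "tensor_assoc U V W \<in> blin UV_W.T UV_W.P U_VW.T U_VW.P"
  unfolding assoc_eq
  using UV_W.tensor_lift_blin[OF U_VW.graded_frechet_T, of "\<lambda>t z. G z t"] assoc_bbil
  by (simp add: bbil_def)

lemma assoc_elem: "t \<in> carrier UV.T \<Longrightarrow> z \<in> carrier W \<Longrightarrow> tensor_assoc U V W (UV_W.elem t z) = G z t"
  unfolding assoc_eq
  using UV_W.tensor_lift_elem[OF U_VW.graded_frechet_T, of "\<lambda>t z. G z t" t z] assoc_bbil
  by (simp add: bbil_def)

lemma assoc_elem_elem:
  "x \<in> carrier U \<Longrightarrow> y \<in> carrier V \<Longrightarrow> z \<in> carrier W \<Longrightarrow>
    tensor_assoc U V W (UV_W.elem (UV.elem x y) z) = U_VW.elem x (VW.elem y z)"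
  by (subst assoc_elem) (auto simp: G_elem)

text \<open>Continuity and linearity reduce this to elementary tensors, twice.\<close>

lemma G_mult:
  assumes z: "z \<in> carrier W" "z' \<in> carrier W" and t: "t \<in> carrier UV.T" and t': "t' \<in> carrier UV.T"
  shows "G (z \<otimes>\<^bsub>W\<^esub> z') (t \<otimes>\<^bsub>UV.TA\<^esub> t') = G z t \<otimes>\<^bsub>U_VW.TA\<^esub> G z' t'"
proof (rule UV.tensor_eq[OF U_VW.graded_frechet_T _ _ _ t])
  have zz: "z \<otimes>\<^bsub>W\<^esub> z' \<in> carrier W" using z by auto
  show "(\<lambda>t. G (z \<otimes>\<^bsub>W\<^esub> z') (t \<otimes>\<^bsub>UV.TA\<^esub> t')) \<in> blin UV.T UV.P U_VW.T U_VW.P"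
    by (rule blin_comp[OF UV.TA_blin_right[OF t'] G_blin[OF zz] UV.graded_frechet_T])
  show "(\<lambda>t. G z t \<otimes>\<^bsub>U_VW.TA\<^esub> G z' t') \<in> blin UV.T UV.P U_VW.T U_VW.P"
    using blin_comp[OF G_blin[OF z(1)] U_VW.TA_blin_right U_VW.graded_frechet_T] blinD(1)[OF G_blin[OF z(2)] t']
    by simp
  fix x y assume xy: "x \<in> carrier U" "y \<in> carrier V"
  have gx: "G z (UV.elem x y) \<in> carrier U_VW.T" using blinD(1)[OF G_blin[OF z(1)]] xy by auto
  show "G (z \<otimes>\<^bsub>W\<^esub> z') (UV.elem x y \<otimes>\<^bsub>UV.TA\<^esub> t') = G z (UV.elem x y) \<otimes>\<^bsub>U_VW.TA\<^esub> G z' t'"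
  proof (rule UV.tensor_eq[OF U_VW.graded_frechet_T _ _ _ t'])
    show "(\<lambda>t'. G (z \<otimes>\<^bsub>W\<^esub> z') (UV.elem x y \<otimes>\<^bsub>UV.TA\<^esub> t')) \<in> blin UV.T UV.P U_VW.T U_VW.P"
      using xy by (intro blin_comp[OF UV.TA_blin_left G_blin[OF zz] UV.graded_frechet_T]) auto
    show "(\<lambda>t'. G z (UV.elem x y) \<otimes>\<^bsub>U_VW.TA\<^esub> G z' t') \<in> blin UV.T UV.P U_VW.T U_VW.P"
      using blin_comp[OF G_blin[OF z(2)] U_VW.TA_blin_left U_VW.graded_frechet_T] gx by simp
    fix x' y' assume xy': "x' \<in> carrier U" "y' \<in> carrier V"
    show "G (z \<otimes>\<^bsub>W\<^esub> z') (UV.elem x y \<otimes>\<^bsub>UV.TA\<^esub> UV.elem x' y') =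
        G z (UV.elem x y) \<otimes>\<^bsub>U_VW.TA\<^esub> G z' (UV.elem x' y')"
      using xy xy' z zz U_VW.TA_elem_elem[of x "VW.elem y z" x' "VW.elem y' z'"]
      by (simp add: UV.TA_elem_elem G_elem VW.TA_elem_elem)
  qed
qed

theorem assoc_hom: "tensor_assoc U V W \<in> alg_hom UV_W.TA UV_W.P U_VW.TA U_VW.P"
proof (rule UV_W.tensor_alg_hom[OF U_VW.graded_algebra_TA])
  show "tensor_assoc U V W \<in> blin UV_W.T UV_W.P U_VW.TA U_VW.P" using assoc_blin by simp
qed (use assoc_elem assoc_elem_elem UV.TA_closed in \<open>auto simp: G_mult\<close>)

end

section \<open>Free entire functions\<close>

abbreviation "FE \<equiv> free_entire"

lemma FE_simps [simp]:
  "mult (FE n) = (\<lambda>a b w. \<Sum>k\<le>length w. a (take k w) * b (drop k w))"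
  "one (FE n) = (\<lambda>w. if w = [] then 1 else 0)" "zero (FE n) = (\<lambda>w. 0)"
  "add (FE n) = (\<lambda>a b w. a w + b w)" "smult (FE n) = (\<lambda>c a w. c * a w)"
  by (simp_all add: free_entire_def)

lemma FE_carrier:
  "a \<in> carrier (FE n) \<longleftrightarrow> (\<forall>w. w \<notin> words n \<longrightarrow> a w = 0) \<and>
     (\<forall>r>0. (\<lambda>w. cmod (a w) * r ^ length w) summable_on words n)"
  by (simp add: free_entire_def)

definition fe_mon :: "nat list \<Rightarrow> nat list \<Rightarrow> complex" where
  "fe_mon w = (\<lambda>v. if v = w then 1 else 0)"

lemma fe_norm_le:
  assumes "r > 0" "\<And>S. finite S \<Longrightarrow> S \<subseteq> words n \<Longrightarrow> (\<Sum>w\<in>S. cmod (a w) * r ^ length w) \<le> C"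
  shows "(\<lambda>w. cmod (a w) * r ^ length w) summable_on words n" "fe_norm n r a \<le> C"
proof -
  show s: "(\<lambda>w. cmod (a w) * r ^ length w) summable_on words n"
    by (rule nonneg_bdd_above_summable_on) (use assms in \<open>auto intro!: bdd_aboveI[of _ C]\<close>)
  show "fe_norm n r a \<le> C"
    unfolding fe_norm_def by (rule infsum_le_finite_sums[OF s]) (use assms in auto)
qed

lemma fe_norm_ge:
  assumes "a \<in> carrier (FE n)" "r > 0" "finite S" "S \<subseteq> words n"
  shows "(\<Sum>w\<in>S. cmod (a w) * r ^ length w) \<le> fe_norm n r a"
  unfolding fe_norm_def by (rule finite_sum_le_infsum) (use assms in \<open>auto simp: FE_carrier\<close>)

lemma fe_norm_point:
  "a \<in> carrier (FE n) \<Longrightarrow> r > 0 \<Longrightarrow> w \<in> words n \<Longrightarrow> cmod (a w) * r ^ length w \<le> fe_norm n r a"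
  using fe_norm_ge[of a n r "{w}"] by simp

lemma FE_memI:
  assumes "\<And>w. w \<notin> words n \<Longrightarrow> a w = 0"
    and "\<And>r. r > 0 \<Longrightarrow> \<exists>C. \<forall>S. finite S \<and> S \<subseteq> words n \<longrightarrow> (\<Sum>w\<in>S. cmod (a w) * r ^ length w) \<le> C"
  shows "a \<in> carrier (FE n)"
  unfolding FE_carrier using assms fe_norm_le(1)[of _ n a] by meson

lemma fe_sum_add:
  assumes "a \<in> carrier (FE n)" "b \<in> carrier (FE n)" "r > 0" "finite S" "S \<subseteq> words n"
  shows "(\<Sum>w\<in>S. cmod (a w + b w) * r ^ length w) \<le> fe_norm n r a + fe_norm n r b"
proof -
  have "(\<Sum>w\<in>S. cmod (a w + b w) * r ^ length w) \<le>
      (\<Sum>w\<in>S. cmod (a w) * r ^ length w + cmod (b w) * r ^ length w)"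
    using assms(3) by (intro sum_mono) (auto simp: distrib_right[symmetric] intro!: mult_right_mono norm_triangle_ineq)
  also have "\<dots> \<le> fe_norm n r a + fe_norm n r b"
    unfolding sum.distrib by (intro add_mono fe_norm_ge assms)
  finally show ?thesis .
qed

lemma FE_add:
  assumes "a \<in> carrier (FE n)" "b \<in> carrier (FE n)"
  shows "(\<lambda>w. a w + b w) \<in> carrier (FE n)"
    and "r > 0 \<Longrightarrow> fe_norm n r (\<lambda>w. a w + b w) \<le> fe_norm n r a + fe_norm n r b"
proof -
  show "(\<lambda>w. a w + b w) \<in> carrier (FE n)"
  proof (rule FE_memI)
    show "a w + b w = 0" if "w \<notin> words n" for w using assms that unfolding FE_carrier by simp
  qed (use fe_sum_add[OF assms] in blast)
  show "r > 0 \<Longrightarrow> fe_norm n r (\<lambda>w. a w + b w) \<le> fe_norm n r a + fe_norm n r b"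
    by (rule fe_norm_le(2)) (use fe_sum_add[OF assms] in auto)
qed

lemma FE_smult:
  assumes "a \<in> carrier (FE n)"
  shows "(\<lambda>w. c * a w) \<in> carrier (FE n)" "fe_norm n r (\<lambda>w. c * a w) = cmod c * fe_norm n r a"
  using assms by (auto simp: FE_carrier fe_norm_def norm_mult mult.assoc infsum_cmult_right'
      intro!: summable_on_cmult_right)

lemma words_take_drop: "w \<in> words n \<longleftrightarrow> take k w \<in> words n \<and> drop k w \<in> words n"
  using append_in_lists_conv[of "take k w" "drop k w" "{1..n}"] by (simp only: append_take_drop_id)

text \<open>Splitting a word at each position maps the pairs of a word and a position injectively to pairs of
  words, so the left-hand side is bounded by a part of the product of the two series.\<close>

lemma fe_sum_mult:
  assumes a: "a \<in> carrier (FE n)" and b: "b \<in> carrier (FE n)" and r: "r > 0"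
    and S: "finite S" "S \<subseteq> words n"
  shows "(\<Sum>w\<in>S. cmod (\<Sum>k\<le>length w. a (take k w) * b (drop k w)) * r ^ length w)
    \<le> fe_norm n r a * fe_norm n r b"
proof -
  let ?f = "\<lambda>w. cmod (a w) * r ^ length w" and ?g = "\<lambda>w. cmod (b w) * r ^ length w"
  \<comment> \<open>words with a position, and the two parts into which the position cuts the word\<close>
  let ?D = "Sigma S (\<lambda>w. {..length w})" and ?h = "\<lambda>(w, k). (take k w, drop k w)"
  have inj: "inj_on ?h ?D"
  proof (rule inj_onI, clarify)
    fix w k w' k' assume *: "k \<le> length w" "k' \<le> length w'" "take k w = take k' w'" "drop k w = drop k' w'"
    then have "w = w'" by (metis append_take_drop_id)
    moreover have "k = k'" using * by (metis length_take min.absorb2)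
    ultimately show "w = w' \<and> k = k'" by simp
  qed
  have fin: "finite (?h ` ?D)" using S by auto
  have td: "take k w \<in> words n" "drop k w \<in> words n" if "w \<in> S" for w k
    using S(2) words_take_drop[of w n k] that by blast+
  have sub: "fst ` ?h ` ?D \<subseteq> words n" "snd ` ?h ` ?D \<subseteq> words n"
  proof -
    show "fst ` ?h ` ?D \<subseteq> words n"
    proof
      fix u assume "u \<in> fst ` ?h ` ?D"
      then obtain w k where "w \<in> S" "u = take k w" by auto
      then show "u \<in> words n" using td(1) by blast
    qed
    show "snd ` ?h ` ?D \<subseteq> words n"
    proof
      fix u assume "u \<in> snd ` ?h ` ?D"
      then obtain w k where "w \<in> S" "u = drop k w" by auto
      then show "u \<in> words n" using td(2) by blast
    qed
  qed
  have "(\<Sum>w\<in>S. cmod (\<Sum>k\<le>length w. a (take k w) * b (drop k w)) * r ^ length w) \<le>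
      (\<Sum>w\<in>S. \<Sum>k\<le>length w. ?f (take k w) * ?g (drop k w))"
  proof (rule sum_mono)
    fix w
    have "cmod (\<Sum>k\<le>length w. a (take k w) * b (drop k w)) * r ^ length w \<le>
        (\<Sum>k\<le>length w. cmod (a (take k w) * b (drop k w))) * r ^ length w"
      using r by (intro mult_right_mono norm_sum) auto
    also have "\<dots> = (\<Sum>k\<le>length w. ?f (take k w) * ?g (drop k w))"
      unfolding sum_distrib_right
    proof (rule sum.cong)
      fix k assume "k \<in> {..length w}"
      then have "r ^ length w = r ^ length (take k w) * r ^ length (drop k w)"
        by (simp flip: power_add)
      then show "cmod (a (take k w) * b (drop k w)) * r ^ length w = ?f (take k w) * ?g (drop k w)"
        by (simp add: norm_mult mult_ac)
    qed simp
    finally show "cmod (\<Sum>k\<le>length w. a (take k w) * b (drop k w)) * r ^ length w \<le>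
        (\<Sum>k\<le>length w. ?f (take k w) * ?g (drop k w))" .
  qed
  also have "\<dots> = (\<Sum>z\<in>?D. case z of (w, k) \<Rightarrow> ?f (take k w) * ?g (drop k w))"
    by (rule sum.Sigma[of S "\<lambda>w. {..length w}" "\<lambda>w k. ?f (take k w) * ?g (drop k w)"]) (use S in auto)
  also have "\<dots> = (\<Sum>(u, v)\<in>?h ` ?D. ?f u * ?g v)"
    by (subst sum.reindex[OF inj]) (auto simp: case_prod_unfold o_def)
  also have "\<dots> \<le> (\<Sum>(u, v)\<in>(fst ` ?h ` ?D) \<times> (snd ` ?h ` ?D). ?f u * ?g v)"
  proof (rule sum_mono2)
    show "finite ((fst ` ?h ` ?D) \<times> (snd ` ?h ` ?D))" using fin by blast
    show "?h ` ?D \<subseteq> (fst ` ?h ` ?D) \<times> (snd ` ?h ` ?D)" by force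
  qed (use r in auto)
  also have "\<dots> = (\<Sum>u\<in>fst ` ?h ` ?D. ?f u) * (\<Sum>v\<in>snd ` ?h ` ?D. ?g v)"
    by (simp add: sum_product sum.cartesian_product)
  also have "\<dots> \<le> fe_norm n r a * fe_norm n r b"
  proof (rule mult_mono)
    show "(\<Sum>u\<in>fst ` ?h ` ?D. ?f u) \<le> fe_norm n r a"
      by (rule fe_norm_ge[OF a r _ sub(1)]) (use fin in blast)
    show "(\<Sum>v\<in>snd ` ?h ` ?D. ?g v) \<le> fe_norm n r b"
      by (rule fe_norm_ge[OF b r _ sub(2)]) (use fin in blast)
    show "0 \<le> fe_norm n r a" unfolding fe_norm_def using r by (intro infsum_nonneg) auto
  qed (use r in \<open>auto intro!: sum_nonneg\<close>)
  finally show ?thesis .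
qed

lemma FE_mult:
  assumes "a \<in> carrier (FE n)" "b \<in> carrier (FE n)"
  shows "(\<lambda>w. \<Sum>k\<le>length w. a (take k w) * b (drop k w)) \<in> carrier (FE n)"
    and "r > 0 \<Longrightarrow> fe_norm n r (\<lambda>w. \<Sum>k\<le>length w. a (take k w) * b (drop k w)) \<le> fe_norm n r a * fe_norm n r b"
proof -
  have supp: "(\<Sum>k\<le>length w. a (take k w) * b (drop k w)) = 0" if w: "w \<notin> words n" for w
  proof (rule sum.neutral, rule ballI)
    fix k
    have "take k w \<notin> words n \<or> drop k w \<notin> words n" using w words_take_drop by blast
    then have "a (take k w) = 0 \<or> b (drop k w) = 0" using assms unfolding FE_carrier by blast
    then show "a (take k w) * b (drop k w) = 0" by simp
  qed
  show "(\<lambda>w. \<Sum>k\<le>length w. a (take k w) * b (drop k w)) \<in> carrier (FE n)"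
    by (rule FE_memI) (use supp fe_sum_mult[OF assms] in blast)+
  show "r > 0 \<Longrightarrow> fe_norm n r (\<lambda>w. \<Sum>k\<le>length w. a (take k w) * b (drop k w)) \<le> fe_norm n r a * fe_norm n r b"
    using fe_sum_mult[OF assms] by (intro fe_norm_le(2)) auto
qed

lemma fe_mon_carrier [simp]: "w \<in> words n \<Longrightarrow> fe_mon w \<in> carrier (FE n)"
proof (rule FE_memI)
  fix r :: real assume "r > 0" and w: "w \<in> words n"
  have "(\<Sum>v\<in>S. cmod (fe_mon w v) * r ^ length v) \<le> r ^ length w" if "finite S" for S
  proof -
    have "(\<Sum>v\<in>S. cmod (fe_mon w v) * r ^ length v) = (\<Sum>v\<in>S. if v = w then r ^ length w else 0)"
      by (rule sum.cong) (auto simp: fe_mon_def)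
    then show ?thesis using that \<open>r > 0\<close> by simp
  qed
  then show "\<exists>C. \<forall>S. finite S \<and> S \<subseteq> words n \<longrightarrow> (\<Sum>v\<in>S. cmod (fe_mon w v) * r ^ length v) \<le> C"
    by blast
qed (auto simp: fe_mon_def)

lemma FE_zero: "(\<lambda>w. 0) \<in> carrier (FE n)"
  by (auto simp: FE_carrier)

lemma one_eq_mon: "(\<lambda>w. if w = [] then 1 else 0) = fe_mon []"
  by (simp add: fe_mon_def)

lemma complex_space_FE: "complex_space (FE n)"
proof (rule complex_spaceI)
  show "abelian_group (FE n)"
  proof (rule abelian_groupI)
    fix x assume "x \<in> carrier (FE n)"
    then show "\<exists>y\<in>carrier (FE n). y \<oplus>\<^bsub>FE n\<^esub> x = \<zero>\<^bsub>FE n\<^esub>"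
      by (intro bexI[of _ "\<lambda>w. (-1) * x w"] FE_smult) auto
  qed (auto simp: FE_add FE_zero algebra_simps)
qed (auto simp: FE_smult algebra_simps)

interpretation FE: cvs "FE n" for n
  by (rule cvs_of_complex_space[OF complex_space_FE])

lemma FE_minus: "a \<in> carrier (FE n) \<Longrightarrow> b \<in> carrier (FE n) \<Longrightarrow> a \<ominus>\<^bsub>FE n\<^esub> b = (\<lambda>w. a w - b w)"
  by (simp add: FE.minus_eq FE.neg_eq_sm)

abbreviation "fen n \<equiv> \<lambda>k::nat. fe_norm n (real (Suc k))"

lemma fe_norm_mono:
  assumes a: "a \<in> carrier (FE n)" and r: "0 < r" "r \<le> s"
  shows "fe_norm n r a \<le> fe_norm n s a"
  unfolding fe_norm_def
  by (rule infsum_mono) (use a r in \<open>auto simp: FE_carrier intro!: mult_left_mono power_mono\<close>)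

lemma seminorm_fe: "r > 0 \<Longrightarrow> seminorm (FE n) (fe_norm n r)"
  by (auto simp: seminorm_def FE_add FE_smult) (auto simp: fe_norm_def intro!: infsum_nonneg)

text \<open>The coefficients converge, and the estimates for finite partial sums survive the limit.\<close>

lemma FE_complete:
  assumes "Cauchy_in (FE n) (fen n) s"
  shows "\<exists>x. converges (FE n) (fen n) s x"
proof -
  have s: "s i \<in> carrier (FE n)" for i using assms by (simp add: Cauchy_in_def)
  have C: "\<exists>N. \<forall>i\<ge>N. \<forall>j\<ge>N. fen n k (\<lambda>w. s i w - s j w) < e" if "e > 0" for k e
    using assms that s unfolding Cauchy_in_def by (simp add: FE_minus)
  have sd: "(\<lambda>w. s i w - s j w) \<in> carrier (FE n)" for i j
    using FE.minus_closed[OF s s, of i j] by (simp add: FE_minus s)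
  have "\<exists>l. (\<lambda>i. s i w) \<longlonglongrightarrow> l" for w
  proof (cases "w \<in> words n")
    case True
    have "Cauchy (\<lambda>i. s i w)"
    proof (rule CauchyI)
      fix e :: real assume "e > 0"
      then obtain N where N: "\<And>i j. i \<ge> N \<Longrightarrow> j \<ge> N \<Longrightarrow> fen n 0 (\<lambda>w. s i w - s j w) < e"
        using C by meson
      have "norm (s i w - s j w) < e" if "i \<ge> N" "j \<ge> N" for i j
        using fe_norm_point[OF sd, of 1 w i j] True N[OF that] by simp
      then show "\<exists>M. \<forall>m\<ge>M. \<forall>n\<ge>M. norm (s m w - s n w) < e" by blast
    qed
    then show ?thesis using Cauchy_convergent_iff convergentD by blast
  next
    case False
    then have "s i w = 0" for i using s[of i] by (simp add: FE_carrier)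
    then show ?thesis by auto
  qed
  then obtain a where a: "\<And>w. (\<lambda>i. s i w) \<longlonglongrightarrow> a w" by metis
  have key: "\<exists>N. \<forall>i\<ge>N. \<forall>S. finite S \<and> S \<subseteq> words n \<longrightarrow>
      (\<Sum>w\<in>S. cmod (s i w - a w) * real (Suc k) ^ length w) \<le> e" if e: "e > 0" for k e
  proof -
    obtain N where N: "\<And>i j. i \<ge> N \<Longrightarrow> j \<ge> N \<Longrightarrow> fen n k (\<lambda>w. s i w - s j w) < e"
      using C[OF e] by meson
    have "(\<Sum>w\<in>S. cmod (s i w - a w) * real (Suc k) ^ length w) \<le> e"
      if i: "i \<ge> N" and S: "finite S" "S \<subseteq> words n" for i S
    proof (rule LIMSEQ_le_const2)
      show "(\<lambda>j. \<Sum>w\<in>S. cmod (s i w - s j w) * real (Suc k) ^ length w)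
          \<longlonglongrightarrow> (\<Sum>w\<in>S. cmod (s i w - a w) * real (Suc k) ^ length w)"
        by (intro tendsto_intros a)
      have "(\<Sum>w\<in>S. cmod (s i w - s j w) * real (Suc k) ^ length w) \<le> e" if "j \<ge> N" for j
        using fe_norm_ge[OF sd, of "real (Suc k)" S i j] S N[OF i that] by simp
      then show "\<exists>N. \<forall>j\<ge>N. (\<Sum>w\<in>S. cmod (s i w - s j w) * real (Suc k) ^ length w) \<le> e" by blast
    qed
    then show ?thesis by blast
  qed
  have a0: "a w = 0" if "w \<notin> words n" for w
    using LIMSEQ_unique[OF a[of w], of 0] s that by (simp add: FE_carrier)
  have ac: "a \<in> carrier (FE n)"
  proof (rule FE_memI[OF a0])
    fix r :: real assume r: "r > 0"
    define k where "k = nat \<lceil>r\<rceil>"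
    have rk: "r \<le> real (Suc k)" unfolding k_def by linarith
    obtain N where N: "\<And>S. finite S \<Longrightarrow> S \<subseteq> words n \<Longrightarrow> (\<Sum>w\<in>S. cmod (s N w - a w) * real (Suc k) ^ length w) \<le> 1"
      using key[of 1 k] by (metis le_refl zero_less_one)
    have "(\<Sum>w\<in>S. cmod (a w) * r ^ length w) \<le> 1 + fen n k (s N)" if S: "finite S" "S \<subseteq> words n" for S
    proof -
      have "(\<Sum>w\<in>S. cmod (a w) * r ^ length w) \<le>
          (\<Sum>w\<in>S. cmod (s N w - a w) * real (Suc k) ^ length w + cmod (s N w) * real (Suc k) ^ length w)"
      proof (rule sum_mono)
        fix w
        have "cmod (a w) \<le> cmod (s N w - a w) + cmod (s N w)"
          using norm_triangle_ineq4[of "s N w" "s N w - a w"] by simp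
        then have "cmod (a w) * r ^ length w \<le> (cmod (s N w - a w) + cmod (s N w)) * real (Suc k) ^ length w"
          using r rk by (intro mult_mono power_mono) auto
        then show "cmod (a w) * r ^ length w \<le>
            cmod (s N w - a w) * real (Suc k) ^ length w + cmod (s N w) * real (Suc k) ^ length w"
          by (simp add: distrib_right)
      qed
      also have "\<dots> \<le> 1 + fen n k (s N)"
        unfolding sum.distrib using fe_norm_ge[OF s, of "real (Suc k)" S N] S N[OF S] by simp
      finally show ?thesis .
    qed
    then show "\<exists>C. \<forall>S. finite S \<and> S \<subseteq> words n \<longrightarrow> (\<Sum>w\<in>S. cmod (a w) * r ^ length w) \<le> C" by blast
  qed
  have "converges (FE n) (fen n) s a"
    unfolding converges_def
  proof (intro conjI allI LIMSEQ_I)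
    fix k and e :: real assume e: "e > 0"
    then have "e / 2 > 0" by simp
    then obtain N where N: "\<And>i S. i \<ge> N \<Longrightarrow> finite S \<Longrightarrow> S \<subseteq> words n \<Longrightarrow>
        (\<Sum>w\<in>S. cmod (s i w - a w) * real (Suc k) ^ length w) \<le> e / 2"
      using key[of "e / 2" k] by meson
    have "norm (fen n k (s i \<ominus>\<^bsub>FE n\<^esub> a) - 0) < e" if "i \<ge> N" for i
    proof -
      have "fen n k (\<lambda>w. s i w - a w) \<le> e / 2" by (rule fe_norm_le(2)) (use N[OF that] in auto)
      moreover have "0 \<le> fen n k (\<lambda>w. s i w - a w)" unfolding fe_norm_def by (intro infsum_nonneg) auto
      ultimately show ?thesis using e by (simp add: FE_minus s ac)
    qed
    then show "\<exists>N. \<forall>i\<ge>N. norm (fen n k (s i \<ominus>\<^bsub>FE n\<^esub> a) - 0) < e" by blast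
  qed (use s ac in auto)
  then show ?thesis by blast
qed

lemma graded_frechet_FE: "graded_frechet (FE n) (fen n)"
proof
  show sn: "seminorm (FE n) (fen n k)" for k by (rule seminorm_fe) simp
  show inc: "fen n k x \<le> fen n (Suc k) x" if "x \<in> carrier (FE n)" for k x
    by (rule fe_norm_mono[OF that]) auto
  have "topol (FE n) = seminorm_topology (FE n) {fe_norm n r | r. r > 0}"
    unfolding free_entire_def by (rule topol_lc_space)
  also have "\<dots> = seminorm_topology (FE n) (range (fen n))"
  proof (rule FE.seminorm_topology_graded)
    fix q assume "q \<in> {fe_norm n r | r. r > 0}"
    then obtain r where r: "q = fe_norm n r" "r > 0" by blast
    have "r \<le> real (Suc (nat \<lceil>r\<rceil>))" by linarith
    then have "\<forall>x\<in>carrier (FE n). q x \<le> 1 * fen n (nat \<lceil>r\<rceil>) x"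
      using r fe_norm_mono by auto
    then show "\<exists>k C. \<forall>x\<in>carrier (FE n). q x \<le> C * fen n k x" by blast
  qed (use sn inc in auto)
  finally show "topol (FE n) = seminorm_topology (FE n) (range (fen n))" .
  show "x = \<zero>\<^bsub>FE n\<^esub>" if x: "x \<in> carrier (FE n)" "\<And>k. fen n k x = 0" for x
  proof -
    have "x w = 0" for w
    proof (cases "w \<in> words n")
      case True
      then show ?thesis using fe_norm_point[OF x(1), of 1 w] x(2)[of 0] by simp
    qed (use x in \<open>simp add: FE_carrier\<close>)
    then show ?thesis by auto
  qed
qed (rule FE_complete)

lemma FE_mult_assoc:
  "(\<Sum>k\<le>length w. (\<Sum>j\<le>length (take k w). a (take j (take k w)) * b (drop j (take k w))) * c (drop k w)) =
   (\<Sum>j\<le>length w. a (take j w) * (\<Sum>i\<le>length (drop j w). b (take i (drop j w)) * c (drop i (drop j w))))"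
  for a b c :: "'x list \<Rightarrow> complex"
proof -
  let ?n = "length w"
  let ?g = "\<lambda>j i. a (take j w) * b (take i (drop j w)) * c (drop (i + j) w)"
  have "(\<Sum>k\<le>?n. (\<Sum>j\<le>length (take k w). a (take j (take k w)) * b (drop j (take k w))) * c (drop k w)) =
      (\<Sum>k\<le>?n. \<Sum>j\<le>k. ?g j (k - j))"
  proof (rule sum.cong[OF refl])
    fix k assume k: "k \<in> {..?n}"
    then have len: "length (take k w) = k" by simp
    show "(\<Sum>j\<le>length (take k w). a (take j (take k w)) * b (drop j (take k w))) * c (drop k w) =
        (\<Sum>j\<le>k. ?g j (k - j))"
      unfolding len sum_distrib_right
      by (rule sum.cong[OF refl]) (simp add: drop_take min_absorb1)
  qed
  also have "\<dots> = (\<Sum>(j, i)\<in>{(j, i). j + i \<le> ?n}. ?g j i)"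
    by (rule sum.triangle_reindex_eq[of ?g ?n, symmetric])
  also have "{(j, i). j + i \<le> ?n} = Sigma {..?n} (\<lambda>j. {..?n - j})" by auto
  also have "(\<Sum>(j, i)\<in>Sigma {..?n} (\<lambda>j. {..?n - j}). ?g j i) = (\<Sum>j\<le>?n. \<Sum>i\<le>?n - j. ?g j i)"
    by (rule sum.Sigma[of "{..?n}" "\<lambda>j. {..?n - j}" ?g, symmetric]) auto
  finally show ?thesis by (simp add: sum_distrib_left mult.assoc)
qed

text \<open>Only the position \<open>length u\<close> contributes.\<close>

lemma mon_mult:
  "(\<Sum>k\<le>length w. fe_mon u (take k w) * fe_mon v (drop k w)) = fe_mon (u @ v) w"
proof -
  have "(\<Sum>k\<le>length w. fe_mon u (take k w) * fe_mon v (drop k w)) =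
      (\<Sum>k\<le>length w. if k = length u then fe_mon (u @ v) w else 0)"
  proof (rule sum.cong[OF refl])
    fix k assume "k \<in> {..length w}"
    then have len: "length (take k w) = k" by simp
    show "fe_mon u (take k w) * fe_mon v (drop k w) = (if k = length u then fe_mon (u @ v) w else 0)"
    proof (cases "k = length u")
      case True
      have "w = u @ v \<longleftrightarrow> take k w = u \<and> drop k w = v"
        using append_eq_conv_conj[of u v w] True by metis
      then show ?thesis using True by (simp add: fe_mon_def)
    next
      case False
      then have "take k w \<noteq> u" using len by metis
      then show ?thesis using False by (simp add: fe_mon_def)
    qed
  qed
  also have "\<dots> = fe_mon (u @ v) w" by (auto simp: fe_mon_def)
  finally show ?thesis .
qed

theorem graded_algebra_FE: "graded_algebra (FE n) (fen n)"
proof -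
  have "monoid (FE n)"
  proof (rule monoidI)
    show "\<one>\<^bsub>FE n\<^esub> \<in> carrier (FE n)" using fe_mon_carrier[of "[]" n] by (simp add: one_eq_mon)
    fix x assume x: "x \<in> carrier (FE n)"
    show "\<one>\<^bsub>FE n\<^esub> \<otimes>\<^bsub>FE n\<^esub> x = x"
    proof
      fix w :: "nat list"
      have "(\<Sum>k\<le>length w. (if take k w = [] then 1 else 0) * x (drop k w)) = (\<Sum>k\<le>length w. if k = 0 then x w else 0)"
        by (rule sum.cong) auto
      then show "(\<one>\<^bsub>FE n\<^esub> \<otimes>\<^bsub>FE n\<^esub> x) w = x w" by simp
    qed
    show "x \<otimes>\<^bsub>FE n\<^esub> \<one>\<^bsub>FE n\<^esub> = x"
    proof
      fix w :: "nat list"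
      have "(\<Sum>k\<le>length w. x (take k w) * (if drop k w = [] then 1 else 0)) = (\<Sum>k\<le>length w. if k = length w then x w else 0)"
        by (rule sum.cong) auto
      then show "(x \<otimes>\<^bsub>FE n\<^esub> \<one>\<^bsub>FE n\<^esub>) w = x w" by simp
    qed
  qed (simp_all only: FE_simps FE_mult FE_mult_assoc)
  then have ring: "ring (FE n)"
  proof (rule ringI[OF FE.M.abelian_group_axioms])
    fix x y z
    show "(x \<oplus>\<^bsub>FE n\<^esub> y) \<otimes>\<^bsub>FE n\<^esub> z = x \<otimes>\<^bsub>FE n\<^esub> z \<oplus>\<^bsub>FE n\<^esub> y \<otimes>\<^bsub>FE n\<^esub> z"
      unfolding FE_simps by (rule ext) (simp only: distrib_right sum.distrib)
    show "z \<otimes>\<^bsub>FE n\<^esub> (x \<oplus>\<^bsub>FE n\<^esub> y) = z \<otimes>\<^bsub>FE n\<^esub> x \<oplus>\<^bsub>FE n\<^esub> z \<otimes>\<^bsub>FE n\<^esub> y"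
      unfolding FE_simps by (rule ext) (simp only: distrib_left sum.distrib)
  qed
  show ?thesis
  proof (rule graded_algebra.intro[OF graded_frechet_FE ring], unfold_locales)
    fix x y c k assume xy: "x \<in> carrier (FE n)" "y \<in> carrier (FE n)"
    show "(c \<odot>\<^bsub>FE n\<^esub> x) \<otimes>\<^bsub>FE n\<^esub> y = c \<odot>\<^bsub>FE n\<^esub> (x \<otimes>\<^bsub>FE n\<^esub> y)"
      unfolding FE_simps by (rule ext) (simp only: sum_distrib_left mult.assoc)
    show "x \<otimes>\<^bsub>FE n\<^esub> (c \<odot>\<^bsub>FE n\<^esub> y) = c \<odot>\<^bsub>FE n\<^esub> (x \<otimes>\<^bsub>FE n\<^esub> y)"
      unfolding FE_simps by (rule ext) (simp only: sum_distrib_left mult.left_commute)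
    show "fen n k (x \<otimes>\<^bsub>FE n\<^esub> y) \<le> fen n k x * fen n k y"
      unfolding FE_simps by (rule FE_mult(2)[OF xy]) simp
  qed
qed

interpretation FE: graded_algebra "FE n" "fen n" for n
  by (rule graded_algebra_FE)

lemma fv_ext_mon:
  "Poly_Mapping.keys u \<subseteq> words n \<Longrightarrow> fv_ext (FE n) fe_mon u = Poly_Mapping.lookup u"
proof (induction rule: fv_induct)
  case zero
  show ?case by (simp add: fv_ext_def)
next
  case (single k c)
  have "fv_ext (FE n) fe_mon (Poly_Mapping.single k c) = c \<odot>\<^bsub>FE n\<^esub> fe_mon k"
    by (rule FE.fv_ext_single[of "words n"]) (use single in auto)
  also have "\<dots> = Poly_Mapping.lookup (Poly_Mapping.single k c)"
    by (rule ext) (simp add: fe_mon_def lookup_single when_def)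
  finally show ?case .
next
  case (add u v)
  have "fv_ext (FE n) fe_mon (u + v) = fv_ext (FE n) fe_mon u \<oplus>\<^bsub>FE n\<^esub> fv_ext (FE n) fe_mon v"
    by (rule FE.fv_ext_add[of "words n"]) (use add in auto)
  then show ?case using add by (simp add: lookup_add fun_eq_iff)
qed

lemma finite_words_le: "finite {w \<in> words n. length w \<le> i}"
proof -
  have "{w \<in> words n. length w \<le> i} = {w. set w \<subseteq> {1..n} \<and> length w \<le> i}"
    unfolding lists_eq_set by blast
  then show ?thesis using finite_lists_length_le[of "{1..n}" i] by (simp only: finite_atLeastAtMost)
qed

definition fe_trunc :: "(nat list \<Rightarrow> complex) \<Rightarrow> nat \<Rightarrow> nat \<Rightarrow> nat list \<Rightarrow>\<^sub>0 complex" where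
  "fe_trunc a n i = Abs_poly_mapping (\<lambda>w. if w \<in> words n \<and> length w \<le> i then a w else 0)"

lemma lookup_fe_trunc: "Poly_Mapping.lookup (fe_trunc a n i) w = (if w \<in> words n \<and> length w \<le> i then a w else 0)"
proof -
  have "finite {w. (if w \<in> words n \<and> length w \<le> i then a w else 0) \<noteq> 0}"
    by (rule finite_subset[OF _ finite_words_le[of n i]]) (rule subsetI, simp split: if_splits)
  then show ?thesis unfolding fe_trunc_def by simp
qed

lemma keys_fe_trunc: "Poly_Mapping.keys (fe_trunc a n i) \<subseteq> words n"
  by (rule subsetI) (simp add: in_keys_iff lookup_fe_trunc split: if_splits)

text \<open>The tails of the absolutely convergent series defining the norms tend to 0.\<close>

lemma fe_trunc_converges:
  assumes a: "a \<in> carrier (FE n)"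
  shows "converges (FE n) (fen n) (\<lambda>i. fv_ext (FE n) fe_mon (fe_trunc a n i)) a"
proof -
  let ?t = "\<lambda>i. Poly_Mapping.lookup (fe_trunc a n i)"
  have t: "?t i \<in> carrier (FE n)" for i
    unfolding fv_ext_mon[OF keys_fe_trunc, symmetric]
    by (rule FE.fv_ext_closed[OF _ keys_fe_trunc]) (rule fe_mon_carrier)
  have "(\<lambda>i. fen n k (?t i \<ominus>\<^bsub>FE n\<^esub> a)) \<longlonglongrightarrow> 0" for k
  proof (rule LIMSEQ_I)
    fix e :: real assume e: "e > 0"
    let ?f = "\<lambda>w. cmod (a w) * real (Suc k) ^ length w"
    have summ: "?f summable_on words n" using a by (simp add: FE_carrier)
    obtain S where S: "finite S" "S \<subseteq> words n" "dist (sum ?f S) (infsum ?f (words n)) \<le> e / 2"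
      using infsum_finite_approximation[OF summ, of "e / 2"] e by auto
    define N where "N = Max (length ` S)"
    have N: "length w \<le> N" if "w \<in> S" for w
      unfolding N_def by (rule Max_ge) (use S(1) that in auto)
    have "norm (fen n k (?t i \<ominus>\<^bsub>FE n\<^esub> a) - 0) < e" if i: "i \<ge> N" for i
    proof -
      have "(\<Sum>w\<in>R. cmod (?t i w - a w) * real (Suc k) ^ length w) \<le> e / 2"
        if R: "finite R" "R \<subseteq> words n" for R
      proof -
        have zero: "?t i w = a w" if "w \<in> S" for w
        proof -
          have "w \<in> words n" "length w \<le> i" using S(2) N[OF that] i that by auto
          then show ?thesis by (simp only: lookup_fe_trunc if_True simp_thms)
        qed
        have "(\<Sum>w\<in>R. cmod (?t i w - a w) * real (Suc k) ^ length w) =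
            (\<Sum>w\<in>R - S. cmod (?t i w - a w) * real (Suc k) ^ length w)"
          by (rule sum.mono_neutral_right[OF R(1)]) (use zero in auto)
        also have "\<dots> \<le> (\<Sum>w\<in>R - S. ?f w)"
        proof (rule sum_mono)
          fix w
          have "cmod (?t i w - a w) \<le> cmod (a w)" by (simp only: lookup_fe_trunc split: if_split) simp
          then show "cmod (?t i w - a w) * real (Suc k) ^ length w \<le> ?f w" by (intro mult_right_mono) auto
        qed
        also have "\<dots> = sum ?f ((R - S) \<union> S) - sum ?f S"
          by (subst sum.union_disjoint) (use R S in auto)
        also have "\<dots> \<le> infsum ?f (words n) - sum ?f S"
          using finite_sum_le_infsum[OF summ, of "(R - S) \<union> S"] R S by auto
        also have "\<dots> \<le> e / 2" using S(3) unfolding dist_real_def by linarith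
        finally show ?thesis .
      qed
      then have "fen n k (\<lambda>w. ?t i w - a w) \<le> e / 2" by (intro fe_norm_le(2)) auto
      moreover have "0 \<le> fen n k (\<lambda>w. ?t i w - a w)" unfolding fe_norm_def by (intro infsum_nonneg) auto
      ultimately show ?thesis using e by (simp add: FE_minus t a)
    qed
    then show "\<exists>N. \<forall>i\<ge>N. norm (fen n k (?t i \<ominus>\<^bsub>FE n\<^esub> a) - 0) < e" by blast
  qed
  then show ?thesis unfolding fv_ext_mon[OF keys_fe_trunc] converges_def using t a by blast
qed

lemma generates_FE: "generates (FE n) (fen n) (words n) fe_mon"
  unfolding generates_def
proof (intro conjI ballI)
  fix x assume "x \<in> carrier (FE n)"
  then show "\<exists>s. (\<forall>i. Poly_Mapping.keys (s i) \<subseteq> words n) \<and> converges (FE n) (fen n) (\<lambda>i. fv_ext (FE n) fe_mon (s i)) x"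
    using fe_trunc_converges[of x n] keys_fe_trunc[of x n] by (intro exI[of _ "fe_trunc x n"]) blast
qed (rule fe_mon_carrier)

lemma gen_eq_mon: "fe_gen i = fe_mon [i]"
  by (simp add: fe_gen_def fe_mon_def)

lemma gen_carrier: "i \<in> {1..n} \<Longrightarrow> fe_gen i \<in> carrier (FE n)"
  by (simp add: gen_eq_mon)

lemma mon_append: "fe_mon u \<otimes>\<^bsub>FE n\<^esub> fe_mon v = fe_mon (u @ v)"
  by (simp add: mon_mult)

text \<open>Words are products of generators and their span is dense.\<close>

lemma FE_hom_eq:
  assumes B: "graded_algebra B q" and f: "f \<in> alg_hom (FE n) (fen n) B q" and g: "g \<in> alg_hom (FE n) (fen n) B q"
    and eq: "\<And>i. i \<in> {1..n} \<Longrightarrow> f (fe_gen i) = g (fe_gen i)" and x: "x \<in> carrier (FE n)"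
  shows "f x = g x"
proof -
  interpret B: graded_algebra B q by fact
  have "f (fe_mon w) = g (fe_mon w)" if "w \<in> words n" for w
    using that
  proof (induction w)
    case Nil
    then show ?case using alg_homD(3)[OF f] alg_homD(3)[OF g] by (simp add: one_eq_mon)
  next
    case (Cons i w)
    have "fe_mon (i # w) = fe_gen i \<otimes>\<^bsub>FE n\<^esub> fe_mon w"
      unfolding gen_eq_mon mon_append by simp
    moreover have "fe_gen i \<in> carrier (FE n)" "fe_mon w \<in> carrier (FE n)"
      using Cons by (auto intro: gen_carrier)
    ultimately show ?case
      using Cons eq[of i] alg_homD(2)[OF f] alg_homD(2)[OF g] by (simp del: FE_simps)
  qed
  then show ?thesis
    using generates_eq[OF generates_FE graded_frechet_FE B.frechet alg_homD(1)[OF f] alg_homD(1)[OF g] _ x] by blast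
qed

text \<open>If all \<open>q j (b i)\<close> are at most \<open>R\<close>, the product of the \<open>b i\<close> along a word \<open>w\<close> has seminorm at most
  \<open>q j 1 * R ^ |w|\<close>. The linear extension is thus bounded by the weighted \<open>l^1\<close> norm of radius \<open>R\<close>.\<close>

theorem FE_hom_exists:
  assumes B: "graded_algebra B q" and b: "\<And>i. i \<in> {1..n} \<Longrightarrow> b i \<in> carrier B"
  shows "\<exists>f\<in>alg_hom (FE n) (fen n) B q. \<forall>i\<in>{1..n}. f (fe_gen i) = b i"
proof -
  interpret B: graded_algebra B q by fact
  define wp where "wp = (\<lambda>w. foldr (\<lambda>i x. b i \<otimes>\<^bsub>B\<^esub> x) w \<one>\<^bsub>B\<^esub>)"
  have wp_simps: "wp [] = \<one>\<^bsub>B\<^esub>" "wp (i # w) = b i \<otimes>\<^bsub>B\<^esub> wp w" for i w by (simp_all add: wp_def)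
  have wp_closed: "w \<in> words n \<Longrightarrow> wp w \<in> carrier B" for w
    by (induction w) (auto simp: wp_simps b)
  have wp_append: "u \<in> words n \<Longrightarrow> v \<in> words n \<Longrightarrow> wp (u @ v) = wp u \<otimes>\<^bsub>B\<^esub> wp v" for u v
    by (induction u) (auto simp: wp_simps b wp_closed B.mul_assoc)
  have bound: "q j (wp w) \<le> q j \<one>\<^bsub>B\<^esub> * R ^ length w"
    if "w \<in> words n" "\<And>i. i \<in> {1..n} \<Longrightarrow> q j (b i) \<le> R" "R \<ge> 0" for j w R
    using that(1)
  proof (induction w)
    case Nil
    then show ?case by (simp add: wp_simps)
  next
    case (Cons i w)
    have wc: "wp w \<in> carrier B" by (rule wp_closed) (use Cons in simp)
    have bi: "b i \<in> carrier B" "q j (b i) \<le> R" using Cons b that(2) by auto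
    have "q j (wp (i # w)) \<le> q j (b i) * q j (wp w)"
      unfolding wp_simps by (rule B.submult[OF bi(1) wc])
    also have "\<dots> \<le> R * (q j \<one>\<^bsub>B\<^esub> * R ^ length w)"
      by (intro mult_mono bi Cons.IH that(3) B.nonneg wc)
    finally show ?case by (simp add: mult_ac)
  qed
  have "\<exists>f\<in>cont_linear (FE n) B. \<forall>w\<in>words n. f (fe_mon w) = wp w"
  proof (rule generates_extend[OF generates_FE graded_frechet_FE B.frechet wp_closed])
    fix j
    define R where "R = (\<Sum>i\<in>{1..n}. q j (b i))"
    have R: "q j (b i) \<le> R" if "i \<in> {1..n}" for i
      unfolding R_def by (rule member_le_sum) (use that b in auto)
    have R0: "R \<ge> 0" unfolding R_def by (intro sum_nonneg) (use b in auto)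
    \<comment> \<open>an integral radius that is at least \<open>R\<close>; the radius of the \<open>k\<close>-th norm is \<open>k + 1\<close>\<close>
    define k where "k = nat \<lceil>R\<rceil>"
    have k: "R \<le> real (Suc k)" unfolding k_def by linarith
    have "q j (fv_ext B wp u) \<le> q j \<one>\<^bsub>B\<^esub> * fen n k (fv_ext (FE n) fe_mon u)"
      if u: "Poly_Mapping.keys u \<subseteq> words n" for u
    proof -
      have "q j (fv_ext B wp u) \<le> wsum (\<lambda>w. q j (wp w)) u"
        by (rule B.fv_ext_seminorm[OF wp_closed B.snorm u])
      also have "\<dots> \<le> q j \<one>\<^bsub>B\<^esub> * wsum (\<lambda>w. real (Suc k) ^ length w) u"
      proof (rule wsum_mono[OF _ u])
        fix w assume w: "w \<in> words n"
        have "q j (wp w) \<le> q j \<one>\<^bsub>B\<^esub> * R ^ length w" by (rule bound[OF w R R0])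
        also have "\<dots> \<le> q j \<one>\<^bsub>B\<^esub> * real (Suc k) ^ length w"
          by (intro mult_left_mono power_mono k R0) auto
        finally show "q j (wp w) \<le> q j \<one>\<^bsub>B\<^esub> * real (Suc k) ^ length w" .
      qed
      also have "wsum (\<lambda>w. real (Suc k) ^ length w) u \<le> fen n k (fv_ext (FE n) fe_mon u)"
      proof -
        have "fv_ext (FE n) fe_mon u \<in> carrier (FE n)"
          by (rule FE.fv_ext_closed[of "words n"]) (use u in auto)
        then show ?thesis
          unfolding wsum_def fv_ext_mon[OF u] by (intro fe_norm_ge) (use u in auto)
      qed
      finally show ?thesis by (simp add: mult_left_mono)
    qed
    then show "\<exists>k C. \<forall>u. Poly_Mapping.keys u \<subseteq> words n \<longrightarrow>
        q j (fv_ext B wp u) \<le> C * fen n k (fv_ext (FE n) fe_mon u)" by blast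
  qed
  then obtain f where f: "f \<in> cont_linear (FE n) B" "\<And>w. w \<in> words n \<Longrightarrow> f (fe_mon w) = wp w" by blast
  have fb: "f \<in> blin (FE n) (fen n) B q" by (rule cont_linear_blin[OF f(1) graded_frechet_FE B.frechet])
  have "f (x \<otimes>\<^bsub>FE n\<^esub> y) = f x \<otimes>\<^bsub>B\<^esub> f y" if x: "x \<in> carrier (FE n)" and y: "y \<in> carrier (FE n)" for x y
  proof (rule generates_eq[OF generates_FE graded_frechet_FE B.frechet _ _ _ x])
    show "(\<lambda>x. f (x \<otimes>\<^bsub>FE n\<^esub> y)) \<in> blin (FE n) (fen n) B q"
      by (rule blin_comp[OF FE.mult_blin_right[OF y] fb graded_frechet_FE])
    show "(\<lambda>x. f x \<otimes>\<^bsub>B\<^esub> f y) \<in> blin (FE n) (fen n) B q"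
      by (rule blin_comp[OF fb B.mult_blin_right[OF blinD(1)[OF fb y]] B.frechet])
    fix u assume u: "u \<in> words n"
    show "f (fe_mon u \<otimes>\<^bsub>FE n\<^esub> y) = f (fe_mon u) \<otimes>\<^bsub>B\<^esub> f y"
    proof (rule generates_eq[OF generates_FE graded_frechet_FE B.frechet _ _ _ y])
      show "(\<lambda>y. f (fe_mon u \<otimes>\<^bsub>FE n\<^esub> y)) \<in> blin (FE n) (fen n) B q"
        by (rule blin_comp[OF FE.mult_blin_left[OF fe_mon_carrier[OF u]] fb graded_frechet_FE])
      show "(\<lambda>y. f (fe_mon u) \<otimes>\<^bsub>B\<^esub> f y) \<in> blin (FE n) (fen n) B q"
        by (rule blin_comp[OF fb B.mult_blin_left[OF blinD(1)[OF fb fe_mon_carrier[OF u]]] B.frechet])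
      show "f (fe_mon u \<otimes>\<^bsub>FE n\<^esub> fe_mon v) = f (fe_mon u) \<otimes>\<^bsub>B\<^esub> f (fe_mon v)" if "v \<in> words n" for v
        unfolding mon_append using u that by (simp add: f wp_append)
    qed
  qed
  moreover have "f \<one>\<^bsub>FE n\<^esub> = \<one>\<^bsub>B\<^esub>" using f(2)[of "[]"] by (simp add: one_eq_mon wp_simps)
  ultimately have "f \<in> alg_hom (FE n) (fen n) B q" using fb by (simp add: alg_hom_def del: FE_simps)
  moreover have "f (fe_gen i) = b i" if "i \<in> {1..n}" for i
    using that b by (simp add: gen_eq_mon f wp_simps)
  ultimately show ?thesis by blast
qed

section \<open>Quotients by closed ideals\<close>

locale closed_ideal = graded_algebra A p for A :: "'a lc_struct" (structure) and p +
  fixes I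
  assumes ideal: "ideal I A" and closed: "closedin (topol A) I"
begin

abbreviation "Q \<equiv> quot_alg A I"
abbreviation cl where "cl x \<equiv> I +>\<^bsub>A\<^esub> x"
text \<open>The distance of the coset from the origin in the seminorm \<open>p k\<close>.\<close>

definition "qn k C = Inf (p k ` C)"

lemma I_sub: "x \<in> I \<Longrightarrow> x \<in> carrier A"
  using additive_subgroup.a_subset[OF ideal.axioms(1)[OF ideal]] by blast

lemma I_closed:
  "x \<in> I \<Longrightarrow> y \<in> I \<Longrightarrow> x \<oplus> y \<in> I" "x \<in> carrier A \<Longrightarrow> y \<in> I \<Longrightarrow> x \<otimes> y \<in> I"
  "y \<in> I \<Longrightarrow> c \<odot> y \<in> I" "\<zero> \<in> I"
proof -
  interpret I: Ideal.ideal I A by (rule ideal)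
  show "x \<in> I \<Longrightarrow> y \<in> I \<Longrightarrow> x \<oplus> y \<in> I" by (rule I.a_closed)
  show *: "x \<in> carrier A \<Longrightarrow> y \<in> I \<Longrightarrow> x \<otimes> y \<in> I" for x y by (rule I.I_l_closed)
  show "c \<odot> y \<in> I" if "y \<in> I"
    using *[of "c \<odot> \<one>" y] that I_sub[OF that] by (simp add: sm_mult_left)
  show "\<zero> \<in> I" by (rule I.zero_closed)
qed

lemma cl_eq_iff: "x \<in> carrier A \<Longrightarrow> y \<in> carrier A \<Longrightarrow> cl x = cl y \<longleftrightarrow> x \<ominus> y \<in> I"
  using ring.quotient_eq_iff_same_a_r_cos[OF ring ideal] by blast

lemma mem_cl: "x \<in> carrier A \<Longrightarrow> y \<in> cl x \<longleftrightarrow> y \<in> carrier A \<and> cl y = cl x"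
proof
  assume x: "x \<in> carrier A" and y: "y \<in> cl x"
  have "y \<in> carrier A" using M.a_r_coset_subset_G[of I x] I_sub x y by blast
  moreover have "cl x = cl y"
    by (rule M.a_repr_independence[OF y x]) (rule additive_subgroup.a_subgroup[OF ideal.axioms(1)[OF ideal]])
  ultimately show "y \<in> carrier A \<and> cl y = cl x" by simp
next
  interpret I: Ideal.ideal I A by (rule ideal)
  assume "x \<in> carrier A" and y: "y \<in> carrier A \<and> cl y = cl x"
  then show "y \<in> cl x" using I.a_rcos_self[of y] by simp
qed

lemma carrier_Q: "carrier Q = cl ` carrier A"
  by (auto simp: quot_alg_def FactRing_def A_RCOSETS_def')

lemma cl_closed [simp, intro]: "x \<in> carrier A \<Longrightarrow> cl x \<in> carrier Q"
  by (simp add: carrier_Q)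

lemma Q_ops:
  "x \<in> carrier A \<Longrightarrow> y \<in> carrier A \<Longrightarrow> cl x \<oplus>\<^bsub>Q\<^esub> cl y = cl (x \<oplus> y)"
  "x \<in> carrier A \<Longrightarrow> y \<in> carrier A \<Longrightarrow> cl x \<otimes>\<^bsub>Q\<^esub> cl y = cl (x \<otimes> y)"
  "\<one>\<^bsub>Q\<^esub> = cl \<one>"
proof -
  interpret I: Ideal.ideal I A by (rule ideal)
  show "x \<in> carrier A \<Longrightarrow> y \<in> carrier A \<Longrightarrow> cl x \<oplus>\<^bsub>Q\<^esub> cl y = cl (x \<oplus> y)"
    "x \<in> carrier A \<Longrightarrow> y \<in> carrier A \<Longrightarrow> cl x \<otimes>\<^bsub>Q\<^esub> cl y = cl (x \<otimes> y)" "\<one>\<^bsub>Q\<^esub> = cl \<one>"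
    using I.rcos_ring_hom by (auto simp: quot_alg_def ring_hom_def)
qed

lemma ring_Q: "ring Q"
proof -
  interpret I: Ideal.ideal I A by (rule ideal)
  interpret R: ring "A Quot I" by (rule I.quotient_is_ring)
  have fields: "carrier Q = carrier (A Quot I)" "add Q = add (A Quot I)" "zero Q = zero (A Quot I)"
    "mult Q = mult (A Quot I)" "one Q = one (A Quot I)"
    by (simp_all only: quot_alg_def lc_struct.simps module.simps ring.simps monoid.simps partial_object.simps)
  have "abelian_group Q"
  proof (rule abelian_groupI)
    fix x assume "x \<in> carrier Q"
    then show "\<exists>y\<in>carrier Q. y \<oplus>\<^bsub>Q\<^esub> x = \<zero>\<^bsub>Q\<^esub>"
      unfolding fields using R.a_inv_closed R.l_neg by blast
  qed (simp_all only: fields R.a_closed R.zero_closed R.a_ac R.l_zero R.r_zero)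
  then show ?thesis
  proof (rule ringI)
    show "monoid Q" by (rule monoidI) (simp_all only: fields R.m_closed R.one_closed R.m_assoc R.l_one R.r_one)
  qed (simp_all only: fields R.l_distr R.r_distr)
qed

lemma smult_Q: assumes x: "x \<in> carrier A" shows "c \<odot>\<^bsub>Q\<^esub> cl x = cl (c \<odot> x)"
proof -
  have "cl (c \<odot> y) = cl (c \<odot> x)" if "y \<in> cl x" for y
  proof -
    have y: "y \<in> carrier A" "y \<ominus> x \<in> I" using that mem_cl[OF x] cl_eq_iff x by auto
    have "c \<odot> y \<ominus> c \<odot> x \<in> I" using I_closed(3)[OF y(2), of c] x y by (simp add: sm_minus)
    then show ?thesis using cl_eq_iff x y by simp
  qed
  moreover have "x \<in> cl x" using mem_cl x by simp
  ultimately have "(\<Union>y\<in>cl x. cl (c \<odot> y)) = cl (c \<odot> x)" by blast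
  then show ?thesis by (simp add: quot_alg_def)
qed

lemma complex_space_Q: "complex_space Q"
proof (rule complex_spaceI)
  show "abelian_group Q" using ring_Q by (simp add: ring_def)
qed (auto simp: carrier_Q smult_Q Q_ops sm_ladd sm_radd)

sublocale Q: cvs Q
  by (rule cvs_of_complex_space[OF complex_space_Q])

lemma minus_Q: "x \<in> carrier A \<Longrightarrow> y \<in> carrier A \<Longrightarrow> cl x \<ominus>\<^bsub>Q\<^esub> cl y = cl (x \<ominus> y)"
  by (simp add: Q.minus_eq Q.neg_eq_sm smult_Q Q_ops minus_eq neg_eq_sm)

lemma zero_Q: "\<zero>\<^bsub>Q\<^esub> = cl \<zero>"
  using minus_Q[of \<zero> \<zero>] Q.minus_self[of "cl \<zero>"] by (simp add: minus_self)

lemma qn_le: "x \<in> carrier A \<Longrightarrow> y \<in> cl x \<Longrightarrow> qn k (cl x) \<le> p k y"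
  unfolding qn_def by (rule cInf_lower) (auto intro!: bdd_belowI[of _ 0] simp: mem_cl)

lemma qn_le_self: "x \<in> carrier A \<Longrightarrow> qn k (cl x) \<le> p k x"
  by (rule qn_le) (auto simp: mem_cl)

lemma qn_greatest: "x \<in> carrier A \<Longrightarrow> (\<And>y. y \<in> carrier A \<Longrightarrow> cl y = cl x \<Longrightarrow> c \<le> p k y) \<Longrightarrow> c \<le> qn k (cl x)"
proof -
  assume x: "x \<in> carrier A" and le: "\<And>y. y \<in> carrier A \<Longrightarrow> cl y = cl x \<Longrightarrow> c \<le> p k y"
  have "x \<in> cl x" using mem_cl x by simp
  then show ?thesis unfolding qn_def by (intro cInf_greatest) (use le mem_cl[OF x] in auto)
qed

lemma qn_approx:
  assumes "x \<in> carrier A" "qn k (cl x) < c"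
  obtains y where "y \<in> carrier A" "cl y = cl x" "p k y < c"
proof (rule ccontr)
  assume "\<not> thesis"
  then have "c \<le> qn k (cl x)" using that by (intro qn_greatest[OF assms(1)]) force
  then show False using assms(2) by simp
qed

lemma qn_seminorm: "seminorm Q (qn k)"
  unfolding seminorm_def
proof (intro conjI ballI allI)
  fix X c assume "X \<in> carrier Q"
  then obtain x where x: "X = cl x" "x \<in> carrier A" by (auto simp: carrier_Q)
  show nn: "0 \<le> qn k X" unfolding x(1) by (rule qn_greatest[OF x(2)]) auto
  have le: "qn k (cl (c \<odot> x)) \<le> cmod c * qn k (cl x)" if x: "x \<in> carrier A" for c x
  proof (rule field_le_epsilon)
    fix e :: real assume e: "e > 0"
    then have "qn k (cl x) < qn k (cl x) + e / (cmod c + 1)" by (simp add: add_nonneg_pos)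
    then obtain y where y: "y \<in> carrier A" "cl y = cl x" "p k y < qn k (cl x) + e / (cmod c + 1)"
      by (rule qn_approx[OF x])
    have "cl (c \<odot> y) = cl (c \<odot> x)" using y x smult_Q by metis
    then have "qn k (cl (c \<odot> x)) \<le> p k (c \<odot> y)" using qn_le_self[of "c \<odot> y" k] y by simp
    also have "\<dots> \<le> cmod c * (qn k (cl x) + e / (cmod c + 1))"
      using y by (simp add: p_sm mult_left_mono)
    also have "\<dots> \<le> cmod c * qn k (cl x) + e"
    proof -
      have "cmod c / (cmod c + 1) \<le> 1" by (simp add: divide_simps add_nonneg_pos)
      then have "cmod c * (e / (cmod c + 1)) \<le> e"
        using mult_left_mono[of "cmod c / (cmod c + 1)" 1 e] e by (simp add: mult.commute)
      then show ?thesis by (simp add: distrib_left)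
    qed
    finally show "qn k (cl (c \<odot> x)) \<le> cmod c * qn k (cl x) + e" .
  qed
  show "qn k (c \<odot>\<^bsub>Q\<^esub> X) = cmod c * qn k X"
  proof (cases "c = 0")
    case True
    have "qn k (cl \<zero>) \<le> p k \<zero>" by (rule qn_le_self) simp
    moreover have "0 \<le> qn k (cl \<zero>)" by (rule qn_greatest) auto
    ultimately show ?thesis using True x by (simp add: smult_Q)
  next
    case False
    have "qn k (cl x) \<le> cmod (1 / c) * qn k (cl (c \<odot> x))"
      using le[of "c \<odot> x" "1 / c"] x(2) False by simp
    then have "cmod c * qn k (cl x) \<le> qn k (cl (c \<odot> x))"
      using False by (simp add: norm_divide field_simps)
    then show ?thesis using le[OF x(2), of c] x by (simp add: smult_Q)
  qed
  fix Y assume "Y \<in> carrier Q"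
  then obtain y where y: "Y = cl y" "y \<in> carrier A" by (auto simp: carrier_Q)
  show "qn k (X \<oplus>\<^bsub>Q\<^esub> Y) \<le> qn k X + qn k Y"
  proof (rule field_le_epsilon)
    fix e :: real assume "e > 0"
    then have *: "qn k (cl x) < qn k (cl x) + e / 2" "qn k (cl y) < qn k (cl y) + e / 2" by auto
    obtain x' where x': "x' \<in> carrier A" "cl x' = cl x" "p k x' < qn k (cl x) + e / 2"
      by (rule qn_approx[OF x(2) *(1)])
    obtain y' where y': "y' \<in> carrier A" "cl y' = cl y" "p k y' < qn k (cl y) + e / 2"
      by (rule qn_approx[OF y(2) *(2)])
    have "X \<oplus>\<^bsub>Q\<^esub> Y = cl (x' \<oplus> y')" using x y x' y' Q_ops(1) by metis
    then have "qn k (X \<oplus>\<^bsub>Q\<^esub> Y) \<le> p k (x' \<oplus> y')" using qn_le_self x' y' by simp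
    also have "\<dots> \<le> p k x' + p k y'" using x' y' by (intro p_add)
    finally show "qn k (X \<oplus>\<^bsub>Q\<^esub> Y) \<le> qn k X + qn k Y + e" using x' y' x y by simp
  qed
qed

lemma qn_nonneg: "x \<in> carrier A \<Longrightarrow> 0 \<le> qn k (cl x)"
  by (rule Q.snorm_nonneg[OF qn_seminorm]) simp

text \<open>Products of almost optimal representatives of two cosets represent the product of the cosets.\<close>

lemma qn_submult:
  assumes x: "x \<in> carrier A" and y: "y \<in> carrier A"
  shows "qn k (cl (x \<otimes> y)) \<le> qn k (cl x) * qn k (cl y)"
proof -
  have 1: "qn k (cl (x \<otimes> y)) \<le> p k x' * p k y'"
    if "x' \<in> carrier A" "cl x' = cl x" "y' \<in> carrier A" "cl y' = cl y" for x' y'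
  proof -
    have "cl (x \<otimes> y) = cl (x' \<otimes> y')" using Q_ops(2) x y that by metis
    then show ?thesis using qn_le_self[of "x' \<otimes> y'" k] submult[of x' y' k] that by simp
  qed
  have 2: "qn k (cl (x \<otimes> y)) \<le> p k x' * qn k (cl y)" if x': "x' \<in> carrier A" "cl x' = cl x" for x'
  proof (cases "p k x' = 0")
    case True
    then show ?thesis using 1[OF x' y refl] by simp
  next
    case False
    then have pos: "p k x' > 0" using nonneg[OF x'(1), of k] by linarith
    have "qn k (cl (x \<otimes> y)) / p k x' \<le> qn k (cl y)"
      by (rule qn_greatest[OF y]) (use 1[OF x'] pos in \<open>simp add: field_simps\<close>)
    then show ?thesis using pos by (simp add: field_simps)
  qed
  show ?thesis
  proof (cases "qn k (cl y) = 0")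
    case True
    then show ?thesis using 2[OF x refl] by simp
  next
    case False
    then have pos: "qn k (cl y) > 0" using qn_nonneg[OF y, of k] by simp
    have "qn k (cl (x \<otimes> y)) / qn k (cl y) \<le> qn k (cl x)"
      by (rule qn_greatest[OF x]) (use 2 pos in \<open>simp add: field_simps\<close>)
    then show ?thesis using pos by (simp add: field_simps)
  qed
qed

lemma qn_incr: "x \<in> carrier A \<Longrightarrow> qn k (cl x) \<le> qn (Suc k) (cl x)"
proof (rule qn_greatest)
  fix y assume "x \<in> carrier A" and y: "y \<in> carrier A" "cl y = cl x"
  then show "qn k (cl x) \<le> p (Suc k) y"
    using order_trans[OF qn_le[of x y k] incr[OF y(1), of k]] mem_cl[of x y] by simp
qed

text \<open>A coset at distance 0 from the origin lies in the closure of the ideal.\<close>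

lemma separated_Q: assumes x: "x \<in> carrier A" and z: "\<And>k. qn k (cl x) = 0" shows "cl x = \<zero>\<^bsub>Q\<^esub>"
proof -
  have "x \<in> I"
  proof (rule ccontr)
    assume "x \<notin> I"
    have "openin (topol A) (carrier A - I)" using closed by (simp add: closedin_def)
    then have "graded_open A p (carrier A - I)" by (simp add: openin_iff)
    then obtain k e where e: "e > 0" "{y \<in> carrier A. p k (y \<ominus> x) < e} \<subseteq> carrier A - I"
      using x \<open>x \<notin> I\<close> unfolding graded_open_def by blast
    have "qn k (cl x) < e" using z e by simp
    then obtain y where y: "y \<in> carrier A" "cl y = cl x" "p k y < e" by (rule qn_approx[OF x])
    have "x \<ominus> y \<in> I" using y x cl_eq_iff by metis
    moreover have "p k ((x \<ominus> y) \<ominus> x) < e"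
    proof -
      have "(x \<ominus> y) \<ominus> x = \<ominus> y" using x y(1) plus_minus_cancel[of x "\<ominus> y"] by (simp add: minus_eq)
      then show ?thesis using y snorm_neg[OF snorm] by simp
    qed
    ultimately show False using e(2) x y(1) by blast
  qed
  then have "x \<ominus> \<zero> \<in> I" using x by (simp add: minus_zero_right)
  then show ?thesis using cl_eq_iff x zero_Q by simp
qed

text \<open>The quotient map is open: a ball in the quotient is the image of the ball with the same radius, since
  a coset of seminorm below \<open>e\<close> has a representative of seminorm below \<open>e\<close>.\<close>

lemma openin_Q: "W \<subseteq> carrier Q \<and> openin (topol A) {x \<in> carrier A. cl x \<in> W} \<longleftrightarrow> graded_open Q qn W"
proof (intro iffI)
  assume W: "W \<subseteq> carrier Q \<and> openin (topol A) {x \<in> carrier A. cl x \<in> W}"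
  have "\<exists>k e. e > 0 \<and> {Y \<in> carrier Q. qn k (Y \<ominus>\<^bsub>Q\<^esub> X) < e} \<subseteq> W" if X: "X \<in> W" for X
  proof -
    obtain x where x: "X = cl x" "x \<in> carrier A" using X W by (auto simp: carrier_Q)
    obtain k e where e: "e > 0" "{y \<in> carrier A. p k (y \<ominus> x) < e} \<subseteq> {x \<in> carrier A. cl x \<in> W}"
      using W x X unfolding openin_iff graded_open_def by blast
    have "Y \<in> W" if Y: "Y \<in> carrier Q" "qn k (Y \<ominus>\<^bsub>Q\<^esub> X) < e" for Y
    proof -
      obtain y where y: "Y = cl y" "y \<in> carrier A" using Y(1) by (auto simp: carrier_Q)
      have "qn k (cl (y \<ominus> x)) < e" using Y(2) x y by (simp add: minus_Q)
      then obtain z where z: "z \<in> carrier A" "cl z = cl (y \<ominus> x)" "p k z < e"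
        using qn_approx[of "y \<ominus> x"] x y by blast
      have "cl (x \<oplus> z) = cl x \<oplus>\<^bsub>Q\<^esub> cl (y \<ominus> x)" using Q_ops(1)[OF x(2) z(1)] z(2) by simp
      also have "\<dots> = cl y" using x y Q_ops(1)[of x "y \<ominus> x"] minus_plus_cancel[of y x] by (simp add: M.a_comm)
      finally have "cl (x \<oplus> z) = Y" using y by simp
      moreover have "x \<oplus> z \<in> {y \<in> carrier A. p k (y \<ominus> x) < e}"
        using x z by (simp add: plus_minus_cancel)
      ultimately show ?thesis using e(2) by blast
    qed
    then show ?thesis using e(1) by blast
  qed
  then show "graded_open Q qn W" using W by (auto simp: graded_open_def)
next
  assume W: "graded_open Q qn W"
  have "\<exists>k e. e > 0 \<and> {y \<in> carrier A. p k (y \<ominus> x) < e} \<subseteq> {x \<in> carrier A. cl x \<in> W}"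
    if x: "x \<in> carrier A" "cl x \<in> W" for x
  proof -
    obtain k e where e: "e > 0" "{Y \<in> carrier Q. qn k (Y \<ominus>\<^bsub>Q\<^esub> cl x) < e} \<subseteq> W"
      using W x(2) unfolding graded_open_def by blast
    have "cl y \<in> W" if "y \<in> carrier A" "p k (y \<ominus> x) < e" for y
    proof -
      have "qn k (cl y \<ominus>\<^bsub>Q\<^esub> cl x) < e" using qn_le_self[of "y \<ominus> x" k] that x by (simp add: minus_Q)
      then show ?thesis using e(2) that by auto
    qed
    then show ?thesis using e(1) by blast
  qed
  then have "openin (topol A) {x \<in> carrier A. cl x \<in> W}" unfolding openin_iff graded_open_def by auto
  then show "W \<subseteq> carrier Q \<and> openin (topol A) {x \<in> carrier A. cl x \<in> W}"
    using W by (simp add: graded_open_def)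
qed

lemma topol_Q: "topol Q = seminorm_topology Q (range qn)"
proof -
  have "topol Q = topology (\<lambda>W. W \<subseteq> carrier Q \<and> openin (topol A) {x \<in> carrier A. cl x \<in> W})"
    by (simp add: quot_alg_def)
  also have "\<dots> = topology (openin (seminorm_topology Q (range qn)))"
  proof (rule arg_cong[of _ _ topology], rule ext)
    fix W
    have "openin (seminorm_topology Q (range qn)) W \<longleftrightarrow> graded_open Q qn W"
    proof (rule Q.openin_graded)
      show "\<exists>k C. \<forall>x\<in>carrier Q. q x \<le> C * qn k x" if "q \<in> range qn" for q
        by (rule dominated_range[OF that])
    qed (use qn_seminorm qn_incr in \<open>auto simp: carrier_Q\<close>)
    then show "(W \<subseteq> carrier Q \<and> openin (topol A) {x \<in> carrier A. cl x \<in> W}) =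
        openin (seminorm_topology Q (range qn)) W"
      using openin_Q by simp
  qed
  also have "\<dots> = seminorm_topology Q (range qn)" by (rule openin_inverse)
  finally show ?thesis .
qed

text \<open>A Cauchy sequence of cosets has a subsequence whose successive differences are less than \<open>2^-i\<close> in
  the \<open>i\<close>-th seminorm. Lifting the differences and adding them up gives a Cauchy sequence of
  representatives, and the limit of the subsequence is the limit of the whole sequence.\<close>

lemma complete_Q: assumes C: "Cauchy_in Q qn C" shows "\<exists>X. converges Q qn C X"
proof -
  have Cc: "C i \<in> carrier Q" for i using C by (simp add: Cauchy_in_def)
  have "\<exists>N. \<forall>i\<ge>N. \<forall>j\<ge>N. qn k (C i \<ominus>\<^bsub>Q\<^esub> C j) < (1 / 2) ^ k" for k
    using C unfolding Cauchy_in_def by simp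
  then obtain N where N: "\<And>k i j. i \<ge> N k \<Longrightarrow> j \<ge> N k \<Longrightarrow> qn k (C i \<ominus>\<^bsub>Q\<^esub> C j) < (1 / 2) ^ k" by metis
  \<comment> \<open>indices of the subsequence\<close>
  define f where "f = rec_nat (N 0) (\<lambda>i m. max (Suc m) (N (Suc i)))"
  have fS: "f (Suc i) = max (Suc (f i)) (N (Suc i))" for i by (simp add: f_def)
  have fN: "f i \<ge> N i" for i by (cases i) (auto simp: f_def)
  have fmono: "strict_mono f" by (rule strict_monoI_Suc) (simp add: fS)
  have step: "qn i (C (f (Suc i)) \<ominus>\<^bsub>Q\<^esub> C (f i)) < (1 / 2) ^ i" for i
    by (rule N) (use fN[of i] in \<open>auto simp: fS\<close>)
  have "\<exists>y\<in>carrier A. cl y = C (f (Suc i)) \<ominus>\<^bsub>Q\<^esub> C (f i) \<and> p i y < (1 / 2) ^ i" for i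
  proof -
    have "C (f (Suc i)) \<ominus>\<^bsub>Q\<^esub> C (f i) \<in> carrier Q" using Cc by simp
    then obtain z where z: "z \<in> carrier A" "C (f (Suc i)) \<ominus>\<^bsub>Q\<^esub> C (f i) = cl z" by (auto simp: carrier_Q)
    then show ?thesis using step[of i] qn_approx[OF z(1), of i "(1 / 2) ^ i"] by metis
  qed
  then obtain y where y: "\<And>i. y i \<in> carrier A" "\<And>i. cl (y i) = C (f (Suc i)) \<ominus>\<^bsub>Q\<^esub> C (f i)"
    "\<And>i. p i (y i) < (1 / 2) ^ i" by metis
  obtain x0 where x0: "x0 \<in> carrier A" "C (f 0) = cl x0" using Cc[of "f 0"] by (auto simp: carrier_Q)
  define X where "X = rec_nat x0 (\<lambda>i x. x \<oplus> y i)"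
  have XS: "X 0 = x0" "X (Suc i) = X i \<oplus> y i" for i by (simp_all add: X_def)
  have Xc: "X i \<in> carrier A" for i by (induction i) (auto simp: XS x0 y)
  have clX: "cl (X i) = C (f i)" for i
  proof (induction i)
    case (Suc i)
    have "cl (X (Suc i)) = cl (X i) \<oplus>\<^bsub>Q\<^esub> cl (y i)"
      by (simp only: XS Q_ops(1)[OF Xc y(1)])
    also have "\<dots> = C (f i) \<oplus>\<^bsub>Q\<^esub> (C (f (Suc i)) \<ominus>\<^bsub>Q\<^esub> C (f i))"
      by (simp only: Suc y(2))
    finally show ?case using Q.minus_plus_cancel[OF Cc Cc] Cc by (simp add: Q.M.a_comm)
  qed (simp add: XS x0)
  have tail: "p k (X j \<ominus> X i) \<le> 2 * (1 / 2) ^ i - 2 * (1 / 2) ^ j" if "k \<le> i" "i \<le> j" for i j k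
    using that(2)
  proof (induction rule: dec_induct)
    case base
    show ?case using Xc by (simp add: minus_self)
  next
    case (step j)
    have "X (Suc j) \<ominus> X j = y j" using Xc y by (simp add: XS plus_minus_cancel)
    then have "p k (X (Suc j) \<ominus> X i) \<le> p k (y j) + p k (X j \<ominus> X i)"
      using p_triangle[of "X (Suc j)" "X j" "X i" k] Xc by simp
    moreover have "p k (y j) \<le> (1 / 2) ^ j"
      using p_mono[of k j "y j"] y(1,3)[of j] that step by simp
    ultimately show ?case using step.IH by simp
  qed
  have "Cauchy_in A p X"
    unfolding Cauchy_in_def
  proof (intro conjI allI impI Xc)
    fix k and e :: real assume e: "e > 0"
    obtain n where n: "(1 / 2) ^ n < e / 2" using real_arch_pow_inv[of "e / 2" "1 / 2"] e by auto
    have sm: "p k (X j \<ominus> X i) < e" if "max k n \<le> i" "i \<le> j" for i j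
    proof -
      have "p k (X j \<ominus> X i) \<le> 2 * (1 / 2) ^ i - 2 * (1 / 2) ^ j" using tail that by simp
      also have "\<dots> \<le> 2 * (1 / 2) ^ i" by simp
      also have "\<dots> \<le> 2 * (1 / 2) ^ n" using that by (simp add: power_decreasing)
      finally show ?thesis using n by simp
    qed
    have "p k (X i \<ominus> X j) < e" if "max k n \<le> i" "max k n \<le> j" for i j
      using sm[of i j] sm[of j i] that p_commute[OF Xc Xc, of k i j] by (cases "i \<le> j") auto
    then show "\<exists>N. \<forall>i\<ge>N. \<forall>j\<ge>N. p k (X i \<ominus> X j) < e" by blast
  qed
  then obtain x where x: "converges A p X x" using complete by blast
  have xc: "x \<in> carrier A" using convergesD(2)[OF x] .
  have sub: "(\<lambda>i. qn k (C (f i) \<ominus>\<^bsub>Q\<^esub> cl x)) \<longlonglongrightarrow> 0" for k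
  proof (rule tendsto_sandwich[OF _ _ tendsto_const])
    show "(\<lambda>i. p k (X i \<ominus> x)) \<longlonglongrightarrow> 0" using x by (simp add: converges_def)
    show "\<forall>\<^sub>F i in sequentially. qn k (C (f i) \<ominus>\<^bsub>Q\<^esub> cl x) \<le> p k (X i \<ominus> x)"
      using qn_le_self[of "X _ \<ominus> x" k] Xc xc clX by (intro always_eventually) (simp flip: clX add: minus_Q)
    show "\<forall>\<^sub>F i in sequentially. 0 \<le> qn k (C (f i) \<ominus>\<^bsub>Q\<^esub> cl x)"
      using Cc xc by (intro always_eventually allI Q.snorm_nonneg[OF qn_seminorm]) auto
  qed
  have "(\<lambda>i. qn k (C i \<ominus>\<^bsub>Q\<^esub> cl x)) \<longlonglongrightarrow> 0" for k
  proof (rule LIMSEQ_I)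
    fix e :: real assume e: "e > 0"
    then have e2: "e / 2 > 0" by simp
    obtain M where M: "\<And>i j. i \<ge> M \<Longrightarrow> j \<ge> M \<Longrightarrow> qn k (C i \<ominus>\<^bsub>Q\<^esub> C j) < e / 2"
      using C e2 unfolding Cauchy_in_def by meson
    obtain L where L: "\<And>i. i \<ge> L \<Longrightarrow> norm (qn k (C (f i) \<ominus>\<^bsub>Q\<^esub> cl x) - 0) < e / 2"
      using LIMSEQ_D[OF sub[of k] e2] by blast
    have "norm (qn k (C i \<ominus>\<^bsub>Q\<^esub> cl x) - 0) < e" if i: "i \<ge> max M L" for i
    proof -
      have "f i \<ge> i" using fmono by (rule strict_mono_imp_increasing)
      then have "qn k (C i \<ominus>\<^bsub>Q\<^esub> C (f i)) < e / 2" using M i by auto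
      moreover have "qn k (C (f i) \<ominus>\<^bsub>Q\<^esub> cl x) < e / 2" using L[of i] i by simp
      moreover have "qn k (C i \<ominus>\<^bsub>Q\<^esub> cl x) \<le> qn k (C i \<ominus>\<^bsub>Q\<^esub> C (f i)) + qn k (C (f i) \<ominus>\<^bsub>Q\<^esub> cl x)"
        by (rule Q.snorm_triangle[OF qn_seminorm Cc Cc]) (use xc in auto)
      moreover have "0 \<le> qn k (C i \<ominus>\<^bsub>Q\<^esub> cl x)"
        by (rule Q.snorm_nonneg[OF qn_seminorm]) (use Cc xc in auto)
      ultimately show ?thesis by simp
    qed
    then show "\<exists>M. \<forall>i\<ge>M. norm (qn k (C i \<ominus>\<^bsub>Q\<^esub> cl x) - 0) < e" by blast
  qed
  then have "converges Q qn C (cl x)" using Cc xc by (simp add: converges_def)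
  then show ?thesis by blast
qed

theorem graded_algebra_Q: "graded_algebra Q qn"
proof -
  have "graded_frechet Q qn"
  proof
    show "seminorm Q (qn k)" for k by (rule qn_seminorm)
    show "qn k X \<le> qn (Suc k) X" if "X \<in> carrier Q" for k X using that qn_incr by (auto simp: carrier_Q)
    show "X = \<zero>\<^bsub>Q\<^esub>" if "X \<in> carrier Q" "\<And>k. qn k X = 0" for X
      using that separated_Q by (auto simp: carrier_Q)
  qed (rule topol_Q complete_Q; assumption?)+
  then show ?thesis
    unfolding graded_algebra_def graded_algebra_axioms_def using ring_Q
    by (auto simp: carrier_Q smult_Q Q_ops sm_mult_left sm_mult_right qn_submult)
qed

lemma cl_hom: "cl \<in> alg_hom A p Q qn"
proof -
  have "cl \<in> blin A p Q qn"
  proof (rule blinI)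
    show "\<exists>k C. \<forall>x\<in>carrier A. qn j (cl x) \<le> C * p k x" for j
      using qn_le_self by (intro exI[of _ j] exI[of _ 1]) auto
  qed (auto simp: Q_ops smult_Q)
  then show ?thesis by (simp add: alg_hom_def Q_ops)
qed

lemma quotient_hom_exists:
  assumes B: "graded_algebra B q" and \<Phi>: "\<Phi> \<in> alg_hom A p B q" and ker: "\<And>x. x \<in> I \<Longrightarrow> \<Phi> x = \<zero>\<^bsub>B\<^esub>"
  shows "\<exists>f\<in>alg_hom Q qn B q. \<forall>x\<in>carrier A. f (cl x) = \<Phi> x"
proof -
  interpret B: graded_algebra B q by fact
  note \<Phi>' = alg_homD[OF \<Phi>] blinD[OF alg_homD(1)[OF \<Phi>]]
  have wd: "\<Phi> x = \<Phi> y" if "x \<in> carrier A" "y \<in> carrier A" "cl x = cl y" for x y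
  proof (rule B.minus_eq_zero)
    show "\<Phi> x \<ominus>\<^bsub>B\<^esub> \<Phi> y = \<zero>\<^bsub>B\<^esub>"
      using ker[of "x \<ominus> y"] that cl_eq_iff blin_minus[OF \<Phi>'(1) frechet B.frechet] by auto
  qed (use that \<Phi>' in auto)
  define f where "f X = \<Phi> (SOME x. x \<in> carrier A \<and> cl x = X)" for X
  have f: "f (cl x) = \<Phi> x" if x: "x \<in> carrier A" for x
  proof -
    have "(SOME y. y \<in> carrier A \<and> cl y = cl x) \<in> carrier A \<and> cl (SOME y. y \<in> carrier A \<and> cl y = cl x) = cl x"
      by (rule someI[of "\<lambda>y. y \<in> carrier A \<and> cl y = cl x" x]) (use x in auto)
    then show ?thesis unfolding f_def using wd x by blast
  qed
  have "f \<in> blin Q qn B q"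
  proof (rule blinI)
    fix j
    obtain k C where C: "C > 0" "\<And>x. x \<in> carrier A \<Longrightarrow> q j (\<Phi> x) \<le> C * p k x"
      using blin_bound[OF \<Phi>'(1) frechet, of j] by blast
    have "q j (f X) \<le> C * qn k X" if "X \<in> carrier Q" for X
    proof -
      obtain x where x: "X = cl x" "x \<in> carrier A" using \<open>X \<in> carrier Q\<close> by (auto simp: carrier_Q)
      have "q j (\<Phi> x) / C \<le> qn k (cl x)"
      proof (rule qn_greatest[OF x(2)])
        fix y assume "y \<in> carrier A" "cl y = cl x"
        then show "q j (\<Phi> x) / C \<le> p k y" using C(1) C(2)[of y] wd[of x y] x(2) by (simp add: field_simps)
      qed
      then show ?thesis using x C(1) by (simp add: f field_simps)
    qed
    then show "\<exists>k C. \<forall>X\<in>carrier Q. q j (f X) \<le> C * qn k X" by blast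
  qed (use \<Phi>' in \<open>auto simp: carrier_Q f Q_ops smult_Q\<close>)
  moreover have "f \<one>\<^bsub>Q\<^esub> = \<one>\<^bsub>B\<^esub>" using f[OF unit_closed] \<Phi>'(3) by (simp add: Q_ops)
  moreover have "f (X \<otimes>\<^bsub>Q\<^esub> Y) = f X \<otimes>\<^bsub>B\<^esub> f Y" if "X \<in> carrier Q" "Y \<in> carrier Q" for X Y
    using that \<Phi>' by (auto simp: carrier_Q f Q_ops)
  ultimately show ?thesis using f by (auto simp: alg_hom_def)
qed

end

lemma closed_ideal_gen_closed:
  assumes "graded_algebra A p" "S \<subseteq> carrier A"
  shows "closed_ideal A p (closed_ideal_gen A S)"
proof -
  interpret graded_algebra A p by fact
  let ?J = "{I. ideal I A \<and> closedin (topol A) I \<and> S \<subseteq> I}"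
  have "carrier A \<in> ?J"
    using ring.oneideal[OF ring] assms(2) closedin_topspace[of "topol A"] by simp
  then have ne: "?J \<noteq> {}" by blast
  have "ideal (\<Inter>?J) A" by (rule ring.i_Intersect[OF ring _ ne]) auto
  moreover have "closedin (topol A) (\<Inter>?J)" by (rule closedin_Inter[OF ne]) auto
  ultimately show ?thesis
    by (simp add: closed_ideal_def closed_ideal_axioms_def closed_ideal_gen_def graded_algebra_axioms)
qed

text \<open>A continuous homomorphism into a Hausdorff algebra has a closed kernel.\<close>

lemma kernel_closed_ideal:
  assumes A: "graded_algebra A p" and B: "graded_algebra B q" and f: "f \<in> alg_hom A p B q"
  shows "closed_ideal A p {x \<in> carrier A. f x = \<zero>\<^bsub>B\<^esub>}"
proof -
  interpret A: graded_algebra A p by fact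
  interpret B: graded_algebra B q by fact
  let ?K = "{x \<in> carrier A. f x = \<zero>\<^bsub>B\<^esub>}"
  note fb = alg_homD(1)[OF f]
  have "ring_hom_ring A B f"
    by (rule ring_hom_ringI2[OF A.ring B.ring]) (use alg_homD[OF f] blinD[OF fb] in \<open>auto simp: ring_hom_def\<close>)
  then have "ideal ?K A"
    using ring_hom_ring.kernel_is_ideal by (fastforce simp: a_kernel_def')
  moreover have "graded_open A p (carrier A - ?K)"
    unfolding graded_open_def
  proof (intro conjI ballI)
    fix x assume "x \<in> carrier A - ?K"
    then have x: "x \<in> carrier A" "f x \<noteq> \<zero>\<^bsub>B\<^esub>" by auto
    then obtain j where j: "q j (f x) \<noteq> 0" using B.separated blinD(1)[OF fb] by blast
    obtain k C where C: "C > 0" "\<And>x. x \<in> carrier A \<Longrightarrow> q j (f x) \<le> C * p k x"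
      using blin_bound[OF fb A.frechet, of j] by blast
    have pos: "q j (f x) > 0"
      using j order_le_less[of 0 "q j (f x)"] B.nonneg[OF blinD(1)[OF fb x(1)], of j] by auto
    have "f y \<noteq> \<zero>\<^bsub>B\<^esub>" if y: "y \<in> carrier A" "p k (y \<ominus>\<^bsub>A\<^esub> x) < q j (f x) / C" for y
    proof
      assume "f y = \<zero>\<^bsub>B\<^esub>"
      have "q j (f x) \<le> q j (f y \<ominus>\<^bsub>B\<^esub> f x)"
        using B.p_diff[of "f y" "f x" j] blinD(1)[OF fb x(1)] \<open>f y = \<zero>\<^bsub>B\<^esub>\<close> by simp
      also have "\<dots> \<le> C * p k (y \<ominus>\<^bsub>A\<^esub> x)"
        using C(2)[of "y \<ominus>\<^bsub>A\<^esub> x"] x y by (simp add: blin_minus[OF fb A.frechet B.frechet])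
      also have "\<dots> < q j (f x)" using y(2) C(1) by (simp add: field_simps)
      finally show False by simp
    qed
    then show "\<exists>k e. e > 0 \<and> {y \<in> carrier A. p k (y \<ominus>\<^bsub>A\<^esub> x) < e} \<subseteq> carrier A - ?K"
      using pos C(1) by (intro exI[of _ k] exI[of _ "q j (f x) / C"]) auto
  qed auto
  then have "closedin (topol A) ?K" by (auto simp: closedin_def A.openin_iff)
  ultimately show ?thesis
    by (simp add: closed_ideal_def closed_ideal_axioms_def A.graded_algebra_axioms)
qed

lemma closed_ideal_gen_least:
  "ideal J A \<Longrightarrow> closedin (topol A) J \<Longrightarrow> S \<subseteq> J \<Longrightarrow> closed_ideal_gen A S \<subseteq> J"
  unfolding closed_ideal_gen_def by blast

lemma closed_ideal_gen_superset: "S \<subseteq> closed_ideal_gen A S"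
  unfolding closed_ideal_gen_def by blast

section \<open>Exponentials\<close>

primrec esum :: "'a lc_struct \<Rightarrow> 'a \<Rightarrow> nat \<Rightarrow> 'a" where
  "esum A a 0 = \<one>\<^bsub>A\<^esub>"
| "esum A a (Suc n) = esum A a n \<oplus>\<^bsub>A\<^esub> (1 / fact (Suc n)) \<odot>\<^bsub>A\<^esub> (a [^]\<^bsub>A\<^esub> Suc n)"

text \<open>The exponential is treated as a relation, and its existence is established only where it is needed:
  for multiples of generators of a free algebra, and for images under continuous homomorphisms.\<close>

definition is_exp :: "'a lc_struct \<Rightarrow> (nat \<Rightarrow> 'a \<Rightarrow> real) \<Rightarrow> 'a \<Rightarrow> 'a \<Rightarrow> bool" where
  "is_exp A p a e \<longleftrightarrow> a \<in> carrier A \<and> converges A p (esum A a) e"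

context graded_algebra
begin

lemma pow_closed [simp, intro]: "a \<in> carrier A \<Longrightarrow> a [^] (n::nat) \<in> carrier A"
  by (rule monoid.nat_pow_closed[OF ring.is_monoid[OF ring]])

lemma pow_0 [simp]: "a [^] (0::nat) = \<one>"
  by (rule monoid.nat_pow_0[OF ring.is_monoid[OF ring]])

lemma pow_Suc: "a [^] Suc n = a [^] n \<otimes> a"
  by (rule monoid.nat_pow_Suc[OF ring.is_monoid[OF ring]])

lemma pow_Suc2: "a \<in> carrier A \<Longrightarrow> a [^] Suc n = a \<otimes> a [^] n"
  by (rule monoid.nat_pow_Suc2[OF ring.is_monoid[OF ring]])

lemma esum_closed [simp, intro]: "a \<in> carrier A \<Longrightarrow> esum A a n \<in> carrier A"
  by (induction n) auto

lemma is_expD: "is_exp A p a e \<Longrightarrow> a \<in> carrier A" "is_exp A p a e \<Longrightarrow> e \<in> carrier A"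
  "is_exp A p a e \<Longrightarrow> converges A p (esum A a) e"
  by (auto simp: is_exp_def converges_def)

lemma is_exp_unique: "is_exp A p a e \<Longrightarrow> is_exp A p a f \<Longrightarrow> e = f"
  using converges_unique by (auto simp: is_exp_def)

lemma is_exp_zero: "is_exp A p \<zero> \<one>"
proof -
  have "esum A \<zero> n = \<one>" for n
  proof (induction n)
    case (Suc n)
    have "\<zero> [^] Suc n = \<zero>"
      unfolding pow_Suc2[OF M.zero_closed] by (rule ring.ring_simprules(24)[OF ring]) simp
    then show ?case using Suc by simp
  qed simp
  then have "esum A \<zero> = (\<lambda>_. \<one>)" by (rule ext)
  then show ?thesis by (simp add: is_exp_def converges_const)
qed

lemma pow_commutator:
  assumes "x \<in> carrier A" "a \<in> carrier A" "z \<in> carrier A"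
    and xa: "x \<otimes> a = a \<otimes> x \<oplus> z" and za: "z \<otimes> a = a \<otimes> z"
  shows "x \<otimes> a [^] Suc n = a [^] Suc n \<otimes> x \<oplus> of_nat (Suc n) \<odot> (a [^] n \<otimes> z)"
proof (induction n)
  case 0
  show ?case using assms by (simp add: pow_Suc)
next
  case (Suc n)
  have "x \<otimes> a [^] Suc (Suc n) = (x \<otimes> a [^] Suc n) \<otimes> a"
    using assms by (subst pow_Suc) (simp add: mul_assoc)
  also have "\<dots> = a [^] Suc n \<otimes> (x \<otimes> a) \<oplus> of_nat (Suc n) \<odot> (a [^] n \<otimes> (z \<otimes> a))"
    unfolding Suc using assms(1-3) by (simp add: mul_distr mul_assoc sm_mult_left)
  also have "a [^] n \<otimes> (z \<otimes> a) = a [^] Suc n \<otimes> z"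
    unfolding za pow_Suc using assms(1-3) by (simp add: mul_assoc)
  also have "a [^] Suc n \<otimes> (x \<otimes> a) = a [^] Suc (Suc n) \<otimes> x \<oplus> a [^] Suc n \<otimes> z"
    unfolding xa pow_Suc[of a "Suc n"] using assms(1-3) by (simp add: mul_distr mul_assoc)
  also have "a [^] Suc (Suc n) \<otimes> x \<oplus> a [^] Suc n \<otimes> z \<oplus> of_nat (Suc n) \<odot> (a [^] Suc n \<otimes> z) =
      a [^] Suc (Suc n) \<otimes> x \<oplus> (1 + of_nat (Suc n)) \<odot> (a [^] Suc n \<otimes> z)"
    using assms(1-3) by (simp add: M.a_assoc sm_ladd del: of_nat_Suc)
  finally show ?case by (simp only: of_nat_Suc add.commute)
qed

text \<open>The derivation \<open>[x, -]\<close> maps the partial sum of order \<open>n + 1\<close> of the exponential series to the partial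
  sum of order \<open>n\<close> times \<open>z\<close>, because \<open>[x, a^(n+1)] = (n + 1) a^n z\<close>.\<close>

lemma exp_commutator:
  assumes x: "x \<in> carrier A" and z: "z \<in> carrier A" and e: "is_exp A p a e"
    and xa: "x \<otimes> a = a \<otimes> x \<oplus> z" and za: "z \<otimes> a = a \<otimes> z"
  shows "x \<otimes> e = e \<otimes> x \<oplus> e \<otimes> z"
proof -
  note a = is_expD(1)[OF e] and conv = is_expD(3)[OF e]
  \<comment> \<open>the shift of the index on the right is the derivative of the exponential series\<close>
  have step: "x \<otimes> esum A a (Suc n) = esum A a (Suc n) \<otimes> x \<oplus> esum A a n \<otimes> z" for n
  proof (induction n)
    case 0
    show ?case using x z a xa by (simp add: mul_distr pow_Suc M.a_assoc)
  next
    case (Suc n)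
    let ?N = "Suc (Suc n)" and ?P = "a [^] Suc (Suc n)"
    have pw: "x \<otimes> ?P = ?P \<otimes> x \<oplus> of_nat ?N \<odot> (a [^] Suc n \<otimes> z)"
      by (rule pow_commutator[OF x a z xa za])
    have co: "(1 / fact ?N :: complex) * of_nat ?N = 1 / fact (Suc n)"
      by (simp only: fact_Suc[of "Suc n"]) (simp del: fact_Suc of_nat_Suc)
    then have co: "(of_nat ?N :: complex) / fact ?N = 1 / fact (Suc n)"
      by (simp del: fact_Suc of_nat_Suc)
    have "x \<otimes> esum A a ?N = x \<otimes> esum A a (Suc n) \<oplus> (1 / fact ?N) \<odot> (x \<otimes> ?P)"
      unfolding esum.simps(2)[of A a "Suc n"] using x a
      by (subst mul_distr(2)) (auto simp: sm_mult_right simp del: esum.simps fact_Suc)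
    also have "\<dots> = (esum A a (Suc n) \<otimes> x \<oplus> esum A a n \<otimes> z) \<oplus>
        ((1 / fact ?N) \<odot> (?P \<otimes> x) \<oplus> (1 / fact (Suc n)) \<odot> (a [^] Suc n \<otimes> z))"
      unfolding Suc pw using x a z
      by (subst sm_radd) (auto simp: co simp del: esum.simps fact_Suc of_nat_Suc)
    also have "\<dots> = (esum A a (Suc n) \<otimes> x \<oplus> (1 / fact ?N) \<odot> (?P \<otimes> x)) \<oplus>
        (esum A a n \<otimes> z \<oplus> (1 / fact (Suc n)) \<odot> (a [^] Suc n \<otimes> z))"
      using x a z by (simp add: M.a_ac del: esum.simps fact_Suc)
    also have "esum A a (Suc n) \<otimes> x \<oplus> (1 / fact ?N) \<odot> (?P \<otimes> x) = esum A a ?N \<otimes> x"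
      unfolding esum.simps(2)[of A a "Suc n"] using x a
      by (subst mul_distr(1)) (auto simp: sm_mult_left simp del: esum.simps fact_Suc)
    also have "esum A a n \<otimes> z \<oplus> (1 / fact (Suc n)) \<odot> (a [^] Suc n \<otimes> z) = esum A a (Suc n) \<otimes> z"
      unfolding esum.simps(2)[of A a n] using z a
      by (subst mul_distr(1)) (auto simp: sm_mult_left simp del: esum.simps fact_Suc)
    finally show ?case .
  qed
  have sh: "converges A p (\<lambda>n. esum A a (Suc n)) e"
    by (rule converges_subseq[OF conv, of Suc]) (simp add: strict_mono_def)
  have "converges A p (\<lambda>n. x \<otimes> esum A a (Suc n)) (x \<otimes> e)"
    by (rule converges_mult[OF converges_const[OF x] sh])
  moreover have "converges A p (\<lambda>n. esum A a (Suc n) \<otimes> x \<oplus> esum A a n \<otimes> z) (e \<otimes> x \<oplus> e \<otimes> z)"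
    by (intro converges_add converges_mult sh conv converges_const x z)
  ultimately show ?thesis unfolding step using converges_unique by blast
qed

end

lemma alg_hom_pow:
  assumes "graded_algebra A p" "graded_algebra B q" "f \<in> alg_hom A p B q" "a \<in> carrier A"
  shows "f (a [^]\<^bsub>A\<^esub> (n::nat)) = f a [^]\<^bsub>B\<^esub> n"
proof -
  interpret A: graded_algebra A p by fact
  interpret B: graded_algebra B q by fact
  show ?thesis using assms(4) alg_homD[OF assms(3)] by (induction n) (auto simp: A.pow_Suc B.pow_Suc)
qed

lemma alg_hom_exp:
  assumes "graded_algebra A p" "graded_algebra B q" "f \<in> alg_hom A p B q" "is_exp A p a e"
  shows "is_exp B q (f a) (f e)"
proof -
  interpret A: graded_algebra A p by fact
  interpret B: graded_algebra B q by fact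
  note a = A.is_expD[OF assms(4)] and f = alg_homD[OF assms(3)] and fb = blinD[OF alg_homD(1)[OF assms(3)]]
  have "f (esum A a n) = esum B (f a) n" for n
  proof (induction n)
    case (Suc n)
    then show ?case
      using a(1) f fb by (simp add: alg_hom_pow[OF assms(1-3)] del: fact_Suc)
  qed (simp add: f)
  then have "esum B (f a) = (\<lambda>n. f (esum A a n))" by (simp add: fun_eq_iff)
  then show ?thesis
    using blin_converges[OF f(1) A.frechet B.frechet a(3)] f(4)[OF a(1)] by (simp add: is_exp_def)
qed

lemma is_exp_opposite:
  assumes "graded_algebra A p"
  shows "is_exp (opposite A) p a e \<longleftrightarrow> is_exp A p a e"
proof (cases "a \<in> carrier A")
  case a: True
  interpret A: graded_algebra A p by fact
  interpret B: graded_algebra "opposite A" p by (rule graded_algebra_opposite[OF assms])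
  have pow: "a [^]\<^bsub>opposite A\<^esub> (n::nat) = a [^]\<^bsub>A\<^esub> n" for n
  proof (induction n)
    case (Suc n)
    then show ?case using A.pow_Suc2[OF a, of n] by (simp add: B.pow_Suc)
  qed simp
  have "esum (opposite A) a n = esum A a n" for n
    by (induction n) (simp_all only: esum.simps pow opposite_simps)
  then have "esum (opposite A) a = esum A a" by (rule ext)
  then show ?thesis by (simp add: is_exp_def)
qed (simp add: is_exp_def)

text \<open>The partial sums of the exponential series are the truncations of \<open>E\<close> by length.\<close>

lemma fe_exp:
  fixes c :: complex
  assumes i: "i \<in> {1..n}"
  defines "E \<equiv> \<lambda>w. if w = replicate (length w) i then c ^ length w / fact (length w) else 0"
  shows "is_exp (FE n) (fen n) (c \<odot>\<^bsub>FE n\<^esub> fe_gen i) E"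
proof -
  let ?g = "c \<odot>\<^bsub>FE n\<^esub> fe_gen i"
  have rep: "replicate k i \<in> words n" for k using i by (auto simp: in_lists_conv_set)
  have supp: "E w = 0" if "w \<notin> words n" for w using rep[of "length w"] that by (auto simp: E_def)
  have E: "E \<in> carrier (FE n)"
  proof (rule FE_memI[OF supp])
    fix r :: real assume r: "r > 0"
    have "(\<Sum>w\<in>S. cmod (E w) * r ^ length w) \<le> exp (cmod c * r)" if S: "finite S" for S
    proof -
      let ?S = "{w \<in> S. w = replicate (length w) i}"
      have inj: "inj_on length ?S"
      proof (rule inj_onI)
        fix u v assume "u \<in> ?S" "v \<in> ?S" "length u = length v"
        then have "u = replicate (length u) i" "v = replicate (length u) i" by auto
        then show "u = v" by metis
      qed
      have "(\<Sum>w\<in>S. cmod (E w) * r ^ length w) = (\<Sum>w\<in>?S. cmod (E w) * r ^ length w)"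
        by (rule sum.mono_neutral_right[OF S]) (auto simp: E_def)
      also have "\<dots> = (\<Sum>w\<in>?S. (cmod c * r) ^ length w /\<^sub>R fact (length w))"
      proof (rule sum.cong[OF refl])
        fix w assume "w \<in> ?S"
        then have "E w = c ^ length w / fact (length w)" by (simp add: E_def)
        then have "cmod (E w) = cmod c ^ length w / fact (length w)" by (simp add: norm_divide norm_power)
        then show "cmod (E w) * r ^ length w = (cmod c * r) ^ length w /\<^sub>R fact (length w)"
          by (simp add: power_mult_distrib divide_inverse)
      qed
      also have "\<dots> = (\<Sum>k\<in>length ` ?S. (cmod c * r) ^ k /\<^sub>R fact k)"
        by (simp add: sum.reindex[OF inj])
      also have "\<dots> \<le> suminf (\<lambda>k. (cmod c * r) ^ k /\<^sub>R fact k)"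
        by (rule sum_le_suminf[OF summable_exp_generic]) (use S r in auto)
      also have "\<dots> = exp (cmod c * r)" by (simp add: exp_def)
      finally show ?thesis .
    qed
    then show "\<exists>C. \<forall>S. finite S \<and> S \<subseteq> words n \<longrightarrow> (\<Sum>w\<in>S. cmod (E w) * r ^ length w) \<le> C" by blast
  qed
  have g: "?g \<in> carrier (FE n)" by (rule FE.sm_closed[OF gen_carrier[OF i]])
  have pow: "?g [^]\<^bsub>FE n\<^esub> k = (\<lambda>w. c ^ k * fe_mon (replicate k i) w)" for k
  proof (induction k)
    case 0
    show ?case unfolding FE.pow_0 by (simp add: fe_mon_def fun_eq_iff)
  next
    case (Suc k)
    have "?g [^]\<^bsub>FE n\<^esub> Suc k = (c ^ k \<odot>\<^bsub>FE n\<^esub> fe_mon (replicate k i)) \<otimes>\<^bsub>FE n\<^esub> (c \<odot>\<^bsub>FE n\<^esub> fe_mon [i])"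
      by (simp only: FE.pow_Suc Suc) (simp only: gen_eq_mon FE_simps)
    also have "\<dots> = (c ^ k * c) \<odot>\<^bsub>FE n\<^esub> (fe_mon (replicate k i) \<otimes>\<^bsub>FE n\<^esub> fe_mon [i])"
      using FE.sm_mult_left[OF fe_mon_carrier[OF rep[of k]] FE.sm_closed[OF fe_mon_carrier[OF rep[of 1]]], of "c ^ k" c]
        FE.sm_mult_right[OF fe_mon_carrier[OF rep[of k]] fe_mon_carrier[OF rep[of 1]], of c]
        FE.sm_sm[OF FE.mul_closed[OF fe_mon_carrier[OF rep[of k]] fe_mon_carrier[OF rep[of 1]]], of "c ^ k" c]
      by (simp only: replicate.simps One_nat_def)
    also have "\<dots> = (\<lambda>w. c ^ Suc k * fe_mon (replicate (Suc k) i) w)"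
      unfolding mon_append by (simp add: replicate_append_same mult.commute)
    finally show ?case .
  qed
  have "esum (FE n) ?g N = Poly_Mapping.lookup (fe_trunc E n N)" for N
  proof (induction N)
    case 0
    show ?case
    proof
      fix w :: "nat list"
      show "esum (FE n) ?g 0 w = Poly_Mapping.lookup (fe_trunc E n 0) w"
        unfolding lookup_fe_trunc by (simp add: E_def)
    qed
  next
    case (Suc N)
    show ?case
    proof
      fix w
      have "esum (FE n) ?g (Suc N) w = Poly_Mapping.lookup (fe_trunc E n N) w +
          1 / fact (Suc N) * (c ^ Suc N * fe_mon (replicate (Suc N) i) w)"
        unfolding esum.simps pow Suc by simp
      also have "\<dots> = Poly_Mapping.lookup (fe_trunc E n (Suc N)) w"
      proof (cases "w = replicate (Suc N) i")
        case True
        have "w \<in> words n" using rep[of "Suc N"] True by (simp only:)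
        moreover have "length w = Suc N" using True by simp
        ultimately show ?thesis using True
          by (simp only: lookup_fe_trunc E_def fe_mon_def length_replicate if_True simp_thms) simp
      next
        case False
        have "E w = 0" if "length w = Suc N" using False that by (auto simp: E_def)
        then have "Poly_Mapping.lookup (fe_trunc E n N) w = Poly_Mapping.lookup (fe_trunc E n (Suc N)) w"
          unfolding lookup_fe_trunc by (cases "length w = Suc N") auto
        then show ?thesis using False by (simp add: fe_mon_def)
      qed
      finally show "esum (FE n) ?g (Suc N) w = Poly_Mapping.lookup (fe_trunc E n (Suc N)) w" .
    qed
  qed
  then have "esum (FE n) ?g = (\<lambda>N. fv_ext (FE n) fe_mon (fe_trunc E n N))"
    unfolding fv_ext_mon[OF keys_fe_trunc] by (rule ext)
  then show ?thesis
    unfolding is_exp_def using g fe_trunc_converges[OF E] by simp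
qed

text \<open>The derivatives of \<open>z \<mapsto> exp (c z)\<close> at 0 are the powers of \<open>c\<close>.\<close>

lemma fe_fun_exp:
  "fe_fun (\<lambda>z. exp (c * z)) i = (\<lambda>w. if w = replicate (length w) i then c ^ length w / fact (length w) else 0)"
proof -
  have "(deriv ^^ k) (\<lambda>z. exp (c * z)) = (\<lambda>z. c ^ k * exp (c * z))" for k
  proof (induction k)
    case (Suc k)
    have d: "((\<lambda>z. c ^ k * exp (c * z)) has_field_derivative c ^ Suc k * exp (c * z)) (at z)" for z
      by (auto intro!: derivative_eq_intros)
    show ?case unfolding funpow.simps o_apply Suc by (rule ext, rule DERIV_imp_deriv, rule d)
  qed simp
  note d = this
  show ?thesis unfolding fe_fun_def d by (simp only: mult_zero_right exp_zero mult_1_right)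
qed

lemma fe_fun_sinh:
  "fe_fun (\<lambda>z. sinh (c * z)) i = (\<lambda>w. (1 / 2) * (fe_fun (\<lambda>z. exp (c * z)) i w + (-1) * fe_fun (\<lambda>z. exp (- c * z)) i w))"
proof -
  have "(deriv ^^ k) (\<lambda>z. sinh (c * z)) = (\<lambda>z. (c ^ k * exp (c * z) - (- c) ^ k * exp (- c * z)) / 2)" for k
  proof (induction k)
    case 0
    show ?case by (simp add: sinh_field_def fun_eq_iff)
  next
    case (Suc k)
    have d: "((\<lambda>z. (c ^ k * exp (c * z) - (- c) ^ k * exp (- c * z)) / 2) has_field_derivative
        (c ^ Suc k * exp (c * z) - (- c) ^ Suc k * exp (- c * z)) / 2) (at z)" for z
      by (auto intro!: derivative_eq_intros simp: field_simps)
    show ?case unfolding funpow.simps o_apply Suc by (rule ext, rule DERIV_imp_deriv, rule d)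
  qed
  note d = this
  have cases: "(if P then x else 0) = (1 / 2) * ((if P then y else 0) + (-1) * (if P then z else 0))"
    if "x = (1 / 2) * (y + (-1) * z)" for P and x y z :: complex
    using that by simp
  show ?thesis unfolding fe_fun_exp unfolding fe_fun_def d
    by (rule ext, rule cases) (simp add: field_simps)
qed

section \<open>The addition theorem\<close>

lemma wsum_sum_le:
  assumes "finite S" "S \<subseteq> K" "\<And>k. k \<in> K \<Longrightarrow> 0 \<le> w k"
  shows "wsum w (\<Sum>x\<in>S. Poly_Mapping.single x (c x)) \<le> (\<Sum>x\<in>S. cmod (c x) * w x)"
  using assms(1,2)
proof (induction S)
  case (insert x S)
  have "Poly_Mapping.keys (\<Sum>x\<in>S. Poly_Mapping.single x (c x)) \<subseteq> K"
    using keys_sum[of "\<lambda>x. Poly_Mapping.single x (c x)" S] insert.prems by (auto split: if_splits)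
  then have "wsum w (Poly_Mapping.single x (c x) + (\<Sum>x\<in>S. Poly_Mapping.single x (c x))) \<le>
      wsum w (Poly_Mapping.single x (c x)) + wsum w (\<Sum>x\<in>S. Poly_Mapping.single x (c x))"
    using insert.prems by (intro wsum_add[of K] assms(3)) auto
  then show ?case using insert by simp
qed (simp add: wsum_def)

context graded_algebra
begin

context
  fixes a b
  assumes a: "a \<in> carrier A" and b: "b \<in> carrier A" and ab: "a \<otimes> b = b \<otimes> a"
begin

abbreviation (input) monomial2 :: "nat \<times> nat \<Rightarrow> 'a" where
  "monomial2 \<equiv> \<lambda>kl. a [^] fst kl \<otimes> b [^] snd kl"

abbreviation (input) ev :: "(nat \<times> nat \<Rightarrow>\<^sub>0 complex) \<Rightarrow> 'a" where
  "ev \<equiv> fv_ext A monomial2"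

lemma monomial2_closed: "kl \<in> UNIV \<Longrightarrow> monomial2 kl \<in> carrier A"
  using a b by simp

lemma ev_closed: "ev u \<in> carrier A"
  by (rule fv_ext_closed[of UNIV]) (use monomial2_closed in auto)

lemma ev_add: "ev (u + v) = ev u \<oplus> ev v"
  by (rule fv_ext_add[of UNIV]) (use monomial2_closed in auto)

lemma ev_minus: "ev (u - v) = ev u \<ominus> ev v"
  by (rule fv_ext_minus[of UNIV]) (use monomial2_closed in auto)

lemma ev_single: "ev (Poly_Mapping.single kl c) = c \<odot> monomial2 kl"
  by (rule fv_ext_single[of UNIV]) (use monomial2_closed in auto)

lemma pow_comm1: "b \<otimes> a [^] (k::nat) = a [^] k \<otimes> b"
proof (induction k)
  case (Suc k)
  have "b \<otimes> a [^] Suc k = (b \<otimes> a [^] k) \<otimes> a" using a b by (simp add: pow_Suc mul_assoc)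
  also have "\<dots> = a [^] k \<otimes> (b \<otimes> a)" using a b Suc by (simp add: mul_assoc)
  also have "\<dots> = a [^] Suc k \<otimes> b" unfolding ab[symmetric] using a b by (simp add: pow_Suc mul_assoc)
  finally show ?case .
qed (use b in simp)

lemma pow_comm: "b [^] (l::nat) \<otimes> a [^] (k::nat) = a [^] k \<otimes> b [^] l"
proof (induction l)
  case (Suc l)
  have "b [^] Suc l \<otimes> a [^] k = b [^] l \<otimes> (b \<otimes> a [^] k)" using a b by (simp add: pow_Suc mul_assoc)
  also have "\<dots> = (b [^] l \<otimes> a [^] k) \<otimes> b" unfolding pow_comm1 using a b by (simp add: mul_assoc)
  also have "\<dots> = a [^] k \<otimes> b [^] Suc l" unfolding Suc using a b by (simp add: pow_Suc mul_assoc)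
  finally show ?case .
qed (use a in simp)

lemma pow_add: "x \<in> carrier A \<Longrightarrow> x [^] (k + l::nat) = x [^] k \<otimes> x [^] l"
  using monoid.nat_pow_mult[OF ring.is_monoid[OF ring], of x k l] by simp

lemma monomial2_mult: "monomial2 (kl + kl') = monomial2 kl \<otimes> monomial2 kl'"
proof -
  obtain k l k' l' where *: "kl = (k, l)" "kl' = (k', l')" by (metis surj_pair)
  have "monomial2 kl \<otimes> monomial2 kl' = a [^] k \<otimes> (b [^] l \<otimes> a [^] k') \<otimes> b [^] l'"
    using a b by (simp add: * mul_assoc)
  also have "\<dots> = monomial2 (kl + kl')"
    unfolding pow_comm using a b by (simp add: * pow_add mul_assoc)
  finally show ?thesis by simp
qed

lemma ev_mult: "ev (u * v) = ev u \<otimes> ev v"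
proof -
  have "Poly_Mapping.keys u \<subseteq> UNIV" by simp
  then show ?thesis
  proof (induction rule: fv_induct)
    case zero
    show ?case using ev_closed[of v] ring.ring_simprules(24)[OF ring] by (simp add: fv_ext_def[of _ _ 0])
  next
    case (add u u')
    then show ?case by (simp add: distrib_right ev_add mul_distr ev_closed)
  next
    case (single kl c)
    have "Poly_Mapping.keys v \<subseteq> UNIV" by simp
    then show ?case
    proof (induction rule: fv_induct)
      case zero
      show ?case using ev_closed ring.ring_simprules(25)[OF ring] by (simp add: fv_ext_def[of _ _ 0])
    next
      case (add v v')
      then show ?case by (simp add: distrib_left ev_add mul_distr ev_closed)
    next
      case (single kl' c')
      show ?case using a b
        by (simp add: mult_single ev_single monomial2_mult sm_mult_left sm_mult_right
            mult.commute[of c] del: fst_add snd_add)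
    qed
  qed
qed

lemma ev_pow: "ev (u ^ m) = ev u [^] m"
proof (induction m)
  case 0
  show ?case using ev_single[of 0 1] a b by (simp flip: single_one)
qed (simp add: ev_mult pow_Suc power_Suc2 del: power_Suc)

lemma ev_sum_Suc: "ev (\<Sum>k\<le>Suc n. f k) = ev (\<Sum>k\<le>n. f k) \<oplus> ev (f (Suc n))"
  by (simp add: ev_add)

text \<open>All partial sums are values of polynomials, so that identities between them can be proved in the
  commutative polynomial ring in two variables, realized as finitely supported functions on \<open>nat \<times> nat\<close>.\<close>

lemma esum_ev:
  assumes "ev s = x"
  shows "esum A x n = ev (\<Sum>m\<le>n. Poly_Mapping.single 0 (1 / fact m) * s ^ m)"
proof (induction n)
  case 0
  have "ev 1 = \<one>" using ev_single[of 0 1] a b by (simp flip: single_one)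
  then show ?case by simp
next
  case (Suc n)
  have t: "ev (Poly_Mapping.single 0 c * s ^ m) = c \<odot> (x [^] m)" for c and m :: nat
    unfolding ev_mult ev_single ev_pow assms using ev_closed[of s] a b by (simp add: assms sm_mult_left)
  show ?case by (simp only: esum.simps ev_sum_Suc Suc t)
qed

lemma single_pow:
  "Poly_Mapping.single (1, 0) 1 ^ k = (Poly_Mapping.single (k, 0) 1 :: nat \<times> nat \<Rightarrow>\<^sub>0 complex)"
  "Poly_Mapping.single (0, 1) 1 ^ k = (Poly_Mapping.single (0, k) 1 :: nat \<times> nat \<Rightarrow>\<^sub>0 complex)"
  by (induction k) (simp_all add: mult_single flip: zero_prod_def)

text \<open>In the polynomial ring, \<open>\<Sum> (s + t)^m / m!\<close> is the sum of \<open>s^k t^l / (k! l!)\<close> over the triangle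
  \<open>k + l \<le> n\<close>, and the product of the partial sums for \<open>s\<close> and \<open>t\<close> is the sum over the square
  \<open>k, l \<le> n\<close>. The difference consists of the terms in the square outside of the triangle. The triangle
  inequality bounds it by the same expression for the real numbers \<open>p j a\<close> and \<open>p j b\<close>.\<close>

lemma exp_add_defect:
  "p j (esum A (a \<oplus> b) n \<ominus> esum A a n \<otimes> esum A b n) \<le>
    (p j \<one> * p j \<one>) * ((\<Sum>k\<le>n. p j a ^ k /\<^sub>R fact k) * (\<Sum>k\<le>n. p j b ^ k /\<^sub>R fact k)
      - (\<Sum>m\<le>n. (p j a + p j b) ^ m /\<^sub>R fact m))"
proof -
  let ?S = "Poly_Mapping.single (1, 0) 1 :: nat \<times> nat \<Rightarrow>\<^sub>0 complex"
  let ?T = "Poly_Mapping.single (0, 1) 1 :: nat \<times> nat \<Rightarrow>\<^sub>0 complex"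
  let ?g = "\<lambda>kl :: nat \<times> nat. 1 / (fact (fst kl) * fact (snd kl)) :: complex"
  let ?m = "\<lambda>kl. Poly_Mapping.single kl (?g kl)"
  let ?tri = "{(k, l). k + l \<le> n}" and ?sq = "{..n} \<times> {..n}"
  \<comment> \<open>evaluation at \<open>(a, b)\<close>: the two indeterminates and their sum\<close>
  have evS: "ev ?S = a" "ev ?T = b" "ev (?S + ?T) = a \<oplus> b" using a b by (simp_all add: ev_add ev_single pow_Suc)
  have tri: "(\<Sum>m\<le>n. Poly_Mapping.single 0 (1 / fact m) * (?S + ?T) ^ m) = (\<Sum>kl\<in>?tri. ?m kl)"
  proof -
    have "Poly_Mapping.single 0 (1 / fact m) * (?S + ?T) ^ m = (\<Sum>k\<le>m. ?m (k, m - k))" for m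
    proof -
      have "Poly_Mapping.single 0 (1 / fact m) * (of_nat (m choose k) * ?S ^ k * ?T ^ (m - k)) = ?m (k, m - k)"
        if "k \<le> m" for k
      proof -
        have "(1 / fact m) * of_nat (m choose k) = ?g (k, m - k)"
          using that by (simp add: binomial_fact)
        then show ?thesis
          unfolding single_pow single_of_nat[symmetric] by (simp add: mult_single del: single_of_nat)
      qed
      then show ?thesis unfolding binomial_ring sum_distrib_left by (intro sum.cong) auto
    qed
    then have "(\<Sum>m\<le>n. Poly_Mapping.single 0 (1 / fact m) * (?S + ?T) ^ m) = (\<Sum>m\<le>n. \<Sum>k\<le>m. ?m (k, m - k))"
      by simp
    also have "\<dots> = (\<Sum>(k, l)\<in>?tri. ?m (k, l))"
      by (rule sum.triangle_reindex_eq[of "\<lambda>k l. ?m (k, l)" n, symmetric])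
    finally show ?thesis by (simp add: case_prod_unfold)
  qed
  have sq: "(\<Sum>m\<le>n. Poly_Mapping.single 0 (1 / fact m) * ?S ^ m) * (\<Sum>m\<le>n. Poly_Mapping.single 0 (1 / fact m) * ?T ^ m)
      = (\<Sum>kl\<in>?sq. ?m kl)"
    unfolding sum_product single_pow sum.cartesian_product
    by (rule sum.cong) (auto simp: mult_single)
  have sub: "?tri \<subseteq> ?sq" by auto
  have D: "esum A (a \<oplus> b) n \<ominus> esum A a n \<otimes> esum A b n = ev ((\<Sum>kl\<in>?tri. ?m kl) - (\<Sum>kl\<in>?sq. ?m kl))"
    unfolding esum_ev[OF evS(1)] esum_ev[OF evS(2)] esum_ev[OF evS(3)] ev_mult[symmetric] sq tri ev_minus ..
  also have "(\<Sum>kl\<in>?tri. ?m kl) - (\<Sum>kl\<in>?sq. ?m kl) = (\<Sum>kl\<in>?sq - ?tri. Poly_Mapping.single kl (- ?g kl))"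
    by (subst sum_diff[OF _ sub]) (auto simp: single_uminus sum_negf sum_diff)
  finally have "p j (esum A (a \<oplus> b) n \<ominus> esum A a n \<otimes> esum A b n) \<le>
      wsum (\<lambda>kl. p j (monomial2 kl)) (\<Sum>kl\<in>?sq - ?tri. Poly_Mapping.single kl (- ?g kl))"
    by (simp only:) (rule fv_ext_seminorm[of UNIV], use monomial2_closed snorm in auto)
  also have "\<dots> \<le> (\<Sum>kl\<in>?sq - ?tri. cmod (- ?g kl) * p j (monomial2 kl))"
    by (rule wsum_sum_le[of _ UNIV]) (use monomial2_closed in auto)
  also have "\<dots> \<le> (\<Sum>kl\<in>?sq - ?tri. (p j \<one> * p j \<one>) *
      ((p j a ^ fst kl /\<^sub>R fact (fst kl)) * (p j b ^ snd kl /\<^sub>R fact (snd kl))))"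
  proof (rule sum_mono)
    fix kl :: "nat \<times> nat"
    have pw: "p j (x [^] k) \<le> p j \<one> * p j x ^ k" if x: "x \<in> carrier A" for x and k :: nat
    proof (induction k)
      case (Suc k)
      have "p j (x [^] Suc k) \<le> p j (x [^] k) * p j x" unfolding pow_Suc using x by (intro submult) auto
      also have "\<dots> \<le> (p j \<one> * p j x ^ k) * p j x" using Suc x by (intro mult_right_mono) auto
      finally show ?case by (simp add: mult_ac)
    qed simp
    have "p j (monomial2 kl) \<le> p j (a [^] fst kl) * p j (b [^] snd kl)" using a b by (intro submult) auto
    also have "\<dots> \<le> (p j \<one> * p j a ^ fst kl) * (p j \<one> * p j b ^ snd kl)"
      using a b by (intro mult_mono pw) auto
    finally have "cmod (- ?g kl) * p j (monomial2 kl) \<le>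
        cmod (- ?g kl) * ((p j \<one> * p j a ^ fst kl) * (p j \<one> * p j b ^ snd kl))"
      by (intro mult_left_mono) auto
    then show "cmod (- ?g kl) * p j (monomial2 kl) \<le> (p j \<one> * p j \<one>) *
      ((p j a ^ fst kl /\<^sub>R fact (fst kl)) * (p j b ^ snd kl /\<^sub>R fact (snd kl)))"
      by (simp add: norm_divide norm_mult norm_inverse divide_inverse mult_ac)
  qed
  also have "\<dots> = (p j \<one> * p j \<one>) * ((\<Sum>kl\<in>?sq. (p j a ^ fst kl /\<^sub>R fact (fst kl)) * (p j b ^ snd kl /\<^sub>R fact (snd kl)))
      - (\<Sum>kl\<in>?tri. (p j a ^ fst kl /\<^sub>R fact (fst kl)) * (p j b ^ snd kl /\<^sub>R fact (snd kl))))"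
    by (subst sum_diff[OF _ sub]) (auto simp: sum_distrib_left right_diff_distrib)
  also have "(\<Sum>kl\<in>?sq. (p j a ^ fst kl /\<^sub>R fact (fst kl)) * (p j b ^ snd kl /\<^sub>R fact (snd kl))) =
      (\<Sum>k\<le>n. p j a ^ k /\<^sub>R fact k) * (\<Sum>k\<le>n. p j b ^ k /\<^sub>R fact k)"
    by (simp only: sum_product sum.cartesian_product case_prod_unfold)
  also have "(\<Sum>kl\<in>?tri. (p j a ^ fst kl /\<^sub>R fact (fst kl)) * (p j b ^ snd kl /\<^sub>R fact (snd kl))) =
      (\<Sum>m\<le>n. \<Sum>k\<le>m. (p j a ^ k /\<^sub>R fact k) * (p j b ^ (m - k) /\<^sub>R fact (m - k)))"
    using sum.triangle_reindex_eq[of "\<lambda>k l. (p j a ^ k /\<^sub>R fact k) * (p j b ^ l /\<^sub>R fact l)" n]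
    by (simp only: case_prod_unfold)
  also have "\<dots> = (\<Sum>m\<le>n. (p j a + p j b) ^ m /\<^sub>R fact m)"
    by (rule sum.cong[OF refl]) (rule exp_series_add_commuting[symmetric], simp)
  finally show ?thesis .
qed

text \<open>The bound of \<open>exp_add_defect\<close> tends to a multiple of
  \<open>exp (p j a) * exp (p j b) - exp (p j a + p j b) = 0\<close>.\<close>

theorem is_exp_add:
  assumes e: "is_exp A p a e" and f: "is_exp A p b f"
  shows "is_exp A p (a \<oplus> b) (e \<otimes> f)"
  unfolding is_exp_def
proof
  show "a \<oplus> b \<in> carrier A" using a b by simp
  show "converges A p (esum A (a \<oplus> b)) (e \<otimes> f)"
  proof (rule converges_null_diff[OF converges_mult[OF is_expD(3)[OF e] is_expD(3)[OF f]]])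
    show "esum A (a \<oplus> b) i \<in> carrier A" for i using a b by simp
    fix j
    have ex: "(\<lambda>n. \<Sum>k\<le>n. x ^ k /\<^sub>R fact k) \<longlonglongrightarrow> exp x" for x :: real
      using summable_LIMSEQ'[OF summable_exp_generic[of x]] by (simp add: exp_def)
    have "(\<lambda>n. (p j \<one> * p j \<one>) * ((\<Sum>k\<le>n. p j a ^ k /\<^sub>R fact k) * (\<Sum>k\<le>n. p j b ^ k /\<^sub>R fact k)
      - (\<Sum>m\<le>n. (p j a + p j b) ^ m /\<^sub>R fact m))) \<longlonglongrightarrow>
        (p j \<one> * p j \<one>) * (exp (p j a) * exp (p j b) - exp (p j a + p j b))"
      by (intro tendsto_intros ex)
    then have lim: "(\<lambda>n. (p j \<one> * p j \<one>) * ((\<Sum>k\<le>n. p j a ^ k /\<^sub>R fact k) * (\<Sum>k\<le>n. p j b ^ k /\<^sub>R fact k)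
      - (\<Sum>m\<le>n. (p j a + p j b) ^ m /\<^sub>R fact m))) \<longlonglongrightarrow> 0"
      by (simp add: exp_add)
    show "(\<lambda>i. p j (esum A (a \<oplus> b) i \<ominus> esum A a i \<otimes> esum A b i)) \<longlonglongrightarrow> 0"
    proof (rule tendsto_sandwich[OF _ _ tendsto_const lim])
      show "\<forall>\<^sub>F n in sequentially. 0 \<le> p j (esum A (a \<oplus> b) n \<ominus> esum A a n \<otimes> esum A b n)"
        using a b by (intro always_eventually allI nonneg) auto
    qed (intro always_eventually allI exp_add_defect)
  qed
qed

end

end

section \<open>Products of linear maps, relation ideals, powers of an indeterminate\<close>

(* from here on elements are manipulated by the algebra laws and not through their coefficients *)
declare FE_simps [simp del]

context tensor_pair
begin

lemma bbil_mult:
  assumes Z: "graded_algebra Z r" and f: "f \<in> blin V p Z r" and g: "g \<in> blin W q Z r"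
  shows "bbil V p W q Z r (\<lambda>a b. f a \<otimes>\<^bsub>Z\<^esub> g b)"
proof -
  interpret Z: graded_algebra Z r by fact
  note f' = blinD[OF f] and g' = blinD[OF g]
  have "\<exists>k C. \<forall>x\<in>carrier V. \<forall>y\<in>carrier W. r j (f x \<otimes>\<^bsub>Z\<^esub> g y) \<le> C * (p k x * q k y)" for j
  proof -
    obtain k C where C: "C > 0" "\<And>x. x \<in> carrier V \<Longrightarrow> r j (f x) \<le> C * p k x"
      using blin_bound[OF f V.graded_frechet_axioms, of j] by blast
    obtain l D where D: "D > 0" "\<And>x. x \<in> carrier W \<Longrightarrow> r j (g x) \<le> D * q l x"
      using blin_bound[OF g W.graded_frechet_axioms, of j] by blast
    let ?m = "max k l"
    have "r j (f x \<otimes>\<^bsub>Z\<^esub> g y) \<le> (C * D) * (p ?m x * q ?m y)"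
      if xy: "x \<in> carrier V" "y \<in> carrier W" for x y
    proof -
      have "r j (f x \<otimes>\<^bsub>Z\<^esub> g y) \<le> r j (f x) * r j (g y)" using xy f' g' by (intro Z.submult) auto
      also have "\<dots> \<le> (C * p ?m x) * (D * q ?m y)"
      proof (rule mult_mono)
        show "r j (f x) \<le> C * p ?m x"
          by (rule order_trans[OF C(2)[OF xy(1)]], rule mult_left_mono) (use C V.p_mono xy in auto)
        show "r j (g y) \<le> D * q ?m y"
          by (rule order_trans[OF D(2)[OF xy(2)]], rule mult_left_mono) (use D W.p_mono xy in auto)
      qed (use C xy f' g' in auto)
      finally show ?thesis by (simp add: mult_ac)
    qed
    then show ?thesis by blast
  qed
  then show ?thesis
    unfolding bbil_def using f' g'
    by (auto simp: Z.mul_distr Z.sm_mult_left Z.sm_mult_right)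
qed

lemma tensor_lift_cong:
  assumes "\<And>x y. x \<in> carrier V \<Longrightarrow> y \<in> carrier W \<Longrightarrow> \<beta> x y = \<beta>' x y"
  shows "tensor_lift V W Z \<beta> = tensor_lift V W Z \<beta>'"
proof -
  have "(f \<in> cont_linear T Z \<and> (\<forall>x\<in>carrier V. \<forall>y\<in>carrier W. f (elem x y) = \<beta> x y)) =
      (f \<in> cont_linear T Z \<and> (\<forall>x\<in>carrier V. \<forall>y\<in>carrier W. f (elem x y) = \<beta>' x y))" for f
    using assms by auto
  then show ?thesis unfolding tensor_lift_def by simp
qed

end

lemma relation_ideal_closed:
  assumes "R \<subseteq> carrier (FE n) \<times> carrier (FE n)"
  shows "closed_ideal (FE n) (fen n) (relation_ideal n R)"
  unfolding relation_ideal_def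
  by (rule closed_ideal_gen_closed[OF graded_algebra_FE]) (use assms in auto)

text \<open>The kernel is a closed ideal that contains the relators.\<close>

lemma relation_ideal_vanishes:
  assumes R: "R \<subseteq> carrier (FE n) \<times> carrier (FE n)" and B: "graded_algebra B q"
    and \<Phi>: "\<Phi> \<in> alg_hom (FE n) (fen n) B q" and rel: "\<And>a b. (a, b) \<in> R \<Longrightarrow> \<Phi> a = \<Phi> b"
    and x: "x \<in> relation_ideal n R"
  shows "\<Phi> x = \<zero>\<^bsub>B\<^esub>"
proof -
  interpret B: graded_algebra B q by fact
  let ?K = "{x \<in> carrier (FE n). \<Phi> x = \<zero>\<^bsub>B\<^esub>}"
  interpret K: closed_ideal "FE n" "fen n" ?K by (rule kernel_closed_ideal[OF graded_algebra_FE B \<Phi>])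
  have "relation_ideal n R \<subseteq> ?K"
    unfolding relation_ideal_def
  proof (rule closed_ideal_gen_least[OF K.ideal K.closed], clarify)
    fix a b assume ab: "(a, b) \<in> R"
    then have c: "a \<in> carrier (FE n)" "b \<in> carrier (FE n)" using R by auto
    show "a \<ominus>\<^bsub>FE n\<^esub> b \<in> carrier (FE n) \<and> \<Phi> (a \<ominus>\<^bsub>FE n\<^esub> b) = \<zero>\<^bsub>B\<^esub>"
      using c rel[OF ab] blin_minus[OF alg_homD(1)[OF \<Phi>] graded_frechet_FE B.frechet c]
        alg_homD(4)[OF \<Phi> c(2)] by (simp add: B.minus_self)
  qed
  then show ?thesis using x by blast
qed

interpretation fps: vector_space "\<lambda>c (a :: complex fps). fps_const c * a"
  by unfold_locales
    (simp_all add: algebra_simps fps_const_add[symmetric] fps_const_mult[symmetric] del: fps_const_add fps_const_mult)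

text \<open>The powers are linearly independent, by comparing coefficients.\<close>

lemma fps_powers_not_finite_span:
  assumes B: "finite B"
  shows "\<not> range (\<lambda>n. fps_X ^ n :: complex fps) \<subseteq> fps.span B"
proof
  let ?P = "range (\<lambda>n. fps_X ^ n :: complex fps)"
  assume span: "?P \<subseteq> fps.span B"
  have inj: "fps_X ^ m = (fps_X ^ n :: complex fps) \<longleftrightarrow> m = n" for m n
  proof
    assume "fps_X ^ m = (fps_X ^ n :: complex fps)"
    then have "fps_nth (fps_X ^ m :: complex fps) m = fps_nth (fps_X ^ n) m" by simp
    then show "m = n" by (simp add: fps_X_power_nth split: if_splits)
  qed simp
  have "fps.independent ?P"
  proof
    assume "fps.dependent ?P"
    then obtain t u where t: "finite t" "t \<subseteq> ?P" "(\<Sum>v\<in>t. fps_const (u v) * v) = 0" "\<exists>v\<in>t. u v \<noteq> 0"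
      unfolding fps.dependent_explicit by blast
    then obtain n where n: "fps_X ^ n \<in> t" "u (fps_X ^ n) \<noteq> 0" by blast
    have "0 = fps_nth (\<Sum>v\<in>t. fps_const (u v) * v) n" by (simp add: t(3))
    also have "\<dots> = (\<Sum>v\<in>t. u v * fps_nth v n)" by (simp add: fps_sum_nth)
    also have "\<dots> = (\<Sum>v\<in>t. if v = fps_X ^ n then u v else 0)"
    proof (rule sum.cong[OF refl])
      fix v assume "v \<in> t"
      then obtain m where v: "v = fps_X ^ m" using t(2) by blast
      show "u v * fps_nth v n = (if v = fps_X ^ n then u v else 0)"
        unfolding v inj fps_X_power_nth by auto
    qed
    also have "\<dots> = u (fps_X ^ n)" using t(1) n(1) by simp
    finally show False using n(2) by simp
  qed
  then have "finite ?P" using fps.independent_span_bound[OF B _ span] by blast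
  moreover have "inj (\<lambda>n. fps_X ^ n :: complex fps)" by (rule injI) (simp only: inj)
  ultimately show False using finite_imageD[of "\<lambda>n. fps_X ^ n :: complex fps" UNIV] by simp
qed

section \<open>The quantized algebra of the affine group\<close>

locale af =
  fixes h :: complex
begin

abbreviation "J \<equiv> relation_ideal 2 (af_relations h)"
abbreviation "U \<equiv> U_af h"
abbreviation "X \<equiv> X_af h"
abbreviation "Y \<equiv> Y_af h"
abbreviation "cl \<equiv> af_class h"

definition "fexp c = fe_fun (\<lambda>z. exp (c * z)) 2"
definition "fsinh = fe_fun (\<lambda>z. sinh (h * z)) 2"
definition "E c = cl (fexp c)"
definition "\<kappa> = 1 / (sinh h * 2)"
definition "\<sigma> = cl fsinh"

lemma gens: "fe_gen 1 \<in> carrier (FE 2)" "fe_gen 2 \<in> carrier (FE 2)"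
  by (rule gen_carrier; simp)+

lemma fexp_exp: "is_exp (FE 2) (fen 2) (c \<odot>\<^bsub>FE 2\<^esub> fe_gen 2) (fexp c)"
  unfolding fexp_def fe_fun_exp by (rule fe_exp) simp

lemma fexp_carrier: "fexp c \<in> carrier (FE 2)"
  by (rule FE.is_expD(2)[OF fexp_exp])

lemma fsinh_eq: "fsinh = (1 / 2) \<odot>\<^bsub>FE 2\<^esub> (fexp h \<oplus>\<^bsub>FE 2\<^esub> (-1) \<odot>\<^bsub>FE 2\<^esub> fexp (- h))"
  unfolding fsinh_def fe_fun_sinh fexp_def by (simp add: FE_simps)

lemma fsinh_carrier: "fsinh \<in> carrier (FE 2)"
  unfolding fsinh_eq by (intro FE.sm_closed FE.M.add.m_closed[simplified] fexp_carrier)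

lemma af_rel: "af_relations h = {(fe_gen 1 \<otimes>\<^bsub>FE 2\<^esub> fe_gen 2 \<ominus>\<^bsub>FE 2\<^esub> fe_gen 2 \<otimes>\<^bsub>FE 2\<^esub> fe_gen 1,
    (1 / sinh h) \<odot>\<^bsub>FE 2\<^esub> fsinh)}"
  by (simp add: af_relations_def Let_def fsinh_def)

lemma af_rel_sub: "af_relations h \<subseteq> carrier (FE 2) \<times> carrier (FE 2)"
  unfolding af_rel using gens fsinh_carrier by auto

sublocale C: closed_ideal "FE 2" "fen 2" J
  by (rule relation_ideal_closed[OF af_rel_sub])

abbreviation "un \<equiv> C.qn"

lemma U_eq: "U = C.Q"
  by (simp add: U_af_def universal_HFG_def)

lemma cl_eq: "cl = C.cl"
  by (simp add: af_class_def fun_eq_iff)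

sublocale U: graded_algebra U un
  unfolding U_eq by (rule C.graded_algebra_Q)

lemma UA: "graded_algebra U un" by (rule U.graded_algebra_axioms)

lemma cl_hom: "cl \<in> alg_hom (FE 2) (fen 2) U un"
  unfolding U_eq cl_eq by (rule C.cl_hom)

lemma carrier_U: "carrier U = cl ` carrier (FE 2)"
  unfolding U_eq cl_eq by (rule C.carrier_Q)

lemma XY_carrier [simp, intro]: "X \<in> carrier U" "Y \<in> carrier U"
  unfolding X_af_def Y_af_def using alg_homD(4)[OF cl_hom] gens by auto

lemma E_carrier [simp, intro]: "E c \<in> carrier U"
  unfolding E_def using alg_homD(4)[OF cl_hom] fexp_carrier by auto

lemma fun_Y: "fun_Y_af h (\<lambda>z. exp (c * z)) = E c" "fun_Y_af h (\<lambda>z. sinh (h * z)) = \<sigma>"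
  by (simp_all add: fun_Y_af_def E_def \<sigma>_def fexp_def fsinh_def)

lemma E_exp: "is_exp U un (c \<odot>\<^bsub>U\<^esub> Y) (E c)"
  using alg_hom_exp[OF graded_algebra_FE UA cl_hom fexp_exp, of c] blinD(3)[OF alg_homD(1)[OF cl_hom] gens(2), of c]
  by (simp add: E_def Y_af_def)

lemma \<sigma>_eq: "\<sigma> = (1 / 2) \<odot>\<^bsub>U\<^esub> (E h \<oplus>\<^bsub>U\<^esub> (-1) \<odot>\<^bsub>U\<^esub> E (- h))"
proof -
  note c = blinD[OF alg_homD(1)[OF cl_hom]]
  show ?thesis
    unfolding \<sigma>_def fsinh_eq E_def
    by (simp only: c(2) c(3) fexp_carrier FE.sm_closed FE.M.a_closed)
qed

lemma \<sigma>_carrier [simp, intro]: "\<sigma> \<in> carrier U"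
  unfolding \<sigma>_eq by (intro U.sm_closed U.M.a_closed E_carrier)

text \<open>For the exponentials \<open>e\<close> and \<open>e'\<close> of \<open>h y\<close> and \<open>-h y\<close> this is \<open>sinh(h y) / sinh h\<close>.\<close>

definition rhs where
  "rhs B e e' = \<kappa> \<odot>\<^bsub>B\<^esub> (e \<oplus>\<^bsub>B\<^esub> (-1) \<odot>\<^bsub>B\<^esub> e')"

lemma rhs_\<sigma>: "rhs U (E h) (E (- h)) = (1 / sinh h) \<odot>\<^bsub>U\<^esub> \<sigma>"
  unfolding rhs_def \<sigma>_eq \<kappa>_def by (subst U.sm_sm) (auto intro!: U.M.a_closed)

lemma XY_rel: "X \<otimes>\<^bsub>U\<^esub> Y = Y \<otimes>\<^bsub>U\<^esub> X \<oplus>\<^bsub>U\<^esub> (1 / sinh h) \<odot>\<^bsub>U\<^esub> \<sigma>"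
proof -
  note c = blinD[OF alg_homD(1)[OF cl_hom]] and m = alg_homD[OF cl_hom]
  let ?a = "fe_gen 1 \<otimes>\<^bsub>FE 2\<^esub> fe_gen 2 \<ominus>\<^bsub>FE 2\<^esub> fe_gen 2 \<otimes>\<^bsub>FE 2\<^esub> fe_gen 1" and ?b = "(1 / sinh h) \<odot>\<^bsub>FE 2\<^esub> fsinh"
  have ab: "?a \<in> carrier (FE 2)" "?b \<in> carrier (FE 2)" using gens fsinh_carrier by auto
  have "?a \<ominus>\<^bsub>FE 2\<^esub> ?b \<in> J"
    unfolding relation_ideal_def af_rel
    by (rule closed_ideal_gen_superset[THEN subsetD]) blast
  then have "cl ?a = cl ?b" unfolding cl_eq using C.cl_eq_iff[OF ab] by blast
  moreover have "cl ?a = X \<otimes>\<^bsub>U\<^esub> Y \<ominus>\<^bsub>U\<^esub> Y \<otimes>\<^bsub>U\<^esub> X"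
    unfolding X_af_def Y_af_def using gens
    by (simp add: blin_minus[OF m(1) graded_frechet_FE U.frechet] m(2))
  moreover have "cl ?b = (1 / sinh h) \<odot>\<^bsub>U\<^esub> \<sigma>" unfolding \<sigma>_def by (rule c(3)[OF fsinh_carrier])
  ultimately have "X \<otimes>\<^bsub>U\<^esub> Y \<ominus>\<^bsub>U\<^esub> Y \<otimes>\<^bsub>U\<^esub> X = (1 / sinh h) \<odot>\<^bsub>U\<^esub> \<sigma>" by simp
  then have "(1 / sinh h) \<odot>\<^bsub>U\<^esub> \<sigma> \<oplus>\<^bsub>U\<^esub> Y \<otimes>\<^bsub>U\<^esub> X = X \<otimes>\<^bsub>U\<^esub> Y"
    using U.minus_plus_cancel[of "X \<otimes>\<^bsub>U\<^esub> Y" "Y \<otimes>\<^bsub>U\<^esub> X"] by simp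
  then show ?thesis by (simp add: U.M.a_comm)
qed

lemma cl_gen: "i \<in> {1..2} \<Longrightarrow> cl (fe_gen i) = (if i = 1 then X else Y)"
proof -
  assume "i \<in> {1..2}"
  then have "i = 1 \<or> i = 2" by auto
  then show ?thesis by (auto simp: X_af_def Y_af_def)
qed

theorem U_hom_eq:
  assumes B: "graded_algebra B q" and f: "f \<in> alg_hom U un B q" and g: "g \<in> alg_hom U un B q"
    and "f X = g X" "f Y = g Y" and x: "x \<in> carrier U"
  shows "f x = g x"
proof -
  obtain y where y: "y \<in> carrier (FE 2)" "x = cl y" using x by (auto simp: carrier_U)
  have "f (cl y) = g (cl y)"
  proof (rule FE_hom_eq[OF B _ _ _ y(1)])
    show "(\<lambda>y. f (cl y)) \<in> alg_hom (FE 2) (fen 2) B q" by (rule alg_hom_comp[OF cl_hom f U.frechet])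
    show "(\<lambda>y. g (cl y)) \<in> alg_hom (FE 2) (fen 2) B q" by (rule alg_hom_comp[OF cl_hom g U.frechet])
    show "f (cl (fe_gen i)) = g (cl (fe_gen i))" if "i \<in> {1..2}" for i
      using assms(4,5) by (simp add: cl_gen[OF that])
  qed
  then show ?thesis by (simp add: y)
qed

text \<open>The homomorphism from the free algebra with \<open>X \<mapsto> x\<close>, \<open>Y \<mapsto> y\<close> maps \<open>exp(hY)\<close> and \<open>exp(-hY)\<close> to the
  exponentials \<open>e\<close> and \<open>e'\<close>, so the last assumption says that it respects the defining relation.\<close>

theorem U_hom_exists:
  assumes B: "graded_algebra B q" and xy: "x \<in> carrier B" "y \<in> carrier B"
    and e: "is_exp B q (h \<odot>\<^bsub>B\<^esub> y) e" and e': "is_exp B q ((- h) \<odot>\<^bsub>B\<^esub> y) e'"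
    and rel: "x \<otimes>\<^bsub>B\<^esub> y = y \<otimes>\<^bsub>B\<^esub> x \<oplus>\<^bsub>B\<^esub> rhs B e e'"
  shows "\<exists>f\<in>alg_hom U un B q. f X = x \<and> f Y = y"
proof -
  interpret B: graded_algebra B q by fact
  have "\<exists>\<Phi>\<in>alg_hom (FE 2) (fen 2) B q. \<forall>i\<in>{1..2}. \<Phi> (fe_gen i) = (if i = 1 then x else y)"
    by (rule FE_hom_exists[OF B]) (use xy in auto)
  then obtain \<Phi> where \<Phi>: "\<Phi> \<in> alg_hom (FE 2) (fen 2) B q" "\<Phi> (fe_gen 1) = x" "\<Phi> (fe_gen 2) = y"
    by auto
  note m = alg_homD[OF \<Phi>(1)] and c = blinD[OF alg_homD(1)[OF \<Phi>(1)]]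
  have ex: "is_exp B q (c \<odot>\<^bsub>B\<^esub> y) (\<Phi> (fexp c))" for c
    using alg_hom_exp[OF graded_algebra_FE B \<Phi>(1) fexp_exp, of c] c(3)[OF gens(2), of c] \<Phi>(3) by simp
  have eh: "\<Phi> (fexp h) = e" "\<Phi> (fexp (- h)) = e'"
    using B.is_exp_unique[OF ex e] B.is_exp_unique[OF ex e'] by auto
  have ec: "e \<in> carrier B" "e' \<in> carrier B" using B.is_expD(2)[OF e] B.is_expD(2)[OF e'] by auto
  have "\<Phi> fsinh = (1 / 2) \<odot>\<^bsub>B\<^esub> (e \<oplus>\<^bsub>B\<^esub> (-1) \<odot>\<^bsub>B\<^esub> e')"
    unfolding fsinh_eq by (simp only: c(2) c(3) fexp_carrier FE.sm_closed FE.M.a_closed eh)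
  then have r: "\<Phi> ((1 / sinh h) \<odot>\<^bsub>FE 2\<^esub> fsinh) = rhs B e e'"
    using ec by (simp add: c(3) fsinh_carrier rhs_def \<kappa>_def)
  have "rhs B e e' \<in> carrier B" unfolding rhs_def using ec by auto
  then have l: "\<Phi> (fe_gen 1 \<otimes>\<^bsub>FE 2\<^esub> fe_gen 2 \<ominus>\<^bsub>FE 2\<^esub> fe_gen 2 \<otimes>\<^bsub>FE 2\<^esub> fe_gen 1) = rhs B e e'"
    using gens \<Phi> xy rel B.plus_minus_cancel[of "y \<otimes>\<^bsub>B\<^esub> x" "rhs B e e'"]
    by (simp add: blin_minus[OF m(1) graded_frechet_FE B.frechet] m(2))
  have "\<Phi> a = \<zero>\<^bsub>B\<^esub>" if "a \<in> J" for a
    by (rule relation_ideal_vanishes[OF af_rel_sub B \<Phi>(1) _ that]) (use l r in \<open>auto simp: af_rel\<close>)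
  then obtain f where f: "f \<in> alg_hom U un B q" "\<And>a. a \<in> carrier (FE 2) \<Longrightarrow> f (cl a) = \<Phi> a"
    using C.quotient_hom_exists[OF B \<Phi>(1)] unfolding U_eq cl_eq by blast
  have "f X = x" "f Y = y" using f(2)[OF gens(1)] f(2)[OF gens(2)] \<Phi> by (simp_all add: X_af_def Y_af_def)
  then show ?thesis using f(1) by blast
qed

lemma U_hom_ex1:
  assumes B: "graded_algebra B q" and "\<exists>f\<in>alg_hom U un B q. f X = x \<and> f Y = y"
  shows "\<exists>!f. f \<in> cont_alg_hom U B \<and> f X = x \<and> f Y = y"
proof -
  interpret B: graded_algebra B q by fact
  obtain f where f: "f \<in> alg_hom U un B q" "f X = x" "f Y = y" using assms(2) by blast
  show ?thesis
  proof (rule ex1I[of _ "restrict f (carrier U)"])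
    show "restrict f (carrier U) \<in> cont_alg_hom U B \<and> restrict f (carrier U) X = x \<and> restrict f (carrier U) Y = y"
      using alg_hom_restrict[OF UA B f(1)] f by simp
    fix g assume g: "g \<in> cont_alg_hom U B \<and> g X = x \<and> g Y = y"
    have g': "g \<in> alg_hom U un B q" "g \<in> extensional (carrier U)"
      using g cont_alg_hom_iff[OF U.frechet B.frechet] by auto
    show "g = restrict f (carrier U)"
    proof
      fix u
      show "g u = restrict f (carrier U) u"
        using U_hom_eq[OF B g'(1) f(1), of u] g f g'(2) by (cases "u \<in> carrier U") (auto simp: extensional_def)
    qed
  qed
qed

lemma E_comm: "Y \<otimes>\<^bsub>U\<^esub> E c = E c \<otimes>\<^bsub>U\<^esub> Y"
proof -
  have "Y \<otimes>\<^bsub>U\<^esub> E c = E c \<otimes>\<^bsub>U\<^esub> Y \<oplus>\<^bsub>U\<^esub> E c \<otimes>\<^bsub>U\<^esub> \<zero>\<^bsub>U\<^esub>"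
    by (rule U.exp_commutator[OF _ _ E_exp])
      (auto simp: U.sm_mult_left U.sm_mult_right ring.ring_simprules(24,25)[OF U.ring])
  then show ?thesis by (simp add: ring.ring_simprules(25)[OF U.ring])
qed

lemma E_mult: "E c \<otimes>\<^bsub>U\<^esub> E d = E (c + d)"
proof (rule U.is_exp_unique[OF _ E_exp])
  have "is_exp U un (c \<odot>\<^bsub>U\<^esub> Y \<oplus>\<^bsub>U\<^esub> d \<odot>\<^bsub>U\<^esub> Y) (E c \<otimes>\<^bsub>U\<^esub> E d)"
    by (rule U.is_exp_add[OF _ _ _ E_exp E_exp]) (auto simp: U.sm_mult_left U.sm_mult_right mult.commute)
  then show "is_exp U un ((c + d) \<odot>\<^bsub>U\<^esub> Y) (E c \<otimes>\<^bsub>U\<^esub> E d)" by (simp add: U.sm_ladd)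
qed

lemma \<sigma>_comm: "Y \<otimes>\<^bsub>U\<^esub> \<sigma> = \<sigma> \<otimes>\<^bsub>U\<^esub> Y" "E c \<otimes>\<^bsub>U\<^esub> \<sigma> = \<sigma> \<otimes>\<^bsub>U\<^esub> E c"
  unfolding \<sigma>_eq
  by (simp_all add: U.sm_mult_left U.sm_mult_right U.mul_distr E_comm E_mult add.commute)

text \<open>The commutator \<open>[X, c Y]\<close> is a multiple of \<open>\<sigma>\<close>, which commutes with \<open>Y\<close>, and so
  \<open>exp_commutator\<close> applies.\<close>

lemma XE_rel: "X \<otimes>\<^bsub>U\<^esub> E c = E c \<otimes>\<^bsub>U\<^esub> X \<oplus>\<^bsub>U\<^esub> (c / sinh h) \<odot>\<^bsub>U\<^esub> (E c \<otimes>\<^bsub>U\<^esub> \<sigma>)"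
proof -
  have "X \<otimes>\<^bsub>U\<^esub> E c = E c \<otimes>\<^bsub>U\<^esub> X \<oplus>\<^bsub>U\<^esub> E c \<otimes>\<^bsub>U\<^esub> ((c / sinh h) \<odot>\<^bsub>U\<^esub> \<sigma>)"
    by (rule U.exp_commutator[OF _ _ E_exp])
      (auto simp: U.sm_mult_left U.sm_mult_right XY_rel U.sm_radd \<sigma>_comm)
  then show ?thesis by (simp add: U.sm_mult_right)
qed

subsection \<open>Counit, antipode and comultiplication\<close>

lemma counit_exists: "\<exists>f\<in>alg_hom U un complex_alg (\<lambda>k. cmod). f X = 0 \<and> f Y = 0"
proof (rule U_hom_exists[OF graded_algebra_complex])
  interpret B: graded_algebra complex_alg "\<lambda>k. cmod" by (rule graded_algebra_complex)
  show "is_exp complex_alg (\<lambda>k. cmod) (h \<odot>\<^bsub>complex_alg\<^esub> 0) 1" "is_exp complex_alg (\<lambda>k. cmod) ((- h) \<odot>\<^bsub>complex_alg\<^esub> 0) 1"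
    using B.is_exp_zero by simp_all
qed (simp_all add: rhs_def)

lemma sm_cancel: "x \<in> carrier U \<Longrightarrow> x \<oplus>\<^bsub>U\<^esub> (-1) \<odot>\<^bsub>U\<^esub> x = \<zero>\<^bsub>U\<^esub>"
  using U.minus_self[of x] by (simp add: U.minus_eq U.neg_eq_sm)

text \<open>Any multiple of \<open>\<sigma> = sinh(hY)\<close> may be added to the value \<open>-X\<close>, since it commutes with \<open>Y\<close>. The
  antipode is the case \<open>c = -h / sinh h\<close>, and its inverse is the case of the opposite sign.\<close>

lemma antipode_exists:
  "\<exists>f\<in>alg_hom U un (opposite U) un. f X = (-1) \<odot>\<^bsub>U\<^esub> X \<oplus>\<^bsub>U\<^esub> c \<odot>\<^bsub>U\<^esub> \<sigma> \<and> f Y = (-1) \<odot>\<^bsub>U\<^esub> Y"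
proof (rule U_hom_exists[OF graded_algebra_opposite[OF UA]])
  show "is_exp (opposite U) un (h \<odot>\<^bsub>opposite U\<^esub> ((-1) \<odot>\<^bsub>U\<^esub> Y)) (E (- h))"
    "is_exp (opposite U) un ((- h) \<odot>\<^bsub>opposite U\<^esub> ((-1) \<odot>\<^bsub>U\<^esub> Y)) (E h)"
    unfolding is_exp_opposite[OF UA] opposite_simps U.sm_sm[OF XY_carrier(2)]
    using E_exp[of "- h"] E_exp[of h] by simp_all
  let ?x = "(-1) \<odot>\<^bsub>U\<^esub> X \<oplus>\<^bsub>U\<^esub> c \<odot>\<^bsub>U\<^esub> \<sigma>" and ?y = "(-1) \<odot>\<^bsub>U\<^esub> Y"
  let ?A = "Y \<otimes>\<^bsub>U\<^esub> X" and ?B = "\<sigma> \<otimes>\<^bsub>U\<^esub> Y"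
  have r: "rhs (opposite U) (E (- h)) (E h) = (- (1 / sinh h)) \<odot>\<^bsub>U\<^esub> \<sigma>"
    unfolding rhs_def \<sigma>_eq \<kappa>_def by (simp add: U.sm_radd U.M.a_comm)
  have 1: "?y \<otimes>\<^bsub>U\<^esub> ?x = ?A \<oplus>\<^bsub>U\<^esub> (- c) \<odot>\<^bsub>U\<^esub> ?B"
    by (simp add: U.sm_mult_left U.sm_mult_right U.mul_distr U.sm_radd \<sigma>_comm)
  have 2: "?x \<otimes>\<^bsub>U\<^esub> ?y = (?A \<oplus>\<^bsub>U\<^esub> (1 / sinh h) \<odot>\<^bsub>U\<^esub> \<sigma>) \<oplus>\<^bsub>U\<^esub> (- c) \<odot>\<^bsub>U\<^esub> ?B"
    by (simp add: U.sm_mult_left U.sm_mult_right U.mul_distr U.sm_radd XY_rel)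
  have "?x \<otimes>\<^bsub>U\<^esub> ?y \<oplus>\<^bsub>U\<^esub> (- (1 / sinh h)) \<odot>\<^bsub>U\<^esub> \<sigma> =
      (?A \<oplus>\<^bsub>U\<^esub> (- c) \<odot>\<^bsub>U\<^esub> ?B) \<oplus>\<^bsub>U\<^esub> ((1 / sinh h) \<odot>\<^bsub>U\<^esub> \<sigma> \<oplus>\<^bsub>U\<^esub> (- (1 / sinh h)) \<odot>\<^bsub>U\<^esub> \<sigma>)"
    unfolding 2 by (simp add: U.M.a_ac)
  also have "(1 / sinh h) \<odot>\<^bsub>U\<^esub> \<sigma> \<oplus>\<^bsub>U\<^esub> (- (1 / sinh h)) \<odot>\<^bsub>U\<^esub> \<sigma> = \<zero>\<^bsub>U\<^esub>"
    using U.sm_ladd[of \<sigma> "1 / sinh h" "- (1 / sinh h)"] by simp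
  finally show "?x \<otimes>\<^bsub>opposite U\<^esub> ?y = ?y \<otimes>\<^bsub>opposite U\<^esub> ?x \<oplus>\<^bsub>opposite U\<^esub> rhs (opposite U) (E (- h)) (E h)"
    unfolding r opposite_simps 1 by simp
qed auto

sublocale UU: tensor_alg_pair U un U un
  by (intro tensor_alg_pair.intro UA)

text \<open>The images of \<open>Y\<close> in the two factors commute, so the exponential of their sum is the product of their
  exponentials.\<close>

lemma is_exp_diag: "is_exp UU.TA UU.P (c \<odot>\<^bsub>UU.T\<^esub> (UU.elem \<one>\<^bsub>U\<^esub> Y \<oplus>\<^bsub>UU.T\<^esub> UU.elem Y \<one>\<^bsub>U\<^esub>)) (UU.elem (E c) (E c))"
proof -
  let ?a = "UU.elem \<one>\<^bsub>U\<^esub> (c \<odot>\<^bsub>U\<^esub> Y)" and ?b = "UU.elem (c \<odot>\<^bsub>U\<^esub> Y) \<one>\<^bsub>U\<^esub>"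
  have e: "is_exp UU.TA UU.P ?a (UU.elem \<one>\<^bsub>U\<^esub> (E c))" "is_exp UU.TA UU.P ?b (UU.elem (E c) \<one>\<^bsub>U\<^esub>)"
    by (rule alg_hom_exp[OF UA UU.graded_algebra_TA UU.embed_right E_exp],
        rule alg_hom_exp[OF UA UU.graded_algebra_TA UU.embed_left E_exp])
  have "is_exp UU.TA UU.P (?a \<oplus>\<^bsub>UU.TA\<^esub> ?b) (UU.elem \<one>\<^bsub>U\<^esub> (E c) \<otimes>\<^bsub>UU.TA\<^esub> UU.elem (E c) \<one>\<^bsub>U\<^esub>)"
    by (rule UU.TA.is_exp_add[OF _ _ _ e]) (auto simp: UU.TA_elem_elem)
  moreover have "?a \<oplus>\<^bsub>UU.TA\<^esub> ?b = c \<odot>\<^bsub>UU.T\<^esub> (UU.elem \<one>\<^bsub>U\<^esub> Y \<oplus>\<^bsub>UU.T\<^esub> UU.elem Y \<one>\<^bsub>U\<^esub>)"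
    by (simp add: UU.elem_scale_left UU.elem_scale_right UU.T.sm_radd)
  moreover have "UU.elem \<one>\<^bsub>U\<^esub> (E c) \<otimes>\<^bsub>UU.TA\<^esub> UU.elem (E c) \<one>\<^bsub>U\<^esub> = UU.elem (E c) (E c)"
    by (simp add: UU.TA_elem_elem)
  ultimately show ?thesis by simp
qed

definition "\<Delta>X = UU.elem X (E (- h)) \<oplus>\<^bsub>UU.T\<^esub> UU.elem (E h) X"
definition "\<Delta>Y = UU.elem \<one>\<^bsub>U\<^esub> Y \<oplus>\<^bsub>UU.T\<^esub> UU.elem Y \<one>\<^bsub>U\<^esub>"

lemma \<Delta>XY_carrier: "\<Delta>X \<in> carrier UU.T" "\<Delta>Y \<in> carrier UU.T"
  unfolding \<Delta>X_def \<Delta>Y_def by (auto intro!: UU.T.M.a_closed)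

lemma comult_exists: "\<exists>f\<in>alg_hom U un UU.TA UU.P. f X = \<Delta>X \<and> f Y = \<Delta>Y"
proof (rule U_hom_exists[OF UU.graded_algebra_TA])
  show "is_exp UU.TA UU.P (h \<odot>\<^bsub>UU.TA\<^esub> \<Delta>Y) (UU.elem (E h) (E h))"
    "is_exp UU.TA UU.P ((- h) \<odot>\<^bsub>UU.TA\<^esub> \<Delta>Y) (UU.elem (E (- h)) (E (- h)))"
    using is_exp_diag[of h] is_exp_diag[of "- h"] by (simp_all add: \<Delta>Y_def)
  let ?e = "E h" and ?e' = "E (- h)" and ?z = "(1 / sinh h) \<odot>\<^bsub>U\<^esub> \<sigma>"
  let ?a = "UU.elem X (Y \<otimes>\<^bsub>U\<^esub> ?e')" and ?b = "UU.elem (Y \<otimes>\<^bsub>U\<^esub> X) ?e'" and ?c = "UU.elem ?e (Y \<otimes>\<^bsub>U\<^esub> X)"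
    and ?d = "UU.elem (Y \<otimes>\<^bsub>U\<^esub> ?e) X"
  have l: "\<Delta>X \<otimes>\<^bsub>UU.TA\<^esub> \<Delta>Y = (?a \<oplus>\<^bsub>UU.T\<^esub> ?d \<oplus>\<^bsub>UU.T\<^esub> ?b \<oplus>\<^bsub>UU.T\<^esub> ?c) \<oplus>\<^bsub>UU.T\<^esub> (UU.elem ?z ?e' \<oplus>\<^bsub>UU.T\<^esub> UU.elem ?e ?z)"
    unfolding \<Delta>X_def \<Delta>Y_def
    using UU.TA.mul_distr
    by (simp add: UU.TA_elem_elem XY_rel E_comm UU.elem_add_left UU.elem_add_right UU.T.M.a_ac)
  have r: "\<Delta>Y \<otimes>\<^bsub>UU.TA\<^esub> \<Delta>X = ?a \<oplus>\<^bsub>UU.T\<^esub> ?d \<oplus>\<^bsub>UU.T\<^esub> ?b \<oplus>\<^bsub>UU.T\<^esub> ?c"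
    unfolding \<Delta>X_def \<Delta>Y_def
    using UU.TA.mul_distr
    by (simp add: UU.TA_elem_elem UU.T.M.a_ac)
  have cancel: "(-1) \<odot>\<^bsub>UU.T\<^esub> t \<oplus>\<^bsub>UU.T\<^esub> (t \<oplus>\<^bsub>UU.T\<^esub> u) = u" if "t \<in> carrier UU.T" "u \<in> carrier UU.T" for t u
  proof -
    have "(-1) \<odot>\<^bsub>UU.T\<^esub> t \<oplus>\<^bsub>UU.T\<^esub> t = \<zero>\<^bsub>UU.T\<^esub>"
      using UU.T.sm_ladd[of t "-1" 1] that by simp
    then show ?thesis using that by (simp flip: UU.T.M.a_assoc)
  qed
  have z: "?z = \<kappa> \<odot>\<^bsub>U\<^esub> (?e \<oplus>\<^bsub>U\<^esub> (-1) \<odot>\<^bsub>U\<^esub> ?e')" using rhs_\<sigma> by (simp add: rhs_def)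
  have "UU.elem ?z ?e' \<oplus>\<^bsub>UU.T\<^esub> UU.elem ?e ?z =
      \<kappa> \<odot>\<^bsub>UU.T\<^esub> ((UU.elem ?e ?e' \<oplus>\<^bsub>UU.T\<^esub> (-1) \<odot>\<^bsub>UU.T\<^esub> UU.elem ?e' ?e') \<oplus>\<^bsub>UU.T\<^esub>
        (UU.elem ?e ?e \<oplus>\<^bsub>UU.T\<^esub> (-1) \<odot>\<^bsub>UU.T\<^esub> UU.elem ?e ?e'))"
    unfolding z
    by (simp only: UU.elem_scale_left UU.elem_scale_right UU.elem_add_left UU.elem_add_right
        UU.T.sm_radd[symmetric] E_carrier U.sm_closed U.M.a_closed UU.elem_closed UU.T.sm_closed UU.T.M.a_closed)
  also have "(UU.elem ?e ?e' \<oplus>\<^bsub>UU.T\<^esub> (-1) \<odot>\<^bsub>UU.T\<^esub> UU.elem ?e' ?e') \<oplus>\<^bsub>UU.T\<^esub>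
        (UU.elem ?e ?e \<oplus>\<^bsub>UU.T\<^esub> (-1) \<odot>\<^bsub>UU.T\<^esub> UU.elem ?e ?e') =
      (-1) \<odot>\<^bsub>UU.T\<^esub> UU.elem ?e ?e' \<oplus>\<^bsub>UU.T\<^esub> (UU.elem ?e ?e' \<oplus>\<^bsub>UU.T\<^esub>
        (UU.elem ?e ?e \<oplus>\<^bsub>UU.T\<^esub> (-1) \<odot>\<^bsub>UU.T\<^esub> UU.elem ?e' ?e'))"
    by (simp add: UU.T.M.a_ac)
  also have "\<dots> = UU.elem ?e ?e \<oplus>\<^bsub>UU.T\<^esub> (-1) \<odot>\<^bsub>UU.T\<^esub> UU.elem ?e' ?e'"
    by (rule cancel) auto
  finally show "\<Delta>X \<otimes>\<^bsub>UU.TA\<^esub> \<Delta>Y = \<Delta>Y \<otimes>\<^bsub>UU.TA\<^esub> \<Delta>X \<oplus>\<^bsub>UU.TA\<^esub> rhs UU.TA (UU.elem ?e ?e) (UU.elem ?e' ?e')"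
    unfolding l r rhs_def by simp
qed (use \<Delta>XY_carrier in auto)

end

lemma blin_opposite [simp]: "blin W p (opposite A) = blin W p A"
  unfolding opposite_def by (simp only: update_mult_simps)

context af
begin

subsection \<open>Maps out of the tensor square\<close>

text \<open>With \<open>\<mu>\<close> for the multiplication of \<open>U\<close>, this is \<open>\<mu> (f \<otimes> g)\<close>; composing it with \<open>\<Delta>\<close> gives the
  convolution product of \<open>f\<close> and \<open>g\<close>.\<close>

definition "mu f g = tensor_lift U U U (\<lambda>a b. f a \<otimes>\<^bsub>U\<^esub> g b)"

context
  fixes f g assumes fg: "f \<in> blin U un U un" "g \<in> blin U un U un"
begin

lemma mu_blin: "mu f g \<in> blin UU.T UU.P U un"
  unfolding mu_def by (rule UU.tensor_lift_blin[OF U.frechet UU.bbil_mult[OF UA fg]])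

lemma mu_elem: "a \<in> carrier U \<Longrightarrow> b \<in> carrier U \<Longrightarrow> mu f g (UU.elem a b) = f a \<otimes>\<^bsub>U\<^esub> g b"
  unfolding mu_def by (rule UU.tensor_lift_elem[OF U.frechet UU.bbil_mult[OF UA fg]])

lemma mu_add: "s \<in> carrier UU.T \<Longrightarrow> t \<in> carrier UU.T \<Longrightarrow> mu f g (s \<oplus>\<^bsub>UU.T\<^esub> t) = mu f g s \<oplus>\<^bsub>U\<^esub> mu f g t"
  by (rule blinD(2)[OF mu_blin])

end

lemma id_blin: "(\<lambda>x. x) \<in> blin U un U un"
  by (rule blin_id[OF U.frechet])

text \<open>Words in \<open>X\<close> and \<open>Y\<close> span a dense subspace; this is an induction on words that adds letters on the left.
  It applies to maps that are not multiplicative, like those in the antipode axiom.\<close>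

lemma blin_eq_left_induct:
  assumes l: "l \<in> blin U un U un" and r: "r \<in> blin U un U un" and one: "l \<one>\<^bsub>U\<^esub> = r \<one>\<^bsub>U\<^esub>"
    and step: "\<And>x. x \<in> carrier U \<Longrightarrow> l x = r x \<Longrightarrow> l (X \<otimes>\<^bsub>U\<^esub> x) = r (X \<otimes>\<^bsub>U\<^esub> x) \<and> l (Y \<otimes>\<^bsub>U\<^esub> x) = r (Y \<otimes>\<^bsub>U\<^esub> x)"
    and x: "x \<in> carrier U"
  shows "l x = r x"
proof -
  note m = alg_homD[OF cl_hom]
  have w: "cl (fe_mon w) \<in> carrier U \<and> l (cl (fe_mon w)) = r (cl (fe_mon w))" if "w \<in> words 2" for w
    using that
  proof (induction w)
    case Nil
    have "cl (fe_mon []) = \<one>\<^bsub>U\<^esub>" using m(3) by (simp add: FE_simps one_eq_mon)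
    then show ?case using one by simp
  next
    case (Cons i w)
    have mem: "fe_gen i \<in> carrier (FE 2)" "fe_mon w \<in> carrier (FE 2)" using Cons by (auto intro: gen_carrier)
    have "fe_mon (i # w) = fe_gen i \<otimes>\<^bsub>FE 2\<^esub> fe_mon w" unfolding gen_eq_mon mon_append by simp
    then have "cl (fe_mon (i # w)) = (if i = 1 then X else Y) \<otimes>\<^bsub>U\<^esub> cl (fe_mon w)"
      using m(2)[OF mem] cl_gen[of i] Cons by simp
    then show ?case using step Cons by auto
  qed
  obtain y where y: "y \<in> carrier (FE 2)" "x = cl y" using x by (auto simp: carrier_U)
  have "l (cl y) = r (cl y)"
    by (rule generates_eq[OF generates_FE graded_frechet_FE U.frechet
          blin_comp[OF m(1) l U.frechet] blin_comp[OF m(1) r U.frechet] _ y(1)]) (use w in blast)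
  then show ?thesis by (simp add: y)
qed

lemma blin_eq_right_induct:
  assumes l: "l \<in> blin U un U un" and r: "r \<in> blin U un U un" and one: "l \<one>\<^bsub>U\<^esub> = r \<one>\<^bsub>U\<^esub>"
    and step: "\<And>x. x \<in> carrier U \<Longrightarrow> l x = r x \<Longrightarrow> l (x \<otimes>\<^bsub>U\<^esub> X) = r (x \<otimes>\<^bsub>U\<^esub> X) \<and> l (x \<otimes>\<^bsub>U\<^esub> Y) = r (x \<otimes>\<^bsub>U\<^esub> Y)"
    and x: "x \<in> carrier U"
  shows "l x = r x"
proof -
  note m = alg_homD[OF cl_hom]
  have w: "cl (fe_mon w) \<in> carrier U \<and> l (cl (fe_mon w)) = r (cl (fe_mon w))" if "w \<in> words 2" for w
    using that
  proof (induction w rule: rev_induct)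
    case Nil
    have "cl (fe_mon []) = \<one>\<^bsub>U\<^esub>" using m(3) by (simp add: FE_simps one_eq_mon)
    then show ?case using one by simp
  next
    case (snoc i w)
    have mem: "fe_mon w \<in> carrier (FE 2)" "fe_gen i \<in> carrier (FE 2)" using snoc by (auto intro: gen_carrier)
    have "fe_mon (w @ [i]) = fe_mon w \<otimes>\<^bsub>FE 2\<^esub> fe_gen i" unfolding gen_eq_mon mon_append ..
    then have "cl (fe_mon (w @ [i])) = cl (fe_mon w) \<otimes>\<^bsub>U\<^esub> (if i = 1 then X else Y)"
      using m(2)[OF mem] cl_gen[of i] snoc by simp
    then show ?case using step snoc by auto
  qed
  obtain y where y: "y \<in> carrier (FE 2)" "x = cl y" using x by (auto simp: carrier_U)
  have "l (cl y) = r (cl y)"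
    by (rule generates_eq[OF generates_FE graded_frechet_FE U.frechet
          blin_comp[OF m(1) l U.frechet] blin_comp[OF m(1) r U.frechet] _ y(1)]) (use w in blast)
  then show ?thesis by (simp add: y)
qed

subsection \<open>The Hopf algebra axioms\<close>

context
  fixes \<Delta> \<epsilon> S
  assumes \<Delta>: "\<Delta> \<in> alg_hom U un UU.TA UU.P" "\<Delta> X = \<Delta>X" "\<Delta> Y = \<Delta>Y"
    and \<epsilon>: "\<epsilon> \<in> alg_hom U un complex_alg (\<lambda>k. cmod)" "\<epsilon> X = 0" "\<epsilon> Y = 0"
    and S: "S \<in> alg_hom U un (opposite U) un"
      "S X = (-1) \<odot>\<^bsub>U\<^esub> X \<oplus>\<^bsub>U\<^esub> (- (h / sinh h)) \<odot>\<^bsub>U\<^esub> \<sigma>" "S Y = (-1) \<odot>\<^bsub>U\<^esub> Y"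
begin

lemma \<Delta>_E: "\<Delta> (E c) = UU.elem (E c) (E c)"
proof (rule UU.TA.is_exp_unique)
  show "is_exp UU.TA UU.P (\<Delta> (c \<odot>\<^bsub>U\<^esub> Y)) (\<Delta> (E c))"
    by (rule alg_hom_exp[OF UA UU.graded_algebra_TA \<Delta>(1) E_exp])
  show "is_exp UU.TA UU.P (\<Delta> (c \<odot>\<^bsub>U\<^esub> Y)) (UU.elem (E c) (E c))"
    using is_exp_diag[of c] blinD(3)[OF alg_homD(1)[OF \<Delta>(1)] XY_carrier(2), of c] by (simp add: \<Delta>(3) \<Delta>Y_def)
qed

lemma \<epsilon>_E: "\<epsilon> (E c) = 1"
proof -
  interpret B: graded_algebra complex_alg "\<lambda>k. cmod" by (rule graded_algebra_complex)
  have "is_exp complex_alg (\<lambda>k. cmod) (\<epsilon> (c \<odot>\<^bsub>U\<^esub> Y)) (\<epsilon> (E c))"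
    by (rule alg_hom_exp[OF UA graded_algebra_complex \<epsilon>(1) E_exp])
  then have "is_exp complex_alg (\<lambda>k. cmod) 0 (\<epsilon> (E c))"
    using blinD(3)[OF alg_homD(1)[OF \<epsilon>(1)] XY_carrier(2), of c] by (simp add: \<epsilon>(3))
  then show ?thesis using B.is_exp_unique B.is_exp_zero by simp
qed

lemma S_E: "S (E c) = E (- c)"
proof -
  have "is_exp U un (S (c \<odot>\<^bsub>U\<^esub> Y)) (S (E c))"
    using alg_hom_exp[OF UA graded_algebra_opposite[OF UA] S(1) E_exp, of c] unfolding is_exp_opposite[OF UA] .
  then have "is_exp U un ((- c) \<odot>\<^bsub>U\<^esub> Y) (S (E c))"
    using blinD(3)[OF alg_homD(1)[OF S(1)] XY_carrier(2), of c] by (simp add: S(3))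
  then show ?thesis using U.is_exp_unique E_exp by blast
qed

lemma S_blin: "S \<in> blin U un U un"
  using alg_homD(1)[OF S(1)] by simp

lemma S_antihom: "a \<in> carrier U \<Longrightarrow> b \<in> carrier U \<Longrightarrow> S (a \<otimes>\<^bsub>U\<^esub> b) = S b \<otimes>\<^bsub>U\<^esub> S a" "S \<one>\<^bsub>U\<^esub> = \<one>\<^bsub>U\<^esub>"
  using alg_homD[OF S(1)] by simp_all

lemma \<Delta>_carrier: "x \<in> carrier U \<Longrightarrow> \<Delta> x \<in> carrier UU.T"
  using alg_homD(4)[OF \<Delta>(1)] by simp

lemma \<Delta>_blin: "\<Delta> \<in> blin U un UU.T UU.P"
  using alg_homD(1)[OF \<Delta>(1)] by simp

text \<open>Both sides are homomorphisms \<open>U \<rightarrow> U \<otimes> (U \<otimes> U)\<close>. They send \<open>X\<close> to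
  \<open>X \<otimes> (E(-h) \<otimes> E(-h)) + E(h) \<otimes> (X \<otimes> E(-h)) + E(h) \<otimes> (E(h) \<otimes> X)\<close>.\<close>

lemma coassociative:
  assumes x: "x \<in> carrier U"
  shows "tensor_assoc U U U (tensor_map U U (tensor_space U U) U \<Delta> id (\<Delta> x)) =
    tensor_map U U U (tensor_space U U) id \<Delta> (\<Delta> x)"
proof -
  interpret TT: tensor_triple U un U un U un by (intro tensor_triple.intro UA)
  let ?l = "tensor_map U U UU.TA U \<Delta> (\<lambda>x. x)" and ?r = "tensor_map U U U UU.TA (\<lambda>x. x) \<Delta>"
  have idh: "(\<lambda>x. x) \<in> alg_hom U un U un" by (rule alg_hom_id[OF U.frechet])
  have l: "?l \<in> alg_hom UU.TA UU.P TT.UV_W.TA TT.UV_W.P"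
    by (rule tensor_map_hom[OF UA UA UU.graded_algebra_TA UA \<Delta>(1) idh])
  have r: "?r \<in> alg_hom UU.TA UU.P TT.U_VW.TA TT.U_VW.P"
    by (rule tensor_map_hom[OF UA UA UA UU.graded_algebra_TA idh \<Delta>(1)])
  note le = tensor_map_elem[OF U.frechet U.frechet UU.TA.frechet U.frechet alg_homD(1)[OF \<Delta>(1)] id_blin]
  note re = tensor_map_elem[OF U.frechet U.frechet U.frechet UU.TA.frechet id_blin alg_homD(1)[OF \<Delta>(1)]]
  note lb = blinD[OF alg_homD(1)[OF l]] and rb = blinD[OF alg_homD(1)[OF r]]
    and ab = blinD[OF alg_homD(1)[OF TT.assoc_hom]]
  have gl: "(\<lambda>x. tensor_assoc U U U (?l (\<Delta> x))) \<in> alg_hom U un TT.U_VW.TA TT.U_VW.P"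
    by (rule alg_hom_comp[OF alg_hom_comp[OF \<Delta>(1) l UU.TA.frechet] TT.assoc_hom TT.UV_W.TA.frechet])
  have gr: "(\<lambda>x. ?r (\<Delta> x)) \<in> alg_hom U un TT.U_VW.TA TT.U_VW.P"
    by (rule alg_hom_comp[OF \<Delta>(1) r UU.TA.frechet])
  have elb: "UU.elem a b \<in> carrier UU.TA" if "a \<in> carrier U" "b \<in> carrier U" for a b using that by simp
  let ?a3 = "\<lambda>a b c. TT.U_VW.elem a (UU.elem b c)"
  have c3: "?a3 a b c \<in> carrier TT.U_VW.T" if "a \<in> carrier U" "b \<in> carrier U" "c \<in> carrier U" for a b c
    using that TT.U_VW.elem_closed[of a "UU.elem b c"] by simp
  have left: "tensor_assoc U U U (?l (UU.elem a b \<oplus>\<^bsub>UU.T\<^esub> UU.elem c d)) =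
      tensor_assoc U U U (TT.UV_W.elem (\<Delta> a) b) \<oplus>\<^bsub>TT.U_VW.T\<^esub> tensor_assoc U U U (TT.UV_W.elem (\<Delta> c) d)"
    if "a \<in> carrier U" "b \<in> carrier U" "c \<in> carrier U" "d \<in> carrier U" for a b c d
  proof -
    have m: "TT.UV_W.elem (\<Delta> a) b \<in> carrier TT.UV_W.TA" "TT.UV_W.elem (\<Delta> c) d \<in> carrier TT.UV_W.TA"
      using that \<Delta>_carrier TT.UV_W.elem_closed[of "\<Delta> a" b] TT.UV_W.elem_closed[of "\<Delta> c" d] by auto
    have "?l (UU.elem a b \<oplus>\<^bsub>UU.TA\<^esub> UU.elem c d) = TT.UV_W.elem (\<Delta> a) b \<oplus>\<^bsub>TT.UV_W.TA\<^esub> TT.UV_W.elem (\<Delta> c) d"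
      using lb(2)[OF elb elb] that by (simp only: le)
    then show ?thesis using ab(2)[OF m] by simp
  qed
  have right: "?r (UU.elem a b \<oplus>\<^bsub>UU.T\<^esub> UU.elem c d) =
      TT.U_VW.elem a (\<Delta> b) \<oplus>\<^bsub>TT.U_VW.T\<^esub> TT.U_VW.elem c (\<Delta> d)"
    if "a \<in> carrier U" "b \<in> carrier U" "c \<in> carrier U" "d \<in> carrier U" for a b c d
    using rb(2)[OF elb elb] that by (simp add: re)
  have split: "tensor_assoc U U U (TT.UV_W.elem (UU.elem a b \<oplus>\<^bsub>UU.T\<^esub> UU.elem c d) z) =
      ?a3 a b z \<oplus>\<^bsub>TT.U_VW.T\<^esub> ?a3 c d z"
    if "a \<in> carrier U" "b \<in> carrier U" "c \<in> carrier U" "d \<in> carrier U" "z \<in> carrier U" for a b c d z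
  proof -
    have "UU.elem a b \<oplus>\<^bsub>UU.T\<^esub> UU.elem c d \<in> carrier UU.T" using that by (intro UU.T.M.a_closed) auto
    then show ?thesis
      using that blinD(2)[OF TT.G_blin[of z] UU.elem_closed[of a b] UU.elem_closed[of c d]]
      by (subst TT.assoc_elem) (auto simp: TT.G_elem)
  qed
  have split': "TT.U_VW.elem z (UU.elem a b \<oplus>\<^bsub>UU.T\<^esub> UU.elem c d) = ?a3 z a b \<oplus>\<^bsub>TT.U_VW.T\<^esub> ?a3 z c d"
    if "a \<in> carrier U" "b \<in> carrier U" "c \<in> carrier U" "d \<in> carrier U" "z \<in> carrier U" for a b c d z
    using that TT.U_VW.elem_add_right[of z "UU.elem a b" "UU.elem c d"] by simp
  have "tensor_assoc U U U (?l (\<Delta> x)) = ?r (\<Delta> x)"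
  proof (rule U_hom_eq[OF TT.U_VW.graded_algebra_TA gl gr _ _ x])
    show "tensor_assoc U U U (?l (\<Delta> X)) = ?r (\<Delta> X)"
      unfolding \<Delta>(2) \<Delta>X_def
      by (simp add: left right \<Delta>(2) \<Delta>_E \<Delta>X_def split[simplified] split'[simplified] TT.assoc_elem_elem[simplified] TT.U_VW.T.M.a_assoc[simplified] c3[simplified])
    show "tensor_assoc U U U (?l (\<Delta> Y)) = ?r (\<Delta> Y)"
      unfolding \<Delta>(3) \<Delta>Y_def
      using alg_homD(3)[OF \<Delta>(1)]
      by (simp add: left right \<Delta>(3) \<Delta>Y_def split[simplified] split'[simplified] TT.assoc_elem_elem[simplified] TT.U_VW.T.M.a_ac[simplified] c3[simplified])
  qed
  then show ?thesis by (simp add: tensor_map_def id_def)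
qed

abbreviation (input) "\<eta>\<epsilon> \<equiv> \<lambda>a. \<epsilon> a \<odot>\<^bsub>U\<^esub> \<one>\<^bsub>U\<^esub>"

lemma \<epsilon>_lin: "a \<in> carrier U \<Longrightarrow> b \<in> carrier U \<Longrightarrow> \<epsilon> (a \<oplus>\<^bsub>U\<^esub> b) = \<epsilon> a + \<epsilon> b"
  "a \<in> carrier U \<Longrightarrow> \<epsilon> (c \<odot>\<^bsub>U\<^esub> a) = c * \<epsilon> a" "a \<in> carrier U \<Longrightarrow> b \<in> carrier U \<Longrightarrow> \<epsilon> (a \<otimes>\<^bsub>U\<^esub> b) = \<epsilon> a * \<epsilon> b"
  "\<epsilon> \<one>\<^bsub>U\<^esub> = 1"
  using alg_homD[OF \<epsilon>(1)] blinD[OF alg_homD(1)[OF \<epsilon>(1)]] by simp_all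

lemma \<eta>\<epsilon>_blin: "\<eta>\<epsilon> \<in> blin U un U un"
proof (rule blinI)
  fix j
  obtain k C where C: "\<And>x. x \<in> carrier U \<Longrightarrow> cmod (\<epsilon> x) \<le> C * un k x"
    using blinD(4)[OF alg_homD(1)[OF \<epsilon>(1)]] by meson
  have "un j (\<epsilon> x \<odot>\<^bsub>U\<^esub> \<one>\<^bsub>U\<^esub>) \<le> (C * un j \<one>\<^bsub>U\<^esub>) * un k x" if "x \<in> carrier U" for x
  proof -
    have "un j (\<epsilon> x \<odot>\<^bsub>U\<^esub> \<one>\<^bsub>U\<^esub>) = cmod (\<epsilon> x) * un j \<one>\<^bsub>U\<^esub>" by (rule U.p_sm) simp
    also have "\<dots> \<le> (C * un k x) * un j \<one>\<^bsub>U\<^esub>" by (rule mult_right_mono[OF C[OF that] U.nonneg]) simp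
    finally show ?thesis by (simp only: mult_ac)
  qed
  then show "\<exists>k C. \<forall>x\<in>carrier U. un j (\<epsilon> x \<odot>\<^bsub>U\<^esub> \<one>\<^bsub>U\<^esub>) \<le> C * un k x" by blast
qed (auto simp: \<epsilon>_lin U.sm_ladd)

text \<open>Both maps on the tensor square are homomorphisms because the values of \<open>\<epsilon>\<close> are scalars, hence central.\<close>

lemma counit:
  assumes x: "x \<in> carrier U"
  shows "tensor_lift U U U (\<lambda>a b. \<epsilon> a \<odot>\<^bsub>U\<^esub> b) (\<Delta> x) = x" "tensor_lift U U U (\<lambda>a b. \<epsilon> b \<odot>\<^bsub>U\<^esub> a) (\<Delta> x) = x"
proof -
  have 1: "tensor_lift U U U (\<lambda>a b. \<epsilon> a \<odot>\<^bsub>U\<^esub> b) = mu \<eta>\<epsilon> (\<lambda>x. x)"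
    unfolding mu_def by (rule UU.tensor_lift_cong) (simp add: U.sm_mult_left)
  have 2: "tensor_lift U U U (\<lambda>a b. \<epsilon> b \<odot>\<^bsub>U\<^esub> a) = mu (\<lambda>x. x) \<eta>\<epsilon>"
    unfolding mu_def by (rule UU.tensor_lift_cong) (simp add: U.sm_mult_right)
  note me1 = mu_elem[OF \<eta>\<epsilon>_blin id_blin] and me2 = mu_elem[OF id_blin \<eta>\<epsilon>_blin]
  have h1: "mu \<eta>\<epsilon> (\<lambda>x. x) \<in> alg_hom UU.TA UU.P U un"
    by (rule UU.tensor_alg_hom[OF UA mu_blin[OF \<eta>\<epsilon>_blin id_blin]])
      (simp_all add: me1 \<epsilon>_lin U.sm_mult_left U.sm_mult_right mult.commute)
  have h2: "mu (\<lambda>x. x) \<eta>\<epsilon> \<in> alg_hom UU.TA UU.P U un"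
    by (rule UU.tensor_alg_hom[OF UA mu_blin[OF id_blin \<eta>\<epsilon>_blin]])
      (simp_all add: me2 \<epsilon>_lin U.sm_mult_left U.sm_mult_right mult.commute)
  show "tensor_lift U U U (\<lambda>a b. \<epsilon> a \<odot>\<^bsub>U\<^esub> b) (\<Delta> x) = x"
    unfolding 1
    by (rule U_hom_eq[OF UA alg_hom_comp[OF \<Delta>(1) h1 UU.TA.frechet] alg_hom_id[OF U.frechet] _ _ x])
      (simp_all add: \<Delta> \<Delta>X_def \<Delta>Y_def mu_add[OF \<eta>\<epsilon>_blin id_blin] me1 \<epsilon>_lin \<epsilon>_E \<epsilon> U.sm_mult_left)
  show "tensor_lift U U U (\<lambda>a b. \<epsilon> b \<odot>\<^bsub>U\<^esub> a) (\<Delta> x) = x"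
    unfolding 2
    by (rule U_hom_eq[OF UA alg_hom_comp[OF \<Delta>(1) h2 UU.TA.frechet] alg_hom_id[OF U.frechet] _ _ x])
      (simp_all add: \<Delta> \<Delta>X_def \<Delta>Y_def mu_add[OF id_blin \<eta>\<epsilon>_blin] me2 \<epsilon>_lin \<epsilon>_E \<epsilon> U.sm_mult_right)
qed

text \<open>Since \<open>S\<close> reverses products, \<open>\<mu> (S \<otimes> 1)\<close> is not multiplicative. But
  \<open>S(a c) b d = S(c) (S(a) b) d\<close>, so that it maps \<open>u (c \<otimes> d)\<close> to \<open>S(c) m d\<close>, where \<open>m\<close> is its value at \<open>u\<close>;
  if \<open>m\<close> is a scalar, it can be moved to the front.\<close>

lemma mu_S_left:
  assumes u: "u \<in> carrier UU.T" and v: "v \<in> carrier UU.T" and e: "mu S (\<lambda>x. x) u = e \<odot>\<^bsub>U\<^esub> \<one>\<^bsub>U\<^esub>"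
  shows "mu S (\<lambda>x. x) (u \<otimes>\<^bsub>UU.TA\<^esub> v) = e \<odot>\<^bsub>U\<^esub> mu S (\<lambda>x. x) v"
proof -
  let ?m = "mu S (\<lambda>x. x)"
  note mb = mu_blin[OF S_blin id_blin] and me = mu_elem[OF S_blin id_blin]
  note Sc = blinD(1)[OF S_blin]
  have inner: "?m (u \<otimes>\<^bsub>UU.TA\<^esub> UU.elem c d) = S c \<otimes>\<^bsub>U\<^esub> ?m u \<otimes>\<^bsub>U\<^esub> d" if cd: "c \<in> carrier U" "d \<in> carrier U" for c d
  proof (rule UU.tensor_eq[OF U.frechet _ _ _ u])
    show "(\<lambda>u. ?m (u \<otimes>\<^bsub>UU.TA\<^esub> UU.elem c d)) \<in> blin UU.T UU.P U un"
      using cd by (intro blin_comp[OF UU.TA_blin_right mb UU.graded_frechet_T]) auto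
    show "(\<lambda>u. S c \<otimes>\<^bsub>U\<^esub> ?m u \<otimes>\<^bsub>U\<^esub> d) \<in> blin UU.T UU.P U un"
      by (rule blin_comp[OF blin_comp[OF mb U.mult_blin_left[OF Sc[OF cd(1)]] U.frechet]
            U.mult_blin_right[OF cd(2)] U.frechet])
    show "?m (UU.elem a b \<otimes>\<^bsub>UU.TA\<^esub> UU.elem c d) = S c \<otimes>\<^bsub>U\<^esub> ?m (UU.elem a b) \<otimes>\<^bsub>U\<^esub> d"
      if "a \<in> carrier U" "b \<in> carrier U" for a b
      using that cd Sc by (simp add: UU.TA_elem_elem me S_antihom U.mul_assoc)
  qed
  show ?thesis
  proof (rule UU.tensor_eq[OF U.frechet _ _ _ v])
    show "(\<lambda>v. ?m (u \<otimes>\<^bsub>UU.TA\<^esub> v)) \<in> blin UU.T UU.P U un"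
      by (rule blin_comp[OF UU.TA_blin_left[OF u] mb UU.graded_frechet_T])
    show "(\<lambda>v. e \<odot>\<^bsub>U\<^esub> ?m v) \<in> blin UU.T UU.P U un" by (rule blin_sm[OF mb U.frechet])
    show "?m (u \<otimes>\<^bsub>UU.TA\<^esub> UU.elem c d) = e \<odot>\<^bsub>U\<^esub> ?m (UU.elem c d)" if "c \<in> carrier U" "d \<in> carrier U" for c d
      using that Sc by (simp add: inner e me U.sm_mult_left U.sm_mult_right)
  qed
qed

text \<open>The mirror image, based on \<open>a c S(b d) = a (c S(d)) S(b)\<close>: now the right factor must go to a scalar.\<close>

lemma mu_S_right:
  assumes u: "u \<in> carrier UU.T" and v: "v \<in> carrier UU.T" and e: "mu (\<lambda>x. x) S v = e \<odot>\<^bsub>U\<^esub> \<one>\<^bsub>U\<^esub>"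
  shows "mu (\<lambda>x. x) S (u \<otimes>\<^bsub>UU.TA\<^esub> v) = e \<odot>\<^bsub>U\<^esub> mu (\<lambda>x. x) S u"
proof -
  let ?m = "mu (\<lambda>x. x) S"
  note mb = mu_blin[OF id_blin S_blin] and me = mu_elem[OF id_blin S_blin]
  note Sc = blinD(1)[OF S_blin]
  have inner: "?m (UU.elem a b \<otimes>\<^bsub>UU.TA\<^esub> v) = a \<otimes>\<^bsub>U\<^esub> ?m v \<otimes>\<^bsub>U\<^esub> S b" if ab: "a \<in> carrier U" "b \<in> carrier U" for a b
  proof (rule UU.tensor_eq[OF U.frechet _ _ _ v])
    show "(\<lambda>v. ?m (UU.elem a b \<otimes>\<^bsub>UU.TA\<^esub> v)) \<in> blin UU.T UU.P U un"
      using ab by (intro blin_comp[OF UU.TA_blin_left mb UU.graded_frechet_T]) auto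
    show "(\<lambda>v. a \<otimes>\<^bsub>U\<^esub> ?m v \<otimes>\<^bsub>U\<^esub> S b) \<in> blin UU.T UU.P U un"
      by (rule blin_comp[OF blin_comp[OF mb U.mult_blin_left[OF ab(1)] U.frechet]
            U.mult_blin_right[OF Sc[OF ab(2)]] U.frechet])
    show "?m (UU.elem a b \<otimes>\<^bsub>UU.TA\<^esub> UU.elem c d) = a \<otimes>\<^bsub>U\<^esub> ?m (UU.elem c d) \<otimes>\<^bsub>U\<^esub> S b"
      if "c \<in> carrier U" "d \<in> carrier U" for c d
      using that ab Sc by (simp add: UU.TA_elem_elem me S_antihom U.mul_assoc)
  qed
  show ?thesis
  proof (rule UU.tensor_eq[OF U.frechet _ _ _ u])
    show "(\<lambda>u. ?m (u \<otimes>\<^bsub>UU.TA\<^esub> v)) \<in> blin UU.T UU.P U un"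
      by (rule blin_comp[OF UU.TA_blin_right[OF v] mb UU.graded_frechet_T])
    show "(\<lambda>u. e \<odot>\<^bsub>U\<^esub> ?m u) \<in> blin UU.T UU.P U un" by (rule blin_sm[OF mb U.frechet])
    show "?m (UU.elem a b \<otimes>\<^bsub>UU.TA\<^esub> v) = e \<odot>\<^bsub>U\<^esub> ?m (UU.elem a b)" if "a \<in> carrier U" "b \<in> carrier U" for a b
      using that Sc by (simp add: inner e me U.sm_mult_left U.sm_mult_right)
  qed
qed

lemma sm_cancel_gen: "x \<in> carrier U \<Longrightarrow> a + b = 0 \<Longrightarrow> a \<odot>\<^bsub>U\<^esub> x \<oplus>\<^bsub>U\<^esub> b \<odot>\<^bsub>U\<^esub> x = \<zero>\<^bsub>U\<^esub>"
  by (simp flip: U.sm_ladd)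

text \<open>For \<open>\<Delta>X\<close> these are the identities \<open>S(X) E(-h) + E(-h) X = 0\<close> and \<open>X E(h) + E(h) S(X) = 0\<close>. By
  \<open>XE_rel\<close> the commutators produce precisely the multiple of \<open>\<sigma>\<close> that is subtracted in \<open>S(X)\<close>.\<close>

lemma mu_S_gens:
  "mu S (\<lambda>x. x) \<Delta>X = 0 \<odot>\<^bsub>U\<^esub> \<one>\<^bsub>U\<^esub>" "mu S (\<lambda>x. x) \<Delta>Y = 0 \<odot>\<^bsub>U\<^esub> \<one>\<^bsub>U\<^esub>"
  "mu (\<lambda>x. x) S \<Delta>X = 0 \<odot>\<^bsub>U\<^esub> \<one>\<^bsub>U\<^esub>" "mu (\<lambda>x. x) S \<Delta>Y = 0 \<odot>\<^bsub>U\<^esub> \<one>\<^bsub>U\<^esub>"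
proof -
  let ?k = "h / sinh h"
  note me1 = mu_elem[OF S_blin id_blin] mu_add[OF S_blin id_blin]
    and me2 = mu_elem[OF id_blin S_blin] mu_add[OF id_blin S_blin]
  have z: "x \<oplus>\<^bsub>U\<^esub> y \<oplus>\<^bsub>U\<^esub> z = \<zero>\<^bsub>U\<^esub>" if "x = (-1) \<odot>\<^bsub>U\<^esub> z \<oplus>\<^bsub>U\<^esub> c \<odot>\<^bsub>U\<^esub> w" "y = (- c) \<odot>\<^bsub>U\<^esub> w" "z \<in> carrier U" "w \<in> carrier U"
    for x y z w c
  proof -
    have "x \<oplus>\<^bsub>U\<^esub> y \<oplus>\<^bsub>U\<^esub> z = ((-1) \<odot>\<^bsub>U\<^esub> z \<oplus>\<^bsub>U\<^esub> 1 \<odot>\<^bsub>U\<^esub> z) \<oplus>\<^bsub>U\<^esub> (c \<odot>\<^bsub>U\<^esub> w \<oplus>\<^bsub>U\<^esub> (- c) \<odot>\<^bsub>U\<^esub> w)"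
      using that by (simp add: U.M.a_ac)
    also have "\<dots> = \<zero>\<^bsub>U\<^esub>"
      using sm_cancel_gen[OF that(3) left_minus] sm_cancel_gen[OF that(4) right_minus] by (simp only:) simp
    finally show ?thesis .
  qed
  have 1: "mu S (\<lambda>x. x) \<Delta>X =
      ((-1) \<odot>\<^bsub>U\<^esub> (X \<otimes>\<^bsub>U\<^esub> E (- h)) \<oplus>\<^bsub>U\<^esub> (- ?k) \<odot>\<^bsub>U\<^esub> (E (- h) \<otimes>\<^bsub>U\<^esub> \<sigma>)) \<oplus>\<^bsub>U\<^esub> E (- h) \<otimes>\<^bsub>U\<^esub> X"
    unfolding \<Delta>X_def by (simp add: me1 S S_E U.mul_distr U.sm_mult_left \<sigma>_comm)
  have "mu S (\<lambda>x. x) \<Delta>X = \<zero>\<^bsub>U\<^esub>"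
    unfolding 1 by (rule z[of _ _ ?k "E (- h) \<otimes>\<^bsub>U\<^esub> \<sigma>"]) (simp_all add: XE_rel U.sm_radd)
  then show "mu S (\<lambda>x. x) \<Delta>X = 0 \<odot>\<^bsub>U\<^esub> \<one>\<^bsub>U\<^esub>" by simp
  have 2: "mu (\<lambda>x. x) S \<Delta>X = X \<otimes>\<^bsub>U\<^esub> E h \<oplus>\<^bsub>U\<^esub>
      ((-1) \<odot>\<^bsub>U\<^esub> (E h \<otimes>\<^bsub>U\<^esub> X) \<oplus>\<^bsub>U\<^esub> (- ?k) \<odot>\<^bsub>U\<^esub> (E h \<otimes>\<^bsub>U\<^esub> \<sigma>))"
    unfolding \<Delta>X_def by (simp add: me2 S S_E U.mul_distr U.sm_mult_right)
  have "\<dots> = (E h \<otimes>\<^bsub>U\<^esub> X \<oplus>\<^bsub>U\<^esub> (-1) \<odot>\<^bsub>U\<^esub> (E h \<otimes>\<^bsub>U\<^esub> X)) \<oplus>\<^bsub>U\<^esub>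
      (?k \<odot>\<^bsub>U\<^esub> (E h \<otimes>\<^bsub>U\<^esub> \<sigma>) \<oplus>\<^bsub>U\<^esub> (- ?k) \<odot>\<^bsub>U\<^esub> (E h \<otimes>\<^bsub>U\<^esub> \<sigma>))"
    by (simp add: XE_rel U.M.a_ac)
  also have "\<dots> = \<zero>\<^bsub>U\<^esub>" by (simp add: sm_cancel sm_cancel_gen)
  finally show "mu (\<lambda>x. x) S \<Delta>X = 0 \<odot>\<^bsub>U\<^esub> \<one>\<^bsub>U\<^esub>" using 2 by simp
  show "mu S (\<lambda>x. x) \<Delta>Y = 0 \<odot>\<^bsub>U\<^esub> \<one>\<^bsub>U\<^esub>"
    unfolding \<Delta>Y_def by (simp add: me1 S S_antihom sm_cancel)
  show "mu (\<lambda>x. x) S \<Delta>Y = 0 \<odot>\<^bsub>U\<^esub> \<one>\<^bsub>U\<^esub>"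
    unfolding \<Delta>Y_def using sm_cancel[of Y] by (simp add: me2 S S_antihom U.M.a_comm)
qed

lemma antipode:
  assumes x: "x \<in> carrier U"
  shows "tensor_lift U U U (\<lambda>a b. S a \<otimes>\<^bsub>U\<^esub> b) (\<Delta> x) = \<epsilon> x \<odot>\<^bsub>U\<^esub> \<one>\<^bsub>U\<^esub>"
    "tensor_lift U U U (\<lambda>a b. a \<otimes>\<^bsub>U\<^esub> S b) (\<Delta> x) = \<epsilon> x \<odot>\<^bsub>U\<^esub> \<one>\<^bsub>U\<^esub>"
proof -
  note mb1 = mu_blin[OF S_blin id_blin] and mb2 = mu_blin[OF id_blin S_blin]
  note dm = alg_homD(2)[OF \<Delta>(1)] and mc1 = blinD(1)[OF mb1 \<Delta>_carrier] and mc2 = blinD(1)[OF mb2 \<Delta>_carrier]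
  have one: "\<Delta> \<one>\<^bsub>U\<^esub> = UU.elem \<one>\<^bsub>U\<^esub> \<one>\<^bsub>U\<^esub>" using alg_homD(3)[OF \<Delta>(1)] by simp
  have "mu S (\<lambda>x. x) (\<Delta> x) = \<epsilon> x \<odot>\<^bsub>U\<^esub> \<one>\<^bsub>U\<^esub>"
  proof (rule blin_eq_left_induct[OF blin_comp[OF \<Delta>_blin mb1 UU.graded_frechet_T] \<eta>\<epsilon>_blin _ _ x])
    show "mu S (\<lambda>x. x) (\<Delta> \<one>\<^bsub>U\<^esub>) = \<epsilon> \<one>\<^bsub>U\<^esub> \<odot>\<^bsub>U\<^esub> \<one>\<^bsub>U\<^esub>"
      by (simp add: one mu_elem[OF S_blin id_blin] S_antihom \<epsilon>_lin)
    fix y assume y: "y \<in> carrier U"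
    show "mu S (\<lambda>x. x) (\<Delta> (X \<otimes>\<^bsub>U\<^esub> y)) = \<epsilon> (X \<otimes>\<^bsub>U\<^esub> y) \<odot>\<^bsub>U\<^esub> \<one>\<^bsub>U\<^esub> \<and>
        mu S (\<lambda>x. x) (\<Delta> (Y \<otimes>\<^bsub>U\<^esub> y)) = \<epsilon> (Y \<otimes>\<^bsub>U\<^esub> y) \<odot>\<^bsub>U\<^esub> \<one>\<^bsub>U\<^esub>"
      using y mc1[OF y]
      by (simp add: dm \<Delta> \<epsilon> \<epsilon>_lin mu_S_left[OF \<Delta>XY_carrier(1) \<Delta>_carrier[OF y] mu_S_gens(1)]
          mu_S_left[OF \<Delta>XY_carrier(2) \<Delta>_carrier[OF y] mu_S_gens(2)])
  qed
  then show "tensor_lift U U U (\<lambda>a b. S a \<otimes>\<^bsub>U\<^esub> b) (\<Delta> x) = \<epsilon> x \<odot>\<^bsub>U\<^esub> \<one>\<^bsub>U\<^esub>" by (simp add: mu_def)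
  have "mu (\<lambda>x. x) S (\<Delta> x) = \<epsilon> x \<odot>\<^bsub>U\<^esub> \<one>\<^bsub>U\<^esub>"
  proof (rule blin_eq_right_induct[OF blin_comp[OF \<Delta>_blin mb2 UU.graded_frechet_T] \<eta>\<epsilon>_blin _ _ x])
    show "mu (\<lambda>x. x) S (\<Delta> \<one>\<^bsub>U\<^esub>) = \<epsilon> \<one>\<^bsub>U\<^esub> \<odot>\<^bsub>U\<^esub> \<one>\<^bsub>U\<^esub>"
      by (simp add: one mu_elem[OF id_blin S_blin] S_antihom \<epsilon>_lin)
    fix y assume y: "y \<in> carrier U"
    show "mu (\<lambda>x. x) S (\<Delta> (y \<otimes>\<^bsub>U\<^esub> X)) = \<epsilon> (y \<otimes>\<^bsub>U\<^esub> X) \<odot>\<^bsub>U\<^esub> \<one>\<^bsub>U\<^esub> \<and>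
        mu (\<lambda>x. x) S (\<Delta> (y \<otimes>\<^bsub>U\<^esub> Y)) = \<epsilon> (y \<otimes>\<^bsub>U\<^esub> Y) \<odot>\<^bsub>U\<^esub> \<one>\<^bsub>U\<^esub>"
      using y mc2[OF y]
      by (simp add: dm \<Delta> \<epsilon> \<epsilon>_lin mu_S_right[OF \<Delta>_carrier[OF y] \<Delta>XY_carrier(1) mu_S_gens(3)]
          mu_S_right[OF \<Delta>_carrier[OF y] \<Delta>XY_carrier(2) mu_S_gens(4)])
  qed
  then show "tensor_lift U U U (\<lambda>a b. a \<otimes>\<^bsub>U\<^esub> S b) (\<Delta> x) = \<epsilon> x \<odot>\<^bsub>U\<^esub> \<one>\<^bsub>U\<^esub>" by (simp add: mu_def)
qed

end

text \<open>The composite of the two antihomomorphisms is an endomorphism of \<open>U\<close>. It fixes \<open>Y\<close>, and also \<open>X\<close>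
  because \<open>g\<close> changes the sign of \<open>\<sigma>\<close>, so that the two multiples of \<open>\<sigma>\<close> cancel.\<close>

lemma antipode_comp_inverse:
  assumes f: "f \<in> alg_hom U un (opposite U) un" "f X = (-1) \<odot>\<^bsub>U\<^esub> X \<oplus>\<^bsub>U\<^esub> c \<odot>\<^bsub>U\<^esub> \<sigma>" "f Y = (-1) \<odot>\<^bsub>U\<^esub> Y"
    and g: "g \<in> alg_hom U un (opposite U) un" "g X = (-1) \<odot>\<^bsub>U\<^esub> X \<oplus>\<^bsub>U\<^esub> (- c) \<odot>\<^bsub>U\<^esub> \<sigma>" "g Y = (-1) \<odot>\<^bsub>U\<^esub> Y"
    and x: "x \<in> carrier U"
  shows "g (f x) = x"
proof -
  note gl = blinD(2,3)[OF alg_homD(1)[OF g(1)], simplified]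
  have gE: "g (E k) = E (- k)" for k
  proof -
    have "is_exp U un (g (k \<odot>\<^bsub>U\<^esub> Y)) (g (E k))"
      using alg_hom_exp[OF UA graded_algebra_opposite[OF UA] g(1) E_exp, of k] unfolding is_exp_opposite[OF UA] .
    then have "is_exp U un ((- k) \<odot>\<^bsub>U\<^esub> Y) (g (E k))" using gl(2)[of Y k] by (simp add: g(3))
    then show ?thesis using U.is_exp_unique E_exp by blast
  qed
  have g\<sigma>: "g \<sigma> = (-1) \<odot>\<^bsub>U\<^esub> \<sigma>"
    unfolding \<sigma>_eq by (simp add: gl gE U.sm_radd U.M.a_comm)
  have comp: "(\<lambda>x. g (f x)) \<in> alg_hom U un U un"
  proof -
    have "(\<lambda>x. g (f x)) \<in> blin U un U un"
      using blin_comp[of f U un U un g U un] alg_homD(1)[OF f(1)] alg_homD(1)[OF g(1)] U.frechet by simp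
    then show ?thesis
      using alg_homD[OF f(1)] alg_homD[OF g(1)] by (simp add: alg_hom_def)
  qed
  show ?thesis
  proof (rule U_hom_eq[OF UA comp alg_hom_id[OF U.frechet] _ _ x])
    have "g (f X) = X \<oplus>\<^bsub>U\<^esub> (c \<odot>\<^bsub>U\<^esub> \<sigma> \<oplus>\<^bsub>U\<^esub> (- c) \<odot>\<^bsub>U\<^esub> \<sigma>)"
      unfolding f(2) by (simp add: gl g g\<sigma> U.sm_radd U.M.a_assoc)
    also have "c \<odot>\<^bsub>U\<^esub> \<sigma> \<oplus>\<^bsub>U\<^esub> (- c) \<odot>\<^bsub>U\<^esub> \<sigma> = \<zero>\<^bsub>U\<^esub>"
      using U.sm_ladd[of \<sigma> c "- c"] by simp
    finally show "g (f X) = X" by simp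
    show "g (f Y) = Y" unfolding f(3) by (simp add: gl g)
  qed
qed

subsection \<open>Infinite dimension\<close>

text \<open>If \<open>Y\<close> goes to 0, so does \<open>sinh(hY)\<close>, and the value of \<open>X\<close> is arbitrary.\<close>

lemma evaluation_exists: "\<exists>f\<in>alg_hom U un (FE 1) (fen 1). f X = fe_gen 1 \<and> f Y = \<zero>\<^bsub>FE 1\<^esub>"
proof (rule U_hom_exists[OF graded_algebra_FE])
  have g: "fe_gen 1 \<in> carrier (FE 1)" by (rule gen_carrier) simp
  then show "fe_gen 1 \<in> carrier (FE 1)" .
  show "is_exp (FE 1) (fen 1) (h \<odot>\<^bsub>FE 1\<^esub> \<zero>\<^bsub>FE 1\<^esub>) \<one>\<^bsub>FE 1\<^esub>" "is_exp (FE 1) (fen 1) ((- h) \<odot>\<^bsub>FE 1\<^esub> \<zero>\<^bsub>FE 1\<^esub>) \<one>\<^bsub>FE 1\<^esub>"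
    using FE.is_exp_zero by simp_all
  have "rhs (FE 1) \<one>\<^bsub>FE 1\<^esub> \<one>\<^bsub>FE 1\<^esub> = \<zero>\<^bsub>FE 1\<^esub>" by (simp add: rhs_def FE_simps)
  then show "fe_gen 1 \<otimes>\<^bsub>FE 1\<^esub> \<zero>\<^bsub>FE 1\<^esub> = \<zero>\<^bsub>FE 1\<^esub> \<otimes>\<^bsub>FE 1\<^esub> fe_gen 1 \<oplus>\<^bsub>FE 1\<^esub> rhs (FE 1) \<one>\<^bsub>FE 1\<^esub> \<one>\<^bsub>FE 1\<^esub>"
    using g by (simp add: ring.ring_simprules(24,25)[OF FE.ring])
qed auto

text \<open>The coefficients of the images under the evaluation homomorphism define a linear map \<open>L\<close> to formal power
  series with \<open>X^n \<mapsto> z^n\<close>. If \<open>U\<close> had finite dimension, all powers of \<open>z\<close> would lie in the span of a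
  finite set.\<close>

lemma infinite_dimensional: "\<not> finite_dimensional U"
proof
  assume "finite_dimensional U"
  then obtain B where B: "finite B" "B \<subseteq> carrier U"
    "\<And>x. x \<in> carrier U \<Longrightarrow> \<exists>c. x = finsum U (\<lambda>b. c b \<odot>\<^bsub>U\<^esub> b) B"
    unfolding finite_dimensional_def by blast
  obtain f where f: "f \<in> alg_hom U un (FE 1) (fen 1)" "f X = fe_gen 1" using evaluation_exists by blast
  note fb = blinD[OF alg_homD(1)[OF f(1)]]
  define L where "L x = Abs_fps (\<lambda>n. f x (replicate n 1))" for x
  have L: "L (x \<oplus>\<^bsub>U\<^esub> y) = L x + L y" "L (c \<odot>\<^bsub>U\<^esub> x) = fps_const c * L x" if "x \<in> carrier U" "y \<in> carrier U" for x y c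
    using that by (simp_all add: L_def fps_eq_iff fb FE_simps)
  have Lsum: "L (finsum U (\<lambda>b. c b \<odot>\<^bsub>U\<^esub> b) A) \<in> fps.span (L ` B)" if "finite A" "A \<subseteq> B" for A c
    using that
  proof (induction A)
    case empty
    have "L \<zero>\<^bsub>U\<^esub> = 0" using L(2)[of "\<zero>\<^bsub>U\<^esub>" "\<zero>\<^bsub>U\<^esub>" 0] by simp
    then show ?case using fps.span_zero by simp
  next
    case (insert b A)
    have mem: "b \<in> carrier U" "\<And>a. a \<in> A \<Longrightarrow> a \<in> carrier U" using insert.prems B(2) by auto
    have "finsum U (\<lambda>b. c b \<odot>\<^bsub>U\<^esub> b) (insert b A) = c b \<odot>\<^bsub>U\<^esub> b \<oplus>\<^bsub>U\<^esub> finsum U (\<lambda>b. c b \<odot>\<^bsub>U\<^esub> b) A"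
      using insert.hyps mem by (intro U.M.finsum_insert) auto
    moreover have "finsum U (\<lambda>b. c b \<odot>\<^bsub>U\<^esub> b) A \<in> carrier U" using mem by (intro U.M.finsum_closed) auto
    ultimately have "L (finsum U (\<lambda>b. c b \<odot>\<^bsub>U\<^esub> b) (insert b A)) =
        fps_const (c b) * L b + L (finsum U (\<lambda>b. c b \<odot>\<^bsub>U\<^esub> b) A)"
      using mem by (simp add: L)
    then show ?case using insert mem
      by (auto intro!: fps.span_add[OF fps.span_scale[OF fps.span_base]])
  qed
  have pow: "L (X [^]\<^bsub>U\<^esub> n) = fps_X ^ n" for n
  proof -
    have "f (X [^]\<^bsub>U\<^esub> n) = fe_gen 1 [^]\<^bsub>FE 1\<^esub> n" using alg_hom_pow[OF UA graded_algebra_FE f(1) XY_carrier(1)] f(2) by simp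
    also have "\<dots> = fe_mon (replicate n 1)"
    proof (induction n)
      case 0
      show ?case unfolding FE.pow_0 by (simp add: FE_simps one_eq_mon)
    next
      case (Suc n)
      have "fe_gen 1 [^]\<^bsub>FE 1\<^esub> Suc n = fe_mon (replicate n 1 @ [1])"
        unfolding mon_append[where n=1, symmetric] FE.pow_Suc Suc by (simp only: gen_eq_mon)
      then show ?case by (simp add: replicate_append_same)
    qed
    finally have f_pow: "f (X [^]\<^bsub>U\<^esub> n) = fe_mon (replicate n 1)" .
    show ?thesis
    proof (rule fps_ext)
      show "fps_nth (L (X [^]\<^bsub>U\<^esub> n)) m = fps_nth (fps_X ^ n) m" for m
        unfolding L_def f_pow fps_nth_Abs_fps fe_mon_def fps_X_power_nth replicate_eq_replicate by simp
    qed
  qed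
  have "fps_X ^ n \<in> fps.span (L ` B)" for n
  proof -
    obtain c where "X [^]\<^bsub>U\<^esub> n = finsum U (\<lambda>b. c b \<odot>\<^bsub>U\<^esub> b) B" using B(3)[OF U.pow_closed[OF XY_carrier(1)]] by blast
    then show ?thesis using Lsum[OF B(1), of c] pow[of n] by simp
  qed
  then show False using fps_powers_not_finite_span[OF finite_imageI[OF B(1)]] by blast
qed

subsection \<open>The Hopf algebra\<close>

lemma HFG_U: "HFG_algebra U"
proof -
  have "restrict (\<lambda>x. x) (carrier U) \<in> cont_alg_hom U U"
    by (rule alg_hom_restrict[OF UA UA alg_hom_id[OF U.frechet]])
  then have "top_alg_isomorphic U U"
    unfolding top_alg_isomorphic_def by (intro bexI[of _ "restrict (\<lambda>x. x) (carrier U)"]) auto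
  then show ?thesis
    unfolding HFG_algebra_def using U.frechet_arens_michael C.ideal C.closed U_eq by auto
qed

lemma is_comult_iff:
  "is_af_comultiplication h \<Delta> \<longleftrightarrow> \<Delta> \<in> cont_alg_hom U UU.TA \<and> \<Delta> X = \<Delta>X \<and> \<Delta> Y = \<Delta>Y"
  by (simp add: is_af_comultiplication_def Let_def fun_Y fun_Y(1)[of "- h", simplified] \<Delta>X_def \<Delta>Y_def)

lemma is_antipode_iff:
  "is_af_antipode h S \<longleftrightarrow> S \<in> cont_alg_hom U (opposite U) \<and>
    S X = (-1) \<odot>\<^bsub>U\<^esub> X \<oplus>\<^bsub>U\<^esub> (- (h / sinh h)) \<odot>\<^bsub>U\<^esub> \<sigma> \<and> S Y = (-1) \<odot>\<^bsub>U\<^esub> Y"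
  by (simp add: is_af_antipode_def Let_def fun_Y cont_alg_antihom_iff[OF UA UA] U.minus_eq U.neg_eq_sm)

theorem Hopf_algebra_U:
  assumes \<Delta>: "is_af_comultiplication h \<Delta>" and \<epsilon>: "is_af_counit h \<epsilon>" and S: "is_af_antipode h S"
  shows "HFG_Hopf_algebra U \<Delta> \<epsilon> S" "top_lin_invertible U S"
proof -
  have d: "\<Delta> \<in> alg_hom U un UU.TA UU.P" "\<Delta> X = \<Delta>X" "\<Delta> Y = \<Delta>Y" "\<Delta> \<in> cont_alg_hom U UU.TA"
    using \<Delta> cont_alg_hom_iff[OF U.frechet UU.TA.frechet] by (auto simp: is_comult_iff)
  have e: "\<epsilon> \<in> alg_hom U un complex_alg (\<lambda>k. cmod)" "\<epsilon> X = 0" "\<epsilon> Y = 0" "\<epsilon> \<in> cont_alg_hom U complex_alg"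
    using \<epsilon> cont_alg_hom_iff[OF U.frechet graded_frechet_complex] by (auto simp: is_af_counit_def)
  have o: "graded_frechet (opposite U) un"
    using graded_algebra_opposite[OF UA] by (simp add: graded_algebra_def)
  have s: "S \<in> alg_hom U un (opposite U) un" "S X = (-1) \<odot>\<^bsub>U\<^esub> X \<oplus>\<^bsub>U\<^esub> (- (h / sinh h)) \<odot>\<^bsub>U\<^esub> \<sigma>"
    "S Y = (-1) \<odot>\<^bsub>U\<^esub> Y" "S \<in> cont_linear U U"
    using S cont_alg_hom_iff[OF U.frechet o] by (auto simp: is_antipode_iff cont_alg_hom_def)
  note ax = d(1-3) e(1-3) s(1-3)
  show "HFG_Hopf_algebra U \<Delta> \<epsilon> S"
    unfolding HFG_Hopf_algebra_def ctensor_Hopf_algebra_def ctensor_bialgebra_def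
    using HFG_U U.ctensor_algebra d(4) e(4) s(4) coassociative[OF ax] counit[OF ax] antipode[OF ax]
    by simp
  obtain g where g: "g \<in> alg_hom U un (opposite U) un"
    "g X = (-1) \<odot>\<^bsub>U\<^esub> X \<oplus>\<^bsub>U\<^esub> (h / sinh h) \<odot>\<^bsub>U\<^esub> \<sigma>" "g Y = (-1) \<odot>\<^bsub>U\<^esub> Y"
    using antipode_exists[of "h / sinh h"] by blast
  have gc: "restrict g (carrier U) \<in> cont_linear U U"
    using blin_cont_linear[of g U un U un] alg_homD(1)[OF g(1)] U.frechet by simp
  have "g (S x) = x" "S (g x) = x" "S x \<in> carrier U" "g x \<in> carrier U" if "x \<in> carrier U" for x
    using antipode_comp_inverse[OF s(1-3) _ _ _ that, of g] antipode_comp_inverse[OF g s(1-3) that] g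
      alg_homD(4)[OF s(1) that] alg_homD(4)[OF g(1) that] by simp_all
  then show "top_lin_invertible U S"
    unfolding top_lin_invertible_def using s(4) gc by (intro conjI bexI[of _ "restrict g (carrier U)"]) simp_all
qed

lemma structure_maps_ex1:
  "\<exists>!\<Delta>. is_af_comultiplication h \<Delta>" "\<exists>!\<epsilon>. is_af_counit h \<epsilon>" "\<exists>!S. is_af_antipode h S"
  using U_hom_ex1[OF UU.graded_algebra_TA comult_exists] U_hom_ex1[OF graded_algebra_complex counit_exists]
    U_hom_ex1[OF graded_algebra_opposite[OF UA] antipode_exists[of "- (h / sinh h)"]]
  by (simp_all add: is_comult_iff is_af_counit_def is_antipode_iff)

end

theorem proposition5p6:
  fixes h :: complex
  assumes "sinh h \<noteq> 0"
  shows "(\<exists>!\<Delta>. is_af_comultiplication h \<Delta>) \<and>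
         (\<exists>!\<epsilon>. is_af_counit h \<epsilon>) \<and>
         (\<exists>!S. is_af_antipode h S) \<and>
         (\<forall>\<Delta> \<epsilon> S. is_af_comultiplication h \<Delta> \<and> is_af_counit h \<epsilon> \<and> is_af_antipode h S \<longrightarrow>
            HFG_Hopf_algebra (U_af h) \<Delta> \<epsilon> S \<and> top_lin_invertible (U_af h) S) \<and>
         \<not> finite_dimensional (U_af h)"
  using af.structure_maps_ex1 af.Hopf_algebra_U af.infinite_dimensional by blast

end
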